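(* Consider an almost Grassmann structure $AG(p-1,p+q-1)$, $p,q\ge 2$, with structure subobjects $S_\alpha=(a_\alpha,b^1_\alpha,b^2_\alpha)$ and $S_\beta=(a_\beta,b^1_\beta,b^2_\beta)$ and complete structure object $S=(a,b,c)$. (i) If $p=2$, then the structure subobject $S_\alpha$ consists only of the tensor $b^1_\alpha=\{b^{i\gamma\delta}_{(jkl)}\}$ (that is, $a_\alpha=0$ and $b^2_\alpha=0$, and $b^1_\alpha$ is a tensor), and the vanishing of $b^1_\alpha$ is necessary and sufficient for the almost Grassmann structure $AG(1,q+1)$ to be $\alpha$-semiintegrable. (ii) If $q=2$, then the structure subobject $S_\beta$ consists only of the tensor $b^2_\beta=\{b^{(\beta\gamma\delta)}_{\alpha kl}\}$ (that is, $a_\beta=0$ and $b^1_\beta=0$, and $b^2_\beta$ is a tensor), and the vanishing of $b^2_\beta$ is necessary and sufficient for the almost Grassmann structure $AG(p-1,p+1)$ (which is equivalent to the structure $AG(1,p+1)$) to be $\beta$-semiintegrable. (iii) If $p=q=2$, then the complete structure object $S$ consists only of the tensors $b^1_\alpha$ and $b^2_\beta$, and the vanishing of $b^1_\alpha$ (respectively, of $b^2_\beta$) is necessary and sufficient for the almost Grassmann structure $AG(1,3)$ to be $\alpha$-semiintegrable (respectively, $\beta$-semiintegrable).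
   Context: Conventions. Greek indices run over $1,\dots,p$, Latin indices over $p+1,\dots,p+q$; repeated indices are summed. Round (square) brackets denote symmetrization (alternation) over the enclosed upper or lower indices alone. In the symbols $a_\alpha,b^1_\alpha,\dots,S_\alpha$ and $a_\beta,b^1_\beta,\dots,S_\beta$ the subscripts $\alpha$, $\beta$ are labels, not tensor indices. Almost Grassmann structure. The Segre cone $SC(p,q)$ in a $pq$-dimensional vector space with coordinates $z^i_\alpha$ is the set $\{z^i_\alpha=t_\alpha s^i\}$, i.e. $\operatorname{rank}(z^i_\alpha)\le 1$. An almost Grassmann structure $AG(p-1,p+q-1)$ on a manifold $M$, $\dim M=pq$, is a differentiable fibration $x\mapsto SC_x\subset T_xM$ of Segre cones $SC_x=SC_x(p,q)$. (The structures $AG(p-1,p+q-1)$ and $AG(q-1,p+q-1)$ are equivalent, being generated by the same kind of family of cones.) An adapted frame $\{e^\alpha_i\}$ of $T_xM$ is one in which $SC_x=\{t_\alpha s^i e^\alpha_i\}$; $\omega^i_\alpha$ denotes the dual coframe. Fixing $s=(s^i)$ up to scale gives a $p$-dimensional plane generator $\xi$ of $SC_x$ (a $(q-1)$-parameter family), and fixing $t=(t_\alpha)$ up to scale gives a $q$-dimensional plane generator $\eta$ (a $(p-1)$-parameter family). The structure is a $G$-structure with $G=\mathbf{SL}(p)\times\mathbf{SL}(q)\times\mathbf{H}$, $\mathbf H$ the group of homotheties. Semiintegrability. Let $P_\alpha$ be the $(q-1)$-dimensional projective space parametrizing the $p$-dimensional generators $\xi$ and $M_\alpha=M\times P_\alpha$.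 The bundle of generators $\xi$ induces on $M_\alpha$ a distribution $\Delta_\alpha$ of $p$-dimensional plane elements; the structure is $\alpha$-semiintegrable if $\Delta_\alpha$ is integrable. The integral manifolds project to $p$-dimensional submanifolds $V_\alpha\subset M$ tangent at each of their points to a $p$-dimensional generator of the Segre cone, and through each $x\in M$ there passes a $(q-1)$-parameter family of them (one tangent to each $p$-dimensional generator of $SC_x$). Equivalently, the system $\omega^i_\alpha=s^i\theta_\alpha$ (with $\theta_1,\dots,\theta_p$ basis forms on $V_\alpha$) is completely integrable. Similarly, with the $q$-dimensional generators $\eta$ in place of $\xi$, one defines the distribution $\Delta_\beta$ of $q$-dimensional plane elements on $M_\beta=M\times P_\beta$, $\dim P_\beta=p-1$; the structure is $\beta$-semiintegrable if $\Delta_\beta$ is integrable, i.e. through each $x$ there passes a $(p-1)$-parameter family of $q$-dimensional submanifolds $V_\beta$ tangent at each of their points to a $q$-dimensional generator; equivalently, the system $\omega^i_\alpha=s_\alpha\theta^i$ is completely integrable. Structure equations (normal Cartan connection). On the prolonged frame bundles associated with the structure there are forms $\omega^i_\alpha$, $\omega$, $\omega^\beta_\alpha$, $\omega^i_j$, $\omega^\alpha_i$ with $\omega^\gamma_\gamma=0$, $\omega^k_k=0$ and $$d\omega_\alpha^i-\omega_\alpha^j\wedge\omega_j^i-\omega_\alpha^\beta\wedge\omega_\beta^i-\omega\wedge\omega_\alpha^i=a_{\alpha jk}^{i\beta\gamma}\omega_\beta^j\wedge\omega_\gamma^k,$$ $$d\omega_\alpha^\beta-\omega_\alpha^\gamma\wedge\omega_\gamma^\beta=\tfrac{q}{p+q}\bigl(\delta_\alpha^\beta\,\omega_\gamma^k\wedge\omega_k^\gamma-p\,\omega_\alpha^k\wedge\omega_k^\beta\bigr)+b_{\alpha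 kl}^{\beta\gamma\delta}\omega_\gamma^k\wedge\omega_\delta^l,$$ $$d\omega_j^i-\omega_j^k\wedge\omega_k^i=\tfrac{p}{p+q}\bigl(\delta_j^i\,\omega_k^\gamma\wedge\omega_\gamma^k-q\,\omega_j^\gamma\wedge\omega_\gamma^i\bigr)+b_{jkl}^{i\gamma\delta}\omega_\gamma^k\wedge\omega_\delta^l,$$ $$d\omega=\omega_i^\alpha\wedge\omega_\alpha^i,$$ $$d\omega_i^\alpha-\omega_i^\beta\wedge\omega_\beta^\alpha-\omega_i^j\wedge\omega_j^\alpha+\omega\wedge\omega_i^\alpha=c_{ijk}^{\alpha\beta\gamma}\omega_\gamma^k\wedge\omega_\beta^j-a_{\gamma ij}^{k\alpha\beta}\omega_k^\gamma\wedge\omega_\beta^j,$$ where $a^{i\beta\gamma}_{\alpha jk}=-a^{i\gamma\beta}_{\alpha kj}$, $a^{i\alpha\gamma}_{\alpha jk}=0$, $a^{i\beta\gamma}_{\alpha ik}=0$; $b^{\beta\gamma\delta}_{\alpha kl}=-b^{\beta\delta\gamma}_{\alpha lk}$, $b^{i\gamma\delta}_{jkl}=-b^{i\delta\gamma}_{jlk}$, $b^{\alpha\gamma\delta}_{\alpha kl}=0$, $b^{i\gamma\delta}_{ikl}=0$, and $b^{\gamma\alpha\delta}_{\alpha kl}-b^{i\gamma\delta}_{kil}+b^{\delta\alpha\gamma}_{\alpha lk}-b^{i\delta\gamma}_{lik}=0$; $c^{\alpha\beta\gamma}_{ijk}=-c^{\alpha\gamma\beta}_{ikj}$ and $c^{[\alpha\beta\gamma]}_{[ijk]}=0$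 (in this last identity, alternation over the vertical pairs $\binom{\alpha}{i},\binom{\beta}{j},\binom{\gamma}{k}$). Objects. $a=\{a^{i\beta\gamma}_{\alpha jk}\}$ is the torsion tensor; $b=(b^1,b^2)$ with $b^1=\{b^{i\gamma\delta}_{jkl}\}$, $b^2=\{b^{\beta\gamma\delta}_{\alpha kl}\}$; $c=\{c^{\alpha\beta\gamma}_{ijk}\}$; the complete structure object is $S=(a,b,c)$. Put $a_\alpha=\{a^{i\beta\gamma}_{\alpha(jk)}\}$, $b^1_\alpha=\{b^{i\gamma\delta}_{(jkl)}\}$, $b^2_\alpha=\{b^{[\beta\gamma\delta]}_{\alpha kl}\}$, $S_\alpha=(a_\alpha,b^1_\alpha,b^2_\alpha)$, and $a_\beta=\{a^{i(\beta\gamma)}_{\alpha jk}\}$, $b^1_\beta=\{b^{i\gamma\delta}_{[jkl]}\}$, $b^2_\beta=\{b^{(\beta\gamma\delta)}_{\alpha kl}\}$, $S_\beta=(a_\beta,b^1_\beta,b^2_\beta)$. That a geometric object ``consists only of'' certain tensors means that its other components vanish or are expressed through the components of these tensors and their Pfaffian derivatives. A family of quantities is a tensor if, under admissible changes of (prolonged) frames, its components transform linearly and homogeneously among themselves. *)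

theory Defs
  imports "HOL-Analysis.Analysis"
begin

(* Greek indices run over the finite type 'p and Latin indices over the finite type 'q, so that
   p = CARD('p) and q = CARD('q). The coordinates z^i_alpha are the entries z $ alpha $ i of a
   matrix z :: real^'q^'p; this pq-dimensional space serves as the model space of the manifold. *)

section \<open>Smooth maps and smooth manifolds\<close>

(* Only meaningful for open S. *)
fun Ck_on :: "nat \<Rightarrow> 'a::real_normed_vector set \<Rightarrow> ('a \<Rightarrow> 'b::real_normed_vector) \<Rightarrow> bool" where
  "Ck_on 0 S f \<longleftrightarrow> continuous_on S f"
| "Ck_on (Suc k) S f \<longleftrightarrow>
     (\<forall>x\<in>S. f differentiable (at x)) \<and> (\<forall>v. Ck_on k S (\<lambda>x. frechet_derivative f (at x) v))"

definition smooth_on :: "'a::real_normed_vector set \<Rightarrow> ('a \<Rightarrow> 'b::real_normed_vector) \<Rightarrow> bool" where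
  "smooth_on S f \<longleftrightarrow> (\<forall>k. Ck_on k S f)"

type_synonym ('m, 'p, 'q) chart = "'m set \<times> ('m \<Rightarrow> real^'q^'p)"

definition chart_inv :: "('m, 'p::finite, 'q::finite) chart \<Rightarrow> real^'q^'p \<Rightarrow> 'm" where
  "chart_inv c = inv_into (fst c) (snd c)"

definition smooth_atlas ::
  "('m::{t2_space, second_countable_topology}, 'p::finite, 'q::finite) chart set \<Rightarrow> bool" where
  "smooth_atlas A \<longleftrightarrow>
     (\<Union>c\<in>A. fst c) = UNIV \<and>
     (\<forall>c\<in>A. open (fst c) \<and> open (snd c ` fst c) \<and>
        homeomorphism (fst c) (snd c ` fst c) (snd c) (chart_inv c)) \<and>
     (\<forall>c\<in>A. \<forall>d\<in>A. smooth_on (snd c ` (fst c \<inter> fst d)) (snd d \<circ> chart_inv c))"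

(* Tangent vectors at x are represented by their coordinates in a chart; passing from the chart c
   to the chart d acts on them by the following map. *)
definition tangent_transition ::
  "('m, 'p::finite, 'q::finite) chart \<Rightarrow> ('m, 'p, 'q) chart \<Rightarrow> 'm \<Rightarrow> real^'q^'p \<Rightarrow> real^'q^'p" where
  "tangent_transition c d x = frechet_derivative (snd d \<circ> chart_inv c) (at (snd c x))"


section \<open>Almost Grassmann structures\<close>

definition dyad :: "real^'p::finite \<Rightarrow> real^'q::finite \<Rightarrow> real^'q^'p" where
  "dyad t s = (\<chi> \<alpha> i. t $ \<alpha> * s $ i)"

definition model_segre_cone :: "(real^'q::finite^'p::finite) set" where
  "model_segre_cone = {dyad t s | t s. True}"

(* The p-dimensional (s fixed) and q-dimensional (t fixed) plane generators. *)
definition model_xi_gens :: "(real^'q::finite^'p::finite) set set" where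
  "model_xi_gens = {range (\<lambda>t. dyad t s) | s. s \<noteq> 0}"

definition model_eta_gens :: "(real^'q::finite^'p::finite) set set" where
  "model_eta_gens = {range (\<lambda>s. dyad t s) | t. t \<noteq> 0}"

(* segre N c x is the Segre cone SC_x and xi_gens N c x the family of its p-dimensional generators
   xi, both in the coordinates of the chart c. For p \<noteq> q the family xi_gens is determined by the
   cone. For p = q the cone carries two families of p-dimensional generators, interchanged by
   transposition of matrices, and xi_gens records which of them is the family xi. *)
record ('m, 'p, 'q) cone_field =
  atlas :: "('m, 'p, 'q) chart set"
  segre :: "('m, 'p, 'q) chart \<Rightarrow> 'm \<Rightarrow> (real^'q^'p) set"
  xi_gens :: "('m, 'p, 'q) chart \<Rightarrow> 'm \<Rightarrow> (real^'q^'p) set set"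

(* L is a coframe (omega^i_alpha) of T_xM: L v $ alpha $ i = omega^i_alpha(v). *)
definition adapted_coframe_at ::
  "('m, 'p::finite, 'q::finite) cone_field \<Rightarrow> ('m, 'p, 'q) chart \<Rightarrow> 'm \<Rightarrow>
   (real^'q^'p \<Rightarrow> real^'q^'p) \<Rightarrow> bool" where
  "adapted_coframe_at N c x L \<longleftrightarrow> linear L \<and> bij L \<and>
     L ` segre N c x = model_segre_cone \<and> (\<lambda>\<xi>. L ` \<xi>) ` xi_gens N c x = model_xi_gens"

definition adapted_coframe_on ::
  "('m, 'p::finite, 'q::finite) cone_field \<Rightarrow> ('m, 'p, 'q) chart \<Rightarrow> (real^'q^'p) set \<Rightarrow>
   (real^'q^'p \<Rightarrow> real^'q^'p \<Rightarrow> real^'q^'p) \<Rightarrow> bool" where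
  "adapted_coframe_on N c U \<theta> \<longleftrightarrow>
     (\<forall>v. smooth_on U (\<lambda>y. \<theta> y v)) \<and> (\<forall>y\<in>U. adapted_coframe_at N c (chart_inv c y) (\<theta> y))"

(* The structure AG(p-1, p+q-1). The field of cones is differentiable in the sense that it admits
   smooth adapted coframes near every point. *)
definition almost_grassmann ::
  "('m::{t2_space, second_countable_topology}, 'p::finite, 'q::finite) cone_field \<Rightarrow> bool" where
  "almost_grassmann N \<longleftrightarrow>
     smooth_atlas (atlas N) \<and>
     (\<forall>c\<in>atlas N. \<forall>d\<in>atlas N. \<forall>x\<in>fst c \<inter> fst d.
        segre N d x = tangent_transition c d x ` segre N c x \<and>
        xi_gens N d x = (\<lambda>\<xi>. tangent_transition c d x ` \<xi>) ` xi_gens N c x) \<and>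
     (\<forall>c\<in>atlas N. \<forall>x\<in>fst c. \<exists>U \<theta>. open U \<and> snd c x \<in> U \<and> U \<subseteq> snd c ` fst c \<and>
        adapted_coframe_on N c U \<theta>)"

definition eta_gens ::
  "('m, 'p::finite, 'q::finite) cone_field \<Rightarrow> ('m, 'p, 'q) chart \<Rightarrow> 'm \<Rightarrow> (real^'q^'p) set set" where
  "eta_gens N c x = {\<eta>. \<exists>L. adapted_coframe_at N c x L \<and> L ` \<eta> \<in> model_eta_gens}"

(* The same family of cones with the roles of p and q interchanged: an AG(p-1, p+q-1) viewed as an
   AG(q-1, p+q-1). *)
definition transposed :: "('m, 'p::finite, 'q::finite) cone_field \<Rightarrow> ('m, 'q, 'p) cone_field" where
  "transposed N =
     \<lparr> atlas = (\<lambda>(U, \<phi>). (U, Finite_Cartesian_Product.transpose \<circ> \<phi>)) ` atlas N,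
       segre = (\<lambda>(U, \<phi>) x. Finite_Cartesian_Product.transpose `
         segre N (U, Finite_Cartesian_Product.transpose \<circ> \<phi>) x),
       xi_gens = (\<lambda>(U, \<phi>) x. (\<lambda>\<eta>. Finite_Cartesian_Product.transpose ` \<eta>) `
         eta_gens N (U, Finite_Cartesian_Product.transpose \<circ> \<phi>) x) \<rparr>"


section \<open>Semiintegrability\<close>

(* f parametrizes a piece of a submanifold V of M, lying in the domain of c, whose tangent space at
   every point is one of the given generators. As the generators have the dimension of the
   parameter space 'n, f is automatically an immersion. *)
definition integral_patch ::
  "(('m, 'p::finite, 'q::finite) chart \<Rightarrow> 'm \<Rightarrow> (real^'q^'p) set set) \<Rightarrow> ('m, 'p, 'q) chart \<Rightarrow>
   (real^'n::finite) set \<Rightarrow> (real^'n \<Rightarrow> 'm) \<Rightarrow> bool" where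
  "integral_patch gens c D f \<longleftrightarrow> open D \<and> f ` D \<subseteq> fst c \<and> smooth_on D (snd c \<circ> f) \<and>
     (\<forall>u\<in>D. range (frechet_derivative (snd c \<circ> f) (at u)) \<in> gens c (f u))"

(* The lift y \<mapsto> (y, T_yV) of such a submanifold V to the manifold M_alpha of pairs (x, xi) is an
   integral manifold of the distribution Delta_alpha, and every integral manifold of Delta_alpha is
   locally of this form. Integrability of Delta_alpha therefore says that for every point (x, xi) of
   M_alpha there is such a V through x tangent to xi at x. The same applies to M_beta. *)
definition alpha_semiintegrable :: "('m, 'p::finite, 'q::finite) cone_field \<Rightarrow> bool" where
  "alpha_semiintegrable N \<longleftrightarrow> (\<forall>c\<in>atlas N. \<forall>x\<in>fst c. \<forall>\<xi>\<in>xi_gens N c x.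
     \<exists>D (f :: real^'p \<Rightarrow> 'm). integral_patch (xi_gens N) c D f \<and> 0 \<in> D \<and> f 0 = x \<and>
       range (frechet_derivative (snd c \<circ> f) (at 0)) = \<xi>)"

definition beta_semiintegrable :: "('m, 'p::finite, 'q::finite) cone_field \<Rightarrow> bool" where
  "beta_semiintegrable N \<longleftrightarrow> (\<forall>c\<in>atlas N. \<forall>x\<in>fst c. \<forall>\<eta>\<in>eta_gens N c x.
     \<exists>D (f :: real^'q \<Rightarrow> 'm). integral_patch (eta_gens N) c D f \<and> 0 \<in> D \<and> f 0 = x \<and>
       range (frechet_derivative (snd c \<circ> f) (at 0)) = \<eta>)"


section \<open>Differential forms\<close>

(* \<eta> y v is the value of the 1-form \<eta> on the vector v at the point y. *)
type_synonym 'e one_form = "'e \<Rightarrow> 'e \<Rightarrow> real"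
type_synonym 'e two_form = "'e \<Rightarrow> 'e \<Rightarrow> 'e \<Rightarrow> real"

definition wedge :: "'e one_form \<Rightarrow> 'e one_form \<Rightarrow> 'e two_form" (infixl "\<^bold>\<and>" 70) where
  "(\<eta> \<^bold>\<and> \<zeta>) y u v = \<eta> y u * \<zeta> y v - \<eta> y v * \<zeta> y u"

(* The normalizations of d and of the wedge product match: d (f dg) = df \<^bold>\<and> dg. *)
definition ext_d :: "'e::real_normed_vector one_form \<Rightarrow> 'e two_form" where
  "ext_d \<eta> y u v =
     frechet_derivative (\<lambda>z. \<eta> z v) (at y) u - frechet_derivative (\<lambda>z. \<eta> z u) (at y) v"

definition kron :: "'a \<Rightarrow> 'a \<Rightarrow> real" where
  "kron a b = (if a = b then 1 else 0)"


section \<open>Prolonged frames and the structure equations\<close>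

(* A section of the prolonged frame bundle over an open set of coordinates: the pulled back forms
     frm_w y v $ alpha $ i    = omega^i_alpha,    frm_h y v                = omega,
     frm_p y v $ alpha $ beta = omega_alpha^beta, frm_q y v $ j $ i        = omega_j^i,
     frm_n y v $ i $ alpha    = omega_i^alpha
   and the components of the structure object S = (a, b, c), upper indices first:
     obj_a  y $ (i, beta, gamma, alpha, j, k)     = a^{i beta gamma}_{alpha j k},
     obj_b1 y $ (i, gamma, delta, j, k, l)        = b^{i gamma delta}_{j k l},
     obj_b2 y $ (beta, gamma, delta, alpha, k, l) = b^{beta gamma delta}_{alpha k l},
     obj_c  y $ (alpha, beta, gamma, i, j, k)     = c^{alpha beta gamma}_{i j k}. *)
record ('p, 'q) prolonged_frame =
  frm_w :: "real^'q^'p \<Rightarrow> real^'q^'p \<Rightarrow> real^'q^'p"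
  frm_h :: "real^'q^'p \<Rightarrow> real^'q^'p \<Rightarrow> real"
  frm_p :: "real^'q^'p \<Rightarrow> real^'q^'p \<Rightarrow> real^'p^'p"
  frm_q :: "real^'q^'p \<Rightarrow> real^'q^'p \<Rightarrow> real^'q^'q"
  frm_n :: "real^'q^'p \<Rightarrow> real^'q^'p \<Rightarrow> real^'p^'q"
  obj_a :: "real^'q^'p \<Rightarrow> real^('q \<times> 'p \<times> 'p \<times> 'p \<times> 'q \<times> 'q)"
  obj_b1 :: "real^'q^'p \<Rightarrow> real^('q \<times> 'p \<times> 'p \<times> 'q \<times> 'q \<times> 'q)"
  obj_b2 :: "real^'q^'p \<Rightarrow> real^('p \<times> 'p \<times> 'p \<times> 'p \<times> 'q \<times> 'q)"
  obj_c :: "real^'q^'p \<Rightarrow> real^('p \<times> 'p \<times> 'p \<times> 'q \<times> 'q \<times> 'q)"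

definition w_form :: "('p::finite, 'q::finite) prolonged_frame \<Rightarrow> 'p \<Rightarrow> 'q \<Rightarrow> (real^'q^'p) one_form" where
  "w_form P \<alpha> i y v = frm_w P y v $ \<alpha> $ i"

definition p_form :: "('p::finite, 'q::finite) prolonged_frame \<Rightarrow> 'p \<Rightarrow> 'p \<Rightarrow> (real^'q^'p) one_form" where
  "p_form P \<alpha> \<beta> y v = frm_p P y v $ \<alpha> $ \<beta>"

definition q_form :: "('p::finite, 'q::finite) prolonged_frame \<Rightarrow> 'q \<Rightarrow> 'q \<Rightarrow> (real^'q^'p) one_form" where
  "q_form P j i y v = frm_q P y v $ j $ i"

definition n_form :: "('p::finite, 'q::finite) prolonged_frame \<Rightarrow> 'q \<Rightarrow> 'p \<Rightarrow> (real^'q^'p) one_form" where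
  "n_form P i \<alpha> y v = frm_n P y v $ i $ \<alpha>"

definition structure_equations_at ::
  "('p::finite, 'q::finite) prolonged_frame \<Rightarrow> real^'q^'p \<Rightarrow> bool" where
  "structure_equations_at P y \<longleftrightarrow>
    (let p = real CARD('p); q = real CARD('q);
         w = w_form P; \<omega> = frm_h P; \<pi> = p_form P; \<rho> = q_form P; \<nu> = n_form P;
         a = (\<lambda>i \<beta> \<gamma> \<alpha> j k. obj_a P y $ (i, \<beta>, \<gamma>, \<alpha>, j, k));
         b1 = (\<lambda>i \<gamma> \<delta> j k l. obj_b1 P y $ (i, \<gamma>, \<delta>, j, k, l));
         b2 = (\<lambda>\<beta> \<gamma> \<delta> \<alpha> k l. obj_b2 P y $ (\<beta>, \<gamma>, \<delta>, \<alpha>, k, l));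
         c = (\<lambda>\<alpha> \<beta> \<gamma> i j k. obj_c P y $ (\<alpha>, \<beta>, \<gamma>, i, j, k))
     in \<forall>u v.
       (\<forall>\<alpha> i. ext_d (w \<alpha> i) y u v - (\<Sum>j\<in>UNIV. (w \<alpha> j \<^bold>\<and> \<rho> j i) y u v)
           - (\<Sum>\<beta>\<in>UNIV. (\<pi> \<alpha> \<beta> \<^bold>\<and> w \<beta> i) y u v) - (\<omega> \<^bold>\<and> w \<alpha> i) y u v
         = (\<Sum>\<beta>\<in>UNIV. \<Sum>\<gamma>\<in>UNIV. \<Sum>j\<in>UNIV. \<Sum>k\<in>UNIV. a i \<beta> \<gamma> \<alpha> j k * (w \<beta> j \<^bold>\<and> w \<gamma> k) y u v)) \<and>
       (\<forall>\<alpha> \<beta>. ext_d (\<pi> \<alpha> \<beta>) y u v - (\<Sum>\<gamma>\<in>UNIV. (\<pi> \<alpha> \<gamma> \<^bold>\<and> \<pi> \<gamma> \<beta>) y u v)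
         = q / (p + q) * (kron \<alpha> \<beta> * (\<Sum>\<gamma>\<in>UNIV. \<Sum>k\<in>UNIV. (w \<gamma> k \<^bold>\<and> \<nu> k \<gamma>) y u v)
             - p * (\<Sum>k\<in>UNIV. (w \<alpha> k \<^bold>\<and> \<nu> k \<beta>) y u v))
           + (\<Sum>\<gamma>\<in>UNIV. \<Sum>\<delta>\<in>UNIV. \<Sum>k\<in>UNIV. \<Sum>l\<in>UNIV. b2 \<beta> \<gamma> \<delta> \<alpha> k l * (w \<gamma> k \<^bold>\<and> w \<delta> l) y u v)) \<and>
       (\<forall>j i. ext_d (\<rho> j i) y u v - (\<Sum>k\<in>UNIV. (\<rho> j k \<^bold>\<and> \<rho> k i) y u v)
         = p / (p + q) * (kron j i * (\<Sum>k\<in>UNIV. \<Sum>\<gamma>\<in>UNIV. (\<nu> k \<gamma> \<^bold>\<and> w \<gamma> k) y u v)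
             - q * (\<Sum>\<gamma>\<in>UNIV. (\<nu> j \<gamma> \<^bold>\<and> w \<gamma> i) y u v))
           + (\<Sum>\<gamma>\<in>UNIV. \<Sum>\<delta>\<in>UNIV. \<Sum>k\<in>UNIV. \<Sum>l\<in>UNIV. b1 i \<gamma> \<delta> j k l * (w \<gamma> k \<^bold>\<and> w \<delta> l) y u v)) \<and>
       ext_d \<omega> y u v = (\<Sum>i\<in>UNIV. \<Sum>\<alpha>\<in>UNIV. (\<nu> i \<alpha> \<^bold>\<and> w \<alpha> i) y u v) \<and>
       (\<forall>i \<alpha>. ext_d (\<nu> i \<alpha>) y u v - (\<Sum>\<beta>\<in>UNIV. (\<nu> i \<beta> \<^bold>\<and> \<pi> \<beta> \<alpha>) y u v)
           - (\<Sum>j\<in>UNIV. (\<rho> i j \<^bold>\<and> \<nu> j \<alpha>) y u v) + (\<omega> \<^bold>\<and> \<nu> i \<alpha>) y u v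
         = (\<Sum>\<beta>\<in>UNIV. \<Sum>\<gamma>\<in>UNIV. \<Sum>j\<in>UNIV. \<Sum>k\<in>UNIV. c \<alpha> \<beta> \<gamma> i j k * (w \<gamma> k \<^bold>\<and> w \<beta> j) y u v)
           - (\<Sum>k\<in>UNIV. \<Sum>\<gamma>\<in>UNIV. \<Sum>\<beta>\<in>UNIV. \<Sum>j\<in>UNIV. a k \<alpha> \<beta> \<gamma> i j * (\<nu> k \<gamma> \<^bold>\<and> w \<beta> j) y u v)))"

definition object_identities_at ::
  "('p::finite, 'q::finite) prolonged_frame \<Rightarrow> real^'q^'p \<Rightarrow> bool" where
  "object_identities_at P y \<longleftrightarrow>
    (let a = (\<lambda>i \<beta> \<gamma> \<alpha> j k. obj_a P y $ (i, \<beta>, \<gamma>, \<alpha>, j, k));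
         b1 = (\<lambda>i \<gamma> \<delta> j k l. obj_b1 P y $ (i, \<gamma>, \<delta>, j, k, l));
         b2 = (\<lambda>\<beta> \<gamma> \<delta> \<alpha> k l. obj_b2 P y $ (\<beta>, \<gamma>, \<delta>, \<alpha>, k, l));
         c = (\<lambda>\<alpha> \<beta> \<gamma> i j k. obj_c P y $ (\<alpha>, \<beta>, \<gamma>, i, j, k))
     in (\<forall>i \<beta> \<gamma> \<alpha> j k. a i \<beta> \<gamma> \<alpha> j k = - a i \<gamma> \<beta> \<alpha> k j) \<and>
        (\<forall>i \<gamma> j k. (\<Sum>\<alpha>\<in>UNIV. a i \<alpha> \<gamma> \<alpha> j k) = 0) \<and>
        (\<forall>\<beta> \<gamma> \<alpha> k. (\<Sum>i\<in>UNIV. a i \<beta> \<gamma> \<alpha> i k) = 0) \<and>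
        (\<forall>\<beta> \<gamma> \<delta> \<alpha> k l. b2 \<beta> \<gamma> \<delta> \<alpha> k l = - b2 \<beta> \<delta> \<gamma> \<alpha> l k) \<and>
        (\<forall>i \<gamma> \<delta> j k l. b1 i \<gamma> \<delta> j k l = - b1 i \<delta> \<gamma> j l k) \<and>
        (\<forall>\<gamma> \<delta> k l. (\<Sum>\<alpha>\<in>UNIV. b2 \<alpha> \<gamma> \<delta> \<alpha> k l) = 0) \<and>
        (\<forall>\<gamma> \<delta> k l. (\<Sum>i\<in>UNIV. b1 i \<gamma> \<delta> i k l) = 0) \<and>
        (\<forall>\<gamma> \<delta> k l. (\<Sum>\<alpha>\<in>UNIV. b2 \<gamma> \<alpha> \<delta> \<alpha> k l) - (\<Sum>i\<in>UNIV. b1 i \<gamma> \<delta> k i l)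
           + (\<Sum>\<alpha>\<in>UNIV. b2 \<delta> \<alpha> \<gamma> \<alpha> l k) - (\<Sum>i\<in>UNIV. b1 i \<delta> \<gamma> l i k) = 0) \<and>
        (\<forall>\<alpha> \<beta> \<gamma> i j k. c \<alpha> \<beta> \<gamma> i j k = - c \<alpha> \<gamma> \<beta> i k j) \<and>
        (\<forall>\<alpha> \<beta> \<gamma> i j k. c \<alpha> \<beta> \<gamma> i j k + c \<beta> \<gamma> \<alpha> j k i + c \<gamma> \<alpha> \<beta> k i j
           - c \<beta> \<alpha> \<gamma> j i k - c \<alpha> \<gamma> \<beta> i k j - c \<gamma> \<beta> \<alpha> k j i = 0))"

(* Every smooth field of coframes on U is adapted to exactly one almost Grassmann structure on U, so
   no structure has to be given beforehand. The forms and (a, b, c) are subject to exactly the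
   structure equations and the normalization of (a, b, c); as a 2-form determines its skew-symmetric
   coefficients, (a, b, c) is determined by the forms. *)
definition prolonged_frame_over ::
  "(real^'q::finite^'p::finite) set \<Rightarrow> ('p, 'q) prolonged_frame \<Rightarrow> bool" where
  "prolonged_frame_over U P \<longleftrightarrow> open U \<and>
     (\<forall>v. smooth_on U (\<lambda>y. frm_w P y v) \<and> smooth_on U (\<lambda>y. frm_h P y v) \<and>
        smooth_on U (\<lambda>y. frm_p P y v) \<and> smooth_on U (\<lambda>y. frm_q P y v) \<and>
        smooth_on U (\<lambda>y. frm_n P y v)) \<and>
     (\<forall>y\<in>U. linear (frm_w P y) \<and> bij (frm_w P y) \<and> linear (frm_h P y) \<and>
        linear (frm_p P y) \<and> linear (frm_q P y) \<and> linear (frm_n P y) \<and>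
        (\<forall>v. (\<Sum>\<gamma>\<in>UNIV. p_form P \<gamma> \<gamma> y v) = 0) \<and> (\<forall>v. (\<Sum>k\<in>UNIV. q_form P k k y v) = 0) \<and>
        structure_equations_at P y \<and> object_identities_at P y)"

definition prolonged_frame_of ::
  "('m, 'p::finite, 'q::finite) cone_field \<Rightarrow> ('m, 'p, 'q) chart \<Rightarrow> (real^'q^'p) set \<Rightarrow>
   ('p, 'q) prolonged_frame \<Rightarrow> bool" where
  "prolonged_frame_of N c U P \<longleftrightarrow> U \<subseteq> snd c ` fst c \<and>
     prolonged_frame_over U P \<and> adapted_coframe_on N c U (frm_w P)"


section \<open>The structure subobjects\<close>

definition sym3 :: "('a \<Rightarrow> 'a \<Rightarrow> 'a \<Rightarrow> real) \<Rightarrow> 'a \<Rightarrow> 'a \<Rightarrow> 'a \<Rightarrow> real" where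
  "sym3 f x y z = (f x y z + f y z x + f z x y + f y x z + f x z y + f z y x) / 6"

definition alt3 :: "('a \<Rightarrow> 'a \<Rightarrow> 'a \<Rightarrow> real) \<Rightarrow> 'a \<Rightarrow> 'a \<Rightarrow> 'a \<Rightarrow> real" where
  "alt3 f x y z = (f x y z + f y z x + f z x y - f y x z - f x z y - f z y x) / 6"

definition a_alpha :: "('p::finite, 'q::finite) prolonged_frame \<Rightarrow> real^'q^'p \<Rightarrow>
    real^('q \<times> 'p \<times> 'p \<times> 'p \<times> 'q \<times> 'q)" where
  "a_alpha P y = vec_lambda (\<lambda>(i, \<beta>, \<gamma>, \<alpha>, j, k).
     (obj_a P y $ (i, \<beta>, \<gamma>, \<alpha>, j, k) + obj_a P y $ (i, \<beta>, \<gamma>, \<alpha>, k, j)) / 2)"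

definition a_beta :: "('p::finite, 'q::finite) prolonged_frame \<Rightarrow> real^'q^'p \<Rightarrow>
    real^('q \<times> 'p \<times> 'p \<times> 'p \<times> 'q \<times> 'q)" where
  "a_beta P y = vec_lambda (\<lambda>(i, \<beta>, \<gamma>, \<alpha>, j, k).
     (obj_a P y $ (i, \<beta>, \<gamma>, \<alpha>, j, k) + obj_a P y $ (i, \<gamma>, \<beta>, \<alpha>, j, k)) / 2)"

definition b1_alpha :: "('p::finite, 'q::finite) prolonged_frame \<Rightarrow> real^'q^'p \<Rightarrow>
    real^('q \<times> 'p \<times> 'p \<times> 'q \<times> 'q \<times> 'q)" where
  "b1_alpha P y = vec_lambda (\<lambda>(i, \<gamma>, \<delta>, j, k, l).
     sym3 (\<lambda>j k l. obj_b1 P y $ (i, \<gamma>, \<delta>, j, k, l)) j k l)"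

definition b1_beta :: "('p::finite, 'q::finite) prolonged_frame \<Rightarrow> real^'q^'p \<Rightarrow>
    real^('q \<times> 'p \<times> 'p \<times> 'q \<times> 'q \<times> 'q)" where
  "b1_beta P y = vec_lambda (\<lambda>(i, \<gamma>, \<delta>, j, k, l).
     alt3 (\<lambda>j k l. obj_b1 P y $ (i, \<gamma>, \<delta>, j, k, l)) j k l)"

definition b2_alpha :: "('p::finite, 'q::finite) prolonged_frame \<Rightarrow> real^'q^'p \<Rightarrow>
    real^('p \<times> 'p \<times> 'p \<times> 'p \<times> 'q \<times> 'q)" where
  "b2_alpha P y = vec_lambda (\<lambda>(\<beta>, \<gamma>, \<delta>, \<alpha>, k, l).
     alt3 (\<lambda>\<beta> \<gamma> \<delta>. obj_b2 P y $ (\<beta>, \<gamma>, \<delta>, \<alpha>, k, l)) \<beta> \<gamma> \<delta>)"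

definition b2_beta :: "('p::finite, 'q::finite) prolonged_frame \<Rightarrow> real^'q^'p \<Rightarrow>
    real^('p \<times> 'p \<times> 'p \<times> 'p \<times> 'q \<times> 'q)" where
  "b2_beta P y = vec_lambda (\<lambda>(\<beta>, \<gamma>, \<delta>, \<alpha>, k, l).
     sym3 (\<lambda>\<beta> \<gamma> \<delta>. obj_b2 P y $ (\<beta>, \<gamma>, \<delta>, \<alpha>, k, l)) \<beta> \<gamma> \<delta>)"

definition vanishes ::
  "('m, 'p::finite, 'q::finite) cone_field \<Rightarrow>
   (('p, 'q) prolonged_frame \<Rightarrow> real^'q^'p \<Rightarrow> real^'n::finite) \<Rightarrow> bool" where
  "vanishes N T \<longleftrightarrow> (\<forall>c\<in>atlas N. \<forall>U P. prolonged_frame_of N c U P \<longrightarrow> (\<forall>y\<in>U. T P y = 0))"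

(* Two prolonged frames over U belong to the same almost Grassmann structure if and only if their
   coframes are related by omega' = A omega B with invertible A and B. The linear law L depends on
   this change of adapted frames only, and not on the structure, the point, or the second order
   parameters of the prolonged frames. *)
definition is_tensor ::
  "(('p::finite, 'q::finite) prolonged_frame \<Rightarrow> real^'q^'p \<Rightarrow> real^'n::finite) \<Rightarrow> bool" where
  "is_tensor T \<longleftrightarrow>
     (\<exists>L :: real^'p^'p \<Rightarrow> real^'q^'q \<Rightarrow> real^'n \<Rightarrow> real^'n. (\<forall>A B. linear (L A B)) \<and>
       (\<forall>U P P' A B. prolonged_frame_over U P \<longrightarrow> prolonged_frame_over U P' \<longrightarrow>
          (\<forall>y\<in>U. invertible (A y) \<and> invertible (B y) \<and>
             (\<forall>v. frm_w P' y v = A y ** frm_w P y v ** B y)) \<longrightarrow>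
          (\<forall>y\<in>U. T P' y = L (A y) (B y) (T P y))))"

(* Covariant differentials nabla T = dT + ..., with the signs given by the first structure
   equation: components of a tangent vector have nabla v^i_alpha
   = dv^i_alpha + omega_j^i v^j_alpha - omega_alpha^beta v^i_beta - omega v^i_alpha, and b1, b2 have
   weight two with respect to the homotheties. *)
definition nabla_b1_alpha :: "('p::finite, 'q::finite) prolonged_frame \<Rightarrow> real^'q^'p \<Rightarrow> real^'q^'p \<Rightarrow>
    real^('q \<times> 'p \<times> 'p \<times> 'q \<times> 'q \<times> 'q)" where
  "nabla_b1_alpha P y v = vec_lambda (\<lambda>(i, \<gamma>, \<delta>, j, k, l).
     let T = (\<lambda>i \<gamma> \<delta> j k l. b1_alpha P y $ (i, \<gamma>, \<delta>, j, k, l)) in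
     frechet_derivative (\<lambda>z. b1_alpha P z $ (i, \<gamma>, \<delta>, j, k, l)) (at y) v
     + (\<Sum>m\<in>UNIV. q_form P m i y v * T m \<gamma> \<delta> j k l)
     + (\<Sum>\<epsilon>\<in>UNIV. p_form P \<epsilon> \<gamma> y v * T i \<epsilon> \<delta> j k l + p_form P \<epsilon> \<delta> y v * T i \<gamma> \<epsilon> j k l)
     - (\<Sum>m\<in>UNIV. q_form P j m y v * T i \<gamma> \<delta> m k l + q_form P k m y v * T i \<gamma> \<delta> j m l
          + q_form P l m y v * T i \<gamma> \<delta> j k m)
     + 2 * frm_h P y v * T i \<gamma> \<delta> j k l)"

definition nabla_b2_beta :: "('p::finite, 'q::finite) prolonged_frame \<Rightarrow> real^'q^'p \<Rightarrow> real^'q^'p \<Rightarrow>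
    real^('p \<times> 'p \<times> 'p \<times> 'p \<times> 'q \<times> 'q)" where
  "nabla_b2_beta P y v = vec_lambda (\<lambda>(\<beta>, \<gamma>, \<delta>, \<alpha>, k, l).
     let T = (\<lambda>\<beta> \<gamma> \<delta> \<alpha> k l. b2_beta P y $ (\<beta>, \<gamma>, \<delta>, \<alpha>, k, l)) in
     frechet_derivative (\<lambda>z. b2_beta P z $ (\<beta>, \<gamma>, \<delta>, \<alpha>, k, l)) (at y) v
     + (\<Sum>\<epsilon>\<in>UNIV. p_form P \<epsilon> \<beta> y v * T \<epsilon> \<gamma> \<delta> \<alpha> k l + p_form P \<epsilon> \<gamma> y v * T \<beta> \<epsilon> \<delta> \<alpha> k l
          + p_form P \<epsilon> \<delta> y v * T \<beta> \<gamma> \<epsilon> \<alpha> k l)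
     - (\<Sum>\<epsilon>\<in>UNIV. p_form P \<alpha> \<epsilon> y v * T \<beta> \<gamma> \<delta> \<epsilon> k l)
     - (\<Sum>m\<in>UNIV. q_form P k m y v * T \<beta> \<gamma> \<delta> \<alpha> m l + q_form P l m y v * T \<beta> \<gamma> \<delta> \<alpha> k m)
     + 2 * frm_h P y v * T \<beta> \<gamma> \<delta> \<alpha> k l)"

(* The vector e^epsilon_m of the frame dual to the coframe omega^i_alpha. *)
definition frame_vector :: "('p::finite, 'q::finite) prolonged_frame \<Rightarrow> real^'q^'p \<Rightarrow> 'p \<Rightarrow> 'q \<Rightarrow> real^'q^'p" where
  "frame_vector P y \<epsilon> m = inv (frm_w P y) (dyad (axis \<epsilon> 1) (axis m 1))"

(* The Pfaffian derivatives: the coefficients of nabla b with respect to omega^m_epsilon. *)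
definition pfaff_b1_alpha :: "('p::finite, 'q::finite) prolonged_frame \<Rightarrow> real^'q^'p \<Rightarrow> 'p \<Rightarrow> 'q \<Rightarrow>
    real^('q \<times> 'p \<times> 'p \<times> 'q \<times> 'q \<times> 'q)" where
  "pfaff_b1_alpha P y \<epsilon> m = nabla_b1_alpha P y (frame_vector P y \<epsilon> m)"

definition pfaff_b2_beta :: "('p::finite, 'q::finite) prolonged_frame \<Rightarrow> real^'q^'p \<Rightarrow> 'p \<Rightarrow> 'q \<Rightarrow>
    real^('p \<times> 'p \<times> 'p \<times> 'p \<times> 'q \<times> 'q)" where
  "pfaff_b2_beta P y \<epsilon> m = nabla_b2_beta P y (frame_vector P y \<epsilon> m)"

end

theory Submission
  imports Defs
begin

text \<open>A generator \<open>s\<close> is preserved along an integral manifold tangent to the dyads \<open>t \<otimes> s\<close>, so there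
  \<open>s\<close> is an eigenvector of the curvature \<open>curv1\<close>; the cubic form \<open>s \<mapsto> s curv1(t \<otimes> s, t' \<otimes> s)\<close>, whose
  coefficients are \<open>b\<^sup>1\<^sub>\<alpha>\<close>, is then proportional to \<open>s\<close>. For \<open>p = 2\<close> the torsion, being trace-free,
  vanishes on pairs of such dyads, and the trace of the first Bianchi identity makes the form
  divergence-free; a divergence-free cubic form proportional to \<open>s\<close> is zero. Conversely, if it
  is zero, the fields \<open>t \<otimes> s\<close> with \<open>s\<close> parallel span an involutive distribution, whose leaves project
  to the integral manifolds. A change of prolonged frame changes the curvature along these dyads
  only modulo \<open>s\<close>, which divergence-freeness again excludes; so \<open>b\<^sup>1\<^sub>\<alpha>\<close> is a tensor. Transposing the
  matrices in the tangent space exchanges \<open>p\<close> with \<open>q\<close> and gives the second part. For \<open>p = q = 2\<close> the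
  first Bianchi identity leaves only the symmetric parts of \<open>b\<^sup>1\<close> and \<open>b\<^sup>2\<close>, and the second
  Bianchi identity expresses \<open>c\<close> through their Pfaffian derivatives.\<close>

section \<open>Calculus of smooth maps\<close>

text \<open>The predicate \<open>vanishes\<close> quantifies over prolonged frames, so it says
  something at a point only if a prolonged frame exists near that point. Hence the normal connection
  of a given coframe has to be constructed; its normalizations are linear systems with determinants
  p^2 - 1, q^2 - 1 and (p + q)^2 - 4, nonzero because p, q >= 2. Smoothness of the torsion and of
  the curvature is not part of \<open>prolonged_frame_over\<close>; it is recovered by solving the
  structure equations for them. The homothety form enters the transport of \<open>s\<close> with the
  weight p (1 - q) / (p + q), fixed by the \<nu>-terms of the curvature equation. That
  \<open>c\<close> is a function of Pfaffian derivatives follows from uniqueness: the difference of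
  two values of \<open>c\<close> with equal derivatives solves a homogeneous linear system with only
  the zero solution. If p = q, some automorphisms of the Segre cone exchange the two families of
  generators, so statements on the planes \<eta> rest on the preservation of the planes
  \<xi>.\<close>

abbreviation fder :: "('a::real_normed_vector \<Rightarrow> 'b::real_normed_vector) \<Rightarrow> 'a \<Rightarrow> 'a \<Rightarrow> 'b" where
  "fder f x \<equiv> frechet_derivative f (at x)"

abbreviation sum_univ :: "('a \<Rightarrow> 'b::comm_monoid_add) \<Rightarrow> 'b" (binder "\<Sigma> " 10) where
  "sum_univ f \<equiv> sum f UNIV"

abbreviation unit_dyad :: "'p::finite \<Rightarrow> 'q::finite \<Rightarrow> real^'q^'p" ("\<E>") where
  "\<E> \<alpha> i \<equiv> dyad (axis \<alpha> 1) (axis i 1)"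

lemma frechet_derivative_eqI:
  "(f has_derivative f') (at x) \<Longrightarrow> fder f x = f'"
  by (metis frechet_derivative_at)

lemma fder_eqI_open:
  assumes "(f has_derivative f') (at x)" "open S" "x \<in> S" "\<And>z. z \<in> S \<Longrightarrow> f z = g z"
  shows "fder g x = f'"
  using has_derivative_transform_within_open[OF assms(1-3), of g] assms(4) by (metis frechet_derivative_at)

lemma has_derivative_frechet:
  "f differentiable (at x) \<Longrightarrow> (f has_derivative fder f x) (at x)"
  by (simp add: frechet_derivative_works)

section \<open>Closure properties of the classes C^k\<close>

lemma Ck_on_cong:
  assumes "open S" "\<And>x. x \<in> S \<Longrightarrow> f x = g x" "Ck_on k S f"
  shows "Ck_on k S g"
  using assms(2,3)
proof (induction k arbitrary: f g)
  case 0
  then show ?case using continuous_on_cong[of S S f g] by simp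
next
  case (Suc k)
  have d: "fder f x = fder g x" if "x \<in> S" for x
    using Suc.prems assms(1) that
    by (intro frechet_derivative_transform_within_open[of f x S g]) auto
  have "g differentiable (at x)" if "x \<in> S" for x
    using Suc.prems that assms(1)
    by (metis Ck_on.simps(2) differentiable_def has_derivative_transform_within_open)
  moreover have "Ck_on k S (\<lambda>x. fder g x v)" for v
    by (rule Suc.IH[of "\<lambda>x. fder f x v"]) (use d Suc.prems in auto)
  ultimately show ?case by simp
qed

lemma Ck_on_subset: "Ck_on k T f \<Longrightarrow> S \<subseteq> T \<Longrightarrow> Ck_on k S f"
  by (induction k arbitrary: f) (auto intro: continuous_on_subset)

lemma Ck_on_SucD: "Ck_on (Suc k) S f \<Longrightarrow> Ck_on k S f"
proof (induction k arbitrary: f)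
  case 0
  then show ?case
    by (simp add: continuous_at_imp_continuous_on differentiable_imp_continuous_within)
next
  case (Suc k)
  then show ?case by (metis Ck_on.simps(2))
qed

text \<open>With the index k gone, smoothness reproduces itself under differentiation, so later
  arguments need no induction on k.\<close>

lemma smooth_on_iff:
  "smooth_on S f \<longleftrightarrow>
     (\<forall>x\<in>S. f differentiable (at x)) \<and> (\<forall>v. smooth_on S (\<lambda>x. fder f x v))"
proof -
  have "Ck_on 0 S f" if "Ck_on 1 S f" using Ck_on_SucD[of 0 S f] that by simp
  then show ?thesis unfolding smooth_on_def
    by (metis Ck_on.simps(2) not0_implies_Suc One_nat_def)
qed

lemma smooth_on_differentiable: "smooth_on S f \<Longrightarrow> x \<in> S \<Longrightarrow> f differentiable (at x)"
  using smooth_on_iff by blast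

lemma smooth_on_has_derivative:
  "smooth_on S f \<Longrightarrow> x \<in> S \<Longrightarrow> (f has_derivative fder f x) (at x)"
  using smooth_on_iff frechet_derivative_works by blast

lemma smooth_on_frechet_derivative:
  "smooth_on S f \<Longrightarrow> smooth_on S (\<lambda>x. fder f x v)"
  using smooth_on_iff by blast

lemma smooth_on_continuous: "smooth_on S f \<Longrightarrow> continuous_on S f"
  unfolding smooth_on_def using Ck_on.simps(1) by blast

lemma smooth_on_cong:
  "open S \<Longrightarrow> (\<And>x. x \<in> S \<Longrightarrow> f x = g x) \<Longrightarrow> smooth_on S f \<Longrightarrow> smooth_on S g"
  unfolding smooth_on_def using Ck_on_cong by blast

lemma smooth_on_subset: "smooth_on T f \<Longrightarrow> S \<subseteq> T \<Longrightarrow> smooth_on S f"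
  unfolding smooth_on_def using Ck_on_subset by blast

lemma Ck_on_const: "Ck_on k S (\<lambda>x. c)"
  by (induction k arbitrary: c) auto

lemma smooth_on_const [simp]: "smooth_on S (\<lambda>x. c)"
  unfolding smooth_on_def using Ck_on_const by blast

lemma smooth_on_bounded_linear: "bounded_linear L \<Longrightarrow> smooth_on S L"
  unfolding smooth_on_iff[of S L]
  by (auto simp: frechet_derivative_eqI[OF bounded_linear_imp_has_derivative]
      bounded_linear_imp_differentiable)

lemma smooth_on_id: "smooth_on S (\<lambda>x. x)"
  by (rule smooth_on_bounded_linear) (rule bounded_linear_ident)

lemma Ck_on_add:
  assumes "open S" "Ck_on k S f" "Ck_on k S g"
  shows "Ck_on k S (\<lambda>x. f x + g x)"
  using assms(2,3)
proof (induction k arbitrary: f g)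
  case 0 then show ?case by (simp add: continuous_on_add)
next
  case (Suc k)
  have d: "((\<lambda>x. f x + g x) has_derivative
     (\<lambda>v. fder f x v + fder g x v)) (at x)" if "x \<in> S" for x
    using Suc.prems that by (auto intro!: has_derivative_add has_derivative_frechet)
  have "Ck_on k S (\<lambda>x. fder (\<lambda>x. f x + g x) x v)" for v
    by (rule Ck_on_cong[OF assms(1), of "\<lambda>x. fder f x v + fder g x v"])
      (use Suc frechet_derivative_eqI[OF d] in auto)
  moreover have "\<forall>x\<in>S. (\<lambda>x. f x + g x) differentiable (at x)"
    using d differentiable_def by blast
  ultimately show ?case by simp
qed

text \<open>One product rule for every bounded bilinear map, so that scalar multiples, inner
  products, dyads and matrix products are covered together. Both undifferentiated factors reappear
  in the derivative, whence the descent by \<open>Ck_on_SucD\<close>.\<close>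

lemma Ck_on_bilinear:
  assumes "open S" "bounded_bilinear B" "Ck_on k S f" "Ck_on k S g"
  shows "Ck_on k S (\<lambda>x. B (f x) (g x))"
  using assms(3,4)
proof (induction k arbitrary: f g)
  case 0 then show ?case
    using bounded_bilinear.continuous_on[OF assms(2)] by simp
next
  case (Suc k)
  have d: "((\<lambda>x. B (f x) (g x)) has_derivative
     (\<lambda>v. B (f x) (fder g x v) + B (fder f x v) (g x))) (at x)"
    if "x \<in> S" for x
    using Suc.prems that
    by (auto intro!: bounded_bilinear.FDERIV[OF assms(2)] has_derivative_frechet)
  have fg: "Ck_on k S f" "Ck_on k S g" using Suc.prems Ck_on_SucD by blast+
  have "Ck_on k S (\<lambda>x. B (f x) (fder g x v) + B (fder f x v) (g x))" for v
    using fg Suc.prems by (intro Ck_on_add[OF assms(1)] Suc.IH) auto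
  then have "Ck_on k S (\<lambda>x. fder (\<lambda>x. B (f x) (g x)) x v)" for v
    by (rule Ck_on_cong[OF assms(1), rotated]) (use frechet_derivative_eqI[OF d] in auto)
  moreover have "\<forall>x\<in>S. (\<lambda>x. B (f x) (g x)) differentiable (at x)"
    using d differentiable_def by blast
  ultimately show ?case by simp
qed

lemma smooth_on_add:
  "open S \<Longrightarrow> smooth_on S f \<Longrightarrow> smooth_on S g \<Longrightarrow> smooth_on S (\<lambda>x. f x + g x)"
  unfolding smooth_on_def using Ck_on_add by blast

lemma smooth_on_bilinear:
  "open S \<Longrightarrow> bounded_bilinear B \<Longrightarrow> smooth_on S f \<Longrightarrow> smooth_on S g \<Longrightarrow> smooth_on S (\<lambda>x. B (f x) (g x))"
  unfolding smooth_on_def using Ck_on_bilinear by blast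

lemmas smooth_on_scaleR = smooth_on_bilinear[OF _ bounded_bilinear_scaleR]
  and smooth_on_mult = smooth_on_bilinear[OF _ bounded_bilinear_mult]
  and smooth_on_inner = smooth_on_bilinear[OF _ bounded_bilinear_inner]

lemma smooth_on_sum:
  assumes "open S" "\<And>i. i \<in> I \<Longrightarrow> smooth_on S (f i)"
  shows "smooth_on S (\<lambda>x. \<Sum>i\<in>I. f i x)"
proof (cases "finite I")
  case True
  then show ?thesis using assms
    by (induction I) (auto intro: smooth_on_add)
qed simp

lemma smooth_on_prod:
  fixes f :: "'i \<Rightarrow> 'a::real_normed_vector \<Rightarrow> real"
  assumes "open S" "\<And>i. i \<in> I \<Longrightarrow> smooth_on S (f i)"
  shows "smooth_on S (\<lambda>x. \<Prod>i\<in>I. f i x)"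
proof (cases "finite I")
  case True
  then show ?thesis using assms
    by (induction I) (auto intro: smooth_on_mult)
qed simp

lemma Ck_on_compose:
  fixes g :: "'a::real_normed_vector \<Rightarrow> 'b::euclidean_space"
  assumes "open S" "g ` S \<subseteq> T" "Ck_on k T f" "Ck_on k S g"
  shows "Ck_on k S (\<lambda>x. f (g x))"
  using assms(3,4)
proof (induction k arbitrary: f)
  case 0 then show ?case
    using assms(2) by (auto intro: continuous_on_compose2)
next
  case (Suc k)
  have gd: "g differentiable (at x)" and fd: "f differentiable (at (g x))" if "x \<in> S" for x
    using Suc.prems that assms(2) by auto
  have d: "((\<lambda>x. f (g x)) has_derivative
     (\<lambda>v. fder f (g x) (fder g x v))) (at x)" if "x \<in> S" for x
    using diff_chain_at[OF has_derivative_frechet[OF gd[OF that]] has_derivative_frechet[OF fd[OF that]]]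
    by (simp add: o_def)
  \<comment> \<open>In the chain rule the direction in which f is differentiated varies with x,
    while the induction hypothesis speaks of fixed directions. Expansion in a basis leaves fixed
    directions with scalar coefficients; this is why g takes values in a Euclidean space.\<close>
  have e: "fder f (g x) w
      = (\<Sum>b\<in>Basis. (w \<bullet> b) *\<^sub>R fder f (g x) b)" if "x \<in> S" for x w
  proof -
    have "linear (fder f (g x))"
      using fd[OF that] by (rule linear_frechet_derivative)
    then have "fder f (g x) (\<Sum>b\<in>Basis. (w \<bullet> b) *\<^sub>R b)
       = (\<Sum>b\<in>Basis. (w \<bullet> b) *\<^sub>R fder f (g x) b)"
      by (simp add: linear_sum linear_scale)
    then show ?thesis by (simp add: euclidean_representation)
  qed
  have gk: "Ck_on k S g" using Suc.prems Ck_on_SucD by blast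
  have "Ck_on k S (\<lambda>x. \<Sum>b\<in>I. (fder g x v \<bullet> b) *\<^sub>R fder f (g x) b)"
    if "I \<subseteq> Basis" for I v
    using finite_subset[OF that finite_Basis] that
  proof (induction I)
    case empty then show ?case by (simp add: Ck_on_const)
  next
    case (insert b I)
    have "Ck_on k S (\<lambda>x. (fder g x v \<bullet> b) *\<^sub>R fder f (g x) b)"
    proof (rule Ck_on_bilinear[OF assms(1) bounded_bilinear_scaleR])
      show "Ck_on k S (\<lambda>x. fder g x v \<bullet> b)"
        by (rule Ck_on_bilinear[OF assms(1) bounded_bilinear_inner])
          (use Suc.prems Ck_on_const in auto)
      show "Ck_on k S (\<lambda>x. fder f (g x) b)"
        using Suc.IH[of "\<lambda>y. fder f y b"] Suc.prems gk by auto
    qed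
    then show ?case using insert Ck_on_add[OF assms(1)] by auto
  qed
  from this[OF order_refl]
  have "Ck_on k S (\<lambda>x. fder (\<lambda>x. f (g x)) x v)" for v
    by (rule Ck_on_cong[OF assms(1), rotated]) (use frechet_derivative_eqI[OF d] e in auto)
  moreover have "\<forall>x\<in>S. (\<lambda>x. f (g x)) differentiable (at x)"
    using d differentiable_def by blast
  ultimately show ?case by simp
qed

lemma smooth_on_compose:
  fixes g :: "'a::real_normed_vector \<Rightarrow> 'b::euclidean_space"
  shows "open S \<Longrightarrow> smooth_on T f \<Longrightarrow> smooth_on S g \<Longrightarrow> g ` S \<subseteq> T \<Longrightarrow> smooth_on S (\<lambda>x. f (g x))"
  unfolding smooth_on_def using Ck_on_compose by blast

lemma smooth_on_linear:
  fixes L :: "'b::euclidean_space \<Rightarrow> 'c::real_normed_vector"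
  shows "open S \<Longrightarrow> linear L \<Longrightarrow> smooth_on S g \<Longrightarrow> smooth_on S (\<lambda>x. L (g x))"
  by (rule smooth_on_compose[of S UNIV L g])
    (auto intro: smooth_on_bounded_linear linear_conv_bounded_linear[THEN iffD1])

lemma smooth_on_minus:
  fixes f :: "'a::real_normed_vector \<Rightarrow> 'b::real_normed_vector"
  shows "open S \<Longrightarrow> smooth_on S f \<Longrightarrow> smooth_on S (\<lambda>x. - f x)"
  using smooth_on_scaleR[of S "\<lambda>x. -1" f] by simp

lemma smooth_on_diff:
  fixes f :: "'a::real_normed_vector \<Rightarrow> 'b::real_normed_vector"
  shows "open S \<Longrightarrow> smooth_on S f \<Longrightarrow> smooth_on S g \<Longrightarrow> smooth_on S (\<lambda>x. f x - g x)"
  using smooth_on_add[of S f "\<lambda>x. - g x"] smooth_on_minus[of S g] by simp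

lemma smooth_on_componentwise:
  fixes f :: "'a::real_normed_vector \<Rightarrow> 'b::euclidean_space"
  assumes "open S" "\<And>b. b \<in> Basis \<Longrightarrow> smooth_on S (\<lambda>x. f x \<bullet> b)"
  shows "smooth_on S f"
proof -
  have "smooth_on S (\<lambda>x. \<Sum>b\<in>Basis. (f x \<bullet> b) *\<^sub>R b)"
    using assms by (intro smooth_on_sum smooth_on_scaleR) auto
  then show ?thesis by (simp add: euclidean_representation)
qed

lemma smooth_on_vec_nth:
  fixes f :: "'a::real_normed_vector \<Rightarrow> 'b::euclidean_space ^ 'n"
  shows "open S \<Longrightarrow> smooth_on S f \<Longrightarrow> smooth_on S (\<lambda>x. f x $ i)"
  by (rule smooth_on_linear) (auto intro: bounded_linear.linear bounded_linear_vec_nth)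

lemma smooth_on_vec:
  fixes f :: "'a::real_normed_vector \<Rightarrow> 'b::euclidean_space ^ 'n"
  assumes "open S" "\<And>i. smooth_on S (\<lambda>x. f x $ i)"
  shows "smooth_on S f"
proof (rule smooth_on_componentwise[OF assms(1)])
  fix b :: "'b^'n" assume "b \<in> Basis"
  then obtain i u where "b = axis i u" unfolding Basis_vec_def by auto
  then have "(\<lambda>x. f x \<bullet> b) = (\<lambda>x. f x $ i \<bullet> u)" by (simp add: inner_axis)
  then show "smooth_on S (\<lambda>x. f x \<bullet> b)"
    using smooth_on_inner[OF assms(1) assms(2)[of i], of "\<lambda>x. u"] by simp
qed

lemma smooth_on_Pair:
  fixes f :: "'a::real_normed_vector \<Rightarrow> 'b::euclidean_space" and g :: "'a \<Rightarrow> 'c::euclidean_space"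
  assumes "open S" "smooth_on S f" "smooth_on S g"
  shows "smooth_on S (\<lambda>x. (f x, g x))"
proof -
  have "smooth_on S (\<lambda>x. (f x, 0) + (0, g x))"
    using assms
    by (intro smooth_on_add smooth_on_linear[of S "\<lambda>y. (y, 0)" f] smooth_on_linear[of S "\<lambda>y. (0, y)" g])
      (auto intro!: linearI)
  then show ?thesis by simp
qed

section \<open>Reciprocals, determinants and inverses of linear families\<close>

lemma smooth_on_inverse_real: "smooth_on (- {0}) (inverse :: real \<Rightarrow> real)"
proof -
  have o: "open (- {0::real})" by (simp add: open_Compl)
  have "Ck_on k (- {0}) (inverse :: real \<Rightarrow> real)" for k
  proof (induction k)
    case 0 then show ?case by (auto intro!: continuous_on_inverse)
  next
    case (Suc k)
    have d: "((inverse :: real \<Rightarrow> real) has_derivative (\<lambda>h. - (inverse x * h * inverse x))) (at x)"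
      if "x \<in> - {0}" for x :: real
      using that has_derivative_inverse'[of x UNIV] by simp
    \<comment> \<open>The derivative is a product of constants and two copies of
      \<open>inverse\<close> itself, so the induction closes.\<close>
    have "Ck_on k (- {0}) (\<lambda>x::real. (inverse x * (- v)) * inverse x)" for v
      by (intro Ck_on_bilinear[OF o bounded_bilinear_mult] Suc Ck_on_const)
    then have "Ck_on k (- {0}) (\<lambda>x::real. fder inverse x v)" for v
      by (rule Ck_on_cong[OF o, rotated]) (use frechet_derivative_eqI[OF d] in auto)
    then show ?case using d by (auto simp: differentiable_def)
  qed
  then show ?thesis by (simp add: smooth_on_def)
qed

lemma smooth_on_inverse:
  fixes f :: "'a::real_normed_vector \<Rightarrow> real"
  assumes "open S" "smooth_on S f" "\<And>x. x \<in> S \<Longrightarrow> f x \<noteq> 0"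
  shows "smooth_on S (\<lambda>x. inverse (f x))"
  by (rule smooth_on_compose[OF assms(1) smooth_on_inverse_real assms(2)]) (use assms(3) in auto)

lemma smooth_on_divide:
  fixes f :: "'a::real_normed_vector \<Rightarrow> real"
  assumes "open S" "smooth_on S f" "smooth_on S g" "\<And>x. x \<in> S \<Longrightarrow> g x \<noteq> 0"
  shows "smooth_on S (\<lambda>x. f x / g x)"
  using smooth_on_mult[OF assms(1,2) smooth_on_inverse[OF assms(1,3,4)]]
  by (simp add: divide_inverse)

lemma smooth_on_det:
  fixes A :: "'a::real_normed_vector \<Rightarrow> real^'n^'n"
  assumes "open S" "\<And>i j. smooth_on S (\<lambda>x. A x $ i $ j)"
  shows "smooth_on S (\<lambda>x. det (A x))"
  unfolding det_def using assms
  by (intro smooth_on_sum smooth_on_mult smooth_on_prod) auto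

lemma matrix_inv_both:
  fixes A :: "real^'n^'n"
  assumes "invertible A"
  shows "A ** matrix_inv A = mat 1 \<and> matrix_inv A ** A = mat 1"
  unfolding matrix_inv_def by (rule someI_ex) (use assms in \<open>simp add: invertible_def\<close>)

lemmas matrix_inv_right = matrix_inv_both[THEN conjunct1]
  and matrix_inv_left = matrix_inv_both[THEN conjunct2]

text \<open>Cramer's rule makes the solution of a linear system a quotient of polynomials in the
  data; smooth dependence of the inverse then needs only products and one reciprocal.\<close>

lemma matrix_inv_vector_mult_cramer:
  fixes A :: "real^'n^'n"
  assumes "det A \<noteq> 0"
  shows "(matrix_inv A *v b) $ k = det (\<chi> i j. if j = k then b $ i else A $ i $ j) / det A"
proof -
  have "A *v (matrix_inv A *v b) = b"
    using matrix_inv_right[of A] assms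
    by (simp only: matrix_vector_mul_assoc invertible_det_nz not_False_eq_True simp_thms matrix_vector_mul_lid)
  then have "matrix_inv A *v b = (\<chi> k. det (\<chi> i j. if j = k then b $ i else A $ i $ j) / det A)"
    using cramer[OF assms, of "matrix_inv A *v b" b] by (rule iffD1[rotated])
  then show ?thesis by simp
qed

lemma smooth_on_matrix_inv_mult:
  fixes A :: "'a::real_normed_vector \<Rightarrow> real^'n^'n"
  assumes S: "open S" and A: "\<And>i j. smooth_on S (\<lambda>x. A x $ i $ j)"
    and b: "\<And>i. smooth_on S (\<lambda>x. b x $ i)" and d: "\<And>x. x \<in> S \<Longrightarrow> det (A x) \<noteq> 0"
  shows "smooth_on S (\<lambda>x. matrix_inv (A x) *v b x)"
proof (rule smooth_on_vec[OF S])
  fix k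
  have "smooth_on S (\<lambda>x. det (\<chi> i j. if j = k then b x $ i else A x $ i $ j) / det (A x))"
  proof (intro smooth_on_divide smooth_on_det S d)
    show "smooth_on S (\<lambda>x. (\<chi> i j. if j = k then b x $ i else A x $ i $ j) $ i $ j)" for i j
      using A b by (cases "j = k") auto
  qed (use A in auto)
  then show "smooth_on S (\<lambda>x. (matrix_inv (A x) *v b x) $ k)"
    by (rule smooth_on_cong[OF S, rotated]) (simp add: matrix_inv_vector_mult_cramer d)
qed

text \<open>Forms are assumed smooth only on constant vectors; expansion in a basis extends this to
  moving vectors.\<close>

lemma smooth_on_linear_family:
  fixes \<beta> :: "'g::real_normed_vector \<Rightarrow> 'e::euclidean_space \<Rightarrow> 'f::real_normed_vector"
  assumes S: "open S" and \<beta>: "\<And>v. smooth_on S (\<lambda>y. \<beta> y v)" and l: "\<And>y. y \<in> S \<Longrightarrow> linear (\<beta> y)"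
    and h: "smooth_on S h"
  shows "smooth_on S (\<lambda>x. \<beta> x (h x))"
proof -
  have "smooth_on S (\<lambda>x. \<Sum>b\<in>Basis. (h x \<bullet> b) *\<^sub>R \<beta> x b)"
    using S \<beta> h by (intro smooth_on_sum smooth_on_scaleR smooth_on_inner) auto
  then show ?thesis
  proof (rule smooth_on_cong[OF S, rotated])
    fix x assume "x \<in> S"
    then have "\<beta> x (\<Sum>b\<in>Basis. (h x \<bullet> b) *\<^sub>R b) = (\<Sum>b\<in>Basis. (h x \<bullet> b) *\<^sub>R \<beta> x b)"
      using l by (simp add: linear_sum linear_scale)
    then show "(\<Sum>b\<in>Basis. (h x \<bullet> b) *\<^sub>R \<beta> x b) = \<beta> x (h x)" by (simp add: euclidean_representation)
  qed
qed

text \<open>Pairs of indices become one index, so that an endomorphism of the space of coordinate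
  matrices has a square matrix and a determinant.\<close>

definition flatten :: "real^'q^'p \<Rightarrow> real^('p \<times> 'q)" where
  "flatten z = (\<chi> k. z $ fst k $ snd k)"

lemma flatten_eq_iff: "flatten z = flatten z' \<longleftrightarrow> z = z'"
  by (auto simp: flatten_def vec_eq_iff)

lemma smooth_on_inv_family:
  fixes L :: "'g::real_normed_vector \<Rightarrow> real^'q::finite^'p::finite \<Rightarrow> real^'q^'p"
  assumes S: "open S" and L: "\<And>v. smooth_on S (\<lambda>y. L y v)" and l: "\<And>y. y \<in> S \<Longrightarrow> linear (L y)"
    and b: "\<And>y. y \<in> S \<Longrightarrow> bij (L y)" and h: "smooth_on S h"
  shows "smooth_on S (\<lambda>y. inv (L y) (h y))"
proof -
  define M :: "'g \<Rightarrow> real^('p \<times> 'q)^('p \<times> 'q)" where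
    "M y = (\<chi> k l. L y (axis (fst l) (axis (snd l) 1)) $ fst k $ snd k)" for y
  have rep: "z = (\<Sigma> l. (flatten z $ l) *\<^sub>R axis (fst l) (axis (snd l) 1))" for z :: "real^'q^'p"
  proof -
    have "(\<Sigma> l. (flatten z $ l) *\<^sub>R axis (fst l) (axis (snd l) 1)) $ \<alpha> $ i = z $ \<alpha> $ i" for \<alpha> i
    proof -
      have e: "((flatten z $ l) *\<^sub>R axis (fst l) (axis (snd l) 1) :: real^'q^'p) $ \<alpha> $ i
        = (if l = (\<alpha>, i) then z $ \<alpha> $ i else 0)" for l
        by (cases l) (auto simp: flatten_def axis_def)
      have "(\<Sigma> l. (flatten z $ l) *\<^sub>R axis (fst l) (axis (snd l) 1)) $ \<alpha> $ i
        = (\<Sigma> l. if l = (\<alpha>, i) then z $ \<alpha> $ i else 0)"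
        by (simp add: e[simplified])
      then show ?thesis by simp
    qed
    then show ?thesis by (simp add: vec_eq_iff)
  qed
  have Mrep: "flatten (L y z) = M y *v flatten z" if "y \<in> S" for y z
  proof -
    have "L y z = (\<Sigma> l. (flatten z $ l) *\<^sub>R L y (axis (fst l) (axis (snd l) 1)))"
      by (subst rep) (simp add: linear_sum linear_scale l[OF that])
    then show ?thesis
      by (simp add: vec_eq_iff flatten_def M_def matrix_vector_mult_def mult.commute)
  qed
  have inv: "L y (inv (L y) v) = v" if "y \<in> S" for y v
    using b[OF that] by (simp add: bij_is_surj surj_f_inv_f)
  have d: "det (M y) \<noteq> 0" if "y \<in> S" for y
  proof -
    have "z = 0" if z: "M y *v z = 0" for z
    proof -
      define z' :: "real^'q^'p" where "z' = (\<chi> \<alpha> i. z $ (\<alpha>, i))"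
      have z': "z = flatten z'" by (simp add: z'_def flatten_def vec_eq_iff)
      have "flatten (L y z') = flatten (L y 0)"
        using z Mrep[OF \<open>y \<in> S\<close>, of z'] l[OF \<open>y \<in> S\<close>] z' by (simp add: linear_0) (simp add: flatten_def vec_eq_iff)
      then have "z' = 0" using b[OF \<open>y \<in> S\<close>] by (metis bij_is_inj flatten_eq_iff injD)
      then show "z = 0" using z' by (simp add: flatten_def vec_eq_iff)
    qed
    then have "inj ((*v) (M y))"
      by (metis linear_injective_0 matrix_vector_mul_linear)
    then show ?thesis by (simp add: inj_matrix_vector_mult invertible_det_nz[symmetric] invertible_left_inverse matrix_left_invertible_injective)
  qed
  have "smooth_on S (\<lambda>y. matrix_inv (M y) *v flatten (h y))"
    using L h d by (intro smooth_on_matrix_inv_mult S) (auto simp: M_def flatten_def intro!: smooth_on_vec_nth S)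
  moreover have "matrix_inv (M y) *v flatten (h y) = flatten (inv (L y) (h y))" if "y \<in> S" for y
    using Mrep[OF that, of "inv (L y) (h y)"] inv[OF that] d[OF that] matrix_inv_left[of "M y"]
    by (simp only: matrix_vector_mul_assoc invertible_det_nz not_False_eq_True simp_thms matrix_vector_mul_lid)
  ultimately have *: "smooth_on S (\<lambda>y. flatten (inv (L y) (h y)))"
    using smooth_on_cong[OF S] by (metis (no_types, lifting))
  have "smooth_on S (\<lambda>y. flatten (inv (L y) (h y)) $ (\<alpha>, i))" for \<alpha> i
    using * by (intro smooth_on_vec_nth S)
  then show ?thesis
    by (intro smooth_on_vec S) (auto simp: flatten_def)
qed

section \<open>Symmetry of second derivatives\<close>

lemma smooth_on_line_derivative:
  fixes f :: "'a::real_normed_vector \<Rightarrow> real"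
  assumes "smooth_on (ball c r) f" "x + s *\<^sub>R u \<in> ball c r"
  shows "((\<lambda>s. f (x + s *\<^sub>R u)) has_real_derivative fder f (x + s *\<^sub>R u) u) (at s)"
proof -
  have d0: "((\<lambda>s. x + s *\<^sub>R u) has_derivative (\<lambda>k. k *\<^sub>R u)) (at s)"
    by (auto intro!: derivative_eq_intros)
  note fd = smooth_on_has_derivative[OF assms]
  have "((\<lambda>s. f (x + s *\<^sub>R u)) has_derivative (\<lambda>k. fder f (x + s *\<^sub>R u) (k *\<^sub>R u))) (at s)"
    using diff_chain_at[OF d0 fd] by (simp add: o_def)
  then show ?thesis unfolding has_field_derivative_def
    by (rule has_derivative_eq_rhs) (auto simp: linear_scale[OF has_derivative_linear[OF fd]])
qed

text \<open>The mean value theorem is applied twice, first along \<open>u\<close> to the increment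
  in the direction \<open>v\<close>, then along \<open>v\<close>. The second difference on the left
  is symmetric in \<open>u\<close> and \<open>v\<close>, which is what makes the lemma
  useful.\<close>

lemma second_difference_mvt:
  fixes f :: "'a::real_normed_vector \<Rightarrow> real"
  assumes f: "smooth_on (ball x r) f" and h: "0 < h" "h * (norm u + norm v) < r"
  shows "\<exists>z. dist x z \<le> h * (norm u + norm v) \<and>
     f (x + h *\<^sub>R u + h *\<^sub>R v) - f (x + h *\<^sub>R u) - f (x + h *\<^sub>R v) + f x
       = h * h * fder (\<lambda>x. fder f x u) z v"
proof -
  define fu where "fu z = fder f z u" for z
  have fus: "smooth_on (ball x r) fu" unfolding fu_def by (rule smooth_on_frechet_derivative[OF f])
  have near: "dist x (x + s *\<^sub>R u + t *\<^sub>R v) \<le> h * (norm u + norm v)"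
    if "0 \<le> s" "s \<le> h" "0 \<le> t" "t \<le> h" for s t
  proof -
    have "norm (s *\<^sub>R u + t *\<^sub>R v) \<le> s * norm u + t * norm v"
      using norm_triangle_ineq[of "s *\<^sub>R u" "t *\<^sub>R v"] that by simp
    also have "\<dots> \<le> h * norm u + h * norm v"
      using that by (intro add_mono mult_right_mono) auto
    finally show ?thesis
      using norm_minus_cancel[of "s *\<^sub>R u + t *\<^sub>R v"] by (simp add: dist_norm algebra_simps)
  qed
  have inb: "x + s *\<^sub>R u + t *\<^sub>R v \<in> ball x r"
    if "0 \<le> s" "s \<le> h" "0 \<le> t" "t \<le> h" for s t
    using near[OF that] h by simp
  have d1: "((\<lambda>s. f (x + s *\<^sub>R u + t *\<^sub>R v)) has_real_derivative fu (x + s *\<^sub>R u + t *\<^sub>R v)) (at s)"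
    if "0 \<le> s" "s \<le> h" "0 \<le> t" "t \<le> h" for s t
    using smooth_on_line_derivative[OF f, of "x + t *\<^sub>R v" s u] inb[OF that] by (simp add: fu_def add.assoc add.commute add.left_commute)
  have d2: "((\<lambda>t. fu (x + s *\<^sub>R u + t *\<^sub>R v)) has_real_derivative
      fder fu (x + s *\<^sub>R u + t *\<^sub>R v) v) (at t)"
    if "0 \<le> s" "s \<le> h" "0 \<le> t" "t \<le> h" for s t
    by (rule smooth_on_line_derivative[OF fus inb[OF that]])
  have "\<exists>s. s > 0 \<and> s < h \<and>
      (f (x + h *\<^sub>R u + h *\<^sub>R v) - f (x + h *\<^sub>R u + 0 *\<^sub>R v))
      - (f (x + 0 *\<^sub>R u + h *\<^sub>R v) - f (x + 0 *\<^sub>R u + 0 *\<^sub>R v))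
      = (h - 0) * (fu (x + s *\<^sub>R u + h *\<^sub>R v) - fu (x + s *\<^sub>R u + 0 *\<^sub>R v))"
    by (rule MVT2[where f="\<lambda>s. f (x + s *\<^sub>R u + h *\<^sub>R v) - f (x + s *\<^sub>R u + 0 *\<^sub>R v)"
          and f'="\<lambda>s. fu (x + s *\<^sub>R u + h *\<^sub>R v) - fu (x + s *\<^sub>R u + 0 *\<^sub>R v)"])
      (use h in \<open>auto intro!: DERIV_diff d1 d1[where t=0, simplified]\<close>)
  then obtain s where s: "0 < s" "s < h" and e1:
    "f (x + h *\<^sub>R u + h *\<^sub>R v) - f (x + h *\<^sub>R u) - f (x + h *\<^sub>R v) + f x
      = h * (fu (x + s *\<^sub>R u + h *\<^sub>R v) - fu (x + s *\<^sub>R u + 0 *\<^sub>R v))"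
    by auto
  have "\<exists>t. t > 0 \<and> t < h \<and> fu (x + s *\<^sub>R u + h *\<^sub>R v) - fu (x + s *\<^sub>R u + 0 *\<^sub>R v)
      = (h - 0) * fder fu (x + s *\<^sub>R u + t *\<^sub>R v) v"
    by (rule MVT2[where f="\<lambda>t. fu (x + s *\<^sub>R u + t *\<^sub>R v)"]) (use h s in \<open>auto intro!: d2\<close>)
  then obtain t where t: "0 < t" "t < h" and e2:
    "fu (x + s *\<^sub>R u + h *\<^sub>R v) - fu (x + s *\<^sub>R u + 0 *\<^sub>R v)
      = h * fder fu (x + s *\<^sub>R u + t *\<^sub>R v) v" by auto
  show ?thesis
    by (rule exI[of _ "x + s *\<^sub>R u + t *\<^sub>R v"])
      (use near[of s t] s t e1 e2 in \<open>auto simp: fu_def[abs_def]\<close>)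
qed

text \<open>The symmetric second difference equals each mixed derivative at some point near
  \<open>x\<close>. If the two differed at \<open>x\<close>, their continuity would keep them apart
  on a small ball.\<close>

lemma second_derivative_symmetric_real:
  fixes f :: "'a::real_normed_vector \<Rightarrow> real"
  assumes S: "open S" and f: "smooth_on S f" and x: "x \<in> S"
  shows "fder (\<lambda>x. fder f x u) x v
       = fder (\<lambda>x. fder f x v) x u" (is "?a x = ?b x")
proof (rule ccontr)
  assume ne: "?a x \<noteq> ?b x"
  define e where "e = \<bar>?a x - ?b x\<bar> / 2"
  have e: "e > 0" using ne by (simp add: e_def)
  obtain r where r: "r > 0" "ball x r \<subseteq> S" using S x open_contains_ball by blast
  have fr: "smooth_on (ball x r) f" using smooth_on_subset[OF f r(2)] .
  have "continuous_on (ball x r) ?a" "continuous_on (ball x r) ?b"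
    using fr by (auto intro!: smooth_on_continuous smooth_on_frechet_derivative)
  then have "isCont ?a x" "isCont ?b x"
    using r by (auto simp: continuous_on_eq_continuous_at)
  then obtain d1 d2 where d: "d1 > 0" "d2 > 0"
    "\<And>z. dist z x < d1 \<Longrightarrow> dist (?a z) (?a x) < e" "\<And>z. dist z x < d2 \<Longrightarrow> dist (?b z) (?b x) < e"
    using e unfolding continuous_at_eps_delta by metis
  define m where "m = min r (min d1 d2)"
  define h where "h = m / (norm u + norm v + 1)"
  have m: "m > 0" using r d by (simp add: m_def)
  have n: "0 < norm u + norm v + 1"
    using norm_ge_zero[of u] norm_ge_zero[of v] by linarith
  have h: "h > 0" using m n by (simp add: h_def)
  have hm: "h * (norm u + norm v) < m"
  proof -
    have "h * (norm u + norm v) < h * (norm u + norm v + 1)" using h by simp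
    also have "\<dots> = m" using n by (simp add: h_def)
    finally show ?thesis .
  qed
  then have hr: "h * (norm u + norm v) < r" and hr': "h * (norm v + norm u) < r"
    by (simp_all add: m_def add.commute)
  obtain z1 where z1: "dist x z1 \<le> h * (norm u + norm v)"
    "f (x + h *\<^sub>R u + h *\<^sub>R v) - f (x + h *\<^sub>R u) - f (x + h *\<^sub>R v) + f x = h * h * ?a z1"
    using second_difference_mvt[OF fr h hr] by blast
  obtain z2 where z2: "dist x z2 \<le> h * (norm v + norm u)"
    "f (x + h *\<^sub>R v + h *\<^sub>R u) - f (x + h *\<^sub>R v) - f (x + h *\<^sub>R u) + f x = h * h * ?b z2"
    using second_difference_mvt[OF fr h hr'] by blast
  have "x + h *\<^sub>R v + h *\<^sub>R u = x + h *\<^sub>R u + h *\<^sub>R v"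
    by (simp only: add.assoc add.commute[of "h *\<^sub>R v"])
  then have "f (x + h *\<^sub>R v + h *\<^sub>R u) = f (x + h *\<^sub>R u + h *\<^sub>R v)" by (simp only:)
  then have "h * h * ?a z1 = h * h * ?b z2" using z1(2) z2(2) by linarith
  then have "?a z1 = ?b z2" using h by simp
  moreover have nz: "dist z1 x < d1" "dist z2 x < d2"
    using z1(1) z2(1) hm by (simp_all add: m_def dist_commute[of _ x] add.commute[of "norm v"])
  moreover have "dist (?a z1) (?a x) < e" "dist (?b z2) (?b x) < e"
    using d(3)[OF nz(1)] d(4)[OF nz(2)] .
  ultimately have "\<bar>?a x - ?b x\<bar> < 2 * e" by (simp add: dist_real_def)
  then show False by (simp add: e_def)
qed

lemma frechet_derivative_inner:
  "f differentiable (at x) \<Longrightarrow>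
     fder (\<lambda>x. f x \<bullet> b) x v = fder f x v \<bullet> b"
  by (subst frechet_derivative_eqI[OF has_derivative_inner_left[OF has_derivative_frechet]]) auto

lemma second_derivative_symmetric:
  fixes f :: "'a::real_normed_vector \<Rightarrow> 'b::euclidean_space"
  assumes S: "open S" and f: "smooth_on S f" and x: "x \<in> S"
  shows "fder (\<lambda>x. fder f x u) x v
       = fder (\<lambda>x. fder f x v) x u"
proof (rule euclidean_eqI)
  fix b :: 'b assume "b \<in> Basis"
  have *: "fder (\<lambda>x. fder f x u) x v \<bullet> b
     = fder (\<lambda>x. fder (\<lambda>x. f x \<bullet> b) x u) x v" for u v
  proof -
    have "fder (\<lambda>x. fder (\<lambda>x. f x \<bullet> b) x u) x
       = fder (\<lambda>x. fder f x u \<bullet> b) x"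
    proof (rule frechet_derivative_transform_within_open[OF _ S x, symmetric])
      show "(\<lambda>x. fder f x u \<bullet> b) differentiable at x"
        using smooth_on_differentiable[OF smooth_on_frechet_derivative[OF f] x, of u]
        by (metis differentiable_def has_derivative_inner_left)
    qed (simp add: frechet_derivative_inner smooth_on_differentiable[OF f])
    then show ?thesis
      using frechet_derivative_inner[OF smooth_on_differentiable[OF smooth_on_frechet_derivative[OF f] x], of u b v]
      by simp
  qed
  have "smooth_on S (\<lambda>x. f x \<bullet> b)" using smooth_on_inner[OF S f smooth_on_const] .
  from second_derivative_symmetric_real[OF S this x, of u v]
  show "fder (\<lambda>x. fder f x u) x v \<bullet> b
     = fder (\<lambda>x. fder f x v) x u \<bullet> b"
    by (simp add: *)
qed

section \<open>Commuting vector fields\<close>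

text \<open>On a time interval of length 1 the integral operator has the Lipschitz constant
  \<open>L\<close> of the field itself, so \<open>L < 1\<close> suffices for the contraction
  principle, without any weighted norm.\<close>

lemma picard_unit_interval:
  fixes G :: "'e::euclidean_space \<Rightarrow> 'e"
  assumes lip: "\<And>x y. norm (G x - G y) \<le> L * norm (x - y)" and L: "0 \<le> L" "L < 1"
    and bd: "\<And>x. norm (G x) \<le> M"
  obtains Z where "Z 0 = z0"
    "\<And>t. t \<in> {0..1} \<Longrightarrow> (Z has_vector_derivative G (Z t)) (at t within {0..1::real})"
    "\<And>t. t \<in> {0..1} \<Longrightarrow> norm (Z t - z0) \<le> M"
proof -
  \<comment> \<open>Bounded continuous functions live on the whole line; clamping the time to the
    unit interval makes the integral operator act on them.\<close>
  define cl where "cl t = max 0 (min 1 t)" for t :: real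
  have cl: "0 \<le> cl t" "cl t \<le> 1" "cl t \<in> {0..1}" for t by (auto simp: cl_def)
  have ccl: "continuous_on UNIV cl" unfolding cl_def by (intro continuous_intros)
  have cG: "continuous_on UNIV G"
  proof (rule continuous_onI)
    fix x :: 'e and e :: real assume e: "e > 0"
    show "\<exists>d>0. \<forall>x'\<in>UNIV. dist x' x < d \<longrightarrow> dist (G x') (G x) \<le> e"
    proof (intro exI conjI ballI impI)
      show "e > 0" by fact
      fix x' assume "dist x' x < e"
      then have "L * norm (x' - x) \<le> 1 * e" using L by (intro mult_mono) (auto simp: dist_norm)
      then show "dist (G x') (G x) \<le> e" using lip[of x' x] by (simp add: dist_norm)
    qed
  qed
  define J where "J f t = z0 + integral {0..t} (\<lambda>s. G (f s))" for f :: "real \<Rightarrow> 'e" and t :: real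
  have cGf: "continuous_on A (\<lambda>s. G (apply_bcontfun f s))" for f and A :: "real set"
    by (rule continuous_on_compose2[OF cG]) auto
  have int: "(\<lambda>s. G (apply_bcontfun f s)) integrable_on {0..t}" for f and t :: real
    by (rule integrable_continuous_real[OF cGf])
  have Jb: "norm (integral {0..t} (\<lambda>s. G (apply_bcontfun f s))) \<le> M * t" if "t \<ge> 0" for f t
    using integral_bound[OF that cGf bd] by simp
  have M: "M \<ge> 0" using bd[of 0] norm_ge_zero[of "G 0"] by linarith
  have Jin: "(\<lambda>t. J f (cl t)) \<in> bcontfun" for f :: "real \<Rightarrow>\<^sub>C 'e"
  proof (rule bcontfun_normI)
    have "continuous_on {0..1} (J f)"
      unfolding J_def using indefinite_integral_continuous_1[OF int[of f 1]] by (intro continuous_intros)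
    then show "continuous_on UNIV (\<lambda>t. J f (cl t))"
      using continuous_on_compose2[OF _ ccl] cl by (metis image_subset_iff)
    show "norm (J f (cl t)) \<le> norm z0 + M" for t
    proof -
      have "norm (J f (cl t)) \<le> norm z0 + M * cl t"
        unfolding J_def using norm_triangle_ineq Jb[OF cl(1)] by (meson add_left_mono order_trans)
      also have "\<dots> \<le> norm z0 + M" using cl[of t] M by (simp add: mult_left_le)
      finally show ?thesis .
    qed
  qed
  define T where "T f = Bcontfun (\<lambda>t. J (apply_bcontfun f) (cl t))" for f
  have T: "apply_bcontfun (T f) t = J f (cl t)" for f t
    unfolding T_def by (simp add: Bcontfun_inverse[OF Jin])
  have "dist (T f) (T g) \<le> L * dist f g" for f g
  proof (rule dist_bound)
    fix t
    have "J f (cl t) - J g (cl t) = integral {0..cl t} (\<lambda>s. G (f s) - G (g s))"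
      unfolding J_def by (simp add: integral_diff[OF int int])
    also have "norm \<dots> \<le> (L * dist f g) * (cl t - 0)"
    proof (rule integral_bound[OF cl(1)])
      show "continuous_on {0..cl t} (\<lambda>s. G (f s) - G (g s))" by (intro continuous_on_diff cGf)
      fix s
      have "norm (G (f s) - G (g s)) \<le> L * norm (f s - g s)" by (rule lip)
      also have "\<dots> \<le> L * dist f g"
        using L dist_bounded[of f s g] by (intro mult_left_mono) (auto simp: dist_norm)
      finally show "norm (G (f s) - G (g s)) \<le> L * dist f g" .
    qed
    also have "\<dots> \<le> L * dist f g" using cl[of t] L by (simp add: mult_left_le)
    finally show "dist (T f t) (T g t) \<le> L * dist f g" by (simp add: T dist_norm)
  qed
  then obtain f where f: "T f = f" using banach_fix_type[OF L] by blast
  define Z where "Z = J (apply_bcontfun f)"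
  have Zf: "Z t = f t" if "t \<in> {0..1}" for t
    using T[of f t] that unfolding f Z_def cl_def by (auto simp: max_def min_def)
  show ?thesis
  proof
    show "Z 0 = z0" by (simp add: Z_def J_def)
    fix t :: real assume t: "t \<in> {0..1}"
    have "(Z has_vector_derivative 0 + G (f t)) (at t within {0..1})"
      unfolding Z_def J_def
      by (intro has_vector_derivative_add has_vector_derivative_const integral_has_vector_derivative cGf t)
    then show "(Z has_vector_derivative G (Z t)) (at t within {0..1})" by (simp add: Zf[OF t])
    have "norm (Z t - z0) \<le> M * t" unfolding Z_def J_def using Jb[of t f] t by simp
    also have "\<dots> \<le> M" using t M by (simp add: mult_left_le)
    finally show "norm (Z t - z0) \<le> M" .
  qed
qed

text \<open>The square of the norm is used because the norm is not differentiable at 0.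
  Cauchy-Schwarz and 2 |e| B <= |e|^2 + B^2 bound the derivative of |e|^2 by (2 C + 1) |e|^2 +
  B^2.\<close>

lemma gronwall_norm:
  fixes e :: "real \<Rightarrow> 'e::real_inner"
  assumes d: "\<And>t. t \<in> {0..1} \<Longrightarrow> (e has_vector_derivative e' t) (at t within {0..1})"
    and b: "\<And>t. t \<in> {0..1} \<Longrightarrow> norm (e' t) \<le> C * norm (e t) + B"
    and "e 0 = 0" "0 \<le> C" "0 \<le> B" and t: "t \<in> {0..1}"
  shows "norm (e t) \<le> B * exp (2 * C + 1)"
proof -
  \<comment> \<open>The integrating factor removes the multiple of |e|^2 and the linear term removes
    the constant; what remains is nonincreasing.\<close>
  define h where "h t = exp (- (2 * C + 1) * t) * (e t \<bullet> e t) - B\<^sup>2 * t" for t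
  define h' where "h' t = exp (- (2 * C + 1) * t) * (2 * (e t \<bullet> e' t) - (2 * C + 1) * (e t \<bullet> e t)) - B\<^sup>2" for t
  have hd: "(h has_real_derivative h' t) (at t within {0..1})" if "t \<in> {0..1}" for t
  proof -
    have "((\<lambda>t. e t \<bullet> e t) has_real_derivative 2 * (e t \<bullet> e' t)) (at t within {0..1})"
      using has_derivative_inner[OF d[OF that, unfolded has_vector_derivative_def] d[OF that, unfolded has_vector_derivative_def]]
      unfolding has_field_derivative_def
      by (rule has_derivative_eq_rhs) (auto simp: inner_commute algebra_simps)
    note [derivative_intros] = this
    show ?thesis unfolding h_def h'_def
      by (auto intro!: derivative_eq_intros simp: algebra_simps)
  qed
  have neg: "h' t \<le> 0" if t: "t \<in> {0..1}" for t
  proof -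
    have "e t \<bullet> e' t \<le> norm (e t) * norm (e' t)" by (rule norm_cauchy_schwarz)
    also have "\<dots> \<le> norm (e t) * (C * norm (e t) + B)" by (intro mult_left_mono b t) simp
    finally have 1: "2 * (e t \<bullet> e' t) \<le> 2 * C * (norm (e t))\<^sup>2 + 2 * norm (e t) * B"
      by (simp add: power2_eq_square algebra_simps)
    have "2 * norm (e t) * B \<le> (norm (e t))\<^sup>2 + B\<^sup>2"
      using sum_squares_bound[of "norm (e t)" B] by simp
    with 1 have "2 * (e t \<bullet> e' t) - (2 * C + 1) * (e t \<bullet> e t) \<le> B\<^sup>2"
      by (simp add: power2_norm_eq_inner algebra_simps)
    then have "exp (- (2 * C + 1) * t) * (2 * (e t \<bullet> e' t) - (2 * C + 1) * (e t \<bullet> e t))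
        \<le> exp (- (2 * C + 1) * t) * B\<^sup>2"
      by (intro mult_left_mono) auto
    also have "\<dots> \<le> 1 * B\<^sup>2"
    proof (rule mult_right_mono)
      have "0 \<le> (2 * C + 1) * t" using assms(4) t by simp
      then show "exp (- (2 * C + 1) * t) \<le> 1" by (simp only: exp_le_one_iff mult_minus_left neg_le_0_iff_le)
    qed simp
    finally show ?thesis by (simp add: h'_def)
  qed
  have "h t \<le> h 0"
  proof (cases "t = 0")
    case False
    have "\<exists>x\<in>{0<..<t}. h t - h 0 = h' x * (t - 0)"
    proof (rule mvt_simple[of 0 t h "\<lambda>x k. h' x * k"])
      show "0 < t" using False t by simp
      show "(h has_derivative (*) (h' x)) (at x within {0..t})" if "0 \<le> x" "x \<le> t" for x
        using hd[of x] that t unfolding has_field_derivative_def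
        by (meson atLeastAtMost_iff atLeastatMost_subset_iff has_derivative_subset order_trans order_refl)
    qed
    then obtain x where "x \<in> {0<..<t}" "h t - h 0 = h' x * t" by auto
    moreover have "h' x * t \<le> 0"
      using neg[of x] t \<open>x \<in> {0<..<t}\<close> by (intro mult_nonpos_nonneg) auto
    ultimately show ?thesis by simp
  qed simp
  then have "exp (- (2 * C + 1) * t) * (norm (e t))\<^sup>2 \<le> B\<^sup>2 * t"
    using assms(3) by (simp add: h_def power2_norm_eq_inner)
  also have "\<dots> \<le> B\<^sup>2" using t by (simp add: mult_left_le)
  finally have "exp ((2 * C + 1) * t) * (exp (- (2 * C + 1) * t) * (norm (e t))\<^sup>2) \<le> exp ((2 * C + 1) * t) * B\<^sup>2"
    by (intro mult_left_mono) auto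
  moreover have "exp ((2 * C + 1) * t) * exp (- (2 * C + 1) * t) = 1"
    unfolding exp_add[symmetric] by (simp add: algebra_simps)
  ultimately have "(norm (e t))\<^sup>2 \<le> exp ((2 * C + 1) * t) * B\<^sup>2"
    by (simp only: mult.assoc[symmetric] mult_1_left)
  also have "\<dots> \<le> (exp (2 * C + 1))\<^sup>2 * B\<^sup>2"
  proof (rule mult_right_mono)
    have "(2 * C + 1) * t \<le> 2 * C + 1" using assms(4) t by (simp add: mult_left_le)
    also have "\<dots> \<le> 2 * (2 * C + 1)" using assms(4) by simp
    finally show "exp ((2 * C + 1) * t) \<le> (exp (2 * C + 1))\<^sup>2" by (simp add: exp_double[symmetric])
  qed simp
  finally have "(norm (e t))\<^sup>2 \<le> (B * exp (2 * C + 1))\<^sup>2" by (simp add: power_mult_distrib mult.commute)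
  then show ?thesis by (rule power2_le_imp_le) (simp add: assms(5))
qed

lemma smooth_on_cball_lipschitz:
  fixes g :: "'e::euclidean_space \<Rightarrow> 'f::euclidean_space"
  assumes g: "smooth_on W g" and W: "cball z0 r \<subseteq> W"
  obtains B where "B \<ge> 0" "\<And>z. z \<in> cball z0 r \<Longrightarrow> norm (g z) \<le> B"
    "\<And>z h. z \<in> cball z0 r \<Longrightarrow> norm (fder g z h) \<le> B * norm h"
    "\<And>z z'. z \<in> cball z0 r \<Longrightarrow> z' \<in> cball z0 r \<Longrightarrow> norm (g z' - g z) \<le> B * norm (z' - z)"
proof -
  have bnd: "\<exists>B. B \<ge> 0 \<and> (\<forall>z\<in>cball z0 r. norm (f z) \<le> B)" if "smooth_on W f" for f :: "'e \<Rightarrow> 'f"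
  proof -
    have "compact (f ` cball z0 r)"
      using smooth_on_continuous[OF smooth_on_subset[OF that W]] by (intro compact_continuous_image) auto
    then obtain B where "\<forall>x\<in>f ` cball z0 r. norm x \<le> B" using compact_imp_bounded bounded_iff by metis
    then show ?thesis by (intro exI[of _ "max B 0"]) auto
  qed
  obtain B0 where B0: "B0 \<ge> 0" "\<And>z. z \<in> cball z0 r \<Longrightarrow> norm (g z) \<le> B0" using bnd[OF g] by blast
  have "\<forall>b. \<exists>B. B \<ge> 0 \<and> (\<forall>z\<in>cball z0 r. norm (fder g z b) \<le> B)"
    using bnd[OF smooth_on_frechet_derivative[OF g]] by blast
  from choice[OF this] obtain Bb where Bb:
    "\<And>b. Bb b \<ge> 0" "\<And>b z. z \<in> cball z0 r \<Longrightarrow> norm (fder g z b) \<le> Bb b"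
    by blast
  define B1 where "B1 = (\<Sum>b\<in>Basis. Bb b)"
  have B1: "B1 \<ge> 0" using Bb(1) by (simp add: B1_def sum_nonneg)
  have d: "norm (fder g z h) \<le> B1 * norm h" if z: "z \<in> cball z0 r" for z h
  proof -
    have l: "linear (fder g z)"
      using z W by (intro linear_frechet_derivative smooth_on_differentiable[OF g]) blast
    have "fder g z h = fder g z (\<Sum>b\<in>Basis. (h \<bullet> b) *\<^sub>R b)"
      by (simp add: euclidean_representation)
    also have "\<dots> = (\<Sum>b\<in>Basis. (h \<bullet> b) *\<^sub>R fder g z b)"
      by (simp only: linear_sum[OF l] linear_scale[OF l])
    also have "norm \<dots> \<le> (\<Sum>b\<in>Basis. norm h * Bb b)"
    proof (rule sum_norm_le)
      fix b :: 'e assume b: "b \<in> Basis"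
      have "\<bar>h \<bullet> b\<bar> * norm (fder g z b) \<le> norm h * Bb b"
        using Basis_le_norm[OF b, of h] Bb(2)[OF z, of b] by (intro mult_mono) auto
      then show "norm ((h \<bullet> b) *\<^sub>R fder g z b) \<le> norm h * Bb b" by simp
    qed
    finally show ?thesis by (simp add: B1_def sum_distrib_left mult.commute)
  qed
  have on: "onorm (fder g z) \<le> B1" if z: "z \<in> cball z0 r" for z
    by (rule onorm_le) (rule d[OF z])
  have l: "norm (g z' - g z) \<le> B1 * norm (z' - z)" if "z \<in> cball z0 r" "z' \<in> cball z0 r" for z z'
  proof (rule differentiable_bound[OF convex_cball _ _ that(2,1)])
    fix x assume x: "x \<in> cball z0 r"
    then show "(g has_derivative fder g x) (at x within cball z0 r)"
      using W by (blast intro: has_derivative_at_withinI[OF smooth_on_has_derivative[OF g]])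
    from x show "onorm (fder g x) \<le> B1" by (rule on)
  qed
  show ?thesis
  proof (rule that[of "max B0 B1"])
    fix z h assume z: "z \<in> cball z0 r"
    show "norm (g z) \<le> max B0 B1" using B0 z by (auto intro: max.coboundedI1)
    show "norm (fder g z h) \<le> max B0 B1 * norm h"
      by (rule order_trans[OF d[OF z] mult_right_mono]) auto
  next
    fix z z' assume "z \<in> cball z0 r" "z' \<in> cball z0 r"
    then show "norm (g z' - g z) \<le> max B0 B1 * norm (z' - z)"
      by (intro order_trans[OF l mult_right_mono]) auto
  qed (use B0 in simp)
qed

text \<open>The quadratic remainder comes from the Lipschitz bound of the derivative along the
  segment from \<open>z\<close> to \<open>z'\<close>. It is needed below to control the error of a
  linearization.\<close>

lemma smooth_on_cball_bounds:
  fixes g :: "'e::euclidean_space \<Rightarrow> 'f::euclidean_space"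
  assumes g: "smooth_on W g" and W: "cball z0 r \<subseteq> W"
  obtains B where "B \<ge> 0" "\<And>z. z \<in> cball z0 r \<Longrightarrow> norm (g z) \<le> B"
    "\<And>z h. z \<in> cball z0 r \<Longrightarrow> norm (fder g z h) \<le> B * norm h"
    "\<And>z z'. z \<in> cball z0 r \<Longrightarrow> z' \<in> cball z0 r \<Longrightarrow> norm (g z' - g z) \<le> B * norm (z' - z)"
    "\<And>z z'. z \<in> cball z0 r \<Longrightarrow> z' \<in> cball z0 r \<Longrightarrow>
       norm (g z' - g z - fder g z (z' - z)) \<le> B * (norm (z' - z))\<^sup>2"
proof -
  obtain B where B: "B \<ge> 0" "\<And>z. z \<in> cball z0 r \<Longrightarrow> norm (g z) \<le> B"
    "\<And>z h. z \<in> cball z0 r \<Longrightarrow> norm (fder g z h) \<le> B * norm h"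
    "\<And>z z'. z \<in> cball z0 r \<Longrightarrow> z' \<in> cball z0 r \<Longrightarrow> norm (g z' - g z) \<le> B * norm (z' - z)"
    by (rule smooth_on_cball_lipschitz[OF g W]) blast
  have "\<exists>C. C \<ge> 0 \<and> (\<forall>z\<in>cball z0 r. \<forall>z'\<in>cball z0 r.
      norm (fder g z' b - fder g z b) \<le> C * norm (z' - z))" for b
    by (rule smooth_on_cball_lipschitz[OF smooth_on_frechet_derivative[OF g, of b] W]) blast
  then have "\<forall>b. \<exists>C. C \<ge> 0 \<and> (\<forall>z\<in>cball z0 r. \<forall>z'\<in>cball z0 r.
      norm (fder g z' b - fder g z b) \<le> C * norm (z' - z))" by blast
  from choice[OF this] obtain Cb where Cb: "\<And>b. Cb b \<ge> 0" "\<And>b z z'. z \<in> cball z0 r \<Longrightarrow> z' \<in> cball z0 r \<Longrightarrow>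
      norm (fder g z' b - fder g z b) \<le> Cb b * norm (z' - z)"
    by blast
  define C where "C = (\<Sum>b\<in>Basis. Cb b)"
  have C: "C \<ge> 0" using Cb(1) by (simp add: C_def sum_nonneg)
  have q: "norm (g z' - g z - fder g z (z' - z)) \<le> C * (norm (z' - z))\<^sup>2"
    if z: "z \<in> cball z0 r" "z' \<in> cball z0 r" for z z'
  proof -
    have seg: "closed_segment z z' \<subseteq> cball z0 r"
      using z by (intro closed_segment_subset) auto
    have lin: "linear (fder g x)" if "x \<in> cball z0 r" for x
      using that W by (intro linear_frechet_derivative smooth_on_differentiable[OF g]) blast
    have "norm (g z' - g z - fder g z (z' - z)) \<le> norm (z' - z) * (C * norm (z' - z))"
    proof (rule differentiable_bound_linearization[where S="closed_segment z z'" and f'="\<lambda>x. fder g x"])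
      show "z + t *\<^sub>R (z' - z) \<in> closed_segment z z'" if "t \<in> {0..1}" for t
        using that unfolding closed_segment_def
        by (auto intro!: exI[of _ t] simp: algebra_simps)
      fix x assume x: "x \<in> closed_segment z z'"
      then have xb: "x \<in> cball z0 r" using seg by blast
      show "(g has_derivative fder g x) (at x within closed_segment z z')"
        using xb W by (blast intro: has_derivative_at_withinI[OF smooth_on_has_derivative[OF g]])
      show "onorm (fder g x - fder g z) \<le> C * norm (z' - z)"
      proof (rule onorm_le)
        fix h
        have "(fder g x - fder g z) h
           = fder g x (\<Sum>b\<in>Basis. (h \<bullet> b) *\<^sub>R b)
             - fder g z (\<Sum>b\<in>Basis. (h \<bullet> b) *\<^sub>R b)"
          by (simp add: euclidean_representation)
        also have "\<dots> = (\<Sum>b\<in>Basis. (h \<bullet> b) *\<^sub>R (fder g x b - fder g z b))"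
          using lin[OF xb] lin[OF z(1)]
          by (simp add: linear_sum linear_scale sum_subtractf scaleR_diff_right)
        also have "norm \<dots> \<le> (\<Sum>b\<in>Basis. norm h * (Cb b * norm (z' - z)))"
        proof (rule sum_norm_le)
          fix b :: 'e assume b: "b \<in> Basis"
          have "norm (x - z) \<le> norm (z' - z)" using segment_bound1[OF x] by (simp add: norm_minus_commute)
          then have "norm (fder g x b - fder g z b) \<le> Cb b * norm (z' - z)"
            using Cb(1)[of b] by (intro order_trans[OF Cb(2)[OF z(1) xb] mult_left_mono])
          then have "\<bar>h \<bullet> b\<bar> * norm (fder g x b - fder g z b)
              \<le> norm h * (Cb b * norm (z' - z))"
            using Basis_le_norm[OF b] by (intro mult_mono) auto
          then show "norm ((h \<bullet> b) *\<^sub>R (fder g x b - fder g z b))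
              \<le> norm h * (Cb b * norm (z' - z))" by simp
        qed
        also have "\<dots> = C * norm (z' - z) * norm h"
          by (simp add: C_def sum_distrib_left sum_distrib_right mult.commute mult.left_commute)
        finally show "norm ((fder g x - fder g z) h)
            \<le> C * norm (z' - z) * norm h" .
      qed
    qed auto
    then show ?thesis by (simp add: power2_eq_square algebra_simps)
  qed
  show ?thesis
  proof (rule that[of "max B C"])
    fix z h assume z: "z \<in> cball z0 r"
    show "norm (g z) \<le> max B C" using B z by (auto intro: max.coboundedI1)
    show "norm (fder g z h) \<le> max B C * norm h"
      by (rule order_trans[OF B(3)[OF z] mult_right_mono]) auto
  next
    fix z z' assume z: "z \<in> cball z0 r" "z' \<in> cball z0 r"
    show "norm (g z' - g z) \<le> max B C * norm (z' - z)"
      by (rule order_trans[OF B(4)[OF z] mult_right_mono]) auto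
    show "norm (g z' - g z - fder g z (z' - z)) \<le> max B C * (norm (z' - z))\<^sup>2"
      by (rule order_trans[OF q[OF z] mult_right_mono]) auto
  qed (use B in simp)
qed

text \<open>The map sends \<open>u\<close> to the value at time 1 of the solution of Z' = F u Z
  through \<open>z0\<close>, where F u is the combination of the fields with coefficients u. Instead
  of differentiable dependence on parameters, a direct estimate shows that its increment from
  \<open>u\<close> to \<open>v\<close> is F (v - u) up to an error of second order.\<close>

theorem commuting_fields_integrable:
  fixes Y :: "'n::finite \<Rightarrow> 'e::euclidean_space \<Rightarrow> 'e"
  assumes W: "open W" "z0 \<in> W" and Y: "\<And>\<mu>. smooth_on W (Y \<mu>)"
    and comm: "\<And>\<mu> \<nu> z. z \<in> W \<Longrightarrow>
      fder (Y \<nu>) z (Y \<mu> z) = fder (Y \<mu>) z (Y \<nu> z)"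
  obtains D and \<phi> :: "real^'n \<Rightarrow> 'e" where "open D" "0 \<in> D" "\<phi> 0 = z0" "\<phi> ` D \<subseteq> W"
    "\<And>u. u \<in> D \<Longrightarrow> (\<phi> has_derivative (\<lambda>h. \<Sigma> \<mu>. h $ \<mu> *\<^sub>R Y \<mu> (\<phi> u))) (at u)"
    "smooth_on D \<phi>"
proof -
  obtain r where r: "r > 0" "cball z0 r \<subseteq> W" using W open_contains_cball by blast
  define F where "F u z = (\<Sigma> \<mu>. u $ \<mu> *\<^sub>R Y \<mu> z)" for u :: "real^'n" and z
  define F' where "F' u z h = (\<Sigma> \<mu>. u $ \<mu> *\<^sub>R fder (Y \<mu>) z h)" for u :: "real^'n" and z h
  have "\<exists>B. B \<ge> 0 \<and> (\<forall>z\<in>cball z0 r. norm (Y \<mu> z) \<le> B \<and>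
      (\<forall>h. norm (fder (Y \<mu>) z h) \<le> B * norm h) \<and>
      (\<forall>z'\<in>cball z0 r. norm (Y \<mu> z' - Y \<mu> z) \<le> B * norm (z' - z) \<and>
        norm (Y \<mu> z' - Y \<mu> z - fder (Y \<mu>) z (z' - z)) \<le> B * (norm (z' - z))\<^sup>2))" for \<mu>
    by (rule smooth_on_cball_bounds[OF Y[of \<mu>] r(2)]) blast
  then obtain B where B': "\<And>\<mu>. B \<mu> \<ge> 0 \<and> (\<forall>z\<in>cball z0 r. norm (Y \<mu> z) \<le> B \<mu> \<and>
      (\<forall>h. norm (fder (Y \<mu>) z h) \<le> B \<mu> * norm h) \<and>
      (\<forall>z'\<in>cball z0 r. norm (Y \<mu> z' - Y \<mu> z) \<le> B \<mu> * norm (z' - z) \<and>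
        norm (Y \<mu> z' - Y \<mu> z - fder (Y \<mu>) z (z' - z)) \<le> B \<mu> * (norm (z' - z))\<^sup>2))"
    by metis
  note B = B'[THEN conjunct1] B'[THEN conjunct2, rule_format, THEN conjunct1]
    B'[THEN conjunct2, rule_format, THEN conjunct2, THEN conjunct1, rule_format]
    B'[THEN conjunct2, rule_format, THEN conjunct2, THEN conjunct2, rule_format, THEN conjunct1]
    B'[THEN conjunct2, rule_format, THEN conjunct2, THEN conjunct2, rule_format, THEN conjunct2]
  define M where "M = (\<Sigma> \<mu>. B \<mu>) + 1"
  have M: "M > 0" using B(1) by (simp add: M_def sum_nonneg add_nonneg_pos)
  have comb: "norm (\<Sigma> \<mu>. u $ \<mu> *\<^sub>R x \<mu>) \<le> M * norm u * c"
    if "\<And>\<mu>. norm (x \<mu>) \<le> B \<mu> * c" "c \<ge> 0" for u :: "real^'n" and x :: "'n \<Rightarrow> 'e" and c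
  proof -
    have "norm (\<Sigma> \<mu>. u $ \<mu> *\<^sub>R x \<mu>) \<le> (\<Sigma> \<mu>. norm u * (B \<mu> * c))"
    proof (rule sum_norm_le)
      fix \<mu>
      have "\<bar>u $ \<mu>\<bar> * norm (x \<mu>) \<le> norm u * (B \<mu> * c)"
        using that component_le_norm_cart[of u \<mu>] by (intro mult_mono) auto
      then show "norm (u $ \<mu> *\<^sub>R x \<mu>) \<le> norm u * (B \<mu> * c)" by simp
    qed
    also have "\<dots> = (M - 1) * norm u * c"
      by (simp add: M_def sum_distrib_left sum_distrib_right algebra_simps)
    also have "\<dots> \<le> M * norm u * c" using that(2) by (intro mult_right_mono) auto
    finally show ?thesis .
  qed
  have Fb: "norm (F u z) \<le> M * norm u" if "z \<in> cball z0 r" for u z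
    using comb[of "\<lambda>\<mu>. Y \<mu> z" 1 u] B(2)[OF that] by (simp add: F_def)
  have Fl: "norm (F u z' - F u z) \<le> M * norm u * norm (z' - z)" if "z \<in> cball z0 r" "z' \<in> cball z0 r" for u z z'
    using comb[of "\<lambda>\<mu>. Y \<mu> z' - Y \<mu> z" "norm (z' - z)" u] B(4)[OF that]
    by (simp add: F_def sum_subtractf scaleR_diff_right)
  have F'b: "norm (F' u z h) \<le> M * norm u * norm h" if "z \<in> cball z0 r" for u z h
    using comb[of "\<lambda>\<mu>. fder (Y \<mu>) z h" "norm h" u] B(3)[OF that] by (simp add: F'_def)
  have Fq: "norm (F u z' - F u z - F' u z (z' - z)) \<le> M * norm u * (norm (z' - z))\<^sup>2"
    if "z \<in> cball z0 r" "z' \<in> cball z0 r" for u z z'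
    using comb[of "\<lambda>\<mu>. Y \<mu> z' - Y \<mu> z - fder (Y \<mu>) z (z' - z)" "(norm (z' - z))\<^sup>2" u] B(5)[OF that]
    by (simp add: F_def F'_def sum_subtractf scaleR_diff_right)
  have Fd: "(F u has_derivative F' u z) (at z)" if "z \<in> W" for u z
    unfolding F_def[abs_def] F'_def[abs_def]
    by (intro has_derivative_sum has_derivative_scaleR_right smooth_on_has_derivative[OF Y that])
  have F'lin: "linear (F' u z)" if "z \<in> W" for u z
    using Fd[OF that] has_derivative_linear by blast
  have Fdiff: "F (u - v) z = F u z - F v z" for u v z
    by (simp add: F_def scaleR_diff_left sum_subtractf)
  have F'diff: "F' (u - v) z h = F' u z h - F' v z h" for u v z h
    by (simp add: F'_def scaleR_diff_left sum_subtractf)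
  have F'comm: "F' u z (F v z) = F' v z (F u z)" if "z \<in> W" for u v z
  proof -
    have l: "linear (fder (Y \<mu>) z)" for \<mu>
      using smooth_on_differentiable[OF Y that] by (rule linear_frechet_derivative)
    have e: "F' u z (F v z) = (\<Sigma> \<mu> \<nu>. (u $ \<mu> * v $ \<nu>) *\<^sub>R fder (Y \<mu>) z (Y \<nu> z))" for u v
      by (simp add: F'_def F_def linear_sum[OF l] linear_scale[OF l] scaleR_sum_right)
    show ?thesis
      unfolding e[of u v] e[of v u] sum.swap[of "\<lambda>\<mu> \<nu>. (v $ \<mu> * u $ \<nu>) *\<^sub>R _ \<mu> \<nu>"]
      by (intro sum.cong refl) (simp add: comm[OF that] mult.commute)
  qed
  \<comment> \<open>The bound 1/2 on \<open>M * \<epsilon>\<close> makes the integral operator a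
    contraction, the bound \<open>r\<close> keeps solutions in the ball for unit time, and
    \<epsilon> <= 1 lets factors \<open>norm v\<close> be dropped.\<close>
  define \<epsilon> where "\<epsilon> = min 1 (min (1 / (2 * M)) (r / M))"
  have \<epsilon>: "\<epsilon> > 0" "\<epsilon> \<le> 1" "M * \<epsilon> \<le> 1/2" "M * \<epsilon> \<le> r"
  proof -
    show "\<epsilon> > 0" "\<epsilon> \<le> 1" using M r by (auto simp: \<epsilon>_def)
    have "\<epsilon> \<le> 1 / (2 * M)" "\<epsilon> \<le> r / M" by (simp_all add: \<epsilon>_def)
    then show "M * \<epsilon> \<le> 1/2" "M * \<epsilon> \<le> r" using M by (simp_all add: field_simps)
  qed
  have "\<exists>Z. Z 0 = z0 \<and> (\<forall>t\<in>{0..1}. (Z has_vector_derivative F u (Z t)) (at t within {0..1::real})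
      \<and> Z t \<in> cball z0 r \<and> norm (Z t - z0) \<le> M * norm u)" if u: "u \<in> ball 0 \<epsilon>" for u
  proof -
    \<comment> \<open>Composition with the projection onto the ball extends the field to the whole
      space without increasing its Lipschitz constant. Solutions stay in the ball, where both fields
      agree.\<close>
    define G where "G z = F u (closest_point (cball z0 r) z)" for z
    have cp: "closest_point (cball z0 r) z \<in> cball z0 r" for z
      using r by (intro closest_point_in_set) auto
    have n: "M * norm u \<le> M * \<epsilon>" using u M by (simp add: mult_left_mono)
    have 1: "norm (G x - G y) \<le> (M * norm u) * norm (x - y)" for x y
    proof -
      have "norm (G x - G y) \<le> M * norm u * norm (closest_point (cball z0 r) x - closest_point (cball z0 r) y)"
        unfolding G_def by (rule Fl[OF cp cp])
      also have "\<dots> \<le> (M * norm u) * norm (x - y)"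
        using closest_point_lipschitz[of "cball z0 r" x y] r M
        by (intro mult_left_mono) (auto simp: dist_norm)
      finally show ?thesis .
    qed
    have 2: "norm (G x) \<le> M * norm u" for x unfolding G_def by (rule Fb[OF cp])
    obtain Z where Z: "Z 0 = z0" "\<And>t. t \<in> {0..1} \<Longrightarrow> (Z has_vector_derivative G (Z t)) (at t within {0..1})"
      "\<And>t. t \<in> {0..1} \<Longrightarrow> norm (Z t - z0) \<le> M * norm u"
      using picard_unit_interval[of G "M * norm u" "M * norm u" z0] 1 2 n \<epsilon> M by auto
    have in_cball: "Z t \<in> cball z0 r" if "t \<in> {0..1}" for t
      using Z(3)[OF that] n \<epsilon>(4) by (simp add: dist_norm norm_minus_commute)
    then have "G (Z t) = F u (Z t)" if "t \<in> {0..1}" for t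
      unfolding G_def using closest_point_self that by metis
    then show ?thesis using Z in_cball by auto
  qed
  then obtain Z where Z: "\<And>u. u \<in> ball 0 \<epsilon> \<Longrightarrow> Z u 0 = z0"
    "\<And>u t. u \<in> ball 0 \<epsilon> \<Longrightarrow> t \<in> {0..1} \<Longrightarrow> (Z u has_vector_derivative F u (Z u t)) (at t within {0..1::real})"
    "\<And>u t. u \<in> ball 0 \<epsilon> \<Longrightarrow> t \<in> {0..1} \<Longrightarrow> Z u t \<in> cball z0 r"
    "\<And>u t. u \<in> ball 0 \<epsilon> \<Longrightarrow> t \<in> {0..1} \<Longrightarrow> norm (Z u t - z0) \<le> M * norm u"
    by metis
  define E where "E = exp (2 * M + 1)"
  have E: "E \<ge> 0" by (simp add: E_def)
  \<comment> \<open>The first summand bounds the Taylor remainder, with the distance of the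
    solutions at most \<open>M * norm (v - u) * E\<close>; the second bounds the term of second
    order in \<open>v - u\<close>; \<open>E\<close> is the Gronwall factor.\<close>
  define K where "K = (M * (M * E)\<^sup>2 + M * M) * E"
  define \<phi> where "\<phi> u = Z u 1" for u
  have main: "norm (\<phi> v - \<phi> u - F (v - u) (\<phi> u)) \<le> K * (norm (v - u))\<^sup>2"
    if u: "u \<in> ball 0 \<epsilon>" and v: "v \<in> ball 0 \<epsilon>" for u v
  proof -
    have nv: "norm v \<le> 1" using v \<epsilon> by simp
    have Mv: "M * norm v * x \<le> M * x" if "x \<ge> 0" for x
      using nv M that by (intro mult_right_mono mult_left_le) auto
    define \<delta> where "\<delta> = norm (v - u)"
    have \<delta>: "\<delta> \<ge> 0" by (simp add: \<delta>_def)
    define d where "d t = Z v t - Z u t" for t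
    have dd: "(d has_vector_derivative F v (Z v t) - F u (Z u t)) (at t within {0..1})" if "t \<in> {0..1}" for t
      unfolding d_def using Z(2)[OF u that] Z(2)[OF v that] by (rule has_vector_derivative_diff[rotated])
    have db: "norm (d t) \<le> M * \<delta> * E" if "t \<in> {0..1}" for t
      unfolding E_def
    proof (rule gronwall_norm[OF dd _ _ _ _ that])
      fix t :: real assume t: "t \<in> {0..1}"
      have "F v (Z v t) - F u (Z u t) = (F v (Z v t) - F v (Z u t)) + F (v - u) (Z u t)"
        by (simp add: Fdiff)
      also have "norm \<dots> \<le> M * norm v * norm (Z v t - Z u t) + M * norm (v - u)"
        by (intro norm_triangle_mono Fl Fb Z t u v)
      also have "\<dots> \<le> M * norm (d t) + M * \<delta>"
        using Mv[of "norm (d t)"] by (simp add: d_def \<delta>_def)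
      finally show "norm (F v (Z v t) - F u (Z u t)) \<le> M * norm (d t) + M * \<delta>" .
    qed (use Z(1)[OF u] Z(1)[OF v] M \<delta> in \<open>auto simp: d_def\<close>)
    \<comment> \<open>For commuting fields \<open>t *\<^sub>R F (v - u) (Z u t)\<close> is the
      first-order variation of the solution, so \<open>e\<close> should be of second order in
      \<open>v - u\<close>.\<close>
    define e where "e t = d t - t *\<^sub>R F (v - u) (Z u t)" for t
    define e' where "e' t = F v (Z v t) - F u (Z u t)
        - (t *\<^sub>R F' (v - u) (Z u t) (F u (Z u t)) + 1 *\<^sub>R F (v - u) (Z u t))" for t
    have ed: "(e has_vector_derivative e' t) (at t within {0..1})" if t: "t \<in> {0..1}" for t
    proof -
      have zW: "Z u t \<in> W" using Z(3)[OF u t] r by blast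
      have "((\<lambda>t. F (v - u) (Z u t)) has_derivative (\<lambda>k. F' (v - u) (Z u t) (k *\<^sub>R F u (Z u t)))) (at t within {0..1})"
        using has_derivative_compose[OF Z(2)[OF u t, unfolded has_vector_derivative_def] Fd[OF zW, of "v - u"]]
        by simp
      then have "((\<lambda>t. F (v - u) (Z u t)) has_vector_derivative F' (v - u) (Z u t) (F u (Z u t))) (at t within {0..1})"
        unfolding has_vector_derivative_def using linear_scale[OF F'lin[OF zW]] by simp
      then show ?thesis unfolding e_def e'_def
        by (intro has_vector_derivative_diff dd t has_vector_derivative_scaleR DERIV_ident)
    qed
    have eb: "norm (e t) \<le> ((M * (M * E)\<^sup>2 + M * M) * \<delta>\<^sup>2) * E" if "t \<in> {0..1}" for t
      unfolding E_def
    proof (rule gronwall_norm[OF ed _ _ _ _ that], fold E_def)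
      fix t :: real assume t: "t \<in> {0..1}"
      let ?z = "Z u t"
      have z: "?z \<in> cball z0 r" by (rule Z(3)[OF u t])
      then have zW: "?z \<in> W" using r by blast
      have "F' v ?z (d t) = F' v ?z (e t) + t *\<^sub>R F' v ?z (F (v - u) ?z)"
        using F'lin[OF zW, of v] by (simp add: e_def linear_diff linear_scale)
      \<comment> \<open>Commutation enters here: it turns the derivative of F u along F (v - u) into
        the derivative of F (v - u) along F u, which cancels against the term from the moving base
        point. The rest is quadratic in \<open>v - u\<close>.\<close>
      moreover have "F' v ?z (F (v - u) ?z) = F' (v - u) ?z (F (v - u) ?z) + F' (v - u) ?z (F u ?z)"
        using F'comm[OF zW, of u "v - u"] by (simp add: F'diff)
      ultimately have "e' t = (F v (Z v t) - F v ?z - F' v ?z (Z v t - ?z)) + F' v ?z (e t)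
          + t *\<^sub>R F' (v - u) ?z (F (v - u) ?z)"
        by (simp add: e'_def d_def Fdiff algebra_simps)
      also have "norm \<dots> \<le> M * norm v * (norm (d t))\<^sup>2 + M * norm v * norm (e t) + M * \<delta> * (M * \<delta>)"
      proof (intro norm_triangle_mono)
        show "norm (F v (Z v t) - F v ?z - F' v ?z (Z v t - ?z)) \<le> M * norm v * (norm (d t))\<^sup>2"
          unfolding d_def by (intro Fq Z t u v)
        show "norm (F' v ?z (e t)) \<le> M * norm v * norm (e t)" by (rule F'b[OF z])
        have "norm (F' (v - u) ?z (F (v - u) ?z)) \<le> M * \<delta> * norm (F (v - u) ?z)"
          unfolding \<delta>_def by (rule F'b[OF z])
        also have "\<dots> \<le> M * \<delta> * (M * \<delta>)"
          using Fb[OF z, of "v - u"] M \<delta> by (intro mult_left_mono) (auto simp: \<delta>_def)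
        finally have "norm (F' (v - u) ?z (F (v - u) ?z)) \<le> M * \<delta> * (M * \<delta>)" .
        then show "norm (t *\<^sub>R F' (v - u) ?z (F (v - u) ?z)) \<le> M * \<delta> * (M * \<delta>)"
          using t by (simp add: mult_left_le_one_le order_trans[OF mult_left_le_one_le])
      qed
      also have "\<dots> \<le> M * (M * \<delta> * E)\<^sup>2 + M * norm (e t) + M * \<delta> * (M * \<delta>)"
      proof (intro add_mono order_refl)
        have "M * norm v * (norm (d t))\<^sup>2 \<le> M * (norm (d t))\<^sup>2" by (rule Mv) simp
        also have "\<dots> \<le> M * (M * \<delta> * E)\<^sup>2"
          using db[OF t] M by (intro mult_left_mono power_mono) auto
        finally show "M * norm v * (norm (d t))\<^sup>2 \<le> M * (M * \<delta> * E)\<^sup>2" .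
        show "M * norm v * norm (e t) \<le> M * norm (e t)" by (rule Mv) simp
      qed
      finally show "norm (e' t) \<le> M * norm (e t) + (M * (M * E)\<^sup>2 + M * M) * \<delta>\<^sup>2"
        by (simp add: power2_eq_square algebra_simps)
    qed (use Z(1)[OF u] Z(1)[OF v] M in \<open>auto simp: e_def d_def\<close>)
    from eb[of 1] show ?thesis
      by (simp add: e_def d_def \<phi>_def K_def \<delta>_def algebra_simps)
  qed
  have der: "(\<phi> has_derivative (\<lambda>h. F h (\<phi> u))) (at u)" if u: "u \<in> ball 0 \<epsilon>" for u
  proof -
    have lin: "bounded_linear (\<lambda>h. F h (\<phi> u))"
      unfolding linear_conv_bounded_linear[symmetric] F_def
      by (intro linearI) (simp_all add: scaleR_add_left sum.distrib scaleR_sum_right)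
    have K: "K \<ge> 0" using M E by (simp add: K_def)
    show ?thesis unfolding has_derivative_at_alt
    proof (intro conjI lin allI impI)
      fix e :: real assume e: "e > 0"
      obtain s where s: "s > 0" "ball u s \<subseteq> ball 0 \<epsilon>" using u by (meson open_ball open_contains_ball)
      have "K + 1 > 0" using K by simp
      show "\<exists>d>0. \<forall>y. norm (y - u) < d \<longrightarrow> norm (\<phi> y - \<phi> u - F (y - u) (\<phi> u)) \<le> e * norm (y - u)"
      proof (intro exI[of _ "min s (e / (K + 1))"] conjI allI impI)
        show "min s (e / (K + 1)) > 0" using s e \<open>K + 1 > 0\<close> by simp
        fix y assume y: "norm (y - u) < min s (e / (K + 1))"
        then have "y \<in> ball 0 \<epsilon>" using s by (auto simp: dist_norm norm_minus_commute)
        from main[OF u this] have "norm (\<phi> y - \<phi> u - F (y - u) (\<phi> u)) \<le> (K * norm (y - u)) * norm (y - u)"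
          by (simp add: power2_eq_square mult.assoc)
        also have "\<dots> \<le> e * norm (y - u)"
        proof (rule mult_right_mono)
          have "K * norm (y - u) \<le> (K + 1) * norm (y - u)" by (simp add: mult_right_mono)
          also have "\<dots> \<le> (K + 1) * (e / (K + 1))" using y \<open>K + 1 > 0\<close> by (intro mult_left_mono) auto
          also have "\<dots> = e" using \<open>K + 1 > 0\<close> by simp
          finally show "K * norm (y - u) \<le> e" .
        qed simp
        finally show "norm (\<phi> y - \<phi> u - F (y - u) (\<phi> u)) \<le> e * norm (y - u)" .
      qed
    qed
  qed
  have im: "\<phi> ` ball 0 \<epsilon> \<subseteq> W" using Z(3) r by (auto simp: \<phi>_def)
  \<comment> \<open>The derivative of the map is a smooth field composed with the map itself, so
    each order of differentiability yields the next.\<close>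
  have "Ck_on k (ball 0 \<epsilon>) \<phi>" for k
  proof (induction k)
    case 0
    show ?case using der by (auto intro!: continuous_at_imp_continuous_on has_derivative_continuous)
  next
    case (Suc k)
    have 1: "smooth_on W (F v)" for v
      unfolding F_def using W Y by (intro smooth_on_sum smooth_on_scaleR) auto
    have "Ck_on k (ball 0 \<epsilon>) (\<lambda>u. F v (\<phi> u))" for v
      by (rule Ck_on_compose[OF _ im]) (use 1 Suc in \<open>auto simp: smooth_on_def\<close>)
    then have "Ck_on k (ball 0 \<epsilon>) (\<lambda>u. fder \<phi> u v)" for v
      by (rule Ck_on_cong[rotated 2]) (use frechet_derivative_eqI[OF der] in auto)
    moreover have "\<forall>u\<in>ball 0 \<epsilon>. \<phi> differentiable (at u)" using der differentiable_def by blast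
    ultimately show ?case by simp
  qed
  then have sm: "smooth_on (ball 0 \<epsilon>) \<phi>" by (simp add: smooth_on_def)
  have "\<phi> 0 = z0" using Z(4)[of 0 1] \<epsilon> by (simp add: \<phi>_def)
  then show ?thesis
    using that[of "ball 0 \<epsilon>" \<phi>] \<epsilon>(1) im der sm by (simp add: F_def)
qed

section \<open>Vector-valued forms\<close>

definition smooth_form :: "'e::euclidean_space set \<Rightarrow> ('e \<Rightarrow> 'e \<Rightarrow> 'f::real_normed_vector) \<Rightarrow> bool" where
  "smooth_form U \<beta> \<longleftrightarrow> (\<forall>v. smooth_on U (\<lambda>y. \<beta> y v)) \<and> (\<forall>y\<in>U. linear (\<beta> y))"

definition vext_d :: "('e::real_normed_vector \<Rightarrow> 'e \<Rightarrow> 'f::real_normed_vector) \<Rightarrow> 'e \<Rightarrow> 'e \<Rightarrow> 'e \<Rightarrow> 'f" where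
  "vext_d \<beta> y u v = fder (\<lambda>z. \<beta> z v) y u - fder (\<lambda>z. \<beta> z u) y v"

lemma smooth_form_smooth: "smooth_form U \<beta> \<Longrightarrow> smooth_on U (\<lambda>y. \<beta> y v)"
  and smooth_form_linear: "smooth_form U \<beta> \<Longrightarrow> y \<in> U \<Longrightarrow> linear (\<beta> y)"
  by (auto simp: smooth_form_def)

lemma smooth_form_compose:
  fixes g :: "'g::real_normed_vector \<Rightarrow> 'e::euclidean_space"
  assumes "smooth_form U \<beta>" "open S" "smooth_on S g" "g ` S \<subseteq> U" "smooth_on S \<eta>"
  shows "smooth_on S (\<lambda>x. \<beta> (g x) (\<eta> x))"
proof (rule smooth_on_linear_family[where \<beta>="\<lambda>x. \<beta> (g x)"])
  show "smooth_on S (\<lambda>x. \<beta> (g x) v)" for v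
    by (rule smooth_on_compose[OF assms(2) _ assms(3,4)]) (use assms(1) in \<open>simp add: smooth_form_def\<close>)
  show "linear (\<beta> (g x))" if "x \<in> S" for x
    using assms(1,4) that by (auto simp: smooth_form_def)
qed (use assms in auto)

text \<open>The product rule for a form whose base point and argument both move; a family of linear
  maps is treated as a sum over a basis so that the ordinary product rule applies.\<close>

lemma form_has_derivative:
  fixes g :: "'g::real_normed_vector \<Rightarrow> 'e::euclidean_space"
  assumes U: "open U" and \<beta>: "smooth_form U \<beta>" and x: "g x \<in> U"
    and g: "(g has_derivative g') (at x)" and \<eta>: "(\<eta> has_derivative \<eta>') (at x)"
  shows "((\<lambda>z. \<beta> (g z) (\<eta> z)) has_derivative
    (\<lambda>k. fder (\<lambda>y. \<beta> y (\<eta> x)) (g x) (g' k) + \<beta> (g x) (\<eta>' k))) (at x)"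
proof -
  have lin: "\<beta> y v = (\<Sum>b\<in>Basis. (v \<bullet> b) *\<^sub>R \<beta> y b)" if "y \<in> U" for y v
  proof -
    have "\<beta> y (\<Sum>b\<in>Basis. (v \<bullet> b) *\<^sub>R b) = (\<Sum>b\<in>Basis. (v \<bullet> b) *\<^sub>R \<beta> y b)"
      using smooth_form_linear[OF \<beta> that] by (simp add: linear_sum linear_scale)
    then show ?thesis by (simp add: euclidean_representation)
  qed
  define D where "D v = fder (\<lambda>y. \<beta> y v) (g x)" for v
  have D: "((\<lambda>y. \<beta> y v) has_derivative D v) (at (g x))" for v
    unfolding D_def by (rule smooth_on_has_derivative[OF smooth_form_smooth[OF \<beta>] x])
  have Dg: "((\<lambda>z. \<beta> (g z) b) has_derivative (\<lambda>k. D b (g' k))) (at x)" for b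
    using diff_chain_at[OF g D] by (simp add: o_def)
  have 1: "((\<lambda>z. \<Sum>b\<in>Basis. (\<eta> z \<bullet> b) *\<^sub>R \<beta> (g z) b) has_derivative
     (\<lambda>k. \<Sum>b\<in>Basis. (\<eta> x \<bullet> b) *\<^sub>R D b (g' k) + (\<eta>' k \<bullet> b) *\<^sub>R \<beta> (g x) b)) (at x)"
    by (intro has_derivative_sum has_derivative_scaleR has_derivative_inner_left \<eta> Dg)
  have "D (\<eta> x) = (\<lambda>k. \<Sum>b\<in>Basis. (\<eta> x \<bullet> b) *\<^sub>R D b k)"
  proof -
    have "((\<lambda>y. \<Sum>b\<in>Basis. (\<eta> x \<bullet> b) *\<^sub>R \<beta> y b) has_derivative (\<lambda>k. \<Sum>b\<in>Basis. (\<eta> x \<bullet> b) *\<^sub>R D b k)) (at (g x))"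
      by (intro has_derivative_sum has_derivative_scaleR_right D)
    then have "((\<lambda>y. \<beta> y (\<eta> x)) has_derivative (\<lambda>k. \<Sum>b\<in>Basis. (\<eta> x \<bullet> b) *\<^sub>R D b k)) (at (g x))"
      by (rule has_derivative_transform_within_open[OF _ U x]) (simp add: lin[symmetric])
    then show ?thesis using D has_derivative_unique by blast
  qed
  then have 2: "(\<lambda>k. \<Sum>b\<in>Basis. (\<eta> x \<bullet> b) *\<^sub>R D b (g' k) + (\<eta>' k \<bullet> b) *\<^sub>R \<beta> (g x) b)
     = (\<lambda>k. D (\<eta> x) (g' k) + \<beta> (g x) (\<eta>' k))"
    using x by (simp add: sum.distrib lin[of "g x", symmetric])
  have "isCont g x" using g has_derivative_continuous by blast
  then have "eventually (\<lambda>z. g z \<in> U) (at x)"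
    using U x by (simp add: continuous_at tendsto_def)
  then have "eventually (\<lambda>z. (\<Sum>b\<in>Basis. (\<eta> z \<bullet> b) *\<^sub>R \<beta> (g z) b) = \<beta> (g z) (\<eta> z)) (at x)"
    by eventually_elim (simp add: lin[symmetric])
  from has_derivative_transform_eventually[OF 1[unfolded 2] this] x
  show ?thesis by (simp add: D_def lin[symmetric])
qed

text \<open>For a map \<open>g\<close> and fields \<open>\<eta>1\<close>, \<open>\<eta>2\<close> along it that are tangent to its image, the exterior
  derivative is computed on the parameter space; for \<open>g = (\<lambda>y. y)\<close> this is the invariant formula
  with the Lie bracket.\<close>

lemma vext_d_along:
  fixes g :: "'g::real_normed_vector \<Rightarrow> 'e::euclidean_space"
  assumes U: "open U" and \<beta>: "smooth_form U \<beta>" and x: "g x \<in> U"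
    and g: "(g has_derivative g') (at x)"
    and \<eta>: "(\<eta>1 has_derivative \<eta>1') (at x)" "(\<eta>2 has_derivative \<eta>2') (at x)"
    and k: "g' k1 = \<eta>1 x" "g' k2 = \<eta>2 x"
  shows "fder (\<lambda>z. \<beta> (g z) (\<eta>2 z)) x k1 - fder (\<lambda>z. \<beta> (g z) (\<eta>1 z)) x k2
    = vext_d \<beta> (g x) (\<eta>1 x) (\<eta>2 x) + \<beta> (g x) (\<eta>2' k1 - \<eta>1' k2)"
  using frechet_derivative_eqI[OF form_has_derivative[OF U \<beta> x g \<eta>(1)]]
    frechet_derivative_eqI[OF form_has_derivative[OF U \<beta> x g \<eta>(2)]] k
    smooth_form_linear[OF \<beta> x]
  by (simp add: vext_d_def linear_diff)

lemma vext_d_skew: "vext_d \<beta> y u v = - vext_d \<beta> y v u"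
  by (simp add: vext_d_def)

lemma smooth_form_linear_second:
  assumes \<beta>: "smooth_form U \<beta>" and U: "open U" "y \<in> U"
  shows "linear (\<lambda>v. fder (\<lambda>z. \<beta> z v) y u)"
proof (rule linearI)
  have d: "((\<lambda>z. \<beta> z v) has_derivative fder (\<lambda>z. \<beta> z v) y) (at y)" for v
    by (rule smooth_on_has_derivative[OF smooth_form_smooth[OF \<beta>] U(2)])
  fix a b :: 'a and r :: real
  have "((\<lambda>z. \<beta> z (a + b)) has_derivative (\<lambda>k. fder (\<lambda>z. \<beta> z a) y k + fder (\<lambda>z. \<beta> z b) y k)) (at y)"
    by (rule has_derivative_transform_within_open[OF has_derivative_add[OF d[of a] d[of b]] U])
      (simp add: linear_add[OF smooth_form_linear[OF \<beta>]])
  then show "fder (\<lambda>z. \<beta> z (a + b)) y u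
     = fder (\<lambda>z. \<beta> z a) y u + fder (\<lambda>z. \<beta> z b) y u"
    by (simp add: frechet_derivative_eqI)
  have "((\<lambda>z. \<beta> z (r *\<^sub>R b)) has_derivative (\<lambda>k. r *\<^sub>R fder (\<lambda>z. \<beta> z b) y k)) (at y)"
    by (rule has_derivative_transform_within_open[OF has_derivative_scaleR_right[OF d[of b]] U])
      (simp add: linear_scale[OF smooth_form_linear[OF \<beta>]])
  then show "fder (\<lambda>z. \<beta> z (r *\<^sub>R b)) y u = r *\<^sub>R fder (\<lambda>z. \<beta> z b) y u"
    by (simp add: frechet_derivative_eqI)
qed

lemma vext_d_bilinear:
  assumes \<beta>: "smooth_form U \<beta>" and U: "open U" "y \<in> U"
  shows "bilinear (vext_d \<beta> y)"
proof -
  have "linear (fder (\<lambda>z. \<beta> z v) y)" for v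
    by (intro linear_frechet_derivative smooth_on_differentiable[OF smooth_form_smooth[OF \<beta>] U(2)])
  then show ?thesis unfolding bilinear_def vext_d_def
    by (auto intro!: linear_compose_sub smooth_form_linear_second[OF \<beta> U])
qed

section \<open>The structure equations in matrix form\<close>

definition tors :: "('p::finite, 'q::finite) prolonged_frame \<Rightarrow> real^'q^'p \<Rightarrow> real^'q^'p \<Rightarrow> real^'q^'p \<Rightarrow> real^'q^'p" where
  "tors P y z z' = (\<chi> \<alpha> i. \<Sigma> \<beta> \<gamma> j k.
     obj_a P y $ (i, \<beta>, \<gamma>, \<alpha>, j, k) * (z $ \<beta> $ j * z' $ \<gamma> $ k - z' $ \<beta> $ j * z $ \<gamma> $ k))"

text \<open>The lower Latin index labels the rows, as in \<open>frm_q\<close>; so a Latin vector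
  acts as a row vector from the left, while Greek vectors are columns.\<close>

definition curv1 :: "('p::finite, 'q::finite) prolonged_frame \<Rightarrow> real^'q^'p \<Rightarrow> real^'q^'p \<Rightarrow> real^'q^'p \<Rightarrow> real^'q^'q" where
  "curv1 P y z z' = (\<chi> j i. \<Sigma> \<gamma> \<delta> k l.
     obj_b1 P y $ (i, \<gamma>, \<delta>, j, k, l) * (z $ \<gamma> $ k * z' $ \<delta> $ l - z' $ \<gamma> $ k * z $ \<delta> $ l))"

definition curv2 :: "('p::finite, 'q::finite) prolonged_frame \<Rightarrow> real^'q^'p \<Rightarrow> real^'q^'p \<Rightarrow> real^'q^'p \<Rightarrow> real^'p^'p" where
  "curv2 P y z z' = (\<chi> \<alpha> \<beta>. \<Sigma> \<gamma> \<delta> k l.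
     obj_b2 P y $ (\<beta>, \<gamma>, \<delta>, \<alpha>, k, l) * (z $ \<gamma> $ k * z' $ \<delta> $ l - z' $ \<gamma> $ k * z $ \<delta> $ l))"

text \<open>The last structure equation contracts c with the product of the third pair and then the
  second one; the exchanged order is kept here, and it reappears in
  \<open>curvn_axis\<close>.\<close>

definition curvn :: "('p::finite, 'q::finite) prolonged_frame \<Rightarrow> real^'q^'p \<Rightarrow> real^'q^'p \<Rightarrow> real^'q^'p \<Rightarrow> real^'p^'q" where
  "curvn P y z z' = (\<chi> i \<alpha>. \<Sigma> \<beta> \<gamma> j k.
     obj_c P y $ (\<alpha>, \<beta>, \<gamma>, i, j, k) * (z $ \<gamma> $ k * z' $ \<beta> $ j - z' $ \<gamma> $ k * z $ \<beta> $ j))"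

text \<open>The torsion carried over to \<nu> by the trace pairing of \<open>\<nu>\<close> with
  \<open>w\<close>; see \<open>trace_tdual\<close>.\<close>

definition tdual :: "('p::finite, 'q::finite) prolonged_frame \<Rightarrow> real^'q^'p \<Rightarrow> real^'p^'q \<Rightarrow> real^'q^'p \<Rightarrow> real^'p^'q" where
  "tdual P y n z = (\<chi> i \<alpha>. \<Sigma> k \<gamma> \<beta> j.
     obj_a P y $ (k, \<alpha>, \<beta>, \<gamma>, i, j) * (n $ k $ \<gamma> * z $ \<beta> $ j))"

lemma frechet_derivative_component:
  "f differentiable (at x) \<Longrightarrow> fder (\<lambda>z. f z $ i) x v = fder f x v $ i"
  by (subst frechet_derivative_eqI[OF bounded_linear.has_derivative[OF bounded_linear_vec_nth has_derivative_frechet]])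
    auto

lemma differentiable_component:
  "f differentiable (at x) \<Longrightarrow> (\<lambda>z. f z $ i) differentiable (at x)"
  using bounded_linear.has_derivative[OF bounded_linear_vec_nth]
  unfolding differentiable_def by blast

lemma ext_d_component2:
  fixes \<beta> :: "'e::real_normed_vector \<Rightarrow> 'e \<Rightarrow> real^'a^'b"
  assumes "\<And>v. (\<lambda>z. \<beta> z v) differentiable (at y)"
  shows "ext_d (\<lambda>y v. \<beta> y v $ i $ j) y u v = vext_d \<beta> y u v $ i $ j"
  by (simp add: ext_d_def vext_d_def assms frechet_derivative_component differentiable_component)

text \<open>Matrix products absorb the sums over repeated indices, so that later computations with
  the structure equations become noncommutative algebra.\<close>

definition matrix_structure_equations ::
  "('p::finite, 'q::finite) prolonged_frame \<Rightarrow> real^'q^'p \<Rightarrow> bool" where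
  "matrix_structure_equations P y \<longleftrightarrow>
    (let p = real CARD('p); q = real CARD('q);
         w = frm_w P y; \<omega> = frm_h P y; \<pi> = frm_p P y; \<rho> = frm_q P y; \<nu> = frm_n P y
     in \<forall>u v.
      vext_d (frm_w P) y u v = (w u ** \<rho> v - w v ** \<rho> u) + (\<pi> u ** w v - \<pi> v ** w u)
         + (\<omega> u *\<^sub>R w v - \<omega> v *\<^sub>R w u) + tors P y (w u) (w v) \<and>
      vext_d (frm_p P) y u v = (\<pi> u ** \<pi> v - \<pi> v ** \<pi> u)
         + (q / (p + q)) *\<^sub>R ((trace (w u ** \<nu> v) - trace (w v ** \<nu> u)) *\<^sub>R mat 1
              - p *\<^sub>R (w u ** \<nu> v - w v ** \<nu> u)) + curv2 P y (w u) (w v) \<and>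
      vext_d (frm_q P) y u v = (\<rho> u ** \<rho> v - \<rho> v ** \<rho> u)
         + (p / (p + q)) *\<^sub>R ((trace (\<nu> u ** w v) - trace (\<nu> v ** w u)) *\<^sub>R mat 1
              - q *\<^sub>R (\<nu> u ** w v - \<nu> v ** w u)) + curv1 P y (w u) (w v) \<and>
      vext_d (frm_h P) y u v = trace (\<nu> u ** w v) - trace (\<nu> v ** w u) \<and>
      vext_d (frm_n P) y u v = (\<nu> u ** \<pi> v - \<nu> v ** \<pi> u) + (\<rho> u ** \<nu> v - \<rho> v ** \<nu> u)
         - (\<omega> u *\<^sub>R \<nu> v - \<omega> v *\<^sub>R \<nu> u) + curvn P y (w u) (w v)
         - (tdual P y (\<nu> u) (w v) - tdual P y (\<nu> v) (w u)))"

lemma structure_equations_matrix_iff: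
  fixes P :: "('p::finite, 'q::finite) prolonged_frame"
  assumes "\<And>v. (\<lambda>y. frm_w P y v) differentiable (at y)" "\<And>v. (\<lambda>y. frm_p P y v) differentiable (at y)"
    "\<And>v. (\<lambda>y. frm_q P y v) differentiable (at y)" "\<And>v. (\<lambda>y. frm_n P y v) differentiable (at y)"
  shows "structure_equations_at P y \<longleftrightarrow> matrix_structure_equations P y"
proof -
  have e: "ext_d (w_form P \<alpha> i) y u v = vext_d (frm_w P) y u v $ \<alpha> $ i"
    "ext_d (p_form P \<alpha> \<beta>) y u v = vext_d (frm_p P) y u v $ \<alpha> $ \<beta>"
    "ext_d (q_form P j i) y u v = vext_d (frm_q P) y u v $ j $ i"
    "ext_d (n_form P i \<alpha>) y u v = vext_d (frm_n P) y u v $ i $ \<alpha>"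
    "ext_d (frm_h P) y u v = vext_d (frm_h P) y u v" for u v \<alpha> \<beta> i j
    using assms
    by (simp_all add: ext_d_component2[symmetric] w_form_def[abs_def] p_form_def[abs_def] q_form_def[abs_def]
        n_form_def[abs_def]) (simp add: ext_d_def vext_d_def)
  note forms = w_form_def p_form_def q_form_def n_form_def
  have s: "(\<Sigma> j. (w_form P \<alpha> j \<^bold>\<and> q_form P j i) y u v)
      = (frm_w P y u ** frm_q P y v - frm_w P y v ** frm_q P y u) $ \<alpha> $ i"
    "(\<Sigma> \<beta>. (p_form P \<alpha> \<beta> \<^bold>\<and> w_form P \<beta> i) y u v)
      = (frm_p P y u ** frm_w P y v - frm_p P y v ** frm_w P y u) $ \<alpha> $ i"
    "(\<Sigma> \<gamma>. (p_form P \<alpha> \<gamma> \<^bold>\<and> p_form P \<gamma> \<beta>) y u v)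
      = (frm_p P y u ** frm_p P y v - frm_p P y v ** frm_p P y u) $ \<alpha> $ \<beta>"
    "(\<Sigma> k. (w_form P \<alpha> k \<^bold>\<and> n_form P k \<beta>) y u v)
      = (frm_w P y u ** frm_n P y v - frm_w P y v ** frm_n P y u) $ \<alpha> $ \<beta>"
    "(\<Sigma> k. (q_form P j k \<^bold>\<and> q_form P k i) y u v)
      = (frm_q P y u ** frm_q P y v - frm_q P y v ** frm_q P y u) $ j $ i"
    "(\<Sigma> \<gamma>. (n_form P j \<gamma> \<^bold>\<and> w_form P \<gamma> i) y u v)
      = (frm_n P y u ** frm_w P y v - frm_n P y v ** frm_w P y u) $ j $ i"
    "(\<Sigma> \<beta>. (n_form P i \<beta> \<^bold>\<and> p_form P \<beta> \<alpha>) y u v)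
      = (frm_n P y u ** frm_p P y v - frm_n P y v ** frm_p P y u) $ i $ \<alpha>"
    "(\<Sigma> k. (q_form P i k \<^bold>\<and> n_form P k \<alpha>) y u v)
      = (frm_q P y u ** frm_n P y v - frm_q P y v ** frm_n P y u) $ i $ \<alpha>" for u v i j \<alpha> \<beta>
    by (simp_all add: forms wedge_def matrix_matrix_mult_def sum_subtractf)
  have t: "(\<Sigma> \<gamma> k. (w_form P \<gamma> k \<^bold>\<and> n_form P k \<gamma>) y u v)
      = trace (frm_w P y u ** frm_n P y v) - trace (frm_w P y v ** frm_n P y u)"
    "(\<Sigma> k \<gamma>. (n_form P k \<gamma> \<^bold>\<and> w_form P \<gamma> k) y u v)
      = trace (frm_n P y u ** frm_w P y v) - trace (frm_n P y v ** frm_w P y u)" for u v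
    unfolding s by (simp_all add: trace_def sum_subtractf)
  have h: "(frm_h P \<^bold>\<and> w_form P \<alpha> i) y u v
      = (frm_h P y u *\<^sub>R frm_w P y v - frm_h P y v *\<^sub>R frm_w P y u) $ \<alpha> $ i"
    "(frm_h P \<^bold>\<and> n_form P i \<alpha>) y u v
      = (frm_h P y u *\<^sub>R frm_n P y v - frm_h P y v *\<^sub>R frm_n P y u) $ i $ \<alpha>" for u v \<alpha> i
    by (simp_all add: forms wedge_def mult.commute)
  have c: "(\<Sigma> \<beta> \<gamma> j k. obj_a P y $ (i, \<beta>, \<gamma>, \<alpha>, j, k) * (w_form P \<beta> j \<^bold>\<and> w_form P \<gamma> k) y u v)
      = tors P y (frm_w P y u) (frm_w P y v) $ \<alpha> $ i"
    "(\<Sigma> \<gamma> \<delta> k l. obj_b2 P y $ (\<beta>, \<gamma>, \<delta>, \<alpha>, k, l) * (w_form P \<gamma> k \<^bold>\<and> w_form P \<delta> l) y u v)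
      = curv2 P y (frm_w P y u) (frm_w P y v) $ \<alpha> $ \<beta>"
    "(\<Sigma> \<gamma> \<delta> k l. obj_b1 P y $ (i, \<gamma>, \<delta>, j, k, l) * (w_form P \<gamma> k \<^bold>\<and> w_form P \<delta> l) y u v)
      = curv1 P y (frm_w P y u) (frm_w P y v) $ j $ i"
    "(\<Sigma> \<beta> \<gamma> j k. obj_c P y $ (\<alpha>, \<beta>, \<gamma>, i, j, k) * (w_form P \<gamma> k \<^bold>\<and> w_form P \<beta> j) y u v)
      = curvn P y (frm_w P y u) (frm_w P y v) $ i $ \<alpha>"
    "(\<Sigma> k \<gamma> \<beta> j. obj_a P y $ (k, \<alpha>, \<beta>, \<gamma>, i, j) * (n_form P k \<gamma> \<^bold>\<and> w_form P \<beta> j) y u v)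
      = (tdual P y (frm_n P y u) (frm_w P y v) - tdual P y (frm_n P y v) (frm_w P y u)) $ i $ \<alpha>" for u v \<alpha> \<beta> i j
    by (simp_all add: tors_def curv1_def curv2_def curvn_def tdual_def forms wedge_def
        right_diff_distrib sum_subtractf)
  have k: "kron a b = (mat 1 :: real^'c^'c) $ a $ b" for a b :: "'c::finite"
    by (simp add: kron_def mat_def)
  show ?thesis
    unfolding structure_equations_at_def matrix_structure_equations_def Let_def t
    unfolding e s h c k vec_eq_iff
    by (intro iff_allI arg_cong2[where f="(\<and>)"]) (simp_all add: algebra_simps)
qed

subsection \<open>Matrix algebra\<close>

lemma dyad_add_left: "dyad (t + t') s = dyad t s + dyad t' s"
  and dyad_add_right: "dyad t (s + s') = dyad t s + dyad t s'"
  and dyad_scale_left: "dyad (c *\<^sub>R t) s = c *\<^sub>R dyad t s"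
  and dyad_scale_right: "dyad t (c *\<^sub>R s) = c *\<^sub>R dyad t s"
  by (simp_all add: dyad_def vec_eq_iff algebra_simps)

lemma bilinear_dyad: "bilinear dyad"
  unfolding bilinear_def
  by (auto intro!: linearI simp: dyad_add_left dyad_add_right dyad_scale_left dyad_scale_right)

lemma bounded_bilinear_dyad: "bounded_bilinear dyad"
  using bilinear_dyad bilinear_conv_bounded_bilinear by blast

lemmas dyad_diff_left = bounded_bilinear.diff_left[OF bounded_bilinear_dyad]
  and dyad_diff_right = bounded_bilinear.diff_right[OF bounded_bilinear_dyad]
  and dyad_zero_left = bounded_bilinear.zero_left[OF bounded_bilinear_dyad]

lemma dyad_matrix: "dyad t s ** A = dyad t (s v* A)"
  by (simp add: dyad_def vec_eq_iff matrix_matrix_mult_def vector_matrix_mult_def sum_distrib_left mult.assoc)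

lemma matrix_dyad: "A ** dyad t s = dyad (A *v t) s"
  by (simp add: dyad_def vec_eq_iff matrix_matrix_mult_def matrix_vector_mult_def sum_distrib_right mult.assoc)

lemma vector_dyad: "x v* dyad t s = (x \<bullet> t) *\<^sub>R s"
  by (simp add: dyad_def vec_eq_iff vector_matrix_mult_def inner_vec_def sum_distrib_right mult.assoc)

lemma dyad_vector: "dyad t s *v x = (s \<bullet> x) *\<^sub>R t"
  by (simp add: dyad_def vec_eq_iff matrix_vector_mult_def inner_vec_def sum_distrib_left mult.assoc)
    (simp add: mult.commute mult.left_commute sum_distrib_left)

lemma trace_dyad: "trace (dyad t s) = t \<bullet> s"
  by (simp add: trace_def dyad_def inner_vec_def)

lemma vector_matrix_assoc: "(x v* A) v* B = x v* (A ** B)" for A :: "real^'n^'m" and B :: "real^'k^'n"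
  by (simp add: matrix_matrix_mult_def vector_matrix_mult_def sum_distrib_left sum_distrib_right vec_eq_iff mult_ac)
    (subst sum.swap, simp)

lemma vector_matrix_simps:
  fixes A B :: "real^'n^'m"
  shows "x v* (A + B) = x v* A + x v* B" "x v* (A - B) = x v* A - x v* B"
    "x v* (c *\<^sub>R A) = c *\<^sub>R (x v* A)" "(x + x') v* A = x v* A + x' v* A"
    "(x - x') v* A = x v* A - x' v* A" "(c *\<^sub>R x) v* A = c *\<^sub>R (x v* A)"
    "(- x) v* A = - (x v* A)" "x v* (- A) = - (x v* A)" "0 v* A = 0" "x v* (0 :: real^'n^'m) = 0"
  by (simp_all add: vector_matrix_mult_def vec_eq_iff algebra_simps sum.distrib sum_subtractf
      sum_distrib_left sum_negf)

lemma vector_mat_1: "x v* (mat 1 :: real^'n^'n) = x"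
  by (simp add: vector_matrix_mult_def mat_def vec_eq_iff if_distrib[of "\<lambda>a. _ * a"] cong: if_cong)

lemma bounded_bilinear_vm: "bounded_bilinear (\<lambda>x (A :: real^'n^'m). x v* A)"
  unfolding bilinear_conv_bounded_bilinear[symmetric] bilinear_def
  by (auto intro!: linearI simp: vector_matrix_simps)

lemma bounded_bilinear_mm: "bounded_bilinear (\<lambda>(A :: real^'n^'m) (B :: real^'k^'n). A ** B)"
  unfolding bilinear_conv_bounded_bilinear[symmetric] bilinear_def
  by (auto intro!: linearI simp: matrix_matrix_mult_def vec_eq_iff algebra_simps sum.distrib sum_distrib_left)

lemmas mm_simps = bounded_bilinear.add_left[OF bounded_bilinear_mm] bounded_bilinear.add_right[OF bounded_bilinear_mm]
  bounded_bilinear.diff_left[OF bounded_bilinear_mm] bounded_bilinear.diff_right[OF bounded_bilinear_mm]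
  bounded_bilinear.minus_left[OF bounded_bilinear_mm] bounded_bilinear.minus_right[OF bounded_bilinear_mm]
  bounded_bilinear.scaleR_left[OF bounded_bilinear_mm] bounded_bilinear.scaleR_right[OF bounded_bilinear_mm]
  bounded_bilinear.zero_left[OF bounded_bilinear_mm] bounded_bilinear.zero_right[OF bounded_bilinear_mm]

lemma trace_simps:
  fixes A B :: "real^'n^'n"
  shows "trace (A - B) = trace A - trace B" "trace (c *\<^sub>R A) = c * trace A"
    "trace (A + B) = trace A + trace B" "trace (- A) = - trace A" "trace (0 :: real^'n^'n) = 0"
  by (simp_all add: trace_def sum_subtractf sum_distrib_left sum.distrib sum_negf)

lemma bounded_linear_trace: "bounded_linear (trace :: real^'n^'n \<Rightarrow> real)"
  unfolding linear_conv_bounded_linear[symmetric] by (intro linearI) (simp_all add: trace_simps)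

text \<open>The sign of the quadratic term is that of the structure equations; it is opposite to the
  common convention in which the square of the connection is added.\<close>

definition curvature :: "('e::euclidean_space \<Rightarrow> 'e \<Rightarrow> real^'n^'n) \<Rightarrow> 'e \<Rightarrow> 'e \<Rightarrow> 'e \<Rightarrow> real^'n^'n" where
  "curvature \<beta> y u v = vext_d \<beta> y u v - (\<beta> y u ** \<beta> y v - \<beta> y v ** \<beta> y u)"

lemma curvature_skew: "curvature \<beta> y u v = - curvature \<beta> y v u"
  using vext_d_skew[of \<beta> y u v] by (simp add: curvature_def)

lemma bilinear_curvature:
  assumes "open U" "smooth_form U \<beta>" "y \<in> U"
  shows "bilinear (curvature \<beta> y)"
proof -
  note b = vext_d_bilinear[OF assms(2,1,3)] and l = smooth_form_linear[OF assms(2,3)]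
  show ?thesis unfolding bilinear_def curvature_def
    by (auto intro!: linearI simp: bilinear_ladd[OF b] bilinear_radd[OF b] bilinear_lmul[OF b] bilinear_rmul[OF b]
        linear_add[OF l] linear_scale[OF l] mm_simps algebra_simps)
qed

lemma trace_curvature:
  assumes U: "open U" "y \<in> U" and \<beta>: "smooth_form U \<beta>" "\<And>y v. y \<in> U \<Longrightarrow> trace (\<beta> y v) = 0"
  shows "trace (curvature \<beta> y u v) = 0"
proof -
  have "trace (fder (\<lambda>z. \<beta> z a) y b) = 0" for a b
  proof -
    have "((\<lambda>z. trace (\<beta> z a)) has_derivative (\<lambda>b. trace (fder (\<lambda>z. \<beta> z a) y b))) (at y)"
      by (rule bounded_linear.has_derivative[OF bounded_linear_trace smooth_on_has_derivative[OF smooth_form_smooth[OF \<beta>(1)] U(2)]])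
    from fder_eqI_open[OF this U, of "\<lambda>_. 0"] show ?thesis using fun_cong by (fastforce simp: \<beta>(2))
  qed
  then show ?thesis by (simp add: curvature_def vext_d_def trace_simps trace_mul_sym[of "\<beta> y u"])
qed

section \<open>Prolonged frames\<close>

locale pframe =
  fixes U :: "(real^'q::finite^'p::finite) set" and P :: "('p, 'q) prolonged_frame"
  assumes over: "prolonged_frame_over U P"
begin

abbreviation "w \<equiv> frm_w P"
abbreviation "h \<equiv> frm_h P"
abbreviation "\<pi> \<equiv> frm_p P"
abbreviation "\<rho> \<equiv> frm_q P"
abbreviation "\<nu> \<equiv> frm_n P"

lemma open_U: "open U"
  and forms: "smooth_form U w" "smooth_form U h" "smooth_form U \<pi>" "smooth_form U \<rho>" "smooth_form U \<nu>"
  using over by (simp_all add: prolonged_frame_over_def smooth_form_def)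

lemma bij_w: "y \<in> U \<Longrightarrow> bij (w y)"
  and object_identities: "y \<in> U \<Longrightarrow> object_identities_at P y"
  using over by (simp_all add: prolonged_frame_over_def)

lemma trace_\<pi>: "y \<in> U \<Longrightarrow> trace (\<pi> y v) = 0" and trace_\<rho>: "y \<in> U \<Longrightarrow> trace (\<rho> y v) = 0"
  using over by (simp_all add: prolonged_frame_over_def trace_def p_form_def q_form_def)

lemma forms_differentiable: "smooth_form U \<beta> \<Longrightarrow> y \<in> U \<Longrightarrow> (\<lambda>y. \<beta> y v) differentiable (at y)"
  using smooth_on_differentiable smooth_form_smooth by blast

lemma matrix_structure: "y \<in> U \<Longrightarrow> matrix_structure_equations P y"
  using over
  by (subst structure_equations_matrix_iff[symmetric])
    (auto intro!: forms_differentiable forms, simp add: prolonged_frame_over_def)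

lemma structure_eqs:
  assumes "y \<in> U"
  shows "vext_d w y u v = (w y u ** \<rho> y v - w y v ** \<rho> y u) + (\<pi> y u ** w y v - \<pi> y v ** w y u)
         + (h y u *\<^sub>R w y v - h y v *\<^sub>R w y u) + tors P y (w y u) (w y v)" (is ?w)
    and "vext_d \<pi> y u v = (\<pi> y u ** \<pi> y v - \<pi> y v ** \<pi> y u)
         + (real CARD('q) / (real CARD('p) + real CARD('q))) *\<^sub>R
            ((trace (w y u ** \<nu> y v) - trace (w y v ** \<nu> y u)) *\<^sub>R mat 1
              - real CARD('p) *\<^sub>R (w y u ** \<nu> y v - w y v ** \<nu> y u)) + curv2 P y (w y u) (w y v)" (is ?p)
    and "vext_d \<rho> y u v = (\<rho> y u ** \<rho> y v - \<rho> y v ** \<rho> y u)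
         + (real CARD('p) / (real CARD('p) + real CARD('q))) *\<^sub>R
            ((trace (\<nu> y u ** w y v) - trace (\<nu> y v ** w y u)) *\<^sub>R mat 1
              - real CARD('q) *\<^sub>R (\<nu> y u ** w y v - \<nu> y v ** w y u)) + curv1 P y (w y u) (w y v)" (is ?q)
    and "vext_d h y u v = trace (\<nu> y u ** w y v) - trace (\<nu> y v ** w y u)" (is ?h)
    and "vext_d \<nu> y u v = (\<nu> y u ** \<pi> y v - \<nu> y v ** \<pi> y u) + (\<rho> y u ** \<nu> y v - \<rho> y v ** \<nu> y u)
         - (h y u *\<^sub>R \<nu> y v - h y v *\<^sub>R \<nu> y u) + curvn P y (w y u) (w y v)
         - (tdual P y (\<nu> y u) (w y v) - tdual P y (\<nu> y v) (w y u))" (is ?n)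
proof -
  have "?w \<and> ?p \<and> ?q \<and> ?h \<and> ?n"
    using matrix_structure[OF assms] unfolding matrix_structure_equations_def Let_def by blast
  then show ?w ?p ?q ?h ?n by blast+
qed

definition X :: "real^'q^'p \<Rightarrow> real^'q^'p \<Rightarrow> real^'q^'p" where
  "X y = inv (w y)"

lemma w_X [simp]: "y \<in> U \<Longrightarrow> w y (X y z) = z"
  and X_w [simp]: "y \<in> U \<Longrightarrow> X y (w y v) = v"
  using bij_w by (simp_all add: X_def bij_is_surj surj_f_inv_f bij_is_inj)

lemma linear_w: "y \<in> U \<Longrightarrow> linear (w y)"
  using forms(1) by (simp add: smooth_form_def)

lemma linear_X: "y \<in> U \<Longrightarrow> linear (X y)"
  unfolding X_def using linear_w bij_w by (metis bij_is_inj inj_linear_imp_inv_linear)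

lemma smooth_X: "open S \<Longrightarrow> g ` S \<subseteq> U \<Longrightarrow> smooth_on S g \<Longrightarrow> smooth_on S f \<Longrightarrow> smooth_on S (\<lambda>x. X (g x) (f x))"
  for g :: "'g::real_normed_vector \<Rightarrow> real^'q^'p"
  unfolding X_def
  by (rule smooth_on_inv_family)
    (use forms(1) bij_w in \<open>auto simp: smooth_form_def intro!: smooth_on_compose[of S U _ g]\<close>)

lemma smooth_form_X: "smooth_form U X"
  unfolding smooth_form_def
  by (auto intro!: linear_X smooth_X[OF open_U, of "\<lambda>x. x"] smooth_on_id)

end

lemma tors_skew: "tors P y z z' = - tors P y z' z"
  by (simp add: tors_def vec_eq_iff sum_negf[symmetric] mult_minus_right[symmetric] del: mult_minus_right)

lemma curv1_skew: "curv1 P y z z' = - curv1 P y z' z"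
  by (simp add: curv1_def vec_eq_iff sum_negf[symmetric] mult_minus_right[symmetric] del: mult_minus_right)

lemma bilinear_tors: "bilinear (tors P y)"
  unfolding bilinear_def tors_def
  by (auto intro!: linearI simp: vec_eq_iff algebra_simps sum.distrib sum_distrib_left sum_subtractf)

lemma bilinear_curv1: "bilinear (curv1 P y)"
  unfolding bilinear_def curv1_def
  by (auto intro!: linearI simp: vec_eq_iff algebra_simps sum.distrib sum_distrib_left sum_subtractf)

lemma bounded_bilinear_tors: "bounded_bilinear (tors P y)"
  and bounded_bilinear_curv1: "bounded_bilinear (curv1 P y)"
  using bilinear_tors bilinear_curv1 bilinear_conv_bounded_bilinear by blast+

definition cub :: "('p::finite, 'q::finite) prolonged_frame \<Rightarrow> real^'q^'p \<Rightarrow> real^'p \<Rightarrow> real^'p \<Rightarrow> real^'q \<Rightarrow> real^'q" where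
  "cub P y t t' s = s v* curv1 P y (dyad t s) (dyad t' s)"

section \<open>Integral manifolds when the cubic form vanishes\<close>

context pframe
begin

text \<open>The rank \<open>p\<close> distribution that lifts \<open>\<Delta>\<^sub>\<alpha>\<close> to pairs \<open>(y, s)\<close> is spanned by fields along which
  \<open>s\<close> is parallel for the connection \<open>\<rho>\<close> up to the multiple of \<open>\<omega>\<close> that makes the distribution
  involutive. Normalizing the fields by a projection \<open>p0\<close> onto a fixed \<open>p\<close>-plane makes them
  commute.\<close>

theorem alpha_integral_exists:
  assumes tz: "\<And>y t t' s. y \<in> U \<Longrightarrow> tors P y (dyad t s) (dyad t' s) = 0"
    and cz: "\<And>y t t' s. y \<in> U \<Longrightarrow> cub P y t t' s = 0"
    and y0: "y0 \<in> U" and s0: "s0 \<noteq> 0"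
  obtains D and \<phi> :: "real^'p \<Rightarrow> real^'q^'p" and T :: "real^'p \<Rightarrow> real^'p \<Rightarrow> real^'p" and s
  where "open D" "0 \<in> D" "\<phi> 0 = y0" "\<phi> ` D \<subseteq> U" "smooth_on D \<phi>" "s 0 = s0"
    "\<And>u. u \<in> D \<Longrightarrow> s u \<noteq> 0" "\<And>u. u \<in> D \<Longrightarrow> bij (T u)"
    "\<And>u k. u \<in> D \<Longrightarrow> w (\<phi> u) (fder \<phi> u k) = dyad (T u k) (s u)"
proof -
  \<comment> \<open>A left inverse of \<open>t \<mapsto> X y0 (dyad t s0)\<close>, hence a
    projection onto the parameters of the chosen generator at \<open>y0\<close>; it is the same
    linear map at all points.\<close>
  define p0 where "p0 v = inverse (s0 \<bullet> s0) *\<^sub>R (w y0 v *v s0)" for v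
  have lin_p0: "linear p0" unfolding p0_def
    using linear_w[OF y0]
    by (intro linearI) (simp_all add: linear_add linear_scale matrix_vector_mult_add_rdistrib
        scaleR_matrix_vector_assoc[symmetric] scaleR_add_right)
  have p0_0: "p0 (X y0 (dyad t s0)) = t" for t
    using y0 s0 by (simp add: p0_def dyad_vector)
  \<comment> \<open>\<open>Q x\<close> compares the generator at \<open>x\<close> with the fixed
    p-plane through \<open>p0\<close>. It is the identity at the initial point, so invertible
    nearby, and its inverse supplies the parameters \<open>N\<close> for which
    \<open>p0 (\<eta> \<mu> x)\<close> is the constant vector \<open>axis \<mu> 1\<close>.\<close>
  define Q :: "(real^'q^'p) \<times> (real^'q) \<Rightarrow> real^'p^'p" where
    "Q x = (\<chi> \<kappa> \<alpha>. p0 (X (fst x) (dyad (axis \<alpha> 1) (snd x))) $ \<kappa>)" for x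
  define V :: "((real^'q^'p) \<times> (real^'q)) set" where "V = U \<times> UNIV"
  have oV: "open V" unfolding V_def using open_U by (intro open_Times) auto
  have fV: "fst ` V \<subseteq> U" by (auto simp: V_def)
  have sf: "smooth_on A fst" and ss: "smooth_on A snd" for A :: "((real^'q^'p) \<times> (real^'q)) set"
    by (auto intro: smooth_on_bounded_linear bounded_linear_fst bounded_linear_snd)
  have Qv: "Q x *v t = p0 (X (fst x) (dyad t (snd x)))" if "x \<in> V" for x t
  proof -
    have lin: "linear (\<lambda>t. p0 (X (fst x) (dyad t (snd x))))"
      using that linear_X[of "fst x"] lin_p0
      by (intro linearI) (auto simp: V_def dyad_add_left dyad_scale_left linear_add linear_scale)
    have "Q x = matrix (\<lambda>t. p0 (X (fst x) (dyad t (snd x))))"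
      by (simp add: Q_def matrix_def)
    then show ?thesis using matrix_works[OF lin[folded linear_matrix_vector_mul_eq]] by simp
  qed
  have Qs: "smooth_on V (\<lambda>x. Q x $ i $ j)" for i j
    unfolding Q_def
    by (auto intro!: smooth_on_vec_nth oV smooth_on_linear[OF oV lin_p0] smooth_X[OF oV fV] sf ss
        smooth_on_bilinear[OF oV bounded_bilinear_dyad])
  have detc: "continuous_on V (\<lambda>x. det (Q x))"
    by (intro smooth_on_continuous smooth_on_det oV Qs)
  define W where "W = {x \<in> V. det (Q x) \<noteq> 0 \<and> snd x \<noteq> 0}"
  have W_eq: "W = V \<inter> (\<lambda>x. det (Q x)) -` (- {0}) \<inter> snd -` (- {0})" by (auto simp: W_def)
  have oW: "open W"
    unfolding W_eq
    by (intro open_Int continuous_open_preimage[OF detc oV] open_vimage continuous_on_snd continuous_on_id)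
      (auto intro: open_Compl)
  have WV: "W \<subseteq> V" by (auto simp: W_def)
  then have fW: "fst ` W \<subseteq> U" using fV by blast
  have W0: "(y0, s0) \<in> W"
  proof -
    have "Q (y0, s0) *v t = t" for t using Qv[of "(y0, s0)" t] y0 p0_0 by (simp add: V_def)
    then have "Q (y0, s0) = mat 1" by (metis matrix_eq matrix_vector_mul_lid)
    then show ?thesis using y0 s0 by (simp add: W_def V_def)
  qed
  define N where "N \<mu> x = matrix_inv (Q x) *v axis \<mu> 1" for \<mu> x
  have Ns: "smooth_on W (N \<mu>)" for \<mu>
    unfolding N_def
    by (rule smooth_on_matrix_inv_mult[OF oW smooth_on_subset[OF Qs WV]]) (auto simp: W_def)
  have QN: "Q x *v N \<mu> x = axis \<mu> 1" if "x \<in> W" for x \<mu>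
    using that matrix_inv_right[of "Q x"]
    by (simp add: N_def W_def matrix_vector_mul_assoc invertible_det_nz)
  \<comment> \<open>On the dyads in question the \<nu>-part of the curvature of
    \<open>\<rho>\<close> maps \<open>s\<close> to p/(p+q) (1 - q) d\<omega> times \<open>s\<close>.
    Adding this multiple of \<omega> to the transport of \<open>s\<close> cancels that
    contribution.\<close>
  define cc where "cc = real CARD('p) / (real CARD('p) + real CARD('q)) * (1 - real CARD('q))"
  define \<eta> where "\<eta> \<mu> x = X (fst x) (dyad (N \<mu> x) (snd x))" for \<mu> x
  define \<sigma> where "\<sigma> \<mu> x = cc *\<^sub>R (h (fst x) (\<eta> \<mu> x) *\<^sub>R snd x) - snd x v* \<rho> (fst x) (\<eta> \<mu> x)" for \<mu> x
  define Y where "Y \<mu> x = (\<eta> \<mu> x, \<sigma> \<mu> x)" for \<mu> x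
  have \<eta>s: "smooth_on W (\<eta> \<mu>)" for \<mu>
    unfolding \<eta>_def by (intro smooth_X[OF oW fW] sf ss smooth_on_bilinear[OF oW bounded_bilinear_dyad] Ns)
  have fs: "smooth_on W (\<lambda>x. h (fst x) (\<eta> \<mu> x))" "smooth_on W (\<lambda>x. \<rho> (fst x) (\<eta> \<mu> x))"
    "smooth_on W (\<lambda>x. snd x v* \<rho> (fst x) (\<eta> \<mu> x))" for \<mu>
    by (intro smooth_on_bilinear[OF oW bounded_bilinear_vm] smooth_form_compose[OF _ oW sf fW \<eta>s] forms ss)+
  have \<sigma>s: "smooth_on W (\<sigma> \<mu>)" for \<mu>
    unfolding \<sigma>_def by (intro smooth_on_diff smooth_on_scaleR oW fs ss smooth_on_const)
  have Ys: "smooth_on W (Y \<mu>)" for \<mu>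
    unfolding Y_def by (intro smooth_on_Pair oW \<eta>s \<sigma>s)
  have w\<eta>: "w (fst x) (\<eta> \<mu> x) = dyad (N \<mu> x) (snd x)" if "x \<in> W" for x \<mu>
    using that fW by (auto simp: \<eta>_def)
  have comm: "fder (Y \<nu>') x (Y \<mu> x) = fder (Y \<mu>) x (Y \<nu>' x)"
    if x: "x \<in> W" for \<mu> \<nu>' x
  proof -
    let ?y = "fst x" and ?s = "snd x"
    have yU: "?y \<in> U" using x fW by blast
    have \<eta>d: "(\<eta> \<mu> has_derivative fder (\<eta> \<mu>) x) (at x)" for \<mu>
      by (rule smooth_on_has_derivative[OF \<eta>s x])
    have \<sigma>d: "(\<sigma> \<mu> has_derivative fder (\<sigma> \<mu>) x) (at x)" for \<mu>
      by (rule smooth_on_has_derivative[OF \<sigma>s x])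
    have Nd: "(N \<mu> has_derivative fder (N \<mu>) x) (at x)" for \<mu>
      by (rule smooth_on_has_derivative[OF Ns x])
    have fd: "(fst has_derivative fst) (at x)" and sd: "(snd has_derivative snd) (at x)"
      by (auto intro: bounded_linear_imp_has_derivative bounded_linear_fst bounded_linear_snd)
    have Yd: "fder (Y \<mu>) x k = (fder (\<eta> \<mu>) x k, fder (\<sigma> \<mu>) x k)" for \<mu> k
      unfolding Y_def by (subst frechet_derivative_eqI[OF has_derivative_Pair[OF \<eta>d \<sigma>d]]) simp
    define zy where "zy = fder (\<eta> \<nu>') x (Y \<mu> x) - fder (\<eta> \<mu>) x (Y \<nu>' x)"
    define zs where "zs = fder (\<sigma> \<nu>') x (Y \<mu> x) - fder (\<sigma> \<mu>) x (Y \<nu>' x)"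
    have along: "fder (\<lambda>z. \<beta> (fst z) (\<eta> \<nu>' z)) x (Y \<mu> x)
        - fder (\<lambda>z. \<beta> (fst z) (\<eta> \<mu> z)) x (Y \<nu>' x)
      = vext_d \<beta> ?y (\<eta> \<mu> x) (\<eta> \<nu>' x) + \<beta> ?y zy" if "smooth_form U \<beta>" for \<beta> :: "_ \<Rightarrow> _ \<Rightarrow> 'z::real_normed_vector"
      unfolding zy_def by (rule vext_d_along[OF open_U that yU fd \<eta>d \<eta>d]) (auto simp: Y_def)
    have dw: "fder (\<lambda>z. w (fst z) (\<eta> \<mu> z)) x = (\<lambda>k. dyad (N \<mu> x) (snd k) + dyad (fder (N \<mu>) x k) ?s)" for \<mu>
      by (rule fder_eqI_open[OF bounded_bilinear.FDERIV[OF bounded_bilinear_dyad Nd sd] oW x]) (simp add: w\<eta>)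
    \<comment> \<open>The collected factor of \<open>s\<close> in the base component of the bracket.
      With vanishing torsion on the generator and this transport of \<open>s\<close>, the bracket
      stays in the generator of \<open>s\<close>.\<close>
    define \<tau> where "\<tau> = (fder (N \<nu>') x (Y \<mu> x) - fder (N \<mu>) x (Y \<nu>' x))
        + (cc * h ?y (\<eta> \<mu> x)) *\<^sub>R N \<nu>' x - (cc * h ?y (\<eta> \<nu>' x)) *\<^sub>R N \<mu> x
        - (\<pi> ?y (\<eta> \<mu> x) *v N \<nu>' x - \<pi> ?y (\<eta> \<nu>' x) *v N \<mu> x)
        - (h ?y (\<eta> \<mu> x) *\<^sub>R N \<nu>' x - h ?y (\<eta> \<nu>' x) *\<^sub>R N \<mu> x)"
    have wz: "w ?y zy = dyad \<tau> ?s"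
    proof -
      have "w ?y zy = (dyad (N \<nu>' x) (\<sigma> \<mu> x) + dyad (fder (N \<nu>') x (Y \<mu> x)) ?s)
          - (dyad (N \<mu> x) (\<sigma> \<nu>' x) + dyad (fder (N \<mu>) x (Y \<nu>' x)) ?s)
          - vext_d w ?y (\<eta> \<mu> x) (\<eta> \<nu>' x)"
        using along[OF forms(1)] by (simp add: dw Y_def algebra_simps)
      also have "vext_d w ?y (\<eta> \<mu> x) (\<eta> \<nu>' x) = dyad (N \<mu> x) (?s v* \<rho> ?y (\<eta> \<nu>' x)) - dyad (N \<nu>' x) (?s v* \<rho> ?y (\<eta> \<mu> x))
         + (dyad (\<pi> ?y (\<eta> \<mu> x) *v N \<nu>' x) ?s - dyad (\<pi> ?y (\<eta> \<nu>' x) *v N \<mu> x) ?s)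
         + (h ?y (\<eta> \<mu> x) *\<^sub>R dyad (N \<nu>' x) ?s - h ?y (\<eta> \<nu>' x) *\<^sub>R dyad (N \<mu> x) ?s)"
        using tz[OF yU] by (simp add: structure_eqs[OF yU] w\<eta>[OF x] dyad_matrix matrix_dyad)
      finally show ?thesis
        by (simp add: \<tau>_def \<sigma>_def dyad_diff_right dyad_diff_left dyad_add_left dyad_scale_right dyad_scale_left
            scaleR_diff_right scaleR_diff_left scaleR_add_left algebra_simps)
    qed
    have zy: "zy = X ?y (dyad \<tau> ?s)" using X_w[OF yU, of zy] by (simp add: wz)
    \<comment> \<open>The fields have constant image under \<open>p0\<close>, so their bracket has
      image zero; being also tangent to the generator, on which \<open>Q x\<close> is injective, the
      bracket vanishes.\<close>
    have "p0 (fder (\<eta> \<mu>) x k) = 0" for \<mu> k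
    proof -
      have "((\<lambda>z. p0 (\<eta> \<mu> z)) has_derivative (\<lambda>k. p0 (fder (\<eta> \<mu>) x k))) (at x)"
        by (rule bounded_linear.has_derivative[OF linear_conv_bounded_linear[THEN iffD1, OF lin_p0] \<eta>d])
      moreover have "((\<lambda>z. p0 (\<eta> \<mu> z)) has_derivative (\<lambda>k. 0)) (at x)"
      proof (rule has_derivative_transform_within_open[OF _ oW x])
        show "((\<lambda>z. axis \<mu> 1 :: real^'p) has_derivative (\<lambda>k. 0)) (at x)" by simp
        show "axis \<mu> 1 = p0 (\<eta> \<mu> z)" if "z \<in> W" for z
          using QN[OF that] Qv[of z] that WV by (auto simp: \<eta>_def)
      qed
      ultimately show ?thesis using has_derivative_unique by metis
    qed
    then have "p0 zy = 0" by (simp add: zy_def linear_diff[OF lin_p0])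
    then have "Q x *v \<tau> = 0" using Qv[of x \<tau>] x WV by (auto simp: zy)
    then have "matrix_inv (Q x) *v (Q x *v \<tau>) = 0" by simp
    moreover have "invertible (Q x)" using x by (simp add: W_def invertible_det_nz)
    ultimately have "\<tau> = 0" by (simp only: matrix_vector_mul_assoc matrix_inv_left matrix_vector_mul_lid)
    then have zy0: "zy = 0" using linear_0[OF linear_X[OF yU]] by (simp add: zy dyad_zero_left)
    have lin0: "\<beta> ?y zy = 0" if "smooth_form U \<beta>" for \<beta> :: "_ \<Rightarrow> _ \<Rightarrow> 'z::real_normed_vector"
      using smooth_form_linear[OF that yU] by (simp add: zy0 linear_0)
    have hd: "((\<lambda>z. h (fst z) (\<eta> \<mu> z)) has_derivative fder (\<lambda>z. h (fst z) (\<eta> \<mu> z)) x) (at x)"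
      and \<rho>d: "((\<lambda>z. \<rho> (fst z) (\<eta> \<mu> z)) has_derivative fder (\<lambda>z. \<rho> (fst z) (\<eta> \<mu> z)) x) (at x)" for \<mu>
      by (intro smooth_on_has_derivative[OF _ x] fs)+
    have \<sigma>D: "fder (\<sigma> \<mu>) x k = cc *\<^sub>R (h ?y (\<eta> \<mu> x) *\<^sub>R snd k
        + fder (\<lambda>z. h (fst z) (\<eta> \<mu> z)) x k *\<^sub>R ?s)
        - (?s v* fder (\<lambda>z. \<rho> (fst z) (\<eta> \<mu> z)) x k + snd k v* \<rho> ?y (\<eta> \<mu> x))" for \<mu> k
      unfolding \<sigma>_def[abs_def]
      by (subst frechet_derivative_eqI[OF has_derivative_diff[OF has_derivative_scaleR_right[OF has_derivative_scaleR[OF hd sd]]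
            bounded_bilinear.FDERIV[OF bounded_bilinear_vm sd \<rho>d]]]) simp
    define hm hn rm rn where "hm = h ?y (\<eta> \<mu> x)" and "hn = h ?y (\<eta> \<nu>' x)"
      and "rm = \<rho> ?y (\<eta> \<mu> x)" and "rn = \<rho> ?y (\<eta> \<nu>' x)"
    have "zs = cc *\<^sub>R (hn *\<^sub>R \<sigma> \<mu> x - hm *\<^sub>R \<sigma> \<nu>' x + vext_d h ?y (\<eta> \<mu> x) (\<eta> \<nu>' x) *\<^sub>R ?s)
        - (?s v* vext_d \<rho> ?y (\<eta> \<mu> x) (\<eta> \<nu>' x) + \<sigma> \<mu> x v* rn - \<sigma> \<nu>' x v* rm)"
      using along[OF forms(2)] along[OF forms(4)] unfolding lin0[OF forms(2)] lin0[OF forms(4)]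
      unfolding zs_def \<sigma>D hm_def hn_def rm_def rn_def
      by (simp add: Y_def algebra_simps vector_matrix_simps flip: scaleR_diff_left)
    also have "\<dots> = cc *\<^sub>R (vext_d h ?y (\<eta> \<mu> x) (\<eta> \<nu>' x) *\<^sub>R ?s)
        - ?s v* (vext_d \<rho> ?y (\<eta> \<mu> x) (\<eta> \<nu>' x) - (rm ** rn - rn ** rm))"
      unfolding \<sigma>_def hm_def[symmetric] hn_def[symmetric] rm_def[symmetric] rn_def[symmetric]
      by (simp add: vector_matrix_simps vector_matrix_assoc algebra_simps)
    \<comment> \<open>Both the trace and the action on \<open>s\<close> of the \<nu>-terms reduce to
      the scalars \<open>A \<mu> \<bullet> N \<nu>'\<close>; the constant \<open>cc\<close> makes
      them cancel, and the rest is the cubic form.\<close>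
    also have "\<dots> = 0"
    proof -
      define A where "A \<mu> = ?s v* \<nu> ?y (\<eta> \<mu> x)" for \<mu>
      have n: "trace (\<nu> ?y (\<eta> \<mu> x) ** dyad (N \<nu>' x) ?s) = A \<mu> \<bullet> N \<nu>' x"
        "?s v* (\<nu> ?y (\<eta> \<mu> x) ** dyad (N \<nu>' x) ?s) = (A \<mu> \<bullet> N \<nu>' x) *\<^sub>R ?s" for \<mu> \<nu>'
      proof -
        show "?s v* (\<nu> ?y (\<eta> \<mu> x) ** dyad (N \<nu>' x) ?s) = (A \<mu> \<bullet> N \<nu>' x) *\<^sub>R ?s"
          by (simp add: A_def vector_matrix_assoc[symmetric] vector_dyad)
        have "trace (\<nu> ?y (\<eta> \<mu> x) ** dyad (N \<nu>' x) ?s) = (\<nu> ?y (\<eta> \<mu> x) *v N \<nu>' x) \<bullet> ?s"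
          by (simp add: matrix_dyad trace_dyad)
        also have "\<dots> = A \<mu> \<bullet> N \<nu>' x" unfolding A_def dot_lmul_matrix by (rule inner_commute)
        finally show "trace (\<nu> ?y (\<eta> \<mu> x) ** dyad (N \<nu>' x) ?s) = A \<mu> \<bullet> N \<nu>' x" .
      qed
      have "?s v* curv1 P ?y (dyad (N \<mu> x) ?s) (dyad (N \<nu>' x) ?s) = 0"
        using cz[OF yU] by (simp add: cub_def)
      then show ?thesis
        unfolding structure_eqs[OF yU] w\<eta>[OF x] rm_def rn_def
        by (simp add: n vector_matrix_simps vector_mat_1 cc_def algebra_simps flip: scaleR_add_left scaleR_diff_left)
          (simp only: add_divide_distrib diff_divide_distrib, simp)
    qed
    finally have "zs = 0" .
    with zy0 show ?thesis by (simp add: Yd zy_def zs_def)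
  qed
  obtain D and z where D: "open D" "0 \<in> D" "z 0 = (y0, s0)" "z ` D \<subseteq> W"
    "\<And>u. u \<in> D \<Longrightarrow> (z has_derivative (\<lambda>k. \<Sigma> \<mu>. k $ \<mu> *\<^sub>R Y \<mu> (z u))) (at u)"
    "smooth_on D z"
    by (rule commuting_fields_integrable[where Y=Y, OF oW W0 Ys]) (erule comm, rule that)
  define \<phi> where "\<phi> u = fst (z u)" for u
  define s where "s u = snd (z u)" for u
  define T where "T u k = matrix_inv (Q (z u)) *v k" for u k
  have zW: "z u \<in> W" if "u \<in> D" for u using D that by blast
  have \<phi>d: "fder \<phi> u k = X (\<phi> u) (dyad (T u k) (s u))" if u: "u \<in> D" for u k
  proof -
    have "(\<phi> has_derivative (\<lambda>k. fst (\<Sigma> \<mu>. k $ \<mu> *\<^sub>R Y \<mu> (z u)))) (at u)"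
      unfolding \<phi>_def by (rule has_derivative_fst[OF D(5)[OF u]])
    then have "fder \<phi> u k = (\<Sigma> \<mu>. k $ \<mu> *\<^sub>R \<eta> \<mu> (z u))"
      by (simp add: frechet_derivative_eqI fst_sum Y_def)
    also have "\<dots> = X (\<phi> u) (dyad (\<Sigma> \<mu>. k $ \<mu> *\<^sub>R N \<mu> (z u)) (s u))"
    proof -
      have l: "linear (\<lambda>t. X (\<phi> u) (dyad t (s u)))"
        using linear_X[of "\<phi> u"] zW[OF u] fW
        by (intro linearI) (auto simp: \<phi>_def dyad_add_left dyad_scale_left linear_add linear_scale image_subset_iff)
      show ?thesis
        using linear_sum[OF l, of "\<lambda>\<mu>. k $ \<mu> *\<^sub>R N \<mu> (z u)" UNIV]
        by (simp add: linear_scale[OF l] \<eta>_def \<phi>_def[symmetric] s_def[symmetric])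
    qed
    also have "(\<Sigma> \<mu>. k $ \<mu> *\<^sub>R N \<mu> (z u)) = T u k"
    proof -
      have "T u (\<Sigma> \<mu>. k $ \<mu> *\<^sub>R axis \<mu> 1) = (\<Sigma> \<mu>. k $ \<mu> *\<^sub>R N \<mu> (z u))"
        unfolding T_def N_def by (simp add: linear_sum linear_scale matrix_vector_mul_linear)
      then show ?thesis by (simp add: basis_expansion[of k, unfolded scalar_mult_eq_scaleR])
    qed
    finally show ?thesis .
  qed
  show ?thesis
  proof (rule that[of D \<phi> s T])
    show "open D" "0 \<in> D" "\<phi> 0 = y0" "s 0 = s0" using D by (simp_all add: \<phi>_def s_def)
    show "\<phi> ` D \<subseteq> U" using zW fW by (auto simp: \<phi>_def)
    show "smooth_on D \<phi>"
      unfolding \<phi>_def by (rule smooth_on_compose[OF D(1) sf D(6)]) (rule subset_UNIV)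
    show "s u \<noteq> 0" if "u \<in> D" for u using zW[OF that] by (simp add: W_def s_def)
    show "bij (T u)" if "u \<in> D" for u
    proof -
      have "invertible (Q (z u))" using zW[OF that] by (simp add: W_def invertible_det_nz)
      then have "invertible (matrix_inv (Q (z u)))"
        using matrix_inv_both invertible_def by blast
      then show ?thesis unfolding T_def using invertible_eq_bij by blast
    qed
    show "w (\<phi> u) (fder \<phi> u k) = dyad (T u k) (s u)" if "u \<in> D" for u k
      using \<phi>d[OF that] zW[OF that] fW by (auto simp: \<phi>_def)
  qed
qed

end

lemma exists_orthogonal_nonzero:
  fixes t :: "real^'p"
  assumes "CARD('p) \<ge> 2"
  obtains x where "x \<noteq> 0" "x \<bullet> t = 0"
proof (cases "t = 0")
  case True
  then show ?thesis using that[of "axis undefined 1"] by simp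
next
  case False
  have "card {undefined :: 'p} < CARD('p)" using assms by simp
  then have "\<exists>j. j \<noteq> i" for i :: 'p
    using assms by (metis UNIV_eq_I card.empty card.insert empty_not_UNIV finite.emptyI insertCI insert_absorb is_singletonI' is_singleton_altdef numeral_le_one_iff semiring_norm(69) empty_iff)
  moreover obtain i where i: "t $ i \<noteq> 0" using False by (auto simp: vec_eq_iff)
  ultimately obtain j where j: "j \<noteq> i" by blast
  show ?thesis
  proof (rule that)
    show "t $ i *\<^sub>R axis j 1 - t $ j *\<^sub>R axis i 1 \<noteq> (0 :: real^'p)"
    proof
      assume "t $ i *\<^sub>R axis j 1 - t $ j *\<^sub>R axis i 1 = (0 :: real^'p)"
      from arg_cong[OF this, of "\<lambda>v. v $ j"] show False using i j by (simp add: axis_def)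
    qed
    show "(t $ i *\<^sub>R axis j 1 - t $ j *\<^sub>R axis i 1) \<bullet> t = 0"
      by (simp add: inner_diff_left inner_axis inner_commute[of "axis _ _"])
  qed
qed

section \<open>Curvature along a given integral manifold\<close>

context pframe
begin

text \<open>The first structure equation, restricted to the manifold, shows that \<open>s\<close> is
  recurrent: its covariant derivative is lam times \<open>s\<close>. Differentiating once more and
  using the symmetry of second derivatives, the curvature maps \<open>s\<close> to a multiple of
  itself.\<close>

theorem alpha_integral_curvature:
  fixes \<phi> :: "real^'p \<Rightarrow> real^'q^'p"
  assumes p2: "CARD('p) \<ge> 2"
    and tz: "\<And>y t t' s. y \<in> U \<Longrightarrow> tors P y (dyad t s) (dyad t' s) = 0"
    and D: "open D" "0 \<in> D" "smooth_on D \<phi>" "\<phi> ` D \<subseteq> U"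
    and gen: "\<And>u. u \<in> D \<Longrightarrow> \<exists>S. S \<noteq> 0 \<and> range (\<lambda>k. w (\<phi> u) (fder \<phi> u k)) = range (\<lambda>t. dyad t S)"
    and gen0: "s0 \<noteq> 0" "range (\<lambda>k. w (\<phi> 0) (fder \<phi> 0 k)) = range (\<lambda>t. dyad t s0)"
  shows "\<exists>c. cub P (\<phi> 0) t t' s0 = c *\<^sub>R s0"
proof -
  define c where "c u k = w (\<phi> u) (fder \<phi> u k)" for u k
  have \<phi>U: "\<phi> u \<in> U" if "u \<in> D" for u using that D by blast
  have \<phi>lin: "linear (fder \<phi> u)" if "u \<in> D" for u
    by (intro linear_frechet_derivative smooth_on_differentiable[OF D(3) that])
  have \<phi>ks: "smooth_on D (\<lambda>u. fder \<phi> u k)" for k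
    by (rule smooth_on_frechet_derivative[OF D(3)])
  have cs: "smooth_on D (\<lambda>u. c u k)" for k
    unfolding c_def by (rule smooth_form_compose[OF forms(1) D(1,3,4) \<phi>ks])
  have clin: "linear (c u)" if "u \<in> D" for u
    unfolding c_def using linear_compose[OF \<phi>lin[OF that] linear_w[OF \<phi>U[OF that]]] by (simp add: o_def)
  \<comment> \<open>An arbitrary row index. Along the parameter direction \<open>k0\<close> the
    coframe takes at 0 the value \<open>axis \<alpha> 1\<close> times \<open>s0\<close>, and the row
    \<alpha> of its values nearby is a smooth choice of \<open>s\<close>.\<close>
  define \<alpha> :: 'p where "\<alpha> = undefined"
  have "dyad (axis \<alpha> 1) s0 \<in> range (c 0)" using gen0(2) unfolding c_def by blast
  then obtain k0 where k0: "c 0 k0 = dyad (axis \<alpha> 1) s0" by auto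
  define s where "s u = c u k0 $ \<alpha>" for u
  have ss: "smooth_on D s" unfolding s_def by (intro smooth_on_vec_nth D(1) cs)
  have s0: "s 0 = s0" by (simp add: s_def k0 dyad_def vec_eq_iff)
  define D' where "D' = D \<inter> s -` (- {0})"
  have oD': "open D'"
    unfolding D'_def
    by (rule continuous_open_preimage[OF smooth_on_continuous[OF ss] D(1)]) (auto intro: open_Compl)
  have D'0: "0 \<in> D'" using D(2) s0 gen0(1) by (simp add: D'_def)
  have D'D: "D' \<subseteq> D" by (auto simp: D'_def)
  have snz: "s u \<noteq> 0" if "u \<in> D'" for u using that by (simp add: D'_def)
  have ss': "smooth_on D' s" using smooth_on_subset[OF ss D'D] .
  have nzs: "s u \<bullet> s u \<noteq> 0" if "u \<in> D'" for u using snz[OF that] by simp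
  \<comment> \<open>The other factor of the dyad, obtained by contraction with \<open>s\<close>;
    this formula shows that it is smooth.\<close>
  define \<tau> where "\<tau> u k = inverse (s u \<bullet> s u) *\<^sub>R (c u k *v s u)" for u k
  have bmv: "bounded_bilinear (\<lambda>(A :: real^'q^'p) x. A *v x)"
    unfolding bilinear_conv_bounded_bilinear[symmetric] bilinear_def
    by (auto intro!: linearI simp: matrix_vector_mult_add_rdistrib matrix_vector_right_distrib
        scaleR_matrix_vector_assoc[symmetric] matrix_vector_mult_scaleR)
  have \<tau>s: "smooth_on D' (\<lambda>u. \<tau> u k)" for k
    unfolding \<tau>_def
    by (intro smooth_on_scaleR smooth_on_inverse smooth_on_inner smooth_on_bilinear[OF oD' bmv] oD' ss' nzs
        smooth_on_subset[OF cs D'D])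
  have \<tau>lin: "linear (\<tau> u)" if "u \<in> D'" for u
    unfolding \<tau>_def using clin that D'D
    by (intro linearI) (auto simp: subset_iff linear_add linear_scale matrix_vector_mult_add_rdistrib
        scaleR_matrix_vector_assoc[symmetric] scaleR_add_right)
  have c_dyad: "c u k = dyad (\<tau> u k) (s u)" and \<tau>surj: "\<exists>k. \<tau> u k = x" if u: "u \<in> D'" for u k x
  proof -
    obtain S where S: "S \<noteq> 0" "range (c u) = range (\<lambda>t. dyad t S)"
      using gen[of u] u D'D unfolding c_def by blast
    then obtain t0 where "c u k0 = dyad t0 S" by blast
    then have sS: "s u = t0 $ \<alpha> *\<^sub>R S" by (simp add: s_def dyad_def vec_eq_iff)
    then have a: "t0 $ \<alpha> \<noteq> 0" using snz[OF u] by auto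
    then have Ss: "dyad t S = dyad (inverse (t0 $ \<alpha>) *\<^sub>R t) (s u)" for t
      by (simp add: sS dyad_scale_left dyad_scale_right)
    have \<tau>d: "\<tau> u k = t" if "c u k = dyad t (s u)" for k t
      using nzs[OF u] by (simp add: \<tau>_def that dyad_vector)
    obtain t where "c u k = dyad t S" using S by blast
    then show "c u k = dyad (\<tau> u k) (s u)" using \<tau>d Ss by metis
    have "dyad (t0 $ \<alpha> *\<^sub>R x) S \<in> range (c u)" using S by blast
    then obtain k where "c u k = dyad (t0 $ \<alpha> *\<^sub>R x) S" by auto
    then have "c u k = dyad x (s u)" using a by (simp add: sS dyad_scale_left dyad_scale_right)
    then show "\<exists>k. \<tau> u k = x" using \<tau>d by blast
  qed
  define r where "r u k = \<rho> (\<phi> u) (fder \<phi> u k)" for u k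
  have rs: "smooth_on D' (\<lambda>u. r u k)" for k
    unfolding r_def
    by (rule smooth_on_subset[OF smooth_form_compose[OF forms(4) D(1,3,4) \<phi>ks] D'D])
  have rlin: "linear (r u)" if "u \<in> D'" for u
    unfolding r_def using linear_compose[OF \<phi>lin smooth_form_linear[OF forms(4) \<phi>U], of u] that D'D
    by (auto simp: o_def)
  have along: "fder (\<lambda>z. \<beta> (\<phi> z) (fder \<phi> z k2)) u k1
      - fder (\<lambda>z. \<beta> (\<phi> z) (fder \<phi> z k1)) u k2
     = vext_d \<beta> (\<phi> u) (fder \<phi> u k1) (fder \<phi> u k2)"
    if \<beta>: "smooth_form U \<beta>" and u: "u \<in> D'" for \<beta> :: "_ \<Rightarrow> _ \<Rightarrow> 'z::real_normed_vector" and u k1 k2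
  proof -
    have uD: "u \<in> D" using u D'D by blast
    have "vext_d \<beta> (\<phi> u) (fder \<phi> u k1) (fder \<phi> u k2)
      + \<beta> (\<phi> u) (fder (\<lambda>z. fder \<phi> z k2) u k1
         - fder (\<lambda>z. fder \<phi> z k1) u k2)
      = fder (\<lambda>z. \<beta> (\<phi> z) (fder \<phi> z k2)) u k1
      - fder (\<lambda>z. \<beta> (\<phi> z) (fder \<phi> z k1)) u k2"
      by (rule vext_d_along[symmetric, OF open_U \<beta> \<phi>U[OF uD] smooth_on_has_derivative[OF D(3) uD]
            smooth_on_has_derivative[OF \<phi>ks uD] smooth_on_has_derivative[OF \<phi>ks uD]]) simp_all
    then show ?thesis
      using second_derivative_symmetric[OF D(1,3) uD, of k2 k1] linear_0[OF smooth_form_linear[OF \<beta> \<phi>U[OF uD]]]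
      by simp
  qed
  define \<sigma> where "\<sigma> k u = fder s u k + s u v* r u k" for k u
  have \<sigma>s: "smooth_on D' (\<sigma> k)" for k
    unfolding \<sigma>_def
    by (intro smooth_on_add oD' smooth_on_frechet_derivative ss' smooth_on_bilinear[OF oD' bounded_bilinear_vm] rs)
  \<comment> \<open>Orthogonal projection onto \<open>s\<close>. The mere existence of a factor
    would not give a smooth one.\<close>
  define lam where "lam k u = (\<sigma> k u \<bullet> s u) * inverse (s u \<bullet> s u)" for k u
  have lams: "smooth_on D' (lam k)" for k
    unfolding lam_def by (intro smooth_on_mult smooth_on_inner smooth_on_inverse oD' \<sigma>s ss' nzs)
  have \<sigma>_lam: "\<sigma> k u = lam k u *\<^sub>R s u" if u: "u \<in> D'" for k u
  proof -
    have uU: "\<phi> u \<in> U" using u D'D \<phi>U by blast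
    \<comment> \<open>Contracting the structure equation with \<open>x\<close> kills the dyads whose
      first factor is \<open>\<tau> u k\<close>; taking the second direction with first factor
      \<open>x\<close> isolates the covariant derivative of \<open>s\<close> along \<open>k\<close>
      modulo \<open>s\<close>. For p = 1 no such \<open>x\<close> need exist.\<close>
    obtain x where x: "x \<noteq> 0" "x \<bullet> \<tau> u k = 0" using exists_orthogonal_nonzero[OF p2] by blast
    obtain k1 where k1: "\<tau> u k1 = x" using \<tau>surj[OF u] by blast
    have dc: "fder (\<lambda>z. c z k) u = (\<lambda>j. dyad (\<tau> u k) (fder s u j) + dyad (fder (\<lambda>z. \<tau> z k) u j) (s u))" for k
      by (rule fder_eqI_open[OF bounded_bilinear.FDERIV[OF bounded_bilinear_dyad
            smooth_on_has_derivative[OF \<tau>s u] smooth_on_has_derivative[OF ss' u]] oD' u]) (simp add: c_dyad)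
    have wc: "w (\<phi> u) (fder \<phi> u k) = dyad (\<tau> u k) (s u)" for k
      using c_dyad[OF u, of k] by (simp add: c_def)
    have "vext_d w (\<phi> u) (fder \<phi> u k1) (fder \<phi> u k)
      = dyad (\<tau> u k) (fder s u k1) - dyad (\<tau> u k1) (fder s u k)
        + dyad (fder (\<lambda>z. \<tau> z k) u k1 - fder (\<lambda>z. \<tau> z k1) u k) (s u)"
      using along[OF forms(1) u, of k k1] dc[of k] dc[of k1] unfolding c_def
      by (simp add: dyad_diff_left algebra_simps)
    then have "x v* (dyad (\<tau> u k) (fder s u k1) - dyad (\<tau> u k1) (fder s u k)
        + dyad (fder (\<lambda>z. \<tau> z k) u k1 - fder (\<lambda>z. \<tau> z k1) u k) (s u))
      = x v* (dyad (\<tau> u k1) (s u v* r u k) - dyad (\<tau> u k) (s u v* r u k1)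
         + (dyad (\<pi> (\<phi> u) (fder \<phi> u k1) *v \<tau> u k) (s u)
            - dyad (\<pi> (\<phi> u) (fder \<phi> u k) *v \<tau> u k1) (s u))
         + (h (\<phi> u) (fder \<phi> u k1) *\<^sub>R dyad (\<tau> u k) (s u)
            - h (\<phi> u) (fder \<phi> u k) *\<^sub>R dyad (\<tau> u k1) (s u)))"
      using tz[OF uU] by (simp add: structure_eqs[OF uU] wc dyad_matrix matrix_dyad r_def)
    then have "\<exists>a. (x \<bullet> x) *\<^sub>R \<sigma> k u = a *\<^sub>R s u"
      using x(2)
      by (intro exI[of _ "(x \<bullet> (fder (\<lambda>z. \<tau> z k) u k1 - fder (\<lambda>z. \<tau> z k1) u k))
          - x \<bullet> (\<pi> (\<phi> u) (fder \<phi> u k1) *v \<tau> u k) + x \<bullet> (\<pi> (\<phi> u) (fder \<phi> u k) *v \<tau> u k1)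
          + h (\<phi> u) (fder \<phi> u k) * (x \<bullet> x)"])
        (simp add: vector_matrix_simps vector_dyad k1 \<sigma>_def algebra_simps)
    then obtain a where "(x \<bullet> x) *\<^sub>R \<sigma> k u = a *\<^sub>R s u" by blast
    then have "inverse (x \<bullet> x) *\<^sub>R ((x \<bullet> x) *\<^sub>R \<sigma> k u) = inverse (x \<bullet> x) *\<^sub>R (a *\<^sub>R s u)" by simp
    then have "\<sigma> k u = (inverse (x \<bullet> x) * a) *\<^sub>R s u" using x(1) by simp
    then show ?thesis using nzs[OF u] by (simp add: lam_def)
  qed
  have Ds: "fder s u k = lam k u *\<^sub>R s u - s u v* r u k" if "u \<in> D'" for u k
    using \<sigma>_lam[OF that, of k] by (simp add: \<sigma>_def algebra_simps)
  obtain k1 k2 where k12: "\<tau> 0 k1 = t" "\<tau> 0 k2 = t'" using \<tau>surj[OF D'0] by metis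
  \<comment> \<open>The recurrence equation is differentiated. In the skew part the second
    derivatives of \<open>s\<close> drop out, as do the products of two values of lam.\<close>
  have dd: "fder (\<lambda>z. fder s z k) 0 = (\<lambda>j. lam k 0 *\<^sub>R fder s 0 j + fder (lam k) 0 j *\<^sub>R s0
        - (s0 v* fder (\<lambda>z. r z k) 0 j + fder s 0 j v* r 0 k))" for k
    unfolding s0[symmetric]
    by (rule fder_eqI_open[OF has_derivative_diff[OF has_derivative_scaleR[OF smooth_on_has_derivative[OF lams D'0]
          smooth_on_has_derivative[OF ss' D'0]] bounded_bilinear.FDERIV[OF bounded_bilinear_vm
          smooth_on_has_derivative[OF ss' D'0] smooth_on_has_derivative[OF rs D'0]]] oD' D'0]) (simp add: Ds)
  have uU: "\<phi> 0 \<in> U" using \<phi>U D(2) by blast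
  have wc: "w (\<phi> 0) (fder \<phi> 0 k) = dyad (\<tau> 0 k) s0" for k
    using c_dyad[OF D'0, of k] by (simp add: c_def s0)
  define R where "R = vext_d \<rho> (\<phi> 0) (fder \<phi> 0 k1) (fder \<phi> 0 k2)"
  have R: "R = fder (\<lambda>z. r z k2) 0 k1 - fder (\<lambda>z. r z k1) 0 k2"
    using along[OF forms(4) D'0, of k2 k1] by (simp add: r_def R_def)
  have "s0 v* R - s0 v* (r 0 k1 ** r 0 k2 - r 0 k2 ** r 0 k1)
      = (fder (lam k2) 0 k1 - fder (lam k1) 0 k2) *\<^sub>R s0"
    using second_derivative_symmetric[OF oD' ss' D'0, of k1 k2]
    unfolding dd Ds[OF D'0] s0 R
    by (simp add: vector_matrix_simps vector_matrix_assoc algebra_simps)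
  moreover have "\<exists>b. s0 v* R - s0 v* (r 0 k1 ** r 0 k2 - r 0 k2 ** r 0 k1) = b *\<^sub>R s0 + cub P (\<phi> 0) t t' s0"
    unfolding R_def structure_eqs[OF uU] wc k12 r_def cub_def
    by (intro exI) (simp add: vector_matrix_simps vector_matrix_assoc[symmetric] vector_dyad vector_mat_1 flip: scaleR_diff_left,
        rule disjI1, rule refl)
  ultimately obtain b where "b *\<^sub>R s0 + cub P (\<phi> 0) t t' s0
      = (fder (lam k2) 0 k1 - fder (lam k1) 0 k2) *\<^sub>R s0" by metis
  then have "cub P (\<phi> 0) t t' s0
      = ((fder (lam k2) 0 k1 - fder (lam k1) 0 k2) - b) *\<^sub>R s0"
    by (simp add: algebra_simps)
  then show ?thesis by blast
qed

end

section \<open>The Bianchi identity\<close>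

definition matE :: "'p \<times> 'q \<Rightarrow> real^'q::finite^'p::finite" where
  "matE k = dyad (axis (fst k) 1) (axis (snd k) 1)"

text \<open>The trace of an endomorphism of the pq-dimensional matrix space, computed in the basis
  of unit dyads.\<close>

definition tr2 :: "(real^'q::finite^'p::finite \<Rightarrow> real^'q^'p) \<Rightarrow> real" where
  "tr2 f = (\<Sigma> k. f (matE k) $ fst k $ snd k)"

lemma matE_component: "matE k $ \<alpha> $ i = (if k = (\<alpha>, i) then 1 else 0)"
  by (cases k) (auto simp: matE_def dyad_def axis_def)

lemma mat_representation: "(\<Sigma> k. (z $ fst k $ snd k) *\<^sub>R matE k) = z"
  by (simp add: vec_eq_iff matE_component if_distrib[of "\<lambda>x. _ * x"] cong: if_cong)

lemma tr2_commute:
  assumes "linear f" "linear g"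
  shows "tr2 (\<lambda>x. f (g x)) = tr2 (\<lambda>x. g (f x))"
proof -
  have e: "tr2 (\<lambda>x. f (g x)) = (\<Sigma> k l. (g (matE k) $ fst l $ snd l) * (f (matE l) $ fst k $ snd k))"
    if "linear f" for f g
  proof -
    have "f (g (matE k)) = (\<Sigma> l. (g (matE k) $ fst l $ snd l) *\<^sub>R f (matE l))" for k
      using that by (subst mat_representation[of "g (matE k)", symmetric]) (simp add: linear_sum linear_scale)
    then show ?thesis by (simp add: tr2_def)
  qed
  show ?thesis unfolding e[OF assms(1)] e[OF assms(2)] by (subst sum.swap) (simp add: mult.commute)
qed

lemma tr2_simps:
  "tr2 (\<lambda>x. f x + g x) = tr2 f + tr2 g" "tr2 (\<lambda>x. f x - g x) = tr2 f - tr2 g" "tr2 (\<lambda>x. - f x) = - tr2 f"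
  "tr2 (\<lambda>x. c *\<^sub>R f x) = c * tr2 f" "tr2 (\<lambda>x. 0) = 0"
  by (simp_all add: tr2_def sum.distrib sum_subtractf sum_negf sum_distrib_left)

lemma sum_pairs: "(\<Sigma> k. f (fst k) (snd k)) = (\<Sigma> a b. f a b)"
  for f :: "'a::finite \<Rightarrow> 'b::finite \<Rightarrow> 'c::comm_monoid_add"
  by (simp add: sum.cartesian_product case_prod_beta)

lemma dyad_sum_left: "(\<Sigma> i. s $ i *\<^sub>R dyad t (axis i 1)) = dyad t s"
  and dyad_sum_right: "(\<Sigma> \<alpha>. t $ \<alpha> *\<^sub>R dyad (axis \<alpha> 1) s) = dyad t s"
  by (simp_all add: vec_eq_iff dyad_def axis_def if_distrib[of "\<lambda>x. _ * x"] if_distrib[of "\<lambda>x. x * _"] cong: if_cong)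

text \<open>The image consists of dyads with factor \<open>s\<close>, so the trace is that of the
  restriction to this p-dimensional space.\<close>

lemma tr2_dyad_left:
  assumes "linear L"
  shows "tr2 (\<lambda>x. dyad (L x) s) = (\<Sigma> \<alpha>. L (dyad (axis \<alpha> 1) s) $ \<alpha>)"
proof -
  have "tr2 (\<lambda>x. dyad (L x) s) = (\<Sigma> \<alpha> i. L (\<E> \<alpha> i) $ \<alpha> * s $ i)"
    unfolding tr2_def matE_def by (subst sum_pairs[symmetric]) (simp add: dyad_def)
  also have "\<dots> = (\<Sigma> \<alpha>. L (\<Sigma> i. s $ i *\<^sub>R \<E> \<alpha> i) $ \<alpha>)"
    by (simp add: linear_sum[OF assms] linear_scale[OF assms] mult.commute)
  finally show ?thesis by (simp add: dyad_sum_left)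
qed

lemma tr2_dyad_right:
  assumes "linear L"
  shows "tr2 (\<lambda>x. dyad t (L x)) = (\<Sigma> i. L (dyad t (axis i 1)) $ i)"
proof -
  have "tr2 (\<lambda>x. dyad t (L x)) = (\<Sigma> \<alpha> i. t $ \<alpha> * L (\<E> \<alpha> i) $ i)"
    unfolding tr2_def matE_def by (subst sum_pairs[symmetric]) (simp add: dyad_def)
  also have "\<dots> = (\<Sigma> i. L (\<Sigma> \<alpha>. t $ \<alpha> *\<^sub>R \<E> \<alpha> i) $ i)"
    by (subst sum.swap) (simp add: linear_sum[OF assms] linear_scale[OF assms])
  finally show ?thesis by (simp add: dyad_sum_right)
qed

lemma tr2_mult:
  "tr2 (\<lambda>x :: real^'q^'p. x ** B) = real CARD('p) * trace B"
  "tr2 (\<lambda>x :: real^'q^'p. A ** x) = real CARD('q) * trace A"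
  for A :: "real^'p^'p" and B :: "real^'q^'q"
proof -
  show "tr2 (\<lambda>x :: real^'q^'p. x ** B) = real CARD('p) * trace B"
    by (simp add: tr2_def matE_def dyad_matrix sum_pairs[where f="\<lambda>\<alpha> i. dyad (axis \<alpha> 1) (axis i 1 v* B) $ \<alpha> $ i"])
      (simp add: dyad_def axis_def vector_matrix_mult_def trace_def if_distrib[of "\<lambda>x. x * _"] cong: if_cong)
  show "tr2 (\<lambda>x :: real^'q^'p. A ** x) = real CARD('q) * trace A"
    by (simp add: tr2_def matE_def matrix_dyad sum_pairs[where f="\<lambda>\<alpha> i. dyad (A *v axis \<alpha> 1) (axis i 1) $ \<alpha> $ i"])
      (simp add: dyad_def axis_def matrix_vector_mult_def trace_def if_distrib[of "\<lambda>x. _ * x"] sum_distrib_left cong: if_cong)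
qed

lemma tr2_id: "tr2 (\<lambda>x :: real^'q^'p. x) = real CARD('p) * real CARD('q)"
  by (simp add: tr2_def matE_component)

text \<open>This is d d = 0, evaluated on three constant vectors, for which the bracket terms are
  absent.\<close>

lemma vext_d_closed:
  fixes \<beta> :: "'e::euclidean_space \<Rightarrow> 'e \<Rightarrow> 'f::euclidean_space"
  assumes U: "open U" "y \<in> U" and \<beta>: "smooth_form U \<beta>"
  shows "fder (\<lambda>y. vext_d \<beta> y v x) y u + fder (\<lambda>y. vext_d \<beta> y x u) y v
     + fder (\<lambda>y. vext_d \<beta> y u v) y x = 0"
proof -
  have d: "((\<lambda>y. fder (\<lambda>z. \<beta> z a) y b) has_derivative
      fder (\<lambda>y. fder (\<lambda>z. \<beta> z a) y b) y) (at y)" for a b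
    by (intro smooth_on_has_derivative[OF smooth_on_frechet_derivative[OF smooth_form_smooth[OF \<beta>]] U(2)])
  have e: "fder (\<lambda>y. vext_d \<beta> y a b) y c
     = fder (\<lambda>y. fder (\<lambda>z. \<beta> z b) y a) y c
      - fder (\<lambda>y. fder (\<lambda>z. \<beta> z a) y b) y c" for a b c
    unfolding vext_d_def by (subst frechet_derivative_eqI[OF has_derivative_diff[OF d d]]) simp
  show ?thesis
    unfolding e
    using second_derivative_symmetric[OF U(1) smooth_form_smooth[OF \<beta>, of x] U(2), of u v]
      second_derivative_symmetric[OF U(1) smooth_form_smooth[OF \<beta>, of u] U(2), of v x]
      second_derivative_symmetric[OF U(1) smooth_form_smooth[OF \<beta>, of v] U(2), of x u]
    by simp
qed

lemma smooth_vext_d: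
  assumes "open U" "smooth_form U \<beta>"
  shows "smooth_on U (\<lambda>y. vext_d \<beta> y u v)"
  unfolding vext_d_def using assms
  by (intro smooth_on_diff smooth_on_frechet_derivative smooth_form_smooth)

lemma smooth_on_bilinear_family:
  fixes B :: "'g::real_normed_vector \<Rightarrow> 'e::euclidean_space \<Rightarrow> 'e \<Rightarrow> 'f::real_normed_vector"
  assumes S: "open S" and B: "\<And>u v. smooth_on S (\<lambda>y. B y u v)" and l: "\<And>y. y \<in> S \<Longrightarrow> bilinear (B y)"
    and "smooth_on S f" "smooth_on S g"
  shows "smooth_on S (\<lambda>x. B x (f x) (g x))"
proof (rule smooth_on_linear_family[where \<beta>="\<lambda>x. B x (f x)", OF S _ _ assms(5)])
  show "smooth_on S (\<lambda>y. B y (f y) v)" for v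
    by (rule smooth_on_linear_family[where \<beta>="\<lambda>x u. B x u v", OF S B _ assms(4)])
      (use l in \<open>auto simp: bilinear_def\<close>)
qed (use l in \<open>auto simp: bilinear_def\<close>)

lemma has_derivative_bilinear_family:
  fixes B :: "'e::euclidean_space \<Rightarrow> 'e \<Rightarrow> 'e \<Rightarrow> 'f::real_normed_vector"
  assumes U: "open U" "y \<in> U" and B: "\<And>u v. smooth_on U (\<lambda>y. B y u v)" "\<And>y. bilinear (B y)"
    and fg: "smooth_on U f" "smooth_on U g"
  shows "((\<lambda>z. B z (f z) (g z)) has_derivative
    (\<lambda>k. fder (\<lambda>z. B z (f y) (g y)) y k + B y (fder f y k) (g y) + B y (f y) (fder g y k))) (at y)"
proof -
  have "smooth_form U (\<lambda>y z. B y z c)" for c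
    using B by (auto simp: smooth_form_def bilinear_def)
  from form_has_derivative[OF U(1) this, of "\<lambda>y. y" y "\<lambda>k. k", OF U(2) has_derivative_ident smooth_on_has_derivative[OF fg(1) U(2)]]
  have 1: "((\<lambda>z. B z (f z) c) has_derivative (\<lambda>k. fder (\<lambda>z. B z (f y) c) y k + B y (fder f y k) c)) (at y)" for c
    by simp
  have "smooth_form U (\<lambda>y z. B y (f y) z)"
    using smooth_on_bilinear_family[OF U(1) B fg(1) smooth_on_const] B(2) by (auto simp: smooth_form_def bilinear_def)
  from form_has_derivative[OF U(1) this, of "\<lambda>y. y" y "\<lambda>k. k", OF U(2) has_derivative_ident smooth_on_has_derivative[OF fg(2) U(2)]]
  show ?thesis using frechet_derivative_eqI[OF 1] by simp
qed

section \<open>The first Bianchi identity with torsion\<close>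

context pframe
begin

text \<open>The connection induced on the matrix-valued tangent vectors, signed so that the first
  structure equation reads d w = gam w + torsion, see \<open>dw_gam\<close>. \<open>Rg\<close> is
  its curvature.\<close>

definition gam :: "real^'q^'p \<Rightarrow> real^'q^'p \<Rightarrow> real^'q^'p \<Rightarrow> real^'q^'p" where
  "gam y v z = \<pi> y v ** z - z ** \<rho> y v + h y v *\<^sub>R z"

abbreviation "Rp \<equiv> curvature \<pi>"
abbreviation "Rq \<equiv> curvature \<rho>"

definition Rg :: "real^'q^'p \<Rightarrow> real^'q^'p \<Rightarrow> real^'q^'p \<Rightarrow> real^'q^'p \<Rightarrow> real^'q^'p" where
  "Rg y u v z = Rp y u v ** z - z ** Rq y u v + vext_d h y u v *\<^sub>R z"

lemma dw_gam: "y \<in> U \<Longrightarrow> vext_d w y u v = gam y u (w y v) - gam y v (w y u) + tors P y (w y u) (w y v)"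
  by (simp add: structure_eqs gam_def)

text \<open>A prolonged frame has smooth forms, but nothing is assumed of its coefficients. The
  first structure equation expresses the torsion through the forms and their derivatives.\<close>

lemma smooth_tors: "smooth_on U (\<lambda>y. tors P y z z')"
proof -
  have id: "smooth_on U (\<lambda>y. y)" by (rule smooth_on_id)
  have X: "smooth_on U (\<lambda>y. X y z)" for z by (rule smooth_form_smooth[OF smooth_form_X])
  have f: "smooth_on U (\<lambda>y. \<beta> y (X y z))" if "smooth_form U \<beta>" for \<beta> :: "_ \<Rightarrow> _ \<Rightarrow> 'z::real_normed_vector" and z
    by (rule smooth_form_compose[OF that open_U id _ X]) simp
  have 0: "smooth_on U (\<lambda>y. vext_d w y (X y z) (X y z'))"
    by (rule smooth_on_bilinear_family[OF open_U smooth_vext_d[OF open_U forms(1)] vext_d_bilinear[OF forms(1) open_U] X X])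
  have 1: "smooth_on U (\<lambda>y. \<pi> y (X y z) ** z' - z' ** \<rho> y (X y z) + h y (X y z) *\<^sub>R z')" for z z'
    by (rule smooth_on_add[OF open_U smooth_on_diff[OF open_U
          smooth_on_bilinear[OF open_U bounded_bilinear_mm f[OF forms(3)] smooth_on_const]
          smooth_on_bilinear[OF open_U bounded_bilinear_mm smooth_on_const f[OF forms(4)]]]
          smooth_on_scaleR[OF open_U f[OF forms(2)] smooth_on_const]])
  have "smooth_on U (\<lambda>y. vext_d w y (X y z) (X y z')
      - ((\<pi> y (X y z) ** z' - z' ** \<rho> y (X y z) + h y (X y z) *\<^sub>R z')
         - (\<pi> y (X y z') ** z - z ** \<rho> y (X y z') + h y (X y z') *\<^sub>R z)))"
    by (rule smooth_on_diff[OF open_U 0 smooth_on_diff[OF open_U 1 1]])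
  then show ?thesis
    by (rule smooth_on_cong[OF open_U, rotated]) (simp add: dw_gam gam_def)
qed

lemma bianchi:
  fixes u v x
  assumes y: "y \<in> U"
  defines "DT a b c \<equiv> fder (\<lambda>y. tors P y b c) y a"
    and "T \<equiv> tors P y" and "W \<equiv> w y" and "G \<equiv> gam y"
  shows "(Rg y u v (W x) + Rg y v x (W u) + Rg y x u (W v))
    + (DT u (W v) (W x) + DT v (W x) (W u) + DT x (W u) (W v))
    + (T (G u (W v) - G v (W u) + T (W u) (W v)) (W x) + T (G v (W x) - G x (W v) + T (W v) (W x)) (W u)
       + T (G x (W u) - G u (W x) + T (W x) (W u)) (W v))
    - (G u (T (W v) (W x)) + G v (T (W x) (W u)) + G x (T (W u) (W v))) = 0"
proof -
  define dw where "dw a b = fder (\<lambda>z. w z b) y a" for a b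
  define d\<pi> where "d\<pi> a b = fder (\<lambda>z. \<pi> z b) y a" for a b
  define d\<rho> where "d\<rho> a b = fder (\<lambda>z. \<rho> z b) y a" for a b
  define dh where "dh a b = fder (\<lambda>z. h z b) y a" for a b
  have fd: "((\<lambda>z. \<beta> z b) has_derivative fder (\<lambda>z. \<beta> z b) y) (at y)" if "smooth_form U \<beta>"
    for \<beta> :: "_ \<Rightarrow> _ \<Rightarrow> 'z::real_normed_vector" and b
    by (rule smooth_on_has_derivative[OF smooth_form_smooth[OF that] y])
  have Td: "((\<lambda>z. tors P z (w z a) (w z b)) has_derivative
      (\<lambda>k. DT k (W a) (W b) + T (dw k a) (W b) - T (dw k b) (W a))) (at y)" for a b
    using has_derivative_bilinear_family[OF open_U y smooth_tors bilinear_tors smooth_form_smooth[OF forms(1), of a] smooth_form_smooth[OF forms(1), of b]]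
    by (simp add: DT_def T_def W_def dw_def tors_skew[of P y "w y a"])
  have Dd: "fder (\<lambda>z. vext_d w z a b) y
    = (\<lambda>k. (\<pi> y a ** dw k b + d\<pi> k a ** W b - (W b ** d\<rho> k a + dw k b ** \<rho> y a) + (h y a *\<^sub>R dw k b + dh k a *\<^sub>R W b))
      - (\<pi> y b ** dw k a + d\<pi> k b ** W a - (W a ** d\<rho> k b + dw k a ** \<rho> y b) + (h y b *\<^sub>R dw k a + dh k b *\<^sub>R W a))
      + (DT k (W a) (W b) + T (dw k a) (W b) - T (dw k b) (W a)))" for a b
  proof (rule fder_eqI_open[OF _ open_U y])
    show "((\<lambda>z. gam z a (w z b) - gam z b (w z a) + tors P z (w z a) (w z b)) has_derivative
      (\<lambda>k. (\<pi> y a ** dw k b + d\<pi> k a ** W b - (W b ** d\<rho> k a + dw k b ** \<rho> y a) + (h y a *\<^sub>R dw k b + dh k a *\<^sub>R W b))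
      - (\<pi> y b ** dw k a + d\<pi> k b ** W a - (W a ** d\<rho> k b + dw k a ** \<rho> y b) + (h y b *\<^sub>R dw k a + dh k b *\<^sub>R W a))
      + (DT k (W a) (W b) + T (dw k a) (W b) - T (dw k b) (W a)))) (at y)"
      unfolding gam_def dw_def d\<pi>_def d\<rho>_def dh_def W_def
      by (intro has_derivative_add has_derivative_diff has_derivative_scaleR
          bounded_bilinear.FDERIV[OF bounded_bilinear_mm] fd forms Td[unfolded dw_def W_def])
  qed (simp add: dw_gam)
  have dws: "dw a b = dw b a + (\<pi> y a ** W b - W b ** \<rho> y a + h y a *\<^sub>R W b)
      - (\<pi> y b ** W a - W a ** \<rho> y b + h y b *\<^sub>R W a) + T (W a) (W b)" for a b
    using dw_gam[OF y, of a b] by (simp add: vext_d_def dw_def gam_def W_def T_def algebra_simps)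
  have Ts: "T (W v) (W u) = - T (W u) (W v)" "T (W x) (W v) = - T (W v) (W x)" "T (W u) (W x) = - T (W x) (W u)"
    unfolding T_def by (rule tors_skew)+
  note T_simps = bounded_bilinear.add_left[OF bounded_bilinear_tors, of P y, folded T_def]
    bounded_bilinear.add_right[OF bounded_bilinear_tors, of P y, folded T_def]
    bounded_bilinear.diff_left[OF bounded_bilinear_tors, of P y, folded T_def]
    bounded_bilinear.diff_right[OF bounded_bilinear_tors, of P y, folded T_def]
    bounded_bilinear.minus_left[OF bounded_bilinear_tors, of P y, folded T_def]
    bounded_bilinear.minus_right[OF bounded_bilinear_tors, of P y, folded T_def]
    bounded_bilinear.scaleR_left[OF bounded_bilinear_tors, of P y, folded T_def]
    bounded_bilinear.scaleR_right[OF bounded_bilinear_tors, of P y, folded T_def]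
  \<comment> \<open>The left-hand side is d(d w), expanded by differentiating the first structure
    equation; \<open>dws\<close> brings the remaining derivatives of \<open>w\<close> to one order
    of arguments, after which they cancel.\<close>
  show ?thesis
    apply (rule trans[OF _ vext_d_closed[OF open_U y forms(1), of v x u]])
    unfolding Dd
    unfolding Rg_def curvature_def vext_d_def d\<pi>_def[symmetric] d\<rho>_def[symmetric] dh_def[symmetric] G_def gam_def
    unfolding dws[of v u] dws[of x v] dws[of x u]
    by (simp add: mm_simps algebra_simps T_simps matrix_mul_assoc Ts)
qed

end

lemma tr2_scaleR_const:
  fixes z :: "real^'q::finite^'p::finite"
  assumes "linear f"
  shows "tr2 (\<lambda>x. f x *\<^sub>R z) = f z"
proof -
  have "tr2 (\<lambda>x. f x *\<^sub>R z) = f (\<Sigma> k. (z $ fst k $ snd k) *\<^sub>R matE k)"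
    by (simp add: tr2_def linear_sum[OF assms] linear_scale[OF assms] mult.commute)
  then show ?thesis by (simp add: mat_representation)
qed

lemma linear_dyad_sum:
  assumes "linear f"
  shows "(\<Sigma> i. s $ i *\<^sub>R f (dyad t (axis i 1))) = f (dyad t s)"
  by (subst dyad_sum_left[symmetric]) (simp add: linear_sum[OF assms] linear_scale[OF assms])

context pframe
begin

lemma tr2_dtors:
  assumes tr0: "\<And>y z. y \<in> U \<Longrightarrow> tr2 (tors P y z) = 0" and y: "y \<in> U"
  shows "tr2 (\<lambda>c. fder (\<lambda>y. tors P y b c) y a) = 0"
proof -
  have d: "((\<lambda>y. tors P y b c) has_derivative fder (\<lambda>y. tors P y b c) y) (at y)" for c
    by (rule smooth_on_has_derivative[OF smooth_tors y])
  have "((\<lambda>y. tr2 (tors P y b)) has_derivative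
      (\<lambda>a. tr2 (\<lambda>c. fder (\<lambda>y. tors P y b c) y a))) (at y)"
    unfolding tr2_def by (intro has_derivative_sum bounded_linear.has_derivative[OF bounded_linear_vec_nth] d)
  moreover have "((\<lambda>y. tr2 (tors P y b)) has_derivative (\<lambda>a. 0)) (at y)"
    by (rule has_derivative_transform_within_open[OF _ open_U y, of "\<lambda>y. 0"]) (simp_all add: tr0)
  ultimately show ?thesis using has_derivative_unique by metis
qed

lemma linear_gam: "y \<in> U \<Longrightarrow> linear (\<lambda>x. gam y (X y x) z)" and linear_gam': "linear (gam y v)"
proof -
  show "linear (gam y v)"
    by (intro linearI) (simp_all add: gam_def mm_simps algebra_simps)
  assume y: "y \<in> U"
  show "linear (\<lambda>x. gam y (X y x) z)"
    using smooth_form_linear[OF forms(2) y] smooth_form_linear[OF forms(3) y] smooth_form_linear[OF forms(4) y] linear_X[OF y]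
    by (intro linearI) (simp_all add: gam_def mm_simps linear_add linear_scale algebra_simps)
qed

text \<open>The torsion terms cancel because \<open>tors\<close> is trace-free and is symmetric in the first factors of its two dyadic arguments.\<close>

lemma trace_bianchi:
  fixes t t' :: "real^'p" and s :: "real^'q"
  assumes tz: "\<And>y t t' s. y \<in> U \<Longrightarrow> tors P y (dyad t s) (dyad t' s) = 0"
    and tr0: "\<And>y z. y \<in> U \<Longrightarrow> tr2 (tors P y z) = 0" and y: "y \<in> U"
  defines "u1 \<equiv> X y (dyad t s)" and "u2 \<equiv> X y (dyad t' s)"
  shows "tr2 (Rg y u1 u2) = tr2 (\<lambda>x. Rg y u1 (X y x) (dyad t' s) - Rg y u2 (X y x) (dyad t s))"
proof -
  let ?z1 = "dyad t s" and ?z2 = "dyad t' s"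
  define T where "T = tors P y"
  define G where "G = gam y"
  define H where "H z x = gam y (X y x) z" for z x
  have Tl: "linear (T z)" for z unfolding T_def using bilinear_tors by (auto simp: bilinear_def)
  have T12: "T ?z1 ?z2 = 0" "T ?z2 ?z1 = 0" using tz[OF y] by (simp_all add: T_def)
  have Ts: "T x z = - T z x" for x z unfolding T_def by (rule tors_skew)
  note T_simps = bounded_bilinear.add_left[OF bounded_bilinear_tors, of P y, folded T_def]
    bounded_bilinear.add_right[OF bounded_bilinear_tors, of P y, folded T_def]
    bounded_bilinear.diff_right[OF bounded_bilinear_tors, of P y, folded T_def]
  define DT where "DT a b c = fder (\<lambda>y. tors P y b c) y a" for a b c
  have DT12: "DT a ?z1 ?z2 = 0" for a
  proof -
    have "((\<lambda>y. tors P y ?z1 ?z2) has_derivative (\<lambda>a. 0)) (at y)"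
      by (rule has_derivative_transform_within_open[OF _ open_U y, of "\<lambda>y. 0"]) (simp_all add: tz)
    then show ?thesis by (simp add: DT_def frechet_derivative_eqI)
  qed
  have DTs: "DT a x z = - DT a z x" for a x z
  proof -
    have "((\<lambda>y. - tors P y z x) has_derivative (\<lambda>a. - DT a z x)) (at y)"
      unfolding DT_def by (intro has_derivative_minus smooth_on_has_derivative[OF smooth_tors y])
    then have "((\<lambda>y. tors P y x z) has_derivative (\<lambda>a. - DT a z x)) (at y)"
      by (simp flip: tors_skew)
    then show ?thesis by (simp add: DT_def frechet_derivative_eqI)
  qed
  have Rs: "Rg y a b z = - Rg y b a z" for a b z
    using vext_d_skew[of \<pi> y a b] vext_d_skew[of \<rho> y a b] vext_d_skew[of h y a b]
    by (simp add: Rg_def curvature_def mm_simps algebra_simps)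
  have B: "Rg y u1 u2 x - (Rg y u1 (X y x) ?z2 - Rg y u2 (X y x) ?z1) + (DT u1 ?z2 x - DT u2 ?z1 x)
     + (T (G u1 ?z2 - G u2 ?z1) x - T ?z1 (G u2 x) + T ?z1 (H ?z2 x) - T ?z1 (T ?z2 x)
       - T ?z2 (H ?z1 x) + T ?z2 (G u1 x) + T ?z2 (T ?z1 x))
     - (G u1 (T ?z2 x) - G u2 (T ?z1 x)) = 0" for x
  proof -
    have w: "w y u1 = ?z1" "w y u2 = ?z2" by (simp_all add: u1_def u2_def y)
    have main: "(Rg y u1 u2 x + Rg y u2 (X y x) ?z1 + Rg y (X y x) u1 ?z2)
      + (DT u1 ?z2 x + DT u2 x ?z1 + DT (X y x) ?z1 ?z2)
      + (T (G u1 ?z2 - G u2 ?z1 + T ?z1 ?z2) x + T (G u2 x - G (X y x) ?z2 + T ?z2 x) ?z1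
         + T (G (X y x) ?z1 - G u1 x + T x ?z1) ?z2)
      - (G u1 (T ?z2 x) + G u2 (T x ?z1) + G (X y x) (T ?z1 ?z2)) = 0"
      using bianchi[OF y, of u1 u2 "X y x", folded DT_def T_def G_def] unfolding w w_X[OF y] .
    have e1: "T (G u2 x - G (X y x) ?z2 + T ?z2 x) ?z1 = - (T ?z1 (G u2 x) - T ?z1 (H ?z2 x) + T ?z1 (T ?z2 x))"
      by (subst Ts) (simp add: T_simps G_def H_def)
    have e2: "T (G (X y x) ?z1 - G u1 x + T x ?z1) ?z2 = - (T ?z2 (H ?z1 x) - T ?z2 (G u1 x) - T ?z2 (T ?z1 x))"
      by (subst Ts, subst (2) Ts) (simp add: T_simps G_def H_def linear_neg[OF Tl])
    have e3: "G u2 (T x ?z1) = - G u2 (T ?z1 x)"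
      by (subst Ts) (simp add: G_def linear_neg[OF linear_gam'])
    have e4: "G (X y x) (T ?z1 ?z2) = 0" by (simp add: T12 G_def linear_0[OF linear_gam'])
    have e5: "DT u2 x ?z1 = - DT u2 ?z1 x" by (rule DTs)
    have e6: "Rg y (X y x) u1 ?z2 = - Rg y u1 (X y x) ?z2" by (rule Rs)
    show ?thesis using main unfolding e1 e2 e3 e4 e5 e6 T12 DT12
      by (simp add: algebra_simps G_def linear_0[OF linear_gam'])
  qed
  have Gl: "linear (G a)" for a unfolding G_def by (rule linear_gam')
  have Hl: "linear (H a)" for a unfolding H_def by (rule linear_gam[OF y])
  \<comment> \<open>By cyclicity the trace is that of \<open>H \<circ> T\<close>. The terms with
    \<pi> and h contribute a trace over torsion values on two dyads with common factor
    \<open>s\<close>, hence zero; the \<rho>-term involves only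
    \<open>T (dyad t s) (dyad t' r)\<close>, which is symmetric in \<open>t\<close> and
    \<open>t'\<close> by polarization of \<open>tz\<close>.\<close>
  have TH: "tr2 (\<lambda>x. T ?z1 (H ?z2 x)) = tr2 (\<lambda>x. T ?z2 (H ?z1 x))"
  proof -
    have pol: "T (dyad t s) (dyad t' r) = T (dyad t' s) (dyad t r)" for r
    proof -
      have "T (dyad t (s + r)) (dyad t' (s + r)) = 0" "T (dyad t r) (dyad t' r) = 0"
        using tz[OF y] by (simp_all only: T_def)
      then have "T (dyad t s) (dyad t' r) + T (dyad t r) (dyad t' s) = 0"
        using T12 by (simp add: dyad_add_right T_simps add.commute)
      then show ?thesis using Ts[of "dyad t r" "dyad t' s"] by simp
    qed
    have e: "tr2 (\<lambda>x. T (dyad t s) (H (dyad t' s) x)) = - (\<Sigma> i. (s v* \<rho> y (X y (T (dyad t s) (dyad t' (axis i 1))))) $ i)"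
      if "\<And>r. T (dyad t s) (dyad r s) = 0" for t t'
    proof -
      have "tr2 (\<lambda>x. T (dyad t s) (H (dyad t' s) x)) = tr2 (\<lambda>x. H (dyad t' s) (T (dyad t s) x))"
        by (rule tr2_commute[OF Tl Hl])
      also have "\<dots> = tr2 (\<lambda>x. dyad (\<pi> y (X y (T (dyad t s) x)) *v t' + h y (X y (T (dyad t s) x)) *\<^sub>R t') s)
          - tr2 (\<lambda>x. dyad t' (s v* \<rho> y (X y (T (dyad t s) x))))"
        unfolding tr2_simps(2)[symmetric] H_def gam_def
        by (simp add: matrix_dyad dyad_matrix dyad_add_left dyad_scale_left algebra_simps)
      also have "tr2 (\<lambda>x. dyad (\<pi> y (X y (T (dyad t s) x)) *v t' + h y (X y (T (dyad t s) x)) *\<^sub>R t') s) = 0"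
        using that smooth_form_linear[OF forms(2) y] smooth_form_linear[OF forms(3) y] linear_X[OF y] Tl
        by (subst tr2_dyad_left)
          (auto intro!: linearI simp: linear_0 linear_add linear_scale algebra_simps matrix_vector_mult_add_rdistrib
            scaleR_matrix_vector_assoc[symmetric])
      also have "tr2 (\<lambda>x. dyad t' (s v* \<rho> y (X y (T (dyad t s) x))))
          = (\<Sigma> i. (s v* \<rho> y (X y (T (dyad t s) (dyad t' (axis i 1))))) $ i)"
        using smooth_form_linear[OF forms(4) y] linear_X[OF y] Tl
        by (subst tr2_dyad_right) (auto intro!: linearI simp: linear_add linear_scale vector_matrix_simps)
      finally show ?thesis by simp
    qed
    show ?thesis using tz[OF y] by (simp add: e T_def[symmetric] pol)
  qed
  have Btr: "tr2 (\<lambda>x. Rg y u1 u2 x - (Rg y u1 (X y x) ?z2 - Rg y u2 (X y x) ?z1) + (DT u1 ?z2 x - DT u2 ?z1 x)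
     + (T (G u1 ?z2 - G u2 ?z1) x - T ?z1 (G u2 x) + T ?z1 (H ?z2 x) - T ?z1 (T ?z2 x)
       - T ?z2 (H ?z1 x) + T ?z2 (G u1 x) + T ?z2 (T ?z1 x))
     - (G u1 (T ?z2 x) - G u2 (T ?z1 x))) = tr2 (\<lambda>x. 0 :: real^'q^'p)"
    by (simp only: B)
  show ?thesis
    using Btr
    unfolding tr2_simps
    using TH tr2_dtors[OF tr0 y, folded DT_def] tr0[OF y, folded T_def]
      tr2_commute[OF Tl Gl, of ?z1 u2] tr2_commute[OF Tl Gl, of ?z2 u1] tr2_commute[OF Tl Tl, of ?z1 ?z2]
    by simp
qed

lemma Rq_eq:
  assumes "y \<in> U"
  shows "Rq y u v = (real CARD('p) / (real CARD('p) + real CARD('q))) *\<^sub>R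
            (vext_d h y u v *\<^sub>R mat 1 - real CARD('q) *\<^sub>R (\<nu> y u ** w y v - \<nu> y v ** w y u)) + curv1 P y (w y u) (w y v)"
  using structure_eqs[OF assms] by (simp add: curvature_def)

lemma trace_Rp: "y \<in> U \<Longrightarrow> trace (Rp y u v) = 0"
  by (rule trace_curvature[OF open_U _ forms(3)]) (simp_all add: trace_\<pi>)

lemma trace_Rq: "y \<in> U \<Longrightarrow> trace (Rq y u v) = 0"
  by (rule trace_curvature[OF open_U _ forms(4)]) (simp_all add: trace_\<rho>)

text \<open>The trace of the Bianchi identity is evaluated on two dyads with common factor
  \<open>s\<close> and basis vectors \<open>axis \<alpha> 1\<close>, \<open>axis \<beta> 1\<close>.
  For p = 2 the contributions of \<pi>, \<nu> and the homotheties cancel, and the symmetry of a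
  contraction of b^1 is left; it makes the cubic form divergence-free.\<close>

lemma curv1_trace:
  assumes tz: "\<And>y t t' s. y \<in> U \<Longrightarrow> tors P y (dyad t s) (dyad t' s) = 0"
    and tr0: "\<And>y z. y \<in> U \<Longrightarrow> tr2 (tors P y z) = 0" and y: "y \<in> U"
    and ab: "(UNIV :: 'p set) = {\<alpha>, \<beta>}" "\<alpha> \<noteq> \<beta>"
  shows "(\<Sigma> i. (s v* curv1 P y (dyad (axis \<alpha> 1) s) (\<E> \<beta> i)) $ i)
    = (\<Sigma> i. (s v* curv1 P y (dyad (axis \<beta> 1) s) (\<E> \<alpha> i)) $ i)"
proof -
  define z where "z \<alpha> = (dyad (axis \<alpha> 1) s :: real^'q^'p)" for \<alpha> :: 'p
  define u where "u \<alpha> = X y (z \<alpha>)" for \<alpha>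
  define n where "n \<alpha> = s v* \<nu> y (u \<alpha>)" for \<alpha>
  define C where "C \<alpha> \<beta> = (\<Sigma> i. (s v* curv1 P y (dyad (axis \<alpha> 1) s) (\<E> \<beta> i)) $ i)" for \<alpha> \<beta> :: 'p
  define q where "q = real CARD('q)"
  define K where "K = real CARD('p) / (real CARD('p) + real CARD('q))"
  define N where "N \<alpha> \<beta> = vext_d h y (u \<alpha>) (u \<beta>)" for \<alpha> \<beta>
  have p2: "real CARD('p) = 2" unfolding ab(1) using ab(2) by simp
  have Nn: "N \<alpha> \<beta> = n \<alpha> $ \<beta> - n \<beta> $ \<alpha>" for \<alpha> \<beta>
  proof -
    have e: "trace (\<nu> y (u \<alpha>) ** z \<beta>) = n \<alpha> $ \<beta>" for \<alpha> \<beta>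
    proof -
      have "trace (\<nu> y (u \<alpha>) ** z \<beta>) = s \<bullet> (\<nu> y (u \<alpha>) *v axis \<beta> 1)"
        by (simp add: z_def matrix_dyad trace_dyad inner_commute)
      also have "\<dots> = n \<alpha> $ \<beta>" unfolding n_def dot_lmul_matrix[symmetric] by (simp add: inner_axis)
      finally show ?thesis .
    qed
    show ?thesis unfolding N_def structure_eqs(4)[OF y] by (simp add: u_def w_X[OF y] e[unfolded u_def])
  qed
  have lX: "linear (X y)" by (rule linear_X[OF y])
  have hl: "linear (vext_d h y a)" and \<pi>l: "linear (vext_d \<pi> y a)" and \<rho>l: "linear (vext_d \<rho> y a)" for a
    using vext_d_bilinear[OF _ open_U y] forms by (auto simp: bilinear_def)
  have Rpl: "linear (Rp y a)" and Rql: "linear (Rq y a)" for a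
    unfolding curvature_def
    using \<pi>l \<rho>l smooth_form_linear[OF forms(3) y] smooth_form_linear[OF forms(4) y]
    by (intro linearI; simp add: linear_add linear_scale mm_simps algebra_simps)+
  have \<nu>l: "linear (\<nu> y)" by (rule smooth_form_linear[OF forms(5) y])
  \<comment> \<open>The trace of the curvature of \<open>\<rho>\<close>, with its \<nu>-part written
    through the components \<open>n \<alpha> $ \<beta>\<close>. The square of q arises because one
    \<nu>-term is summed over all Latin indices.\<close>
  have S: "(\<Sigma> i. (s v* Rq y (u \<alpha>) (X y (\<E> \<beta> i))) $ i)
      = K * (N \<alpha> \<beta> - q * (q * n \<alpha> $ \<beta> - n \<beta> $ \<alpha>)) + C \<alpha> \<beta>" for \<alpha> \<beta>
  proof -
    have "(s v* Rq y (u \<alpha>) (X y (\<E> \<beta> i))) $ i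
       = K * (s $ i * vext_d h y (u \<alpha>) (X y (\<E> \<beta> i))
           - q * (n \<alpha> $ \<beta> - s $ i * (s v* \<nu> y (X y (\<E> \<beta> i))) $ \<alpha>))
         + (s v* curv1 P y (dyad (axis \<alpha> 1) s) (\<E> \<beta> i)) $ i" for i
      unfolding Rq_eq[OF y] u_def w_X[OF y] K_def q_def
      by (simp add: mult.commute[of "s $ i"] vector_matrix_simps vector_mat_1 vector_matrix_assoc[symmetric] vector_dyad n_def u_def z_def inner_axis w_X[OF y])
    then have "(\<Sigma> i. (s v* Rq y (u \<alpha>) (X y (\<E> \<beta> i))) $ i)
       = K * ((\<Sigma> i. s $ i *\<^sub>R vext_d h y (u \<alpha>) (X y (\<E> \<beta> i)))
           - q * (q * n \<alpha> $ \<beta> - (\<Sigma> i. s $ i *\<^sub>R (s v* \<nu> y (X y (\<E> \<beta> i))) $ \<alpha>))) + C \<alpha> \<beta>"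
      by (simp add: sum.distrib sum_subtractf C_def q_def flip: sum_distrib_left)
    also have "(\<Sigma> i. s $ i *\<^sub>R vext_d h y (u \<alpha>) (X y (\<E> \<beta> i))) = N \<alpha> \<beta>"
      using linear_dyad_sum[of "\<lambda>x. vext_d h y (u \<alpha>) (X y x)" s "axis \<beta> 1"] linear_compose[OF lX hl]
      by (simp add: o_def N_def u_def z_def)
    also have "(\<Sigma> i. s $ i *\<^sub>R (s v* \<nu> y (X y (\<E> \<beta> i))) $ \<alpha>) = n \<beta> $ \<alpha>"
      using lX \<nu>l linear_dyad_sum[of "\<lambda>x. (s v* \<nu> y (X y x)) $ \<alpha>" s "axis \<beta> 1"]
      by (simp add: n_def u_def z_def linearI linear_add linear_scale vector_matrix_simps)
    finally show ?thesis .
  qed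
  have R: "tr2 (\<lambda>x. Rg y (u \<alpha>) (X y x) (z \<beta>)) = (\<Sigma> \<kappa>. Rp y (u \<alpha>) (u \<kappa>) $ \<kappa> $ \<beta>)
      - (\<Sigma> i. (s v* Rq y (u \<alpha>) (X y (\<E> \<beta> i))) $ i) + N \<alpha> \<beta>" for \<alpha> \<beta>
  proof -
    have "tr2 (\<lambda>x. Rg y (u \<alpha>) (X y x) (z \<beta>)) = tr2 (\<lambda>x. dyad (Rp y (u \<alpha>) (X y x) *v axis \<beta> 1) s)
        - tr2 (\<lambda>x. dyad (axis \<beta> 1) (s v* Rq y (u \<alpha>) (X y x))) + tr2 (\<lambda>x. vext_d h y (u \<alpha>) (X y x) *\<^sub>R z \<beta>)"
      unfolding tr2_simps[symmetric] by (simp add: Rg_def z_def matrix_dyad dyad_matrix)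
    also have "tr2 (\<lambda>x. dyad (Rp y (u \<alpha>) (X y x) *v axis \<beta> 1) s) = (\<Sigma> \<kappa>. Rp y (u \<alpha>) (u \<kappa>) $ \<kappa> $ \<beta>)"
      using lX Rpl
      by (subst tr2_dyad_left) (auto intro!: linearI sum.cong simp: linear_add linear_scale matrix_vector_mult_add_rdistrib
          scaleR_matrix_vector_assoc[symmetric] u_def z_def matrix_vector_mul_component inner_axis row_def)
    also have "tr2 (\<lambda>x. dyad (axis \<beta> 1) (s v* Rq y (u \<alpha>) (X y x)))
        = (\<Sigma> i. (s v* Rq y (u \<alpha>) (X y (\<E> \<beta> i))) $ i)"
      using lX Rql by (subst tr2_dyad_right) (auto intro!: linearI simp: linear_add linear_scale vector_matrix_simps)
    also have "tr2 (\<lambda>x. vext_d h y (u \<alpha>) (X y x) *\<^sub>R z \<beta>) = N \<alpha> \<beta>"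
      using tr2_scaleR_const[of "\<lambda>x. vext_d h y (u \<alpha>) (X y x)" "z \<beta>"] linear_compose[OF lX hl]
      by (simp add: o_def N_def u_def)
    finally show ?thesis .
  qed
  \<comment> \<open>The curvatures of \<open>\<pi>\<close> and \<open>\<rho>\<close> are trace-free,
    so only the homothety part contributes, multiplied by the dimension p q = 2 q.\<close>
  have L: "tr2 (Rg y (u \<alpha>) (u \<beta>)) = 2 * q * N \<alpha> \<beta>"
  proof -
    have "tr2 (Rg y (u \<alpha>) (u \<beta>)) = tr2 (\<lambda>x :: real^'q^'p. Rp y (u \<alpha>) (u \<beta>) ** x) - tr2 (\<lambda>x :: real^'q^'p. x ** Rq y (u \<alpha>) (u \<beta>))
        + tr2 (\<lambda>x :: real^'q^'p. N \<alpha> \<beta> *\<^sub>R x)"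
      unfolding tr2_simps[symmetric] by (simp add: Rg_def[abs_def] N_def)
    also have "\<dots> = 2 * q * N \<alpha> \<beta>"
      unfolding tr2_mult tr2_simps(4) tr2_id trace_Rp[OF y] trace_Rq[OF y] p2 q_def by simp
    finally show ?thesis .
  qed
  have Rps: "Rp y a b = - Rp y b a" for a b
    using vext_d_skew[of \<pi> y a b] by (simp add: curvature_def)
  have "trace (Rp y (u \<alpha>) (u \<beta>)) = Rp y (u \<alpha>) (u \<beta>) $ \<alpha> $ \<alpha> + Rp y (u \<alpha>) (u \<beta>) $ \<beta> $ \<beta>"
    using ab(2) by (simp add: trace_def ab(1))
  then have t0: "Rp y (u \<alpha>) (u \<beta>) $ \<alpha> $ \<alpha> + Rp y (u \<alpha>) (u \<beta>) $ \<beta> $ \<beta> = 0" by (simp add: trace_Rp[OF y])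
  have z0: "Rp y a a = 0" for a using Rps[of a a] by (simp add: vec_eq_iff)
  have "2 * q * N \<alpha> \<beta> = (\<Sigma> \<kappa>. Rp y (u \<alpha>) (u \<kappa>) $ \<kappa> $ \<beta>) - (\<Sigma> \<kappa>. Rp y (u \<beta>) (u \<kappa>) $ \<kappa> $ \<alpha>)
      - (K * (N \<alpha> \<beta> - q * (q * n \<alpha> $ \<beta> - n \<beta> $ \<alpha>)) + C \<alpha> \<beta>)
      + (K * (N \<beta> \<alpha> - q * (q * n \<beta> $ \<alpha> - n \<alpha> $ \<beta>)) + C \<beta> \<alpha>) + N \<alpha> \<beta> - N \<beta> \<alpha>"
    using trace_bianchi[OF tz tr0 y, of "axis \<alpha> 1" s "axis \<beta> 1"]
    unfolding tr2_simps(2) z_def[symmetric] u_def[symmetric] R L S by simp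
  \<comment> \<open>With two Greek indices, skewness turns the difference into the trace of the
    curvature of \<open>\<pi>\<close>, which is zero.\<close>
  also have "(\<Sigma> \<kappa>. Rp y (u \<alpha>) (u \<kappa>) $ \<kappa> $ \<beta>) - (\<Sigma> \<kappa>. Rp y (u \<beta>) (u \<kappa>) $ \<kappa> $ \<alpha>) = 0"
    using ab(2) t0 Rps[of "u \<beta>" "u \<alpha>"] by (simp add: ab(1) z0)
  finally have 1: "2 * q * N \<alpha> \<beta> = (K * (q * (q + 1)) - 2 * K + 2) * N \<alpha> \<beta> - C \<alpha> \<beta> + C \<beta> \<alpha>"
    unfolding Nn by (simp add: algebra_simps)
  have "q > 0" by (simp add: q_def)
  \<comment> \<open>Here p = 2 enters, as K = p / (p + q) = 2 / (q + 2); the coefficient of N on the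
    right becomes 2 q and cancels the left-hand side.\<close>
  then have "K * (q + 2) = 2" by (simp add: K_def p2 q_def divide_simps)
  moreover have "K * (q * (q + 1)) - 2 * K + 2 = (q - 1) * (K * (q + 2)) + 2" by (simp add: algebra_simps)
  ultimately have "K * (q * (q + 1)) - 2 * K + 2 = 2 * q" by simp
  with 1 have "C \<alpha> \<beta> = C \<beta> \<alpha>" by simp
  then show ?thesis by (simp add: C_def)
qed

end

section \<open>Symmetries of the structure object\<close>

lemma card_2_UNIV:
  assumes "CARD('a) = 2"
  obtains x y :: 'a where "UNIV = {x, y}" "x \<noteq> y"
  using assms by (auto simp: card_2_iff)

text \<open>In dimension two an array skew in two indices is the area form times a vector, and the
  trace determines this vector up to sign.\<close>

lemma skew_trace_free_2:
  fixes f :: "'a::finite \<Rightarrow> 'a \<Rightarrow> 'a \<Rightarrow> real"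
  assumes "CARD('a) = 2" and skew: "\<And>x y z. f x y z = - f y x z" and tr: "\<And>y. (\<Sigma> x. f x y x) = 0"
  shows "f x y z = 0"
proof -
  obtain a b :: 'a where ab: "UNIV = {a, b}" "a \<noteq> b" using card_2_UNIV[OF assms(1)] .
  have d: "f x x z = 0" for x z using skew[of x x z] by simp
  have "f b a b = 0" "f a b a = 0" using tr[of a] tr[of b] ab(2) d by (simp_all add: ab(1))
  moreover have "x = a \<or> x = b" "y = a \<or> y = b" "z = a \<or> z = b" using ab(1) by auto
  ultimately show ?thesis using d skew[of a b b] skew[of b a a] by auto
qed

lemma object_identitiesD:
  assumes "object_identities_at P y"
  shows "obj_a P y $ (i, \<beta>, \<gamma>, \<alpha>, j, k) = - obj_a P y $ (i, \<gamma>, \<beta>, \<alpha>, k, j)" (is ?T1)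
    "(\<Sigma> \<alpha>. obj_a P y $ (i, \<alpha>, \<gamma>, \<alpha>, j, k)) = 0" (is ?T2)
    "(\<Sigma> i. obj_a P y $ (i, \<beta>, \<gamma>, \<alpha>, i, k)) = 0" (is ?T3)
    "obj_b2 P y $ (\<beta>, \<gamma>, \<delta>, \<alpha>, k, l) = - obj_b2 P y $ (\<beta>, \<delta>, \<gamma>, \<alpha>, l, k)" (is ?T4)
    "obj_b1 P y $ (i, \<gamma>, \<delta>, j, k, l) = - obj_b1 P y $ (i, \<delta>, \<gamma>, j, l, k)" (is ?T5)
    "(\<Sigma> \<alpha>. obj_b2 P y $ (\<alpha>, \<gamma>, \<delta>, \<alpha>, k, l)) = 0" (is ?T6)
    "(\<Sigma> i. obj_b1 P y $ (i, \<gamma>, \<delta>, i, k, l)) = 0" (is ?T7)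
    "(\<Sigma> \<alpha>. obj_b2 P y $ (\<gamma>, \<alpha>, \<delta>, \<alpha>, k, l)) - (\<Sigma> i. obj_b1 P y $ (i, \<gamma>, \<delta>, k, i, l))
       + (\<Sigma> \<alpha>. obj_b2 P y $ (\<delta>, \<alpha>, \<gamma>, \<alpha>, l, k)) - (\<Sigma> i. obj_b1 P y $ (i, \<delta>, \<gamma>, l, i, k)) = 0" (is ?T8)
    "obj_c P y $ (\<alpha>, \<beta>, \<gamma>, i, j, k) = - obj_c P y $ (\<alpha>, \<gamma>, \<beta>, i, k, j)" (is ?T9)
    "obj_c P y $ (\<alpha>, \<beta>, \<gamma>, i, j, k) + obj_c P y $ (\<beta>, \<gamma>, \<alpha>, j, k, i) + obj_c P y $ (\<gamma>, \<alpha>, \<beta>, k, i, j)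
      - obj_c P y $ (\<beta>, \<alpha>, \<gamma>, j, i, k) - obj_c P y $ (\<alpha>, \<gamma>, \<beta>, i, k, j) - obj_c P y $ (\<gamma>, \<beta>, \<alpha>, k, j, i) = 0" (is ?T10)
proof -
  note o = assms[unfolded object_identities_at_def Let_def]
  show ?T1 ?T2 ?T3 ?T4 ?T5 ?T6 ?T7 ?T8 ?T9 ?T10
    by (rule o[THEN conjunct1, rule_format]
      o[THEN conjunct2, THEN conjunct1, rule_format]
      o[THEN conjunct2, THEN conjunct2, THEN conjunct1, rule_format]
      o[THEN conjunct2, THEN conjunct2, THEN conjunct2, THEN conjunct1, rule_format]
      o[THEN conjunct2, THEN conjunct2, THEN conjunct2, THEN conjunct2, THEN conjunct1, rule_format]
      o[THEN conjunct2, THEN conjunct2, THEN conjunct2, THEN conjunct2, THEN conjunct2, THEN conjunct1, rule_format]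
      o[THEN conjunct2, THEN conjunct2, THEN conjunct2, THEN conjunct2, THEN conjunct2, THEN conjunct2, THEN conjunct1, rule_format]
      o[THEN conjunct2, THEN conjunct2, THEN conjunct2, THEN conjunct2, THEN conjunct2, THEN conjunct2, THEN conjunct2, THEN conjunct1, rule_format]
      o[THEN conjunct2, THEN conjunct2, THEN conjunct2, THEN conjunct2, THEN conjunct2, THEN conjunct2, THEN conjunct2, THEN conjunct2, THEN conjunct1, rule_format]
      o[THEN conjunct2, THEN conjunct2, THEN conjunct2, THEN conjunct2, THEN conjunct2, THEN conjunct2, THEN conjunct2, THEN conjunct2, THEN conjunct2, rule_format])+
qed

text \<open>Symmetrization over the lower Latin indices makes the torsion skew in the upper Greek
  ones, and its trace remains zero.\<close>

lemma a_alpha_eq_0: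
  fixes P :: "('p::finite, 'q::finite) prolonged_frame"
  assumes "object_identities_at P y" "CARD('p) = 2"
  shows "a_alpha P y = 0"
proof -
  note id = object_identitiesD[OF assms(1)]
  have "(obj_a P y $ (i, \<beta>, \<gamma>, \<alpha>, j, k) + obj_a P y $ (i, \<beta>, \<gamma>, \<alpha>, k, j)) = 0" for i \<beta> \<gamma> \<alpha> j k
  proof (rule skew_trace_free_2[OF assms(2), of "\<lambda>\<beta> \<gamma> \<alpha>. obj_a P y $ (i, \<beta>, \<gamma>, \<alpha>, j, k) + obj_a P y $ (i, \<beta>, \<gamma>, \<alpha>, k, j)"])
    show "obj_a P y $ (i, \<beta>, \<gamma>, \<alpha>, j, k) + obj_a P y $ (i, \<beta>, \<gamma>, \<alpha>, k, j)
        = - (obj_a P y $ (i, \<gamma>, \<beta>, \<alpha>, j, k) + obj_a P y $ (i, \<gamma>, \<beta>, \<alpha>, k, j))" for \<beta> \<gamma> \<alpha>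
      using id(1)[of i \<beta> \<gamma> \<alpha> j k] id(1)[of i \<beta> \<gamma> \<alpha> k j] by simp
    show "(\<Sigma> \<alpha>. obj_a P y $ (i, \<alpha>, \<gamma>, \<alpha>, j, k) + obj_a P y $ (i, \<alpha>, \<gamma>, \<alpha>, k, j)) = 0" for \<gamma>
      using id(2) by (simp add: sum.distrib)
  qed
  then show ?thesis by (simp add: a_alpha_def vec_eq_iff)
qed

lemma a_beta_eq_0:
  fixes P :: "('p::finite, 'q::finite) prolonged_frame"
  assumes "object_identities_at P y" "CARD('q) = 2"
  shows "a_beta P y = 0"
proof -
  note id = object_identitiesD[OF assms(1)]
  have "(obj_a P y $ (i, \<beta>, \<gamma>, \<alpha>, j, k) + obj_a P y $ (i, \<gamma>, \<beta>, \<alpha>, j, k)) = 0" for i \<beta> \<gamma> \<alpha> j k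
  proof (rule skew_trace_free_2[OF assms(2), of "\<lambda>j k i. obj_a P y $ (i, \<beta>, \<gamma>, \<alpha>, j, k) + obj_a P y $ (i, \<gamma>, \<beta>, \<alpha>, j, k)"])
    show "obj_a P y $ (i, \<beta>, \<gamma>, \<alpha>, j, k) + obj_a P y $ (i, \<gamma>, \<beta>, \<alpha>, j, k)
        = - (obj_a P y $ (i, \<beta>, \<gamma>, \<alpha>, k, j) + obj_a P y $ (i, \<gamma>, \<beta>, \<alpha>, k, j))" for j k i
      using id(1)[of i \<beta> \<gamma> \<alpha> j k] id(1)[of i \<gamma> \<beta> \<alpha> j k] by simp
    show "(\<Sigma> i. obj_a P y $ (i, \<beta>, \<gamma>, \<alpha>, i, k) + obj_a P y $ (i, \<gamma>, \<beta>, \<alpha>, i, k)) = 0" for k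
      using id(3) by (simp add: sum.distrib)
  qed
  then show ?thesis by (simp add: a_beta_def vec_eq_iff)
qed

lemma alt3_eq_0:
  fixes f :: "'a::finite \<Rightarrow> 'a \<Rightarrow> 'a \<Rightarrow> real"
  assumes "CARD('a) = 2"
  shows "alt3 f x y z = 0"
proof -
  obtain a b :: 'a where "UNIV = {a, b}" "a \<noteq> b" using card_2_UNIV[OF assms] .
  then have "x = a \<or> x = b" "y = a \<or> y = b" "z = a \<or> z = b" by auto
  then show ?thesis by (auto simp: alt3_def)
qed

lemma b2_alpha_eq_0: "CARD('p) = 2 \<Longrightarrow> b2_alpha (P :: ('p::finite, 'q::finite) prolonged_frame) y = 0"
  and b1_beta_eq_0: "CARD('q) = 2 \<Longrightarrow> b1_beta P y = 0"
  by (auto simp: b2_alpha_def b1_beta_def vec_eq_iff alt3_eq_0)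

text \<open>The torsion is now skew in the Latin and in the Greek pair separately, hence symmetric
  under their simultaneous exchange, under which it is also skew.\<close>

lemma obj_a_eq_0:
  fixes P :: "('p::finite, 'q::finite) prolonged_frame"
  assumes "object_identities_at P y" "CARD('p) = 2" "CARD('q) = 2"
  shows "obj_a P y = 0"
proof -
  have "obj_a P y $ (i, \<beta>, \<gamma>, \<alpha>, j, k) = 0" for i \<beta> \<gamma> \<alpha> j k
  proof -
    have "a_alpha P y $ (i, \<beta>, \<gamma>, \<alpha>, j, k) = 0" "a_beta P y $ (i, \<beta>, \<gamma>, \<alpha>, k, j) = 0"
      by (simp_all add: a_alpha_eq_0[OF assms(1,2)] a_beta_eq_0[OF assms(1,3)])
    then show ?thesis
      using object_identitiesD(1)[OF assms(1), of i \<gamma> \<beta> \<alpha> k j] by (simp add: a_alpha_def a_beta_def)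
  qed
  then show ?thesis by (auto simp: vec_eq_iff)
qed

lemma sum2_skew_eq_0:
  fixes f :: "'a \<Rightarrow> 'a \<Rightarrow> real"
  assumes "\<And>j k. f j k + f k j = 0"
  shows "(\<Sum>j\<in>A. \<Sum>k\<in>A. f j k) = 0"
proof -
  have "(\<Sum>j\<in>A. \<Sum>k\<in>A. f j k) + (\<Sum>j\<in>A. \<Sum>k\<in>A. f k j) = 0"
    by (simp add: sum.distrib[symmetric] assms)
  then show ?thesis using sum.swap[of f A A] by simp
qed

text \<open>On dyads with the common factor \<open>s\<close> only the part of the torsion symmetric
  in the lower Latin indices is seen.\<close>

lemma tors_dyad_eq_0:
  assumes "a_alpha P y = 0"
  shows "tors P y (dyad t s) (dyad t' s) = 0"
proof -
  have a: "obj_a P y $ (i, \<beta>, \<gamma>, \<alpha>, j, k) + obj_a P y $ (i, \<beta>, \<gamma>, \<alpha>, k, j) = 0" for i \<beta> \<gamma> \<alpha> j k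
    using arg_cong[OF assms, of "\<lambda>v. v $ (i, \<beta>, \<gamma>, \<alpha>, j, k)"] by (simp add: a_alpha_def)
  have "(\<Sigma> j k. obj_a P y $ (i, \<beta>, \<gamma>, \<alpha>, j, k)
      * (dyad t s $ \<beta> $ j * dyad t' s $ \<gamma> $ k - dyad t' s $ \<beta> $ j * dyad t s $ \<gamma> $ k)) = 0" for i \<beta> \<gamma> \<alpha>
  proof (rule sum2_skew_eq_0)
    fix j k
    have "obj_a P y $ (i, \<beta>, \<gamma>, \<alpha>, j, k) * (dyad t s $ \<beta> $ j * dyad t' s $ \<gamma> $ k - dyad t' s $ \<beta> $ j * dyad t s $ \<gamma> $ k)
      + obj_a P y $ (i, \<beta>, \<gamma>, \<alpha>, k, j) * (dyad t s $ \<beta> $ k * dyad t' s $ \<gamma> $ j - dyad t' s $ \<beta> $ k * dyad t s $ \<gamma> $ j)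
      = (obj_a P y $ (i, \<beta>, \<gamma>, \<alpha>, j, k) + obj_a P y $ (i, \<beta>, \<gamma>, \<alpha>, k, j)) * ((t $ \<beta> * t' $ \<gamma> - t' $ \<beta> * t $ \<gamma>) * (s $ j * s $ k))"
      by (simp add: dyad_def algebra_simps)
    then show "obj_a P y $ (i, \<beta>, \<gamma>, \<alpha>, j, k) * (dyad t s $ \<beta> $ j * dyad t' s $ \<gamma> $ k - dyad t' s $ \<beta> $ j * dyad t s $ \<gamma> $ k)
      + obj_a P y $ (i, \<beta>, \<gamma>, \<alpha>, k, j) * (dyad t s $ \<beta> $ k * dyad t' s $ \<gamma> $ j - dyad t' s $ \<beta> $ k * dyad t s $ \<gamma> $ j) = 0"
      by (simp add: a)
  qed
  then show ?thesis by (simp add: tors_def vec_eq_iff)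
qed

lemma sum_delta2:
  fixes f :: "'a::finite \<Rightarrow> 'b::finite \<Rightarrow> real"
  shows "(\<Sigma> x y. f x y * \<E> a b $ x $ y) = f a b"
  by (simp add: dyad_def axis_def if_distrib[of "\<lambda>x. _ * x"] if_distrib[of "\<lambda>x. x * _"] cong: if_cong)

lemma sum4_rearrange:
  "(\<Sum>\<beta>\<in>A. \<Sum>\<gamma>\<in>B. \<Sum>j\<in>C. \<Sum>k\<in>D. f \<beta> \<gamma> j k) = (\<Sum>\<beta>\<in>A. \<Sum>j\<in>C. \<Sum>\<gamma>\<in>B. \<Sum>k\<in>D. f \<beta> \<gamma> j k)" (is ?th1)
  "(\<Sum>\<beta>\<in>A. \<Sum>\<gamma>\<in>B. \<Sum>j\<in>C. \<Sum>k\<in>D. f \<beta> \<gamma> j k) = (\<Sum>\<gamma>\<in>B. \<Sum>k\<in>D. \<Sum>\<beta>\<in>A. \<Sum>j\<in>C. f \<beta> \<gamma> j k)" (is ?th2)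
proof -
  show ?th1 by (intro sum.cong refl sum.swap)
  have "(\<Sum>\<beta>\<in>A. \<Sum>\<gamma>\<in>B. \<Sum>j\<in>C. \<Sum>k\<in>D. f \<beta> \<gamma> j k) = (\<Sum>\<gamma>\<in>B. \<Sum>\<beta>\<in>A. \<Sum>k\<in>D. \<Sum>j\<in>C. f \<beta> \<gamma> j k)"
    by (subst sum.swap) (intro sum.cong refl sum.swap)
  also have "\<dots> = (\<Sum>\<gamma>\<in>B. \<Sum>k\<in>D. \<Sum>\<beta>\<in>A. \<Sum>j\<in>C. f \<beta> \<gamma> j k)"
    by (intro sum.cong refl sum.swap)
  finally show ?th2 .
qed

lemma tors_axis:
  "tors P y z (\<E> \<mu> m) $ \<alpha> $ i
    = (\<Sigma> \<beta> j. (obj_a P y $ (i, \<beta>, \<mu>, \<alpha>, j, m) - obj_a P y $ (i, \<mu>, \<beta>, \<alpha>, m, j)) * z $ \<beta> $ j)"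
proof -
  have "tors P y z (\<E> \<mu> m) $ \<alpha> $ i
    = (\<Sigma> \<beta> j \<gamma> k. (obj_a P y $ (i, \<beta>, \<gamma>, \<alpha>, j, k) * z $ \<beta> $ j) * \<E> \<mu> m $ \<gamma> $ k)
     - (\<Sigma> \<gamma> k \<beta> j. (obj_a P y $ (i, \<beta>, \<gamma>, \<alpha>, j, k) * z $ \<gamma> $ k) * \<E> \<mu> m $ \<beta> $ j)"
    by (subst sum4_rearrange(1)[symmetric], subst sum4_rearrange(2)[symmetric])
      (simp add: tors_def right_diff_distrib sum_subtractf mult_ac)
  then show ?thesis
    unfolding sum_delta2 by (simp add: sum_subtractf left_diff_distrib)
qed

lemma tr2_tors:
  assumes "object_identities_at P y"
  shows "tr2 (tors P y z) = 0"
proof -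
  note id = object_identitiesD[OF assms]
  have e: "(obj_a P y $ (i, \<beta>, \<alpha>, \<alpha>, j, i) - obj_a P y $ (i, \<alpha>, \<beta>, \<alpha>, i, j)) * z $ \<beta> $ j
      = (- 2 * z $ \<beta> $ j) * obj_a P y $ (i, \<alpha>, \<beta>, \<alpha>, i, j)" for i \<alpha> \<beta> j
    using id(1)[of i \<beta> \<alpha> \<alpha> j i] by simp
  have "tr2 (tors P y z) = (\<Sigma> \<alpha> i. tors P y z (\<E> \<alpha> i) $ \<alpha> $ i)"
    unfolding tr2_def matE_def by (rule sum_pairs[where f="\<lambda>\<alpha> i. tors P y z (\<E> \<alpha> i) $ \<alpha> $ i"])
  also have "\<dots> = (\<Sigma> \<alpha> i \<beta> j. (- 2 * z $ \<beta> $ j) * obj_a P y $ (i, \<alpha>, \<beta>, \<alpha>, i, j))"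
    unfolding tors_axis e ..
  also have "\<dots> = (\<Sigma> \<alpha> \<beta> j i. (- 2 * z $ \<beta> $ j) * obj_a P y $ (i, \<alpha>, \<beta>, \<alpha>, i, j))"
    by (intro sum.cong refl, subst sum.swap, intro sum.cong refl sum.swap)
  also have "\<dots> = 0" by (simp only: sum_distrib_left[symmetric] id(3) mult_zero_right sum.neutral_const)
  finally show ?thesis .
qed

section \<open>The cubic form of the curvature\<close>

lemma sum3_swap:
  "(\<Sum>j\<in>A. \<Sum>k\<in>A. \<Sum>l\<in>A. f k j l) = (\<Sum>j\<in>A. \<Sum>k\<in>A. \<Sum>l\<in>A. f j k l)"
  "(\<Sum>j\<in>A. \<Sum>k\<in>A. \<Sum>l\<in>A. f j l k) = (\<Sum>j\<in>A. \<Sum>k\<in>A. \<Sum>l\<in>A. f j k l)"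
  by (rule sum.swap) (intro sum.cong refl sum.swap)

lemma sum3_sym3:
  fixes f :: "'q::finite \<Rightarrow> 'q \<Rightarrow> 'q \<Rightarrow> real"
  shows "(\<Sigma> j k l. sym3 f j k l * (s j * s k * s l))
    = (\<Sigma> j k l. f j k l * (s j * s k * s l))"
proof -
  define g where "g j k l = f j k l * (s j * s k * s l)" for j k l
  have e: "sym3 f j k l * (s j * s k * s l) = (g j k l + g k l j + g l j k + g k j l + g j l k + g l k j) / 6" for j k l
    by (simp add: g_def sym3_def field_simps)
  let ?S = "\<lambda>g. \<Sigma> j k. \<Sum>l\<in>(UNIV :: 'q set). (g j k l :: real)"
  have "?S (\<lambda>j k l. g k l j) = ?S g"
    using sum3_swap(1)[of "\<lambda>j k l. g j l k" UNIV] sum3_swap(2)[of g UNIV] by simp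
  moreover have "?S (\<lambda>j k l. g l j k) = ?S g"
    using sum3_swap(2)[of "\<lambda>j k l. g k j l" UNIV] sum3_swap(1)[of g UNIV] by simp
  moreover have "?S (\<lambda>j k l. g l k j) = ?S g"
    using sum3_swap(2)[of "\<lambda>j k l. g k l j" UNIV] sum3_swap(1)[of "\<lambda>j k l. g j l k" UNIV] sum3_swap(2)[of g UNIV] by simp
  moreover note sum3_swap(1)[of g UNIV] sum3_swap(2)[of g UNIV]
  ultimately show ?thesis
    unfolding e sum_divide_distrib[symmetric] sum.distrib g_def[symmetric] by simp
qed

section \<open>The cubic form and its polarization\<close>

definition b1form :: "real^('q::finite \<times> 'p::finite \<times> 'p \<times> 'q \<times> 'q \<times> 'q) \<Rightarrow>
    real^'p \<Rightarrow> real^'p \<Rightarrow> real^'q \<Rightarrow> real^'q \<Rightarrow> real^'q \<Rightarrow> real^'q" where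
  "b1form T t t' a b c = (\<chi> i. \<Sigma> \<gamma> \<delta> j k l.
     T $ (i, \<gamma>, \<delta>, j, k, l) * (t $ \<gamma> * t' $ \<delta> * (a $ j * b $ k * c $ l)))"

lemma b1form_add:
  "b1form (T + T') t t' a b c = b1form T t t' a b c + b1form T' t t' a b c"
  "b1form (r *\<^sub>R T) t t' a b c = r *\<^sub>R b1form T t t' a b c"
  "b1form T t t' (a + a') b c = b1form T t t' a b c + b1form T t t' a' b c"
  "b1form T t t' a (b + b') c = b1form T t t' a b c + b1form T t t' a b' c"
  "b1form T t t' a b (c + c') = b1form T t t' a b c + b1form T t t' a b c'"
  by (simp_all add: b1form_def vec_eq_iff algebra_simps sum.distrib sum_distrib_left)

lemma b1form_axis:
  "b1form T (axis \<gamma> 1) (axis \<delta> 1) (axis j 1) (axis k 1) (axis l 1) $ i = T $ (i, \<gamma>, \<delta>, j, k, l)"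
  by (simp add: b1form_def axis_def if_distrib[of "\<lambda>x. _ * x"] if_distrib[of "\<lambda>x. x * _"] cong: if_cong)

lemma b1form_sym:
  assumes "\<And>i \<gamma> \<delta> j k l. T $ (i, \<gamma>, \<delta>, j, k, l) = T $ (i, \<gamma>, \<delta>, k, j, l)"
    "\<And>i \<gamma> \<delta> j k l. T $ (i, \<gamma>, \<delta>, j, k, l) = T $ (i, \<gamma>, \<delta>, j, l, k)"
  shows "b1form T t t' a b c = b1form T t t' b a c" "b1form T t t' a b c = b1form T t t' a c b"
proof -
  have "(\<Sigma> j k l. T $ (i, \<gamma>, \<delta>, j, k, l) * (t $ \<gamma> * t' $ \<delta> * (a $ j * b $ k * c $ l)))
      = (\<Sigma> j k l. T $ (i, \<gamma>, \<delta>, j, k, l) * (t $ \<gamma> * t' $ \<delta> * (b $ j * a $ k * c $ l)))" for i \<gamma> \<delta>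
    by (subst sum3_swap(1)[symmetric]) (simp add: assms(1)[of i \<gamma> \<delta>, symmetric] mult_ac)
  then show "b1form T t t' a b c = b1form T t t' b a c" by (simp add: b1form_def)
  have "(\<Sigma> j k l. T $ (i, \<gamma>, \<delta>, j, k, l) * (t $ \<gamma> * t' $ \<delta> * (a $ j * b $ k * c $ l)))
      = (\<Sigma> j k l. T $ (i, \<gamma>, \<delta>, j, k, l) * (t $ \<gamma> * t' $ \<delta> * (a $ j * c $ k * b $ l)))" for i \<gamma> \<delta>
    by (subst sum3_swap(2)[symmetric]) (simp add: assms(2)[of i \<gamma> \<delta>, symmetric] mult_ac)
  then show "b1form T t t' a b c = b1form T t t' a c b" by (simp add: b1form_def)
qed

text \<open>Expanding at a + b gives f a a b + f a b b = 0. Replacing b by b + c and subtracting the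
  instances for b and c leaves twice f a b c.\<close>

lemma trilinear_polarization:
  fixes f :: "'a::real_vector \<Rightarrow> 'a \<Rightarrow> 'a \<Rightarrow> 'b::real_vector"
  assumes add: "\<And>a a' b c. f (a + a') b c = f a b c + f a' b c" "\<And>a b b' c. f a (b + b') c = f a b c + f a b' c"
      "\<And>a b c c'. f a b (c + c') = f a b c + f a b c'"
    and sym: "\<And>a b c. f a b c = f b a c" "\<And>a b c. f a b c = f a c b"
    and diag: "\<And>a. f a a a = 0"
  shows "f a b c = 0"
proof -
  have 2: "f a a b + f a b b = 0" for a b
  proof -
    have "f (a + b) (a + b) (a + b) = 3 *\<^sub>R (f a a b + f a b b)"
      using sym(1)[of b a] sym(2)[of a b a] sym(2)[of b b a] sym(1)[of b a b] diag[of a] diag[of b]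
      by (simp add: add scaleR_add_right) (simp add: scaleR_left_distrib[of 1 2, simplified] scaleR_2 algebra_simps)
    then show ?thesis using diag[of "a + b"] by simp
  qed
  have "f a a (b + c) + f a (b + c) (b + c) = 2 *\<^sub>R f a b c"
    using 2[of a b] 2[of a c] sym(2)[of a c b] by (simp add: add scaleR_2 algebra_simps)
  then show ?thesis using 2[of a "b + c"] by simp
qed

lemma b1_alpha_sym:
  "b1_alpha P y $ (i, \<gamma>, \<delta>, j, k, l) = b1_alpha P y $ (i, \<gamma>, \<delta>, k, j, l)"
  "b1_alpha P y $ (i, \<gamma>, \<delta>, j, k, l) = b1_alpha P y $ (i, \<gamma>, \<delta>, j, l, k)"
  by (simp_all add: b1_alpha_def sym3_def add_ac)

text \<open>Three contractions with \<open>s\<close> symmetrize the Latin indices. By the skewness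
  of b^1 the result is skew in the Greek indices, so the two orders of \<open>t\<close> and
  \<open>t'\<close> contribute equally, whence the factor 2.\<close>

lemma cub_b1form:
  assumes "object_identities_at P y"
  shows "cub P y t t' s = 2 *\<^sub>R b1form (b1_alpha P y) t t' s s s"
proof -
  let ?b = "\<lambda>i \<gamma> \<delta> j k l. obj_b1 P y $ (i, \<gamma>, \<delta>, j, k, l)"
  have "cub P y t t' s $ i = 2 * b1form (b1_alpha P y) t t' s s s $ i" for i
  proof -
    define S where "S \<gamma> \<delta> = (\<Sigma> j k l. ?b i \<gamma> \<delta> j k l * (s $ j * s $ k * s $ l))" for \<gamma> \<delta>
    have Ss: "S \<gamma> \<delta> = - S \<delta> \<gamma>" for \<gamma> \<delta>
      unfolding S_def
      by (subst sum3_swap(2)[symmetric], subst object_identitiesD(5)[OF assms]) (simp add: sum_negf mult_ac)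
    have "cub P y t t' s $ i = (\<Sigma> j \<gamma> \<delta> k l.
        ?b i \<gamma> \<delta> j k l * (s $ j * s $ k * s $ l) * (t $ \<gamma> * t' $ \<delta> - t' $ \<gamma> * t $ \<delta>))"
      by (simp add: cub_def vector_matrix_mult_def curv1_def sum_distrib_left dyad_def algebra_simps)
    also have "\<dots> = (\<Sigma> \<gamma> \<delta>. S \<gamma> \<delta> * (t $ \<gamma> * t' $ \<delta> - t' $ \<gamma> * t $ \<delta>))"
      unfolding S_def sum_distrib_right by (subst sum.swap, intro sum.cong refl, rule sum.swap)
    also have "\<dots> = (\<Sigma> \<gamma> \<delta>. S \<gamma> \<delta> * (t $ \<gamma> * t' $ \<delta>)) - (\<Sigma> \<delta> \<gamma>. S \<gamma> \<delta> * (t' $ \<gamma> * t $ \<delta>))"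
      by (subst (2) sum.swap) (simp add: right_diff_distrib sum_subtractf)
    also have "(\<Sigma> \<delta> \<gamma>. S \<gamma> \<delta> * (t' $ \<gamma> * t $ \<delta>)) = - (\<Sigma> \<gamma> \<delta>. S \<gamma> \<delta> * (t $ \<gamma> * t' $ \<delta>))"
      unfolding sum_negf[symmetric] by (intro sum.cong refl, subst Ss) simp
    also have "(\<Sigma> \<gamma> \<delta>. S \<gamma> \<delta> * (t $ \<gamma> * t' $ \<delta>)) = b1form (b1_alpha P y) t t' s s s $ i"
      unfolding S_def sum3_sym3[of "?b i _ _" "($) s", symmetric]
      by (simp add: b1form_def b1_alpha_def sum_distrib_left sum_distrib_right mult_ac)
    finally show ?thesis by simp
  qed
  then show ?thesis by (simp add: vec_eq_iff)
qed

lemma cub_eq_0: "object_identities_at P y \<Longrightarrow> b1_alpha P y = 0 \<Longrightarrow> cub P y t t' s = 0"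
  by (simp add: cub_b1form) (simp add: b1form_def vec_eq_iff)

lemma b1_alpha_eq_0:
  assumes "object_identities_at P y" "\<And>t t' s. cub P y t t' s = 0"
  shows "b1_alpha P y = 0"
proof -
  have "b1form (b1_alpha P y) t t' a b c = 0" for t t' a b c
  proof (rule trilinear_polarization[where f="b1form (b1_alpha P y) t t'"])
    show "b1form (b1_alpha P y) t t' a a a = 0" for a
      using assms(2)[of t t' a] by (simp add: cub_b1form[OF assms(1)])
  qed (rule b1form_add b1form_sym[OF b1_alpha_sym])+
  then have "b1_alpha P y $ (i, \<gamma>, \<delta>, j, k, l) = 0" for i \<gamma> \<delta> j k l
    by (metis b1form_axis zero_index)
  then show ?thesis by (auto simp: vec_eq_iff)
qed

text \<open>Differentiating \<open>C\<^sub>i(s) s\<^sub>m = C\<^sub>m(s) s\<^sub>i\<close> in the direction \<open>s\<^sub>i\<close> and summing over \<open>i\<close> gives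
  \<open>C\<^sub>m(s) = (3 + q) C\<^sub>m(s)\<close>.\<close>

lemma cubic_radial_divergence_free:
  fixes C :: "real^'q \<Rightarrow> real^'q"
  assumes C: "\<And>s. (C has_derivative C' s) (at s)" and euler: "\<And>s. C' s s = 3 *\<^sub>R C s"
    and tr: "\<And>s. trace (matrix (C' s)) = 0" and rad: "\<And>s. \<exists>c. C s = c *\<^sub>R s"
  shows "C s = 0"
proof -
  have lin: "linear (C' s)" using C has_derivative_linear by blast
  have e: "C' s r $ i * s $ m + C s $ i * r $ m = C' s r $ m * s $ i + C s $ m * r $ i" for r i m
  proof -
    have "C x $ i * x $ m = C x $ m * x $ i" for x
      using rad[of x] by (auto simp: mult_ac)
    then have eq: "(\<lambda>x. C x $ i * x $ m) = (\<lambda>x. C x $ m * x $ i)" by simp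
    have d: "((\<lambda>x. C x $ i * x $ m) has_derivative (\<lambda>r. C s $ i * r $ m + C' s r $ i * s $ m)) (at s)" for i m
      by (intro has_derivative_mult bounded_linear.has_derivative[OF bounded_linear_vec_nth] C has_derivative_ident)
    have "(\<lambda>r. C s $ i * r $ m + C' s r $ i * s $ m) = (\<lambda>r. C s $ m * r $ i + C' s r $ m * s $ i)"
      using has_derivative_unique[OF d[of i m] d[of m i, folded eq]] .
    from fun_cong[OF this, of r] show ?thesis by simp
  qed
  have "C s $ m = 0" for m
  proof -
    have "(\<Sigma> i. C' s (axis i 1) $ i * s $ m + C s $ i * axis i 1 $ m)
        = (\<Sigma> i. C' s (axis i 1) $ m * s $ i + C s $ m * axis i 1 $ i)"
      by (intro sum.cong refl e)
    moreover have "(\<Sigma> i. C' s (axis i 1) $ i * s $ m) = 0"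
      using tr[of s] by (simp add: trace_def matrix_def sum_distrib_right[symmetric])
    moreover have "(\<Sigma> i. C s $ i * axis i 1 $ m) = C s $ m"
      by (simp add: axis_def if_distrib[of "\<lambda>x. _ * x"] cong: if_cong)
    moreover have "(\<Sigma> i. C' s (axis i 1) $ m * s $ i) = 3 * C s $ m"
    proof -
      have "C' s s = C' s (\<Sigma> i. s $ i *\<^sub>R axis i 1)"
        by (simp only: basis_expansion[of s, unfolded scalar_mult_eq_scaleR])
      also have "\<dots> = (\<Sigma> i. s $ i *\<^sub>R C' s (axis i 1))"
        by (simp add: linear_sum[OF lin] linear_scale[OF lin])
      finally have "3 *\<^sub>R C s = (\<Sigma> i. s $ i *\<^sub>R C' s (axis i 1))" by (simp add: euler)
      from arg_cong[OF this, of "\<lambda>v. v $ m"] show ?thesis by (simp add: mult.commute)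
    qed
    moreover have "(\<Sigma> i. C s $ m * axis i 1 $ (i :: 'q)) = real CARD('q) * C s $ m" by simp
    ultimately have "(real CARD('q) + 2) * C s $ m = 0" by (simp add: sum.distrib algebra_simps)
    then show ?thesis by (simp add: add_nonneg_eq_0_iff)
  qed
  then show ?thesis by (simp add: vec_eq_iff)
qed

lemma prolonged_frame_over_subset:
  assumes "prolonged_frame_over U P" "open V" "V \<subseteq> U"
  shows "prolonged_frame_over V P"
  using assms unfolding prolonged_frame_over_def by (auto intro: smooth_on_subset)

text \<open>For independent s and r, the values at s + r and s - r are compared. Injectivity of L
  forces the factors of these two values to have the sum 2 l, so the mixed term contains L r with
  exactly the factor l that belongs to s.\<close>

lemma quadratic_radial_polar:
  fixes f :: "'a::real_vector \<Rightarrow> 'a \<Rightarrow> 'b::real_vector"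
  assumes add: "\<And>a a' b. f (a + a') b = f a b + f a' b" "\<And>a b b'. f a (b + b') = f a b + f a b'"
    and scale: "\<And>c a b. f (c *\<^sub>R a) b = c *\<^sub>R f a b" "\<And>c a b. f a (c *\<^sub>R b) = c *\<^sub>R f a b"
    and L: "linear L" "inj L" and rad: "\<And>a. \<exists>c. f a a = c *\<^sub>R L a" and s: "f s s = l *\<^sub>R L s" "s \<noteq> 0"
  shows "\<exists>c. f s r + f r s = l *\<^sub>R L r + c *\<^sub>R L s"
proof (cases "\<exists>k. r = k *\<^sub>R s")
  case True
  then obtain k where r: "r = k *\<^sub>R s" by blast
  show ?thesis unfolding r scale s(1) linear_scale[OF L(1)]
    by (intro exI[of _ "k * l"]) (simp add: mult_ac)
next
  case False
  obtain a b d where a: "f (s + r) (s + r) = a *\<^sub>R L (s + r)" and b: "f (s - r) (s - r) = b *\<^sub>R L (s - r)"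
    and d: "f r r = d *\<^sub>R L r" using rad by metis
  have m: "f x (- y) = - f x y" "f (- x) y = - f x y" for x y
    using scale(2)[of x "- 1" y] scale(1)[of "- 1" x y] by simp_all
  have p: "f (s + r) (s + r) = f s s + (f s r + f r s) + f r r" by (simp add: add algebra_simps)
  have q: "f (s - r) (s - r) = f s s - (f s r + f r s) + f r r"
    by (simp only: diff_conv_add_uminus[of s r] add m) (simp add: algebra_simps)
  have "a *\<^sub>R L (s + r) + b *\<^sub>R L (s - r) = (2 * l) *\<^sub>R L s + (2 * d) *\<^sub>R L r"
    unfolding a[symmetric] b[symmetric] p q s(1) d by (simp add: algebra_simps flip: scaleR_2)
  then have "L ((a + b - 2 * l) *\<^sub>R s) = L ((2 * d - a + b) *\<^sub>R r)"
    using L(1) by (simp add: linear_add linear_diff linear_scale algebra_simps)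
  then have e: "(a + b - 2 * l) *\<^sub>R s = (2 * d - a + b) *\<^sub>R r" using L(2) by (simp add: inj_eq)
  have ab: "a + b = 2 * l"
  proof (rule ccontr)
    assume n: "a + b \<noteq> 2 * l"
    have "2 * d - a + b \<noteq> 0"
    proof
      assume "2 * d - a + b = 0"
      then show False using e n s(2) by simp
    qed
    then have "r = ((a + b - 2 * l) / (2 * d - a + b)) *\<^sub>R s"
      using arg_cong[OF e, of "\<lambda>v. inverse (2 * d - a + b) *\<^sub>R v"] by (simp add: divide_inverse mult.commute)
    then show False using False by blast
  qed
  have "2 *\<^sub>R (f s r + f r s) = f (s + r) (s + r) - f (s - r) (s - r)"
    unfolding p q by (simp add: algebra_simps scaleR_2)
  also have "\<dots> = (a + b) *\<^sub>R L r + (a - b) *\<^sub>R L s"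
    unfolding a b using L(1) by (simp add: linear_add linear_diff algebra_simps)
  finally have "2 *\<^sub>R (f s r + f r s) = 2 *\<^sub>R (l *\<^sub>R L r + ((a - b) / 2) *\<^sub>R L s)"
    by (simp add: ab scaleR_add_right)
  then have "f s r + f r s = l *\<^sub>R L r + ((a - b) / 2) *\<^sub>R L s" by (simp only: scaleR_cancel_left) simp
  then show ?thesis by blast
qed

section \<open>Divergence of the cubic form for p = 2\<close>

context pframe
begin

lemma trace_curv1: "y \<in> U \<Longrightarrow> trace (curv1 P y z z') = 0"
proof -
  assume y: "y \<in> U"
  have "trace (Rq y (X y z) (X y z')) = 0" by (rule trace_Rq[OF y])
  then show ?thesis
    unfolding Rq_eq[OF y] structure_eqs(4)[OF y]
    by (simp add: trace_simps y) (simp add: trace_def mat_def)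
qed

definition dcub :: "real^'q^'p \<Rightarrow> real^'p \<Rightarrow> real^'p \<Rightarrow> real^'q \<Rightarrow> real^'q \<Rightarrow> real^'q" where
  "dcub y t t' s r = r v* curv1 P y (dyad t s) (dyad t' s) + s v* curv1 P y (dyad t r) (dyad t' s)
     + s v* curv1 P y (dyad t s) (dyad t' r)"

lemma has_derivative_cub: "(cub P y t t' has_derivative dcub y t t' s) (at s)"
proof -
  have "((\<lambda>s. s v* curv1 P y (dyad t s) (dyad t' s)) has_derivative
      (\<lambda>r. s v* (curv1 P y (dyad t s) (dyad t' r) + curv1 P y (dyad t r) (dyad t' s))
        + r v* curv1 P y (dyad t s) (dyad t' s))) (at s)"
    by (intro bounded_bilinear.FDERIV[OF bounded_bilinear_vm] bounded_bilinear.FDERIV[OF bounded_bilinear_curv1]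
        bounded_linear.has_derivative[OF bounded_bilinear.bounded_linear_right[OF bounded_bilinear_dyad]] has_derivative_ident)
  then show ?thesis
    unfolding cub_def[abs_def] by (rule has_derivative_eq_rhs) (simp add: dcub_def vector_matrix_simps add_ac fun_eq_iff)
qed

lemma dcub_euler: "dcub y t t' s s = 3 *\<^sub>R cub P y t t' s"
  by (simp add: dcub_def cub_def) (simp add: scaleR_left_distrib[of 1 2, simplified] scaleR_2)

text \<open>Of the three terms of the derivative, the first gives the trace of \<open>curv1\<close>,
  which is zero. The other two give \<open>C t t'\<close> and \<open>- C t' t\<close>; by
  \<open>curv1_trace\<close>, extended bilinearly from the two basis vectors, they cancel.\<close>

lemma trace_dcub:
  assumes p2: "CARD('p) = 2" and y: "y \<in> U"
  shows "trace (matrix (dcub y t t' s)) = 0"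
proof -
  obtain \<alpha> \<beta> :: 'p where ab: "UNIV = {\<alpha>, \<beta>}" "\<alpha> \<noteq> \<beta>" using card_2_UNIV[OF p2] .
  define C where "C t t' = (\<Sigma> i. (s v* curv1 P y (dyad t s) (dyad t' (axis i 1))) $ i)" for t t'
  have tz: "tors P y (dyad t s) (dyad t' s) = 0" if "y \<in> U" for y t t' s
    by (rule tors_dyad_eq_0[OF a_alpha_eq_0[OF object_identities[OF that] p2]])
  have tr0: "tr2 (tors P y z) = 0" if "y \<in> U" for y z
    by (rule tr2_tors[OF object_identities[OF that]])
  have Cl: "C (a *\<^sub>R t + b *\<^sub>R t') r = a * C t r + b * C t' r" "C r (a *\<^sub>R t + b *\<^sub>R t') = a * C r t + b * C r t'" for a b t t' r
    by (simp_all add: C_def dyad_add_left dyad_scale_left bounded_bilinear.add_left[OF bounded_bilinear_curv1]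
        bounded_bilinear.add_right[OF bounded_bilinear_curv1] bounded_bilinear.scaleR_left[OF bounded_bilinear_curv1]
        bounded_bilinear.scaleR_right[OF bounded_bilinear_curv1] vector_matrix_simps sum.distrib sum_distrib_left)
  have t: "t = t $ \<alpha> *\<^sub>R axis \<alpha> 1 + t $ \<beta> *\<^sub>R axis \<beta> 1" for t :: "real^'p"
  proof -
    have "x = \<alpha> \<or> x = \<beta>" for x using ab(1) by auto
    then show ?thesis using ab(2) by (auto simp: vec_eq_iff axis_def)
  qed
  have c: "C (axis \<alpha> 1) (axis \<beta> 1) = C (axis \<beta> 1) (axis \<alpha> 1)"
    using curv1_trace[OF tz tr0 y ab, of s] by (simp add: C_def)
  have Csym: "C t t' = C t' t"
    by (subst (1 2) t[of t], subst (1 2) t[of t']) (simp only: Cl c, simp add: algebra_simps)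
  have "trace (matrix (dcub y t t' s)) = (\<Sigma> i. dcub y t t' s (axis i 1) $ i)"
    by (simp add: trace_def matrix_def)
  also have "\<dots> = (\<Sigma> i. (axis i 1 v* curv1 P y (dyad t s) (dyad t' s)) $ i)
      + (\<Sigma> i. (s v* curv1 P y (dyad t (axis i 1)) (dyad t' s)) $ i) + C t t'"
    by (simp add: dcub_def sum.distrib C_def)
  also have "(\<Sigma> i. (axis i 1 v* curv1 P y (dyad t s) (dyad t' s)) $ i) = trace (curv1 P y (dyad t s) (dyad t' s))"
    by (simp add: trace_def vector_matrix_mult_def axis_def if_distrib[of "\<lambda>x. x * _"] if_distrib[of "\<lambda>x. _ * x"] cong: if_cong)
  also have "(\<Sigma> i. (s v* curv1 P y (dyad t (axis i 1)) (dyad t' s)) $ i) = - C t' t"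
    unfolding C_def sum_negf[symmetric] by (intro sum.cong refl, subst curv1_skew) (simp add: vector_matrix_simps)
  finally show ?thesis by (simp add: trace_curv1[OF y] Csym)
qed

theorem b1_alpha_eq_0_if_radial:
  assumes p2: "CARD('p) = 2" and y: "y \<in> U"
    and rad: "\<And>t t' s. s \<noteq> 0 \<Longrightarrow> \<exists>c. cub P y t t' s = c *\<^sub>R s"
  shows "b1_alpha P y = 0"
proof (rule b1_alpha_eq_0[OF object_identities[OF y]])
  fix t t' s
  have "\<exists>c. cub P y t t' s = c *\<^sub>R s" for s
    using rad[of s t t'] by (cases "s = 0") (auto simp: cub_def vector_matrix_simps)
  then show "cub P y t t' s = 0"
    by (intro cubic_radial_divergence_free[OF has_derivative_cub dcub_euler trace_dcub[OF p2 y]])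
qed

text \<open>On vectors of one generator the \<nu>-terms map \<open>s\<close> to multiples of
  \<open>s\<close>, so modulo \<open>s\<close> the curvature of \<open>\<rho>\<close> is the cubic
  form.\<close>

lemma s_Rq:
  assumes y: "y \<in> U" and w: "w y v = dyad t s" "w y v' = dyad t' s"
  shows "\<exists>c. s v* Rq y v v' = c *\<^sub>R s + cub P y t t' s"
  unfolding Rq_eq[OF y] w cub_def
  by (intro exI) (simp add: vector_matrix_simps vector_matrix_assoc[symmetric] vector_dyad vector_mat_1 flip: scaleR_diff_left,
      rule disjI1, rule refl)

end

section \<open>Change of prolonged frame\<close>

text \<open>With \<open>\<Delta>(v; s) = d(s B)(v) + s B \<rho>'(v) - s \<rho>(v) B\<close>, the first structure equations show
  \<open>\<Delta>(t \<otimes> s; s) = \<lambda> s B\<close>; differentiating this along two such fields compares the curvatures of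
  \<open>\<rho>\<close> and \<open>\<rho>'\<close> modulo \<open>s B\<close>.\<close>

lemma gauge_cub:
  fixes P P' :: "('p::finite, 'q::finite) prolonged_frame"
  assumes P: "prolonged_frame_over U P" and P': "prolonged_frame_over U P'" and p2: "CARD('p) = 2"
    and AB: "\<And>y. y \<in> U \<Longrightarrow> invertible (A y)" "\<And>y. y \<in> U \<Longrightarrow> invertible (B y)"
      "\<And>y v. y \<in> U \<Longrightarrow> frm_w P' y v = A y ** frm_w P y v ** B y"
    and A: "\<And>t. smooth_on U (\<lambda>y. A y *v t)" and B: "smooth_on U B"
    and y0: "y0 \<in> U" and s0: "s0 \<noteq> 0"
  shows "\<exists>c. cub P' y0 (A y0 *v t1) (A y0 *v t2) (s0 v* B y0) = cub P y0 t1 t2 s0 v* B y0 + c *\<^sub>R (s0 v* B y0)"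
proof -
  interpret pframe U P by (rule pframe.intro[OF P])
  interpret P': pframe U P' by (rule pframe.intro[OF P'])
  have p2': "CARD('p) \<ge> 2" using p2 by simp
  have tz: "tors P y (dyad t s) (dyad t' s) = 0" "tors P' y (dyad t s) (dyad t' s) = 0" if "y \<in> U" for y t t' s
    using tors_dyad_eq_0[OF a_alpha_eq_0[OF object_identities[OF that] p2]]
      tors_dyad_eq_0[OF a_alpha_eq_0[OF P'.object_identities[OF that] p2]] by simp_all
  define \<rho>' where "\<rho>' = frm_q P'"
  define \<eta> where "\<eta> t s y = X y (dyad t s)" for t s y
  define Db where "Db y v = fder B y v" for y v
  define \<Delta> where "\<Delta> y v s = s v* Db y v + (s v* B y) v* \<rho>' y v - (s v* \<rho> y v) v* B y" for y v s
  have Dbf: "smooth_form U Db"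
    unfolding smooth_form_def Db_def
    using smooth_on_frechet_derivative[OF B] smooth_on_differentiable[OF B] by (auto intro: linear_frechet_derivative)
  have w\<eta>: "w y (\<eta> t s y) = dyad t s" "frm_w P' y (\<eta> t s y) = dyad (A y *v t) (s v* B y)" if "y \<in> U" for y t s
    using that by (simp_all add: \<eta>_def AB(3) matrix_dyad dyad_matrix)
  have sB0: "s v* B y \<noteq> 0" if "s \<noteq> 0" "y \<in> U" for s y
  proof
    assume "s v* B y = 0"
    then have "(s v* B y) v* matrix_inv (B y) = 0" by (simp add: vector_matrix_simps)
    then show False using that matrix_inv_right[OF AB(2)[OF that(2)]] by (simp add: vector_matrix_assoc vector_mat_1)
  qed
  have \<eta>s: "smooth_on U (\<eta> t s)" for t s
    unfolding \<eta>_def by (rule smooth_form_smooth[OF smooth_form_X])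
  have \<eta>d: "(\<eta> t s has_derivative fder (\<eta> t s) y) (at y)" if "y \<in> U" for t s y
    by (rule smooth_on_has_derivative[OF \<eta>s that])
  have idd: "((\<lambda>y. y) has_derivative (\<lambda>k. k)) (at y)" for y :: "real^'q^'p" by (rule has_derivative_ident)
  \<comment> \<open>The Lie bracket of two fields of dyads. The factors \<open>s\<close> are
    constant here rather than parallel, so the bracket leaves the generator, as \<open>wZ\<close>
    shows.\<close>
  define Z where "Z t s t' s' y = fder (\<eta> t' s') y (\<eta> t s y) - fder (\<eta> t s) y (\<eta> t' s' y)" for t s t' s' y
  have along: "fder (\<lambda>z. \<beta> z (\<eta> t' s z)) y (\<eta> t s y) - fder (\<lambda>z. \<beta> z (\<eta> t s z)) y (\<eta> t' s y)
      = vext_d \<beta> y (\<eta> t s y) (\<eta> t' s y) + \<beta> y (Z t s t' s y)"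
    if \<beta>: "smooth_form U \<beta>" and y: "y \<in> U" for \<beta> :: "_ \<Rightarrow> _ \<Rightarrow> 'z::real_normed_vector" and t t' s y
    unfolding Z_def
    by (rule vext_d_along[where g="\<lambda>y. y" and x=y, OF open_U \<beta> y idd \<eta>d[OF y] \<eta>d[OF y]]) simp_all
  have wZ: "\<exists>r. w y (Z t s t' s y) = dyad t' (s v* \<rho> y (\<eta> t s y)) - dyad t (s v* \<rho> y (\<eta> t' s y)) + dyad r s"
    if y: "y \<in> U" for t t' s y
  proof -
    have c: "fder (\<lambda>z. w z (\<eta> t s z)) y k = 0" for t k
    proof -
      have "((\<lambda>z. w z (\<eta> t s z)) has_derivative (\<lambda>k. 0)) (at y)"
        by (rule has_derivative_transform_within_open[OF _ open_U y, of "\<lambda>z. dyad t s"]) (simp_all add: w\<eta>)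
      then show ?thesis by (simp add: frechet_derivative_eqI)
    qed
    have "w y (Z t s t' s y) = - vext_d w y (\<eta> t s y) (\<eta> t' s y)"
      using along[OF forms(1) y, of t' s t] by (simp add: c eq_neg_iff_add_eq_0 add.commute)
    also have "\<dots> = dyad t' (s v* \<rho> y (\<eta> t s y)) - dyad t (s v* \<rho> y (\<eta> t' s y))
        + dyad (\<pi> y (\<eta> t' s y) *v t - \<pi> y (\<eta> t s y) *v t' + h y (\<eta> t' s y) *\<^sub>R t - h y (\<eta> t s y) *\<^sub>R t') s"
      unfolding structure_eqs[OF y] w\<eta>[OF y]
      by (simp add: tz[OF y] dyad_matrix matrix_dyad dyad_add_left dyad_diff_left dyad_scale_left)
    finally show ?thesis by blast
  qed
  have rad: "\<exists>c. \<Delta> y (\<eta> t s y) s = c *\<^sub>R (s v* B y)" if y: "y \<in> U" for t s y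
  proof (cases "s = 0")
    case True
    then show ?thesis by (simp add: \<Delta>_def vector_matrix_simps)
  next
    case False
    \<comment> \<open>Contraction of the structure equation of \<open>P'\<close> with
      \<open>x\<close> removes the dyads with first factor \<open>A y *v t\<close>. The companion
      \<open>t'\<close> has \<open>A y *v t' = x\<close>, so that the remaining terms are
      \<open>\<Delta> y (\<eta> t s y) s\<close>, up to the factor \<open>x \<bullet> x\<close>,
      modulo \<open>s v* B y\<close>.\<close>
    obtain x where x: "x \<noteq> 0" "x \<bullet> (A y *v t) = 0" using exists_orthogonal_nonzero[OF p2'] by blast
    define t' where "t' = matrix_inv (A y) *v x"
    have At': "A y *v t' = x" using matrix_inv_right[OF AB(1)[OF y]] by (simp add: t'_def matrix_vector_mul_assoc)
    have dw: "fder (\<lambda>z. frm_w P' z (\<eta> t s z)) y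
        = (\<lambda>k. dyad (A y *v t) (s v* Db y k) + dyad (fder (\<lambda>z. A z *v t) y k) (s v* B y))" for t
      unfolding Db_def
      by (rule fder_eqI_open[OF bounded_bilinear.FDERIV[OF bounded_bilinear_dyad smooth_on_has_derivative[OF A y]
            bounded_linear.has_derivative[OF bounded_bilinear.bounded_linear_right[OF bounded_bilinear_vm]
            smooth_on_has_derivative[OF B y]]] open_U y]) (simp add: w\<eta>)
    obtain r where r: "w y (Z t' s t s y) = dyad t (s v* \<rho> y (\<eta> t' s y)) - dyad t' (s v* \<rho> y (\<eta> t s y)) + dyad r s"
      using wZ[OF y] by blast
    have w'Z: "frm_w P' y (Z t' s t s y) = dyad (A y *v t) ((s v* \<rho> y (\<eta> t' s y)) v* B y)
        - dyad x ((s v* \<rho> y (\<eta> t s y)) v* B y) + dyad (A y *v r) (s v* B y)"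
      unfolding AB(3)[OF y] r by (simp add: mm_simps matrix_dyad dyad_matrix At')
    have "dyad (A y *v t) (s v* Db y (\<eta> t' s y)) + dyad (fder (\<lambda>z. A z *v t) y (\<eta> t' s y)) (s v* B y)
        - (dyad x (s v* Db y (\<eta> t s y)) + dyad (fder (\<lambda>z. A z *v t') y (\<eta> t s y)) (s v* B y))
       = dyad x ((s v* B y) v* \<rho>' y (\<eta> t s y)) - dyad (A y *v t) ((s v* B y) v* \<rho>' y (\<eta> t' s y))
         + (dyad (frm_p P' y (\<eta> t' s y) *v (A y *v t)) (s v* B y) - dyad (frm_p P' y (\<eta> t s y) *v x) (s v* B y))
         + (frm_h P' y (\<eta> t' s y) *\<^sub>R dyad (A y *v t) (s v* B y) - frm_h P' y (\<eta> t s y) *\<^sub>R dyad x (s v* B y))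
         + frm_w P' y (Z t' s t s y)"
      using along[OF P'.forms(1) y, of t s t'] unfolding dw P'.structure_eqs[OF y] w\<eta>[OF y] At'
      by (simp add: tz[OF y] dyad_matrix matrix_dyad \<rho>'_def)
    from arg_cong[OF this, of "\<lambda>m. x v* m"]
    have "(x \<bullet> x) *\<^sub>R \<Delta> y (\<eta> t s y) s
       = (x \<bullet> fder (\<lambda>z. A z *v t) y (\<eta> t' s y) - x \<bullet> fder (\<lambda>z. A z *v t') y (\<eta> t s y)
          - x \<bullet> (frm_p P' y (\<eta> t' s y) *v (A y *v t)) + x \<bullet> (frm_p P' y (\<eta> t s y) *v x)
          + frm_h P' y (\<eta> t s y) * (x \<bullet> x) - x \<bullet> (A y *v r)) *\<^sub>R (s v* B y)"
      unfolding w'Z using x(2)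
      by (simp add: vector_matrix_simps vector_dyad \<Delta>_def algebra_simps)
    then obtain b where "(x \<bullet> x) *\<^sub>R \<Delta> y (\<eta> t s y) s = b *\<^sub>R (s v* B y)" by blast
    then have "inverse (x \<bullet> x) *\<^sub>R ((x \<bullet> x) *\<^sub>R \<Delta> y (\<eta> t s y) s) = inverse (x \<bullet> x) *\<^sub>R (b *\<^sub>R (s v* B y))" by simp
    then have "\<Delta> y (\<eta> t s y) s = (inverse (x \<bullet> x) * b) *\<^sub>R (s v* B y)" using x(1) by simp
    then show ?thesis by blast
  qed
  define \<sigma> where "\<sigma> y = s0 v* B y" for y
  have \<sigma>s: "smooth_on U \<sigma>"
    unfolding \<sigma>_def by (rule smooth_on_bilinear[OF open_U bounded_bilinear_vm smooth_on_const B])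
  have \<sigma>nz: "\<sigma> y \<bullet> \<sigma> y \<noteq> 0" if "y \<in> U" for y using sB0[OF s0 that] by (simp add: \<sigma>_def)
  have fs: "smooth_on U (\<lambda>y. \<beta> y (\<eta> t s0 y))" if "smooth_form U \<beta>" for \<beta> :: "_ \<Rightarrow> _ \<Rightarrow> 'z::real_normed_vector" and t
    by (rule smooth_form_compose[OF that open_U smooth_on_id _ \<eta>s]) simp
  have \<Delta>s: "smooth_on U (\<lambda>y. \<Delta> y (\<eta> t s0 y) s0)" for t
    unfolding \<Delta>_def \<rho>'_def
    by (intro smooth_on_diff smooth_on_add open_U smooth_on_bilinear[OF open_U bounded_bilinear_vm]
        smooth_on_const B fs[OF Dbf] fs[OF P'.forms(4)] fs[OF forms(4)])
  define lam where "lam t y = (\<Delta> y (\<eta> t s0 y) s0 \<bullet> \<sigma> y) * inverse (\<sigma> y \<bullet> \<sigma> y)" for t y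
  have lams: "smooth_on U (lam t)" for t
    unfolding lam_def
    by (intro smooth_on_mult smooth_on_inverse smooth_on_inner open_U \<Delta>s \<sigma>s \<sigma>nz)
  have \<Delta>_lam: "\<Delta> y (\<eta> t s0 y) s0 = lam t y *\<^sub>R \<sigma> y" if y: "y \<in> U" for t y
    using rad[OF y, of t s0] \<sigma>nz[OF y] by (auto simp: lam_def \<sigma>_def)
  have \<rho>'lin: "linear (\<rho>' y0)" and \<rho>lin: "linear (\<rho> y0)" and Dblin: "linear (Db y0)" and Xlin: "linear (X y0)"
    unfolding \<rho>'_def using smooth_form_linear y0 P'.forms(4) forms(4) Dbf linear_X by auto
  have \<Delta>add: "\<Delta> y0 (v + v') s = \<Delta> y0 v s + \<Delta> y0 v' s" "\<Delta> y0 (v - v') s = \<Delta> y0 v s - \<Delta> y0 v' s"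
      "\<Delta> y0 v (s + s') = \<Delta> y0 v s + \<Delta> y0 v s'"
      "\<Delta> y0 (c *\<^sub>R v) s = c *\<^sub>R \<Delta> y0 v s" "\<Delta> y0 v (c *\<^sub>R s) = c *\<^sub>R \<Delta> y0 v s" for v v' s s' c
    using \<rho>'lin \<rho>lin Dblin
    by (simp_all add: \<Delta>_def linear_add linear_diff linear_scale vector_matrix_simps algebra_simps)
  have \<eta>add: "\<eta> t (s + s') y0 = \<eta> t s y0 + \<eta> t s' y0" "\<eta> t (c *\<^sub>R s) y0 = c *\<^sub>R \<eta> t s y0" for t s s' c
    using Xlin by (simp_all add: \<eta>_def dyad_add_right dyad_scale_right linear_add linear_scale)
  \<comment> \<open>The bracket contains dyads with factor \<open>s0 v* \<rho>\<close> instead of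
    \<open>s0\<close>, on which \<Delta> is not known to be radial. Polarization trades them for the
    other mixed term, which cancels in the commutator of the derivatives.\<close>
  have polar: "\<exists>c. \<Delta> y0 (\<eta> t s0 y0) r + \<Delta> y0 (\<eta> t r y0) s0 = lam t y0 *\<^sub>R (r v* B y0) + c *\<^sub>R \<sigma> y0" for t r
    unfolding \<sigma>_def
  proof (rule quadratic_radial_polar[where f="\<lambda>a b. \<Delta> y0 (\<eta> t a y0) b" and L="\<lambda>s. s v* B y0"])
    show "linear (\<lambda>s. s v* B y0)" by (intro linearI) (simp_all add: vector_matrix_simps)
    show "inj (\<lambda>s. s v* B y0)"
    proof (rule injI)
      fix a b assume "a v* B y0 = b v* B y0"
      then have "(a - b) v* B y0 = 0" by (simp add: vector_matrix_simps)
      then show "a = b" using sB0[OF _ y0, of "a - b"] by auto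
    qed
    show "\<exists>c. \<Delta> y0 (\<eta> t a y0) a = c *\<^sub>R (a v* B y0)" for a by (rule rad[OF y0])
    show "\<Delta> y0 (\<eta> t s0 y0) s0 = lam t y0 *\<^sub>R (s0 v* B y0)" using \<Delta>_lam[OF y0] by (simp add: \<sigma>_def)
    show "s0 \<noteq> 0" by (rule s0)
  qed (simp_all add: \<Delta>add \<eta>add)
  define e1 e2 where "e1 = \<eta> t1 s0 y0" and "e2 = \<eta> t2 s0 y0"
  define r1 r2 where "r1 = s0 v* \<rho> y0 e1" and "r2 = s0 v* \<rho> y0 e2"
  define l1 l2 where "l1 = lam t1 y0" and "l2 = lam t2 y0"
  define zz where "zz = Z t1 s0 t2 s0 y0"
  obtain r where r: "w y0 zz = dyad t2 r1 - dyad t1 r2 + dyad r s0"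
    using wZ[OF y0] unfolding zz_def r1_def r2_def e1_def e2_def by blast
  have "zz = X y0 (w y0 zz)" by (simp add: y0)
  also have "\<dots> = \<eta> t2 r1 y0 - \<eta> t1 r2 y0 + \<eta> r s0 y0"
    unfolding r using Xlin by (simp add: \<eta>_def linear_add linear_diff)
  finally have zz: "zz = \<eta> t2 r1 y0 - \<eta> t1 r2 y0 + \<eta> r s0 y0" .
  obtain c1 c2 where c12: "\<Delta> y0 (\<eta> t2 r1 y0) s0 = l2 *\<^sub>R (r1 v* B y0) + c1 *\<^sub>R \<sigma> y0 - \<Delta> y0 e2 r1"
    "\<Delta> y0 (\<eta> t1 r2 y0) s0 = l1 *\<^sub>R (r2 v* B y0) + c2 *\<^sub>R \<sigma> y0 - \<Delta> y0 e1 r2"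
    using polar[of t2 r1] polar[of t1 r2] unfolding l1_def l2_def e1_def e2_def by (metis add_diff_cancel_left')
  have DZ: "\<Delta> y0 zz s0 = l2 *\<^sub>R (r1 v* B y0) - \<Delta> y0 e2 r1 - l1 *\<^sub>R (r2 v* B y0) + \<Delta> y0 e1 r2 + (c1 - c2 + lam r y0) *\<^sub>R \<sigma> y0"
    unfolding zz \<Delta>add c12 \<Delta>_lam[OF y0] by (simp add: algebra_simps)
  define fB where "fB t k = fder (\<lambda>z. Db z (\<eta> t s0 z)) y0 k" for t k
  define f\<rho> where "f\<rho> t k = fder (\<lambda>z. \<rho> z (\<eta> t s0 z)) y0 k" for t k
  define f\<rho>' where "f\<rho>' t k = fder (\<lambda>z. \<rho>' z (\<eta> t s0 z)) y0 k" for t k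
  have fd: "((\<lambda>z. Db z (\<eta> t s0 z)) has_derivative fB t) (at y0)" "((\<lambda>z. \<rho> z (\<eta> t s0 z)) has_derivative f\<rho> t) (at y0)"
    "((\<lambda>z. \<rho>' z (\<eta> t s0 z)) has_derivative f\<rho>' t) (at y0)" for t
    unfolding fB_def f\<rho>_def f\<rho>'_def \<rho>'_def
    by (rule smooth_on_has_derivative[OF fs y0], rule Dbf forms(4) P'.forms(4))+
  have Bd: "(B has_derivative Db y0) (at y0)" unfolding Db_def by (rule smooth_on_has_derivative[OF B y0])
  have \<sigma>d: "(\<sigma> has_derivative (\<lambda>k. s0 v* Db y0 k)) (at y0)"
    unfolding \<sigma>_def by (rule bounded_linear.has_derivative[OF bounded_bilinear.bounded_linear_right[OF bounded_bilinear_vm] Bd])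
  have D\<Delta>: "lam t y0 *\<^sub>R (s0 v* Db y0 k) + fder (lam t) y0 k *\<^sub>R \<sigma> y0
      = s0 v* fB t k + (\<sigma> y0 v* f\<rho>' t k + (s0 v* Db y0 k) v* \<rho>' y0 (\<eta> t s0 y0))
        - ((s0 v* \<rho> y0 (\<eta> t s0 y0)) v* Db y0 k + (s0 v* f\<rho> t k) v* B y0)" for t k
  proof -
    have 1: "((\<lambda>y. lam t y *\<^sub>R \<sigma> y) has_derivative
        (\<lambda>k. lam t y0 *\<^sub>R (s0 v* Db y0 k) + fder (lam t) y0 k *\<^sub>R \<sigma> y0)) (at y0)"
      by (intro has_derivative_scaleR smooth_on_has_derivative[OF lams y0] \<sigma>d)
    have 2: "fder (\<lambda>y. lam t y *\<^sub>R \<sigma> y) y0 =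
       (\<lambda>k. s0 v* fB t k + (\<sigma> y0 v* f\<rho>' t k + (s0 v* Db y0 k) v* \<rho>' y0 (\<eta> t s0 y0))
        - ((s0 v* \<rho> y0 (\<eta> t s0 y0)) v* Db y0 k + (s0 v* f\<rho> t k) v* B y0))"
      by (rule fder_eqI_open[where f="\<lambda>y. s0 v* Db y (\<eta> t s0 y) + \<sigma> y v* \<rho>' y (\<eta> t s0 y) - (s0 v* \<rho> y (\<eta> t s0 y)) v* B y", OF _ open_U y0],
          intro has_derivative_diff has_derivative_add bounded_bilinear.FDERIV[OF bounded_bilinear_vm] \<sigma>d fd Bd
          bounded_linear.has_derivative[OF bounded_bilinear.bounded_linear_right[OF bounded_bilinear_vm]])
        (simp add: \<Delta>_lam[symmetric], simp add: \<Delta>_def \<sigma>_def)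
    show ?thesis using fun_cong[OF 2, of k] unfolding frechet_derivative_eqI[OF 1] .
  qed
  \<comment> \<open>\<open>Db\<close> is the differential of \<open>B\<close>, hence closed.\<close>
  have dB0: "vext_d Db y0 u v = 0" for u v
    using second_derivative_symmetric[OF open_U B y0, of v u] by (simp add: vext_d_def Db_def)
  have a1: "fB t2 e1 - fB t1 e2 = Db y0 zz"
    using along[OF Dbf y0, of t2 s0 t1] by (simp add: fB_def e1_def e2_def zz_def dB0)
  have a2: "f\<rho> t2 e1 - f\<rho> t1 e2 = vext_d \<rho> y0 e1 e2 + \<rho> y0 zz"
    using along[OF forms(4) y0, of t2 s0 t1] by (simp add: f\<rho>_def e1_def e2_def zz_def)
  have a3: "f\<rho>' t2 e1 - f\<rho>' t1 e2 = vext_d \<rho>' y0 e1 e2 + \<rho>' y0 zz"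
    using along[OF P'.forms(4) y0, of t2 s0 t1] by (simp add: f\<rho>'_def \<rho>'_def e1_def e2_def zz_def)
  have a1': "s0 v* fB t2 e1 = s0 v* fB t1 e2 + s0 v* Db y0 zz"
    using arg_cong[OF a1, of "\<lambda>m. s0 v* m"] by (simp add: vector_matrix_simps algebra_simps)
  have a2': "(s0 v* f\<rho> t2 e1) v* B y0 = (s0 v* f\<rho> t1 e2) v* B y0 + (s0 v* vext_d \<rho> y0 e1 e2) v* B y0 + (s0 v* \<rho> y0 zz) v* B y0"
    using arg_cong[OF a2, of "\<lambda>m. (s0 v* m) v* B y0"] by (simp add: vector_matrix_simps algebra_simps)
  have a3': "\<sigma> y0 v* f\<rho>' t2 e1 = \<sigma> y0 v* f\<rho>' t1 e2 + \<sigma> y0 v* vext_d \<rho>' y0 e1 e2 + \<sigma> y0 v* \<rho>' y0 zz"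
    using arg_cong[OF a3, of "\<lambda>m. \<sigma> y0 v* m"] by (simp add: vector_matrix_simps algebra_simps)
  have \<Delta>e: "s0 v* Db y0 e1 = l1 *\<^sub>R \<sigma> y0 - \<sigma> y0 v* \<rho>' y0 e1 + r1 v* B y0" "s0 v* Db y0 e2 = l2 *\<^sub>R \<sigma> y0 - \<sigma> y0 v* \<rho>' y0 e2 + r2 v* B y0"
    using \<Delta>_lam[OF y0, of t1] \<Delta>_lam[OF y0, of t2]
    by (simp_all add: \<Delta>_def \<sigma>_def e1_def e2_def l1_def l2_def r1_def r2_def algebra_simps)
  have DZ': "s0 v* Db y0 zz = l2 *\<^sub>R (r1 v* B y0) - \<Delta> y0 e2 r1 - l1 *\<^sub>R (r2 v* B y0) + \<Delta> y0 e1 r2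
      + (c1 - c2 + lam r y0) *\<^sub>R \<sigma> y0 - \<sigma> y0 v* \<rho>' y0 zz + (s0 v* \<rho> y0 zz) v* B y0"
    using DZ by (simp add: \<Delta>_def[of y0 zz] \<sigma>_def algebra_simps)
  have main: "\<exists>c. \<sigma> y0 v* (vext_d \<rho>' y0 e1 e2 - (\<rho>' y0 e1 ** \<rho>' y0 e2 - \<rho>' y0 e2 ** \<rho>' y0 e1))
      = (s0 v* (vext_d \<rho> y0 e1 e2 - (\<rho> y0 e1 ** \<rho> y0 e2 - \<rho> y0 e2 ** \<rho> y0 e1))) v* B y0 + c *\<^sub>R \<sigma> y0"
    using arg_cong2[where f="(-)", OF D\<Delta>[of t2 e1] D\<Delta>[of t1 e2]]
    unfolding e1_def[symmetric] e2_def[symmetric] l1_def[symmetric] l2_def[symmetric] r1_def[symmetric] r2_def[symmetric]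
      a1' a2' a3' DZ' \<Delta>e
    unfolding \<Delta>_def
    by (intro exI[of _ "fder (lam t2) y0 e1 - fder (lam t1) y0 e2 - (c1 - c2 + lam r y0)"])
      (simp add: vector_matrix_simps vector_matrix_assoc[symmetric] r1_def[symmetric] r2_def[symmetric] algebra_simps)
  obtain k1 where k1: "s0 v* Rq y0 e1 e2 = k1 *\<^sub>R s0 + cub P y0 t1 t2 s0"
    using s_Rq[OF y0 w\<eta>(1)[OF y0] w\<eta>(1)[OF y0]] unfolding e1_def e2_def by blast
  obtain k2 where k2: "\<sigma> y0 v* P'.Rq y0 e1 e2 = k2 *\<^sub>R \<sigma> y0 + cub P' y0 (A y0 *v t1) (A y0 *v t2) (\<sigma> y0)"
    using P'.s_Rq[OF y0 w\<eta>(2)[OF y0] w\<eta>(2)[OF y0]] unfolding e1_def e2_def \<sigma>_def by blast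
  obtain c where "\<sigma> y0 v* P'.Rq y0 e1 e2 = (s0 v* Rq y0 e1 e2) v* B y0 + c *\<^sub>R \<sigma> y0"
    using main unfolding curvature_def \<rho>'_def by blast
  then have "cub P' y0 (A y0 *v t1) (A y0 *v t2) (\<sigma> y0) = cub P y0 t1 t2 s0 v* B y0 + (k1 + c - k2) *\<^sub>R \<sigma> y0"
    unfolding k1 k2 by (simp add: \<sigma>_def vector_matrix_simps algebra_simps)
  then show ?thesis unfolding \<sigma>_def by blast
qed

lemma invertible_scaleR: "invertible A \<Longrightarrow> c \<noteq> 0 \<Longrightarrow> invertible (c *\<^sub>R A)" for A :: "real^'n^'n"
proof -
  assume "invertible A" "c \<noteq> 0"
  then have "(c *\<^sub>R A) ** (inverse c *\<^sub>R matrix_inv A) = mat 1 \<and> (inverse c *\<^sub>R matrix_inv A) ** (c *\<^sub>R A) = mat 1"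
    using matrix_inv_both[of A] by (simp add: mm_simps)
  then show ?thesis unfolding invertible_def by blast
qed

lemma cub_scale: "cub P y (a *\<^sub>R t) (a *\<^sub>R t') (c *\<^sub>R s) = (a\<^sup>2 * c ^ 3) *\<^sub>R cub P y t t' s"
  by (simp add: cub_def dyad_scale_left dyad_scale_right bounded_bilinear.scaleR_left[OF bounded_bilinear_curv1]
      bounded_bilinear.scaleR_right[OF bounded_bilinear_curv1] vector_matrix_simps power2_eq_square power3_eq_cube mult_ac)

lemma vector_matrix_inv_nonzero:
  fixes B :: "real^'n^'n"
  assumes "invertible B" "s \<noteq> 0"
  shows "s v* B \<noteq> 0"
proof
  assume "s v* B = 0"
  then have "(s v* B) v* matrix_inv B = 0" by (simp add: vector_matrix_simps)
  then show False using assms matrix_inv_right[OF assms(1)] by (simp add: vector_matrix_assoc vector_mat_1)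
qed

text \<open>Only the tensor product of \<open>A\<close> and \<open>B\<close> is smooth; dividing by a nonvanishing entry of \<open>A\<close>
  makes both factors smooth.\<close>

lemma gauge_cub_pointwise:
  fixes P P' :: "('p::finite, 'q::finite) prolonged_frame"
  assumes P: "prolonged_frame_over U P" and P': "prolonged_frame_over U P'" and p2: "CARD('p) = 2"
    and AB: "\<And>y. y \<in> U \<Longrightarrow> invertible (A y)" "\<And>y. y \<in> U \<Longrightarrow> invertible (B y)"
      "\<And>y v. y \<in> U \<Longrightarrow> frm_w P' y v = A y ** frm_w P y v ** B y"
    and y0: "y0 \<in> U" and s0: "s0 \<noteq> 0"
  shows "\<exists>c. cub P' y0 (A y0 *v t1) (A y0 *v t2) (s0 v* B y0) = cub P y0 t1 t2 s0 v* B y0 + c *\<^sub>R (s0 v* B y0)"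
proof -
  interpret pframe U P by (rule pframe.intro[OF P])
  interpret P': pframe U P' by (rule pframe.intro[OF P'])
  have "A y0 \<noteq> 0"
  proof
    assume "A y0 = 0"
    then have "(mat 1 :: real^'p^'p) = 0" using matrix_inv_right[OF AB(1)[OF y0]] by (simp add: mm_simps)
    from arg_cong[OF this, of "\<lambda>m. m $ undefined $ undefined"] show False by (simp add: mat_def)
  qed
  then obtain \<alpha>0 \<beta>0 where ne: "A y0 $ \<alpha>0 $ \<beta>0 \<noteq> 0" by (auto simp: vec_eq_iff)
  define a where "a y = A y $ \<alpha>0 $ \<beta>0" for y
  \<comment> \<open>A row of the change of coframe on dyads with a fixed first factor: it equals
    \<open>a y *\<^sub>R B y\<close> and is smooth although \<open>B\<close> itself need not
    be.\<close>
  define Bh where "Bh y = (\<chi> j. frm_w P' y (X y (dyad (axis \<beta>0 1) (axis j 1))) $ \<alpha>0)" for y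
  have w': "frm_w P' y (X y (dyad t s)) = dyad (A y *v t) (s v* B y)" if "y \<in> U" for y t s
    using that by (simp add: AB(3) matrix_dyad dyad_matrix)
  have Bh: "Bh y = a y *\<^sub>R B y" if "y \<in> U" for y
    unfolding Bh_def w'[OF that]
    by (simp add: vec_eq_iff dyad_def a_def matrix_vector_mult_def vector_matrix_mult_def axis_def
        if_distrib[of "\<lambda>x. _ * x"] if_distrib[of "\<lambda>x. x * _"] cong: if_cong)
  have ws: "smooth_on U (\<lambda>y. frm_w P' y (X y z))" for z
    by (rule smooth_form_compose[OF P'.forms(1) open_U smooth_on_id _ smooth_form_smooth[OF smooth_form_X]]) simp
  have Bhs: "smooth_on U Bh"
    by (rule smooth_on_vec[OF open_U]) (simp add: Bh_def smooth_on_vec_nth[OF open_U ws])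
  define V where "V = U \<inter> Bh -` (- {0})"
  have V: "open V"
    unfolding V_def
    by (rule continuous_open_preimage[OF smooth_on_continuous[OF Bhs] open_U]) (auto intro: open_Compl)
  have VU: "V \<subseteq> U" by (auto simp: V_def)
  have B0: "B y \<noteq> 0" if "y \<in> U" for y
    using vector_matrix_inv_nonzero[OF AB(2)[OF that], of "axis undefined 1"] by (auto simp: vector_matrix_simps)
  have a0: "a y \<noteq> 0" if "y \<in> V" for y using that by (auto simp: V_def Bh)
  have y0V: "y0 \<in> V" using y0 ne B0[OF y0] by (simp add: V_def Bh a_def)
  define Ah where "Ah y = inverse (a y) *\<^sub>R A y" for y
  \<comment> \<open>A fixed nonzero row vector. Contraction of \<open>P'\<close> on dyads with
    factor \<open>s1\<close> by \<open>s1 v* Bh y\<close> recovers the rescaled first factor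
    smoothly.\<close>
  define s1 :: "real^'q" where "s1 = axis undefined 1"
  have nz: "(s1 v* Bh y) \<bullet> (s1 v* Bh y) \<noteq> 0" if "y \<in> V" for y
    using that vector_matrix_inv_nonzero[OF AB(2)[of y], of s1] a0[OF that] VU
    by (auto simp: s1_def Bh vector_matrix_simps)
  have bmv: "bounded_bilinear (\<lambda>(A :: real^'q^'p) x. A *v x)"
    unfolding bilinear_conv_bounded_bilinear[symmetric] bilinear_def
    by (auto intro!: linearI simp: matrix_vector_mult_add_rdistrib matrix_vector_right_distrib
        scaleR_matrix_vector_assoc[symmetric] matrix_vector_mult_scaleR)
  have sB: "smooth_on V (\<lambda>y. s1 v* Bh y)"
    by (intro smooth_on_bilinear[OF V bounded_bilinear_vm] smooth_on_const smooth_on_subset[OF Bhs VU])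
  have Ahs: "smooth_on V (\<lambda>y. Ah y *v t)" for t
  proof (rule smooth_on_cong[OF V])
    show "smooth_on V (\<lambda>y. inverse ((s1 v* Bh y) \<bullet> (s1 v* Bh y)) *\<^sub>R (frm_w P' y (X y (dyad t s1)) *v (s1 v* Bh y)))"
      by (intro smooth_on_scaleR smooth_on_inverse smooth_on_inner V sB nz smooth_on_bilinear[OF V bmv] smooth_on_subset[OF ws VU])
    fix y assume y: "y \<in> V"
    then have yU: "y \<in> U" using VU by blast
    have "frm_w P' y (X y (dyad t s1)) = dyad (Ah y *v t) (s1 v* Bh y)"
      using a0[OF y] by (simp add: w'[OF yU] Ah_def Bh[OF yU] vector_matrix_simps dyad_scale_right dyad_scale_left
          scaleR_matrix_vector_assoc[symmetric])
    then show "inverse ((s1 v* Bh y) \<bullet> (s1 v* Bh y)) *\<^sub>R (frm_w P' y (X y (dyad t s1)) *v (s1 v* Bh y)) = Ah y *v t"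
      using nz[OF y] by (simp add: dyad_vector)
  qed
  have "\<exists>c. cub P' y0 (Ah y0 *v t1) (Ah y0 *v t2) (s0 v* Bh y0) = cub P y0 t1 t2 s0 v* Bh y0 + c *\<^sub>R (s0 v* Bh y0)"
  proof (rule gauge_cub[OF prolonged_frame_over_subset[OF P V VU] prolonged_frame_over_subset[OF P' V VU] p2 _ _ _ Ahs
        smooth_on_subset[OF Bhs VU] y0V s0])
    fix y v assume y: "y \<in> V"
    then have yU: "y \<in> U" using VU by blast
    show "invertible (Ah y)" "invertible (Bh y)"
      using a0[OF y] AB(1,2)[OF yU] by (simp_all add: Ah_def Bh[OF yU] invertible_scaleR)
    show "frm_w P' y v = Ah y ** w y v ** Bh y"
      using a0[OF y] by (simp add: AB(3)[OF yU] Ah_def Bh[OF yU] mm_simps)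
  qed
  then obtain c where c: "cub P' y0 (Ah y0 *v t1) (Ah y0 *v t2) (s0 v* Bh y0) = cub P y0 t1 t2 s0 v* Bh y0 + c *\<^sub>R (s0 v* Bh y0)"
    by blast
  have "cub P' y0 (Ah y0 *v t1) (Ah y0 *v t2) (s0 v* Bh y0) = a y0 *\<^sub>R cub P' y0 (A y0 *v t1) (A y0 *v t2) (s0 v* B y0)"
    using a0[OF y0V]
    by (simp add: Ah_def Bh[OF y0] vector_matrix_simps scaleR_matrix_vector_assoc[symmetric] cub_scale power2_eq_square power3_eq_cube,
        simp add: field_simps)
  then have "a y0 *\<^sub>R cub P' y0 (A y0 *v t1) (A y0 *v t2) (s0 v* B y0) = a y0 *\<^sub>R (cub P y0 t1 t2 s0 v* B y0 + c *\<^sub>R (s0 v* B y0))"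
    using c by (simp add: Bh[OF y0] vector_matrix_simps scaleR_add_right mult.commute)
  then have "cub P' y0 (A y0 *v t1) (A y0 *v t2) (s0 v* B y0) = cub P y0 t1 t2 s0 v* B y0 + c *\<^sub>R (s0 v* B y0)"
    using a0[OF y0V] by simp
  then show ?thesis by blast
qed

lemma trace_matrix_conj:
  fixes f :: "real^'q \<Rightarrow> real^'q" and B B' :: "real^'q^'q"
  assumes f: "linear f" and B: "B ** B' = mat 1"
  shows "trace (matrix (\<lambda>r. f (r v* B) v* B')) = trace (matrix f)"
proof -
  have "matrix (\<lambda>r. f (r v* B) v* B') = transpose B' ** matrix f ** transpose B"
  proof -
    have "f (r v* B) v* B' = (transpose B' ** matrix f ** transpose B) *v r" for r
      using matrix_works[OF f[folded linear_matrix_vector_mul_eq]]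
      by (simp only: matrix_vector_mul_assoc[symmetric] transpose_matrix_vector)
    then have "(\<lambda>r. f (r v* B) v* B') = (\<lambda>r. (transpose B' ** matrix f ** transpose B) *v r)" by blast
    then show ?thesis by (simp only: matrix_of_matrix_vector_mul)
  qed
  also have "trace (transpose B' ** matrix f ** transpose B) = trace (transpose B ** (transpose B' ** matrix f))"
    by (rule trace_mul_sym)
  also have "transpose B ** (transpose B' ** matrix f) = transpose (B' ** B) ** matrix f"
    by (simp add: matrix_mul_assoc matrix_transpose_mul)
  also have "B' ** B = mat 1" using B matrix_left_right_inverse[of B B'] by simp
  finally show ?thesis by (simp add: transpose_mat)
qed

text \<open>The difference of the two cubic forms, pulled back to the same \<open>s\<close>, is
  radial by the comparison of curvatures. It is divergence-free because each form is and the trace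
  is invariant under conjugation by B, so it vanishes.\<close>

lemma cub_tensor:
  fixes P P' :: "('p::finite, 'q::finite) prolonged_frame"
  assumes P: "prolonged_frame_over U P" and P': "prolonged_frame_over U P'" and p2: "CARD('p) = 2"
    and AB: "\<And>y. y \<in> U \<Longrightarrow> invertible (A y)" "\<And>y. y \<in> U \<Longrightarrow> invertible (B y)"
      "\<And>y v. y \<in> U \<Longrightarrow> frm_w P' y v = A y ** frm_w P y v ** B y"
    and y: "y \<in> U"
  shows "cub P' y (A y *v t) (A y *v t') (s v* B y) = cub P y t t' s v* B y"
proof -
  interpret pframe U P by (rule pframe.intro[OF P])
  interpret P': pframe U P' by (rule pframe.intro[OF P'])
  let ?A = "A y" and ?B = "B y"
  define B' where "B' = matrix_inv ?B"
  have BB': "?B ** B' = mat 1" "B' ** ?B = mat 1" using matrix_inv_both[OF AB(2)[OF y]] by (simp_all add: B'_def)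
  define C where "C s = cub P' y (?A *v t) (?A *v t') (s v* ?B) v* B' - cub P y t t' s" for s
  define C' where "C' s r = P'.dcub y (?A *v t) (?A *v t') (s v* ?B) (r v* ?B) v* B' - dcub y t t' s r" for s r
  have l1: "linear (dcub y t t' s)" "linear (P'.dcub y (?A *v t) (?A *v t') s)" for s
    using has_derivative_cub P'.has_derivative_cub has_derivative_linear by blast+
  have "C s = 0" for s
  proof (rule cubic_radial_divergence_free[where C=C and C'=C'])
    fix s :: "real^'q"
    have "((\<lambda>s. cub P' y (?A *v t) (?A *v t') (s v* ?B)) has_derivative
        (\<lambda>r. P'.dcub y (?A *v t) (?A *v t') (s v* ?B) (r v* ?B))) (at s)"
      using diff_chain_at[OF bounded_linear_imp_has_derivative[OF bounded_bilinear.bounded_linear_left[OF bounded_bilinear_vm]]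
          P'.has_derivative_cub] by (simp add: o_def)
    then show "(C has_derivative C' s) (at s)"
      unfolding C_def[abs_def] C'_def[abs_def]
      by (intro has_derivative_diff has_derivative_cub
          bounded_linear.has_derivative[OF bounded_bilinear.bounded_linear_left[OF bounded_bilinear_vm]])
    show "C' s s = 3 *\<^sub>R C s"
      by (simp add: C_def C'_def dcub_euler P'.dcub_euler vector_matrix_simps scaleR_diff_right)
    have lin2: "linear (\<lambda>r. P'.dcub y (?A *v t) (?A *v t') (s v* ?B) (r v* ?B) v* B')"
      using l1(2) by (intro linearI) (simp_all add: vector_matrix_simps linear_add linear_scale)
    have "trace (matrix (C' s)) = trace (matrix (\<lambda>r. P'.dcub y (?A *v t) (?A *v t') (s v* ?B) (r v* ?B) v* B'))
        - trace (matrix (dcub y t t' s))"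
      by (simp add: C'_def trace_def matrix_def sum_subtractf)
    then show "trace (matrix (C' s)) = 0"
      by (simp add: trace_matrix_conj[OF l1(2) BB'(1)] trace_dcub[OF p2 y] P'.trace_dcub[OF p2 y])
    show "\<exists>c. C s = c *\<^sub>R s"
    proof (cases "s = 0")
      case True
      then show ?thesis by (simp add: C_def cub_def vector_matrix_simps)
    next
      case False
      obtain c where "cub P' y (?A *v t) (?A *v t') (s v* ?B) = cub P y t t' s v* ?B + c *\<^sub>R (s v* ?B)"
        using gauge_cub_pointwise[OF P P' p2 AB y False] by blast
      then have "C s = c *\<^sub>R s"
        by (simp add: C_def vector_matrix_simps vector_matrix_assoc BB' vector_mat_1)
      then show ?thesis by blast
    qed
  qed
  then have "cub P' y (?A *v t) (?A *v t') (s v* ?B) v* B' = cub P y t t' s" by (simp add: C_def)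
  then have "(cub P' y (?A *v t) (?A *v t') (s v* ?B) v* B') v* ?B = cub P y t t' s v* ?B" by simp
  then show ?thesis by (simp add: vector_matrix_assoc BB' vector_mat_1)
qed

theorem is_tensor_b1_alpha:
  assumes p2: "CARD('p::finite) = 2"
  shows "is_tensor (b1_alpha :: ('p, 'q::finite) prolonged_frame \<Rightarrow> _)"
proof -
  \<comment> \<open>The arguments are pulled back by the inverse matrices and the value is
    multiplied by B. Linearity in \<open>T\<close> holds for all A and B, whatever
    \<open>matrix_inv\<close> gives on singular matrices.\<close>
  define L :: "real^'p^'p \<Rightarrow> real^'q^'q \<Rightarrow> real^('q \<times> 'p \<times> 'p \<times> 'q \<times> 'q \<times> 'q) \<Rightarrow> real^('q \<times> 'p \<times> 'p \<times> 'q \<times> 'q \<times> 'q)" where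
    "L A B T = vec_lambda (\<lambda>(i, \<gamma>, \<delta>, j, k, l). (b1form T (matrix_inv A *v axis \<gamma> 1) (matrix_inv A *v axis \<delta> 1)
      (axis j 1 v* matrix_inv B) (axis k 1 v* matrix_inv B) (axis l 1 v* matrix_inv B) v* B) $ i)" for A B T
  have "linear (L A B)" for A B
    by (intro linearI) (auto simp: L_def vec_eq_iff b1form_add vector_matrix_simps)
  moreover have "b1_alpha P' y = L (A y) (B y) (b1_alpha P y)"
    if P: "prolonged_frame_over U P" and P': "prolonged_frame_over U P'"
      and AB: "\<forall>y\<in>U. invertible (A y) \<and> invertible (B y) \<and> (\<forall>v. frm_w P' y v = A y ** frm_w P y v ** B y)"
      and y: "y \<in> U" for U :: "(real^'q^'p) set" and P P' A B y
  proof -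
    define A' where "A' = matrix_inv (A y)"
    define B' where "B' = matrix_inv (B y)"
    have inv: "A y ** A' = mat 1" "B' ** B y = mat 1"
      using matrix_inv_both AB y by (auto simp: A'_def B'_def)
    have id: "object_identities_at P y" "object_identities_at P' y"
      using P P' y by (auto simp: prolonged_frame_over_def)
    have e: "b1form (b1_alpha P' y) t t' a b c - b1form (b1_alpha P y) (A' *v t) (A' *v t') (a v* B') (b v* B') (c v* B') v* B y = 0"
      for t t' a b c
    proof (rule trilinear_polarization[where f="\<lambda>a b c. b1form (b1_alpha P' y) t t' a b c
          - b1form (b1_alpha P y) (A' *v t) (A' *v t') (a v* B') (b v* B') (c v* B') v* B y"])
      fix a
      have "cub P' y (A y *v (A' *v t)) (A y *v (A' *v t')) ((a v* B') v* B y) = cub P y (A' *v t) (A' *v t') (a v* B') v* B y"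
        using AB by (intro cub_tensor[OF P P' p2 _ _ _ y]) auto
      then have "2 *\<^sub>R (b1form (b1_alpha P' y) t t' a a a
          - b1form (b1_alpha P y) (A' *v t) (A' *v t') (a v* B') (a v* B') (a v* B') v* B y) = 0"
        by (simp add: matrix_vector_mul_assoc inv vector_matrix_assoc vector_mat_1 cub_b1form[OF id(1)] cub_b1form[OF id(2)]
            scaleR_diff_right vector_matrix_simps)
      then show "b1form (b1_alpha P' y) t t' a a a
          - b1form (b1_alpha P y) (A' *v t) (A' *v t') (a v* B') (a v* B') (a v* B') v* B y = 0"
        by (simp only: scaleR_eq_0_iff) simp
    qed (simp_all add: b1form_add vector_matrix_simps b1form_sym[OF b1_alpha_sym, of P'] b1form_sym[OF b1_alpha_sym, of P])
    have "b1_alpha P' y $ (i, \<gamma>, \<delta>, j, k, l) = L (A y) (B y) (b1_alpha P y) $ (i, \<gamma>, \<delta>, j, k, l)" for i \<gamma> \<delta> j k l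
      using arg_cong[OF e[of "axis \<gamma> 1" "axis \<delta> 1" "axis j 1" "axis k 1" "axis l 1"], of "\<lambda>v. v $ i"]
      by (simp add: b1form_axis L_def A'_def B'_def)
    then show ?thesis by (auto simp: vec_eq_iff)
  qed
  ultimately show ?thesis
    unfolding is_tensor_def by (intro exI[of _ L] conjI) blast+
qed

section \<open>Existence of prolonged frames\<close>

context
  fixes T :: "'q::finite \<Rightarrow> 'p::finite \<Rightarrow> 'p \<Rightarrow> 'p \<Rightarrow> 'q \<Rightarrow> 'q \<Rightarrow> real"
begin

text \<open>The linear algebra of the torsion normalization: \<open>T\<close> is the torsion of an arbitrary
  connection, \<open>nr\<close> and \<open>nP\<close> are the trace-free corrections of the two components of the
  connection, and \<open>na\<close> is the normalized torsion.\<close>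

definition nt1 :: "'q \<Rightarrow> 'p \<Rightarrow> real" where
  "nt1 k \<gamma> = (\<Sigma> \<alpha> i. T i \<alpha> \<gamma> \<alpha> i k)"
definition nt2 :: "'q \<Rightarrow> 'p \<Rightarrow> real" where
  "nt2 k \<gamma> = (\<Sigma> \<alpha> i. T i \<alpha> \<gamma> \<alpha> k i)"
text \<open>\<open>nphi\<close> and \<open>npsi\<close> anticipate the second traces of
  \<open>nP\<close> and \<open>nr\<close>, which occur on the right-hand sides of the equations for
  these corrections. Their values are forced by the requirement that the first traces
  vanish.\<close>

definition nphi :: "'q \<Rightarrow> 'p \<Rightarrow> real" where
  "nphi k \<gamma> = 2 * (real CARD('p) * nt1 k \<gamma> + nt2 k \<gamma>) / (real CARD('p) + real CARD('q))"
definition npsi :: "'q \<Rightarrow> 'p \<Rightarrow> real" where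
  "npsi k \<gamma> = - (2 * (real CARD('q) * nt1 k \<gamma> - nt2 k \<gamma>)) / (real CARD('p) + real CARD('q))"
definition nX :: "'q \<Rightarrow> 'q \<Rightarrow> 'q \<Rightarrow> 'p \<Rightarrow> real" where
  "nX j k i \<gamma> = 2 * (\<Sigma> \<alpha>. T i \<alpha> \<gamma> \<alpha> j k) - (if i = k then nphi j \<gamma> else 0)"
text \<open>The trace condition on the torsion over the Greek indices reads p r_jk - r_kj = X_jk.
  Together with its exchange in j and k this is a 2 x 2 system of determinant p^2 - 1; the formula
  is its solution. \<open>nP\<close> solves the analogous system with q.\<close>

definition nr :: "'q \<Rightarrow> 'q \<Rightarrow> 'q \<Rightarrow> 'p \<Rightarrow> real" where
  "nr j k i \<gamma> = (real CARD('p) * nX j k i \<gamma> + nX k j i \<gamma>) / ((real CARD('p))\<^sup>2 - 1)"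
definition nY :: "'p \<Rightarrow> 'q \<Rightarrow> 'p \<Rightarrow> 'p \<Rightarrow> real" where
  "nY \<alpha> k \<beta> \<gamma> = - 2 * (\<Sigma> i. T i \<beta> \<gamma> \<alpha> i k) - (if \<alpha> = \<gamma> then npsi k \<beta> else 0)"
definition nP :: "'p \<Rightarrow> 'q \<Rightarrow> 'p \<Rightarrow> 'p \<Rightarrow> real" where
  "nP \<alpha> k \<beta> \<gamma> = (real CARD('q) * nY \<alpha> k \<beta> \<gamma> + nY \<alpha> k \<gamma> \<beta>) / ((real CARD('q))\<^sup>2 - 1)"
definition na :: "'q \<Rightarrow> 'p \<Rightarrow> 'p \<Rightarrow> 'p \<Rightarrow> 'q \<Rightarrow> 'q \<Rightarrow> real" where
  "na i \<beta> \<gamma> \<alpha> j k = T i \<beta> \<gamma> \<alpha> j k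
     - ((if \<alpha> = \<beta> then nr j k i \<gamma> else 0) - (if \<alpha> = \<gamma> then nr k j i \<beta> else 0)) / 2
     + ((if i = j then nP \<alpha> k \<beta> \<gamma> else 0) - (if i = k then nP \<alpha> j \<gamma> \<beta> else 0)) / 2"

context
  assumes p2: "CARD('p) \<ge> 2" and q2: "CARD('q) \<ge> 2"
    and skew: "\<And>i \<beta> \<gamma> \<alpha> j k. T i \<beta> \<gamma> \<alpha> j k = - T i \<gamma> \<beta> \<alpha> k j"
begin

lemma na_skew: "na i \<beta> \<gamma> \<alpha> j k = - na i \<gamma> \<beta> \<alpha> k j"
  using skew[of i \<beta> \<gamma> \<alpha> j k] by (auto simp: na_def field_simps)

lemma dims: "(real CARD('p))\<^sup>2 - 1 \<noteq> 0" "(real CARD('q))\<^sup>2 - 1 \<noteq> 0" "real CARD('p) + real CARD('q) \<noteq> 0"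
proof -
  have 1: "real CARD('p) \<ge> 2" "real CARD('q) \<ge> 2" using p2 q2 by simp_all
  then have "(real CARD('p))\<^sup>2 \<ge> 2\<^sup>2" "(real CARD('q))\<^sup>2 \<ge> 2\<^sup>2" by (intro power_mono; simp)+
  then show "(real CARD('p))\<^sup>2 - 1 \<noteq> 0" "(real CARD('q))\<^sup>2 - 1 \<noteq> 0" by simp_all
  show "real CARD('p) + real CARD('q) \<noteq> 0" using 1 by linarith
qed

text \<open>The second and third equations say that the first traces of \<open>nr\<close> and
  \<open>nP\<close> are zero; the first one makes the second traces agree with the anticipated
  values.\<close>

lemma phi_psi: "nphi k \<gamma> - 2 * nt1 k \<gamma> = npsi k \<gamma>"
  "real CARD('p) * (2 * nt1 k \<gamma> - nphi k \<gamma>) + (2 * nt2 k \<gamma> - real CARD('q) * nphi k \<gamma>) = 0"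
  "real CARD('q) * (- 2 * nt1 k \<gamma> - npsi k \<gamma>) + (2 * nt2 k \<gamma> - real CARD('p) * npsi k \<gamma>) = 0"
  using dims(3) by (simp_all add: nphi_def npsi_def field_simps)

lemma nX_traces: "(\<Sigma> i. nX i k i \<gamma>) = 2 * nt1 k \<gamma> - nphi k \<gamma>" (is ?th1)
  "(\<Sigma> i. nX k i i \<gamma>) = 2 * nt2 k \<gamma> - real CARD('q) * nphi k \<gamma>" (is ?th2)
proof -
  have "(\<Sigma> i \<alpha>. T i \<alpha> \<gamma> \<alpha> i k) = nt1 k \<gamma>" "(\<Sigma> i \<alpha>. T i \<alpha> \<gamma> \<alpha> k i) = nt2 k \<gamma>"
    unfolding nt1_def nt2_def by (rule sum.swap)+
  then show ?th1
    ?th2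
    by (simp_all add: nX_def sum_subtractf flip: sum_distrib_left)
qed

lemma nY_traces: "(\<Sigma> \<alpha>. nY \<alpha> k \<alpha> \<gamma>) = - 2 * nt1 k \<gamma> - npsi k \<gamma>" (is ?th1)
  "(\<Sigma> \<alpha>. nY \<alpha> k \<gamma> \<alpha>) = 2 * nt2 k \<gamma> - real CARD('p) * npsi k \<gamma>" (is ?th2)
proof -
  have 1: "(\<Sigma> \<alpha> i. T i \<gamma> \<alpha> \<alpha> i k) = - nt2 k \<gamma>"
    unfolding nt2_def sum_negf[symmetric] by (intro sum.cong refl skew)
  have 2: "(\<Sigma> \<alpha> i. T i \<alpha> \<gamma> \<alpha> i k) = nt1 k \<gamma>" by (simp add: nt1_def)
  show ?th1
    ?th2
    by (simp_all add: nY_def sum_subtractf sum_negf 1 2 flip: sum_distrib_left)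
qed

lemma nr_traces: "(\<Sigma> i. nr i k i \<gamma>) = 0" (is ?th1) "(\<Sigma> i. nr k i i \<gamma>) = npsi k \<gamma>" (is ?th2)
proof -
  have "(\<Sigma> i. nr i k i \<gamma>) * ((real CARD('p))\<^sup>2 - 1) = 0"
    using dims(1) phi_psi(2)[of k \<gamma>] nX_traces[of k \<gamma>]
    by (simp add: nr_def sum.distrib flip: sum_distrib_left sum_divide_distrib)
  then show ?th1 using dims(1) by simp
  have "(\<Sigma> i. nr k i i \<gamma>) * ((real CARD('p))\<^sup>2 - 1)
      = real CARD('p) * (2 * nt2 k \<gamma> - real CARD('q) * nphi k \<gamma>) + (2 * nt1 k \<gamma> - nphi k \<gamma>)"
    using dims(1) nX_traces[of k \<gamma>]
    by (simp add: nr_def sum.distrib flip: sum_distrib_left sum_divide_distrib)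
  also have "2 * nt2 k \<gamma> - real CARD('q) * nphi k \<gamma> = - (real CARD('p) * (2 * nt1 k \<gamma> - nphi k \<gamma>))"
    using phi_psi(2)[of k \<gamma>] by linarith
  also have "real CARD('p) * - (real CARD('p) * (2 * nt1 k \<gamma> - nphi k \<gamma>)) + (2 * nt1 k \<gamma> - nphi k \<gamma>)
      = npsi k \<gamma> * ((real CARD('p))\<^sup>2 - 1)"
    unfolding phi_psi(1)[symmetric] by (simp add: power2_eq_square algebra_simps)
  finally show ?th2 using dims(1) by simp
qed

lemma nP_traces: "(\<Sigma> \<alpha>. nP \<alpha> k \<alpha> \<gamma>) = 0" (is ?th1) "(\<Sigma> \<alpha>. nP \<alpha> k \<gamma> \<alpha>) = nphi k \<gamma>" (is ?th2)
proof -
  have "(\<Sigma> \<alpha>. nP \<alpha> k \<alpha> \<gamma>) * ((real CARD('q))\<^sup>2 - 1) = 0"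
    using dims(2) phi_psi(3)[of k \<gamma>] nY_traces[of k \<gamma>]
    by (simp add: nP_def sum.distrib flip: sum_distrib_left sum_divide_distrib)
  then show ?th1 using dims(2) by simp
  have "(\<Sigma> \<alpha>. nP \<alpha> k \<gamma> \<alpha>) * ((real CARD('q))\<^sup>2 - 1)
      = real CARD('q) * (2 * nt2 k \<gamma> - real CARD('p) * npsi k \<gamma>) + (- 2 * nt1 k \<gamma> - npsi k \<gamma>)"
    using dims(2) nY_traces[of k \<gamma>]
    by (simp add: nP_def sum.distrib flip: sum_distrib_left sum_divide_distrib)
  also have "2 * nt2 k \<gamma> - real CARD('p) * npsi k \<gamma> = - (real CARD('q) * (- 2 * nt1 k \<gamma> - npsi k \<gamma>))"
    using phi_psi(3)[of k \<gamma>] by linarith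
  also have "real CARD('q) * - (real CARD('q) * (- 2 * nt1 k \<gamma> - npsi k \<gamma>)) + (- 2 * nt1 k \<gamma> - npsi k \<gamma>)
      = nphi k \<gamma> * ((real CARD('q))\<^sup>2 - 1)"
    unfolding phi_psi(1)[symmetric] by (simp add: power2_eq_square algebra_simps)
  finally show ?th2 using dims(2) by simp
qed

lemma na_trace1: "(\<Sigma> \<alpha>. na i \<alpha> \<gamma> \<alpha> j k) = 0"
proof -
  have r: "real CARD('p) * nr j k i \<gamma> - nr k j i \<gamma> = nX j k i \<gamma>"
  proof -
    have "(real CARD('p) * nr j k i \<gamma> - nr k j i \<gamma>) * ((real CARD('p))\<^sup>2 - 1)
       = real CARD('p) * (real CARD('p) * nX j k i \<gamma> + nX k j i \<gamma>) - (real CARD('p) * nX k j i \<gamma> + nX j k i \<gamma>)"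
      using dims(1) by (simp add: nr_def left_diff_distrib)
    also have "\<dots> = nX j k i \<gamma> * ((real CARD('p))\<^sup>2 - 1)" by (simp add: power2_eq_square algebra_simps)
    finally show ?thesis using dims(1) by simp
  qed
  have "(\<Sigma> \<alpha>. na i \<alpha> \<gamma> \<alpha> j k) = (\<Sigma> \<alpha>. T i \<alpha> \<gamma> \<alpha> j k) - (real CARD('p) * nr j k i \<gamma> - nr k j i \<gamma>) / 2
      + ((if i = j then \<Sigma> \<alpha>. nP \<alpha> k \<alpha> \<gamma> else 0) - (if i = k then \<Sigma> \<alpha>. nP \<alpha> j \<gamma> \<alpha> else 0)) / 2"
    by (simp add: na_def sum.distrib sum_subtractf flip: sum_divide_distrib)
  also have "\<dots> = 0" unfolding nP_traces r by (simp add: nX_def field_simps)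
  finally show ?thesis .
qed

lemma na_trace2: "(\<Sigma> i. na i \<beta> \<gamma> \<alpha> i k) = 0"
proof -
  have r: "real CARD('q) * nP \<alpha> k \<beta> \<gamma> - nP \<alpha> k \<gamma> \<beta> = nY \<alpha> k \<beta> \<gamma>"
  proof -
    have "(real CARD('q) * nP \<alpha> k \<beta> \<gamma> - nP \<alpha> k \<gamma> \<beta>) * ((real CARD('q))\<^sup>2 - 1)
       = real CARD('q) * (real CARD('q) * nY \<alpha> k \<beta> \<gamma> + nY \<alpha> k \<gamma> \<beta>) - (real CARD('q) * nY \<alpha> k \<gamma> \<beta> + nY \<alpha> k \<beta> \<gamma>)"
      using dims(2) by (simp add: nP_def left_diff_distrib)
    also have "\<dots> = nY \<alpha> k \<beta> \<gamma> * ((real CARD('q))\<^sup>2 - 1)" by (simp add: power2_eq_square algebra_simps)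
    finally show ?thesis using dims(2) by simp
  qed
  have "(\<Sigma> i. na i \<beta> \<gamma> \<alpha> i k) = (\<Sigma> i. T i \<beta> \<gamma> \<alpha> i k)
      - ((if \<alpha> = \<beta> then \<Sigma> i. nr i k i \<gamma> else 0) - (if \<alpha> = \<gamma> then \<Sigma> i. nr k i i \<beta> else 0)) / 2
      + (real CARD('q) * nP \<alpha> k \<beta> \<gamma> - nP \<alpha> k \<gamma> \<beta>) / 2"
    by (simp add: na_def sum.distrib sum_subtractf flip: sum_divide_distrib)
  also have "\<dots> = 0" unfolding nr_traces r by (simp add: nY_def field_simps)
  finally show ?thesis .
qed

end

end

lemma bilinear_mat_expand:
  fixes f :: "real^'q::finite^'p::finite \<Rightarrow> real^'q^'p \<Rightarrow> 'a::real_vector"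
  assumes "bilinear f"
  shows "f z z' = (\<Sigma> \<beta> \<gamma> j k. (z $ \<beta> $ j * z' $ \<gamma> $ k) *\<^sub>R
     f (\<E> \<beta> j) (\<E> \<gamma> k))"
proof -
  have z: "z = (\<Sigma> \<beta> j. z $ \<beta> $ j *\<^sub>R \<E> \<beta> j)" for z :: "real^'q^'p"
    using mat_representation[of z] unfolding matE_def
    by (subst sum_pairs[symmetric, where f="\<lambda>\<beta> j. z $ \<beta> $ j *\<^sub>R \<E> \<beta> j"]) simp
  have l: "linear (f a)" "linear (\<lambda>a. f a b)" for a b using assms by (simp_all add: bilinear_def)
  have s1: "f a b = (\<Sigma> \<beta> j. a $ \<beta> $ j *\<^sub>R f (\<E> \<beta> j) b)" for a b
  proof -
    have "f a b = (\<lambda>a. f a b) (\<Sigma> \<beta> j. a $ \<beta> $ j *\<^sub>R \<E> \<beta> j)"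
      using z[of a] by simp
    also have "\<dots> = (\<Sigma> \<beta> j. a $ \<beta> $ j *\<^sub>R f (\<E> \<beta> j) b)"
      by (simp only: linear_sum[OF l(2)] linear_scale[OF l(2)])
    finally show ?thesis .
  qed
  have s2: "f a b = (\<Sigma> \<gamma> k. b $ \<gamma> $ k *\<^sub>R f a (\<E> \<gamma> k))" for a b
  proof -
    have "f a b = f a (\<Sigma> \<gamma> k. b $ \<gamma> $ k *\<^sub>R \<E> \<gamma> k)"
      using z[of b] by simp
    also have "\<dots> = (\<Sigma> \<gamma> k. b $ \<gamma> $ k *\<^sub>R f a (\<E> \<gamma> k))"
      by (simp only: linear_sum[OF l(1)] linear_scale[OF l(1)])
    finally show ?thesis .
  qed
  have "f z z' = (\<Sigma> \<beta> j \<gamma> k. (z $ \<beta> $ j * z' $ \<gamma> $ k) *\<^sub>R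
     f (\<E> \<beta> j) (\<E> \<gamma> k))"
    by (subst s1, subst s2) (simp only: scaleR_sum_right scaleR_scaleR)
  also have "\<dots> = (\<Sigma> \<beta> \<gamma> j k. (z $ \<beta> $ j * z' $ \<gamma> $ k) *\<^sub>R
     f (\<E> \<beta> j) (\<E> \<gamma> k))"
    by (rule sum.cong[OF refl]) (rule sum.swap)
  finally show ?thesis .
qed

text \<open>A skew form is recovered from half its components, since the structure equations sum over all
  ordered pairs of indices.\<close>

lemma skew_mat_expand:
  fixes f :: "real^'q::finite^'p::finite \<Rightarrow> real^'q^'p \<Rightarrow> real"
  assumes "bilinear f" "\<And>z z'. f z z' = - f z' z"
  shows "(\<Sigma> \<beta> \<gamma> j k.
     (f (\<E> \<beta> j) (\<E> \<gamma> k) / 2) * (z $ \<beta> $ j * z' $ \<gamma> $ k - z' $ \<beta> $ j * z $ \<gamma> $ k)) = f z z'"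
proof -
  have "(\<Sigma> \<beta> \<gamma> j k.
     (f (\<E> \<beta> j) (\<E> \<gamma> k) / 2) * (z $ \<beta> $ j * z' $ \<gamma> $ k - z' $ \<beta> $ j * z $ \<gamma> $ k))
    = f z z' / 2 - f z' z / 2"
    unfolding bilinear_mat_expand[OF assms(1), of z z'] bilinear_mat_expand[OF assms(1), of z' z]
    by (simp add: sum_divide_distrib sum_subtractf[symmetric] algebra_simps diff_divide_distrib)
  also have "f z' z = - f z z'" by (rule assms(2))
  finally show ?thesis by simp
qed

lemma skew_array_expand:
  fixes g :: "'p::finite \<Rightarrow> 'p \<Rightarrow> 'q::finite \<Rightarrow> 'q \<Rightarrow> real"
  assumes "\<And>\<beta> \<gamma> j k. g \<beta> \<gamma> j k = - g \<gamma> \<beta> k j"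
  shows "(\<Sigma> \<beta> \<gamma> j k. g \<beta> \<gamma> j k * (z $ \<beta> $ j * z' $ \<gamma> $ k - z' $ \<beta> $ j * z $ \<gamma> $ k))
    = 2 * (\<Sigma> \<beta> \<gamma> j k. g \<beta> \<gamma> j k * (z $ \<beta> $ j * z' $ \<gamma> $ k))"
proof -
  have "(\<Sigma> \<beta> \<gamma> j k. g \<beta> \<gamma> j k * (z' $ \<beta> $ j * z $ \<gamma> $ k))
      = (\<Sigma> \<beta> \<gamma> j k. g \<gamma> \<beta> k j * (z' $ \<gamma> $ k * z $ \<beta> $ j))"
    by (subst sum.swap, rule sum.cong[OF refl], rule sum.cong[OF refl], rule sum.swap)
  also have "\<dots> = - (\<Sigma> \<beta> \<gamma> j k. g \<beta> \<gamma> j k * (z $ \<beta> $ j * z' $ \<gamma> $ k))"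
    unfolding sum_negf[symmetric] by (intro sum.cong refl, subst assms) simp
  finally show ?thesis by (simp add: right_diff_distrib sum_subtractf)
qed

lemma bilinear_component2: "bilinear f \<Longrightarrow> bilinear (\<lambda>a b. f a b $ i $ j)"
  for f :: "_ \<Rightarrow> _ \<Rightarrow> real^'a^'b"
  unfolding bilinear_def by (simp add: linear_iff)

lemma sum_if_const: "(\<Sum>x\<in>A. if b then f x else 0) = (if b then \<Sum>x\<in>A. f x else 0)"
  by simp

locale coframe =
  fixes U :: "(real^'q::finite^'p::finite) set" and \<theta> :: "real^'q^'p \<Rightarrow> real^'q^'p \<Rightarrow> real^'q^'p"
  assumes open_U: "open U" and form_\<theta>: "smooth_form U \<theta>" and bij_\<theta>: "\<And>y. y \<in> U \<Longrightarrow> bij (\<theta> y)"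
    and dim_p: "CARD('p) \<ge> 2" and dim_q: "CARD('q) \<ge> 2"
begin

definition Y :: "real^'q^'p \<Rightarrow> 'p \<Rightarrow> 'q \<Rightarrow> real^'q^'p" where
  "Y y \<beta> j = inv (\<theta> y) (\<E> \<beta> j)"

lemma smooth_Y: "smooth_on U (\<lambda>y. Y y \<beta> j)"
  unfolding Y_def
  by (rule smooth_on_inv_family) (use form_\<theta> bij_\<theta> open_U in \<open>auto simp: smooth_form_def\<close>)

lemma skew_form_expand:
  fixes f :: "real^'q^'p \<Rightarrow> real^'q^'p \<Rightarrow> real"
  assumes y: "y \<in> U" and f: "bilinear f" "\<And>z z'. f z z' = - f z' z"
  shows "f u v = (\<Sigma> \<beta> \<gamma> j k.
     (f (Y y \<beta> j) (Y y \<gamma> k) / 2) * (\<theta> y u $ \<beta> $ j * \<theta> y v $ \<gamma> $ k - \<theta> y v $ \<beta> $ j * \<theta> y u $ \<gamma> $ k))"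
proof -
  have l: "linear (inv (\<theta> y))"
    using smooth_form_linear[OF form_\<theta> y] bij_\<theta>[OF y] by (metis bij_is_inj inj_linear_imp_inv_linear)
  have i: "inv (\<theta> y) (\<theta> y a) = a" for a using bij_\<theta>[OF y] by (simp add: bij_is_inj)
  have "bilinear (\<lambda>a b. f (inv (\<theta> y) a) (inv (\<theta> y) b))"
    unfolding bilinear_def
    by (auto intro!: linearI simp: linear_add[OF l] linear_scale[OF l] bilinear_ladd[OF f(1)] bilinear_radd[OF f(1)]
        bilinear_lmul[OF f(1)] bilinear_rmul[OF f(1)])
  from skew_mat_expand[OF this f(2), of "\<theta> y u" "\<theta> y v"] show ?thesis by (simp add: Y_def i)
qed

subsection \<open>Normalizing the torsion\<close>

text \<open>The torsion of the connection for which the coframe is parallel, that is, half the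
  components of its exterior derivative.\<close>

definition T0 :: "real^'q^'p \<Rightarrow> 'q \<Rightarrow> 'p \<Rightarrow> 'p \<Rightarrow> 'p \<Rightarrow> 'q \<Rightarrow> 'q \<Rightarrow> real" where
  "T0 y i \<beta> \<gamma> \<alpha> j k = vext_d \<theta> y (Y y \<beta> j) (Y y \<gamma> k) $ \<alpha> $ i / 2"

definition rho :: "real^'q^'p \<Rightarrow> real^'q^'p \<Rightarrow> real^'q^'q" where
  "rho y v = (\<chi> j i. \<Sigma> \<gamma> k. nr (T0 y) j k i \<gamma> * \<theta> y v $ \<gamma> $ k)"

definition pii :: "real^'q^'p \<Rightarrow> real^'q^'p \<Rightarrow> real^'p^'p" where
  "pii y v = (\<chi> \<alpha> \<beta>. \<Sigma> \<gamma> k. nP (T0 y) \<alpha> k \<beta> \<gamma> * \<theta> y v $ \<gamma> $ k)"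

definition Ta :: "real^'q^'p \<Rightarrow> real^('q \<times> 'p \<times> 'p \<times> 'p \<times> 'q \<times> 'q)" where
  "Ta y = vec_lambda (\<lambda>(i, \<beta>, \<gamma>, \<alpha>, j, k). na (T0 y) i \<beta> \<gamma> \<alpha> j k)"

lemma T0_skew: "T0 y i \<beta> \<gamma> \<alpha> j k = - T0 y i \<gamma> \<beta> \<alpha> k j"
  unfolding T0_def by (subst vext_d_skew) simp

lemma smooth_T0: "smooth_on U (\<lambda>y. T0 y i \<beta> \<gamma> \<alpha> j k)"
proof -
  have "smooth_on U (\<lambda>y. vext_d \<theta> y (Y y \<beta> j) (Y y \<gamma> k))"
    by (rule smooth_on_bilinear_family[OF open_U smooth_vext_d[OF open_U form_\<theta>] vext_d_bilinear[OF form_\<theta> open_U] smooth_Y smooth_Y])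
  then have "smooth_on U (\<lambda>y. (1/2) * vext_d \<theta> y (Y y \<beta> j) (Y y \<gamma> k) $ \<alpha> $ i)"
    by (intro smooth_on_mult smooth_on_const smooth_on_vec_nth open_U)
  then show ?thesis by (simp add: T0_def)
qed

lemma smooth_nr_nP: "smooth_on U (\<lambda>y. nr (T0 y) j k i \<gamma>)" (is ?th1) "smooth_on U (\<lambda>y. nP (T0 y) \<alpha> k \<beta> \<gamma>)" (is ?th2)
proof -
  note s = smooth_on_add[OF open_U] smooth_on_diff[OF open_U] smooth_on_mult[OF open_U smooth_on_const]
    smooth_on_minus[OF open_U] smooth_on_sum[OF open_U] smooth_T0 smooth_on_const
  have d: "smooth_on U (\<lambda>y. f y / c)" if "smooth_on U f" for f :: "_ \<Rightarrow> real" and c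
    using smooth_on_mult[OF open_U smooth_on_const that, of "1 / c"] by simp
  have i: "smooth_on U (\<lambda>y. if b then f y else 0)" if "smooth_on U f" for f :: "_ \<Rightarrow> real" and b
    using that by (cases b) simp_all
  have t: "smooth_on U (\<lambda>y. nt1 (T0 y) k \<gamma>)" "smooth_on U (\<lambda>y. nt2 (T0 y) k \<gamma>)" for k \<gamma>
    unfolding nt1_def nt2_def by (rule s | assumption)+
  have f: "smooth_on U (\<lambda>y. nphi (T0 y) k \<gamma>)" "smooth_on U (\<lambda>y. npsi (T0 y) k \<gamma>)" for k \<gamma>
    unfolding nphi_def npsi_def by (rule d t s | assumption)+
  have X: "smooth_on U (\<lambda>y. nX (T0 y) j k i \<gamma>)" "smooth_on U (\<lambda>y. nY (T0 y) \<alpha> k \<beta> \<gamma>)" for j k i \<alpha> \<beta> \<gamma>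
    unfolding nX_def nY_def by (rule i f s | assumption)+
  show ?th1 ?th2
    unfolding nr_def nP_def by (rule d X s | assumption)+
qed

lemma smooth_\<theta>_component: "smooth_on U (\<lambda>y. \<theta> y v $ \<alpha> $ i)"
  by (intro smooth_on_vec_nth open_U smooth_form_smooth[OF form_\<theta>])

lemma smooth_form_sum:
  fixes B :: "real^'q^'p \<Rightarrow> 'r::finite \<Rightarrow> 's::finite \<Rightarrow> 'p \<Rightarrow> 'q \<Rightarrow> real"
  assumes "\<And>r s \<gamma> k. smooth_on U (\<lambda>y. B y r s \<gamma> k)"
  shows "smooth_form U (\<lambda>y v. (\<chi> r s. \<Sigma> \<gamma> k. B y r s \<gamma> k * \<theta> y v $ \<gamma> $ k))"
  unfolding smooth_form_def
proof (intro conjI allI ballI)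
  fix v show "smooth_on U (\<lambda>y. (\<chi> r s. \<Sigma> \<gamma> k. B y r s \<gamma> k * \<theta> y v $ \<gamma> $ k) :: real^'s^'r)"
    by (rule smooth_on_vec[OF open_U], rule smooth_on_vec[OF open_U], simp only: vec_lambda_beta)
      (intro smooth_on_sum smooth_on_mult open_U assms smooth_\<theta>_component)
next
  fix y assume "y \<in> U"
  then have "linear (\<theta> y)" using form_\<theta> smooth_form_linear by blast
  then show "linear (\<lambda>v. (\<chi> r s. \<Sigma> \<gamma> k. B y r s \<gamma> k * \<theta> y v $ \<gamma> $ k) :: real^'s^'r)"
    by (intro linearI) (simp_all add: vec_eq_iff linear_add linear_scale algebra_simps sum.distrib sum_distrib_left)
qed

lemma form_rho: "smooth_form U rho" and form_pii: "smooth_form U pii"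
  unfolding rho_def[abs_def] pii_def[abs_def] by (intro smooth_form_sum smooth_nr_nP)+

lemma trace_rho: "trace (rho y v) = 0"
proof -
  have "trace (rho y v) = (\<Sigma> \<gamma> k. (\<Sigma> i. nr (T0 y) i k i \<gamma>) * \<theta> y v $ \<gamma> $ k)"
    unfolding trace_def rho_def
    by (simp add: sum_distrib_right) (subst sum.swap, rule sum.cong[OF refl], rule sum.swap)
  then show ?thesis using nr_traces(1)[OF dim_p dim_q T0_skew] by simp
qed

lemma trace_pii: "trace (pii y v) = 0"
proof -
  have "trace (pii y v) = (\<Sigma> \<gamma> k. (\<Sigma> \<alpha>. nP (T0 y) \<alpha> k \<alpha> \<gamma>) * \<theta> y v $ \<gamma> $ k)"
    unfolding trace_def pii_def
    by (simp add: sum_distrib_right) (subst sum.swap, rule sum.cong[OF refl], rule sum.swap)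
  then show ?thesis using nP_traces(1)[OF dim_p dim_q T0_skew] by simp
qed

lemma first_structure_equation:
  assumes y: "y \<in> U"
  shows "vext_d \<theta> y u v $ \<alpha> $ i = ((\<theta> y u ** rho y v - \<theta> y v ** rho y u) + (pii y u ** \<theta> y v - pii y v ** \<theta> y u)) $ \<alpha> $ i
    + (\<Sigma> \<beta> \<gamma> j k. na (T0 y) i \<beta> \<gamma> \<alpha> j k *
        (\<theta> y u $ \<beta> $ j * \<theta> y v $ \<gamma> $ k - \<theta> y v $ \<beta> $ j * \<theta> y u $ \<gamma> $ k))"
proof -
  define z where "z = \<theta> y u"
  define z' where "z' = \<theta> y v"
  define S where "S f = (\<Sigma> \<beta> \<gamma> j k. f \<beta> \<gamma> j k * (z $ \<beta> $ j * z' $ \<gamma> $ k))"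
    for f :: "'p \<Rightarrow> 'p \<Rightarrow> 'q \<Rightarrow> 'q \<Rightarrow> real"
  have bl: "bilinear (\<lambda>a b. vext_d \<theta> y a b $ \<alpha> $ i)"
    by (rule bilinear_component2, rule vext_d_bilinear[OF form_\<theta> open_U y])
  have 1: "vext_d \<theta> y u v $ \<alpha> $ i = 2 * S (\<lambda>\<beta> \<gamma> j k. T0 y i \<beta> \<gamma> \<alpha> j k)"
    unfolding S_def z_def z'_def T0_def[symmetric]
    by (subst skew_form_expand[OF y bl], subst vext_d_skew, simp, unfold T0_def[symmetric],
      rule skew_array_expand, rule T0_skew)
  have 2: "(\<Sigma> \<beta> \<gamma> j k. na (T0 y) i \<beta> \<gamma> \<alpha> j k *
        (z $ \<beta> $ j * z' $ \<gamma> $ k - z' $ \<beta> $ j * z $ \<gamma> $ k)) = 2 * S (\<lambda>\<beta> \<gamma> j k. na (T0 y) i \<beta> \<gamma> \<alpha> j k)"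
    unfolding S_def by (rule skew_array_expand, rule na_skew[OF dim_p dim_q T0_skew])
  have 3: "S (\<lambda>\<beta> \<gamma> j k. na (T0 y) i \<beta> \<gamma> \<alpha> j k) = S (\<lambda>\<beta> \<gamma> j k. T0 y i \<beta> \<gamma> \<alpha> j k)
     - (S (\<lambda>\<beta> \<gamma> j k. if \<alpha> = \<beta> then nr (T0 y) j k i \<gamma> else 0) - S (\<lambda>\<beta> \<gamma> j k. if \<alpha> = \<gamma> then nr (T0 y) k j i \<beta> else 0)) / 2
     + (S (\<lambda>\<beta> \<gamma> j k. if i = j then nP (T0 y) \<alpha> k \<beta> \<gamma> else 0) - S (\<lambda>\<beta> \<gamma> j k. if i = k then nP (T0 y) \<alpha> j \<gamma> \<beta> else 0)) / 2"
    unfolding S_def na_def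
    by (simp add: left_diff_distrib distrib_right sum.distrib sum_subtractf sum_divide_distrib[symmetric] diff_divide_distrib)
  have 4: "S (\<lambda>\<beta> \<gamma> j k. if \<alpha> = \<beta> then nr (T0 y) j k i \<gamma> else 0) = (z ** rho y v) $ \<alpha> $ i"
  proof -
    have "(z ** rho y v) $ \<alpha> $ i = (\<Sigma> j \<gamma> k. nr (T0 y) j k i \<gamma> * (z $ \<alpha> $ j * z' $ \<gamma> $ k))"
      by (simp add: matrix_matrix_mult_def rho_def z'_def sum_distrib_left mult_ac)
    also have "\<dots> = (\<Sigma> \<gamma> j k. nr (T0 y) j k i \<gamma> * (z $ \<alpha> $ j * z' $ \<gamma> $ k))"
      by (rule sum.swap)
    finally show ?thesis unfolding S_def
      by (simp add: if_distrib[of "\<lambda>x. x * _"] sum_if_const cong: if_cong)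
  qed
  have 5: "S (\<lambda>\<beta> \<gamma> j k. if \<alpha> = \<gamma> then nr (T0 y) k j i \<beta> else 0) = (z' ** rho y u) $ \<alpha> $ i"
  proof -
    have "(z' ** rho y u) $ \<alpha> $ i = (\<Sigma> k \<beta> j. nr (T0 y) k j i \<beta> * (z $ \<beta> $ j * z' $ \<alpha> $ k))"
      by (simp add: matrix_matrix_mult_def rho_def z_def sum_distrib_left mult_ac)
    also have "\<dots> = (\<Sigma> \<beta> k j. nr (T0 y) k j i \<beta> * (z $ \<beta> $ j * z' $ \<alpha> $ k))"
      by (rule sum.swap)
    also have "\<dots> = (\<Sigma> \<beta> j k. nr (T0 y) k j i \<beta> * (z $ \<beta> $ j * z' $ \<alpha> $ k))"
      by (rule sum.cong[OF refl], rule sum.swap)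
    finally show ?thesis unfolding S_def
      by (simp add: if_distrib[of "\<lambda>x. x * _"] sum_if_const cong: if_cong)
  qed
  have 6: "S (\<lambda>\<beta> \<gamma> j k. if i = j then nP (T0 y) \<alpha> k \<beta> \<gamma> else 0) = (pii y v ** z) $ \<alpha> $ i"
  proof -
    have "(pii y v ** z) $ \<alpha> $ i = (\<Sigma> \<beta> \<gamma> k. nP (T0 y) \<alpha> k \<beta> \<gamma> * (z $ \<beta> $ i * z' $ \<gamma> $ k))"
      by (simp add: matrix_matrix_mult_def pii_def z'_def sum_distrib_left sum_distrib_right mult_ac)
    then show ?thesis unfolding S_def
      by (simp add: if_distrib[of "\<lambda>x. x * _"] sum_if_const cong: if_cong)
  qed
  have 7: "S (\<lambda>\<beta> \<gamma> j k. if i = k then nP (T0 y) \<alpha> j \<gamma> \<beta> else 0) = (pii y u ** z') $ \<alpha> $ i"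
  proof -
    have "(pii y u ** z') $ \<alpha> $ i = (\<Sigma> \<gamma> \<beta> j. nP (T0 y) \<alpha> j \<gamma> \<beta> * (z $ \<beta> $ j * z' $ \<gamma> $ i))"
      by (simp add: matrix_matrix_mult_def pii_def z_def sum_distrib_left sum_distrib_right mult_ac)
    also have "\<dots> = (\<Sigma> \<beta> \<gamma> j. nP (T0 y) \<alpha> j \<gamma> \<beta> * (z $ \<beta> $ j * z' $ \<gamma> $ i))"
      by (rule sum.swap)
    finally show ?thesis unfolding S_def
      by (simp add: if_distrib[of "\<lambda>x. x * _"] sum_if_const cong: if_cong)
  qed
  show ?thesis
    unfolding 1 z_def[symmetric] z'_def[symmetric] 2 3 4 5 6 7 by (simp add: field_simps)
qed

end

lemma trace_commute3: "trace (A ** B ** C) = trace (B ** C ** A)"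
  for A :: "real^'b^'a" and B :: "real^'c^'b" and C :: "real^'a^'c"
  unfolding matrix_mul_assoc[symmetric] by (subst trace_mul_sym) (simp add: matrix_mul_assoc)

context coframe
begin

subsection \<open>Normalizing the curvature\<close>

abbreviation "R1 \<equiv> curvature rho"
abbreviation "R2 \<equiv> curvature pii"

definition r1 :: "real^'q^'p \<Rightarrow> 'q \<Rightarrow> 'p \<Rightarrow> 'p \<Rightarrow> 'q \<Rightarrow> 'q \<Rightarrow> 'q \<Rightarrow> real" where
  "r1 y i \<gamma> \<delta> j k l = R1 y (Y y \<gamma> k) (Y y \<delta> l) $ j $ i / 2"

definition r2 :: "real^'q^'p \<Rightarrow> 'p \<Rightarrow> 'p \<Rightarrow> 'p \<Rightarrow> 'p \<Rightarrow> 'q \<Rightarrow> 'q \<Rightarrow> real" where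
  "r2 y \<beta> \<gamma> \<delta> \<alpha> k l = R2 y (Y y \<gamma> k) (Y y \<delta> l) $ \<alpha> $ \<beta> / 2"

text \<open>The contraction of the curvatures whose part symmetric under exchange of index pairs,
  \<open>SRic\<close>, is to be normalized to zero by the choice of \<nu>.\<close>

definition Ric :: "real^'q^'p \<Rightarrow> 'p \<Rightarrow> 'p \<Rightarrow> 'q \<Rightarrow> 'q \<Rightarrow> real" where
  "Ric y \<gamma> \<delta> k l = (\<Sigma> \<alpha>. r2 y \<gamma> \<alpha> \<delta> \<alpha> k l) - (\<Sigma> i. r1 y i \<gamma> \<delta> k i l)"

definition SRic :: "real^'q^'p \<Rightarrow> 'p \<Rightarrow> 'p \<Rightarrow> 'q \<Rightarrow> 'q \<Rightarrow> real" where
  "SRic y \<gamma> \<delta> k l = Ric y \<gamma> \<delta> k l + Ric y \<delta> \<gamma> l k"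

text \<open>The coefficient of the \<nu>-terms in both curvature equations once the trace terms
  vanish.\<close>

definition c0 :: real where
  "c0 = real CARD('p) * real CARD('q) / (real CARD('p) + real CARD('q))"

text \<open>With m = p + q, the \<nu>-terms change \<open>SRic\<close> by c0 (m N_gd - 2 N_dg),
  where N_gd and N_dg differ by exchange of the Greek indices. The system in these two unknowns has
  determinant m^2 - 4, and this is the solution that cancels \<open>SRic\<close>.\<close>

definition Nc :: "real^'q^'p \<Rightarrow> 'p \<Rightarrow> 'p \<Rightarrow> 'q \<Rightarrow> 'q \<Rightarrow> real" where
  "Nc y \<gamma> \<delta> k l = - ((real CARD('p) + real CARD('q)) * SRic y \<gamma> \<delta> k l + 2 * SRic y \<delta> \<gamma> k l)
     / (c0 * ((real CARD('p) + real CARD('q))\<^sup>2 - 4))"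

definition nu :: "real^'q^'p \<Rightarrow> real^'q^'p \<Rightarrow> real^'p^'q" where
  "nu y v = (\<chi> k \<gamma>. \<Sigma> \<delta> l. Nc y \<gamma> \<delta> k l * \<theta> y v $ \<delta> $ l)"

text \<open>The curvature coefficients left after the \<nu>-terms are moved to the other side of the
  structure equation; likewise \<open>b2c\<close>.\<close>

definition b1c :: "real^'q^'p \<Rightarrow> 'q \<Rightarrow> 'p \<Rightarrow> 'p \<Rightarrow> 'q \<Rightarrow> 'q \<Rightarrow> 'q \<Rightarrow> real" where
  "b1c y i \<gamma> \<delta> j k l = r1 y i \<gamma> \<delta> j k l
     + c0 / 2 * ((if i = l then Nc y \<delta> \<gamma> j k else 0) - (if i = k then Nc y \<gamma> \<delta> j l else 0))"

definition b2c :: "real^'q^'p \<Rightarrow> 'p \<Rightarrow> 'p \<Rightarrow> 'p \<Rightarrow> 'p \<Rightarrow> 'q \<Rightarrow> 'q \<Rightarrow> real" where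
  "b2c y \<beta> \<gamma> \<delta> \<alpha> k l = r2 y \<beta> \<gamma> \<delta> \<alpha> k l
     + c0 / 2 * ((if \<alpha> = \<gamma> then Nc y \<beta> \<delta> k l else 0) - (if \<alpha> = \<delta> then Nc y \<beta> \<gamma> l k else 0))"

lemma r_skew: "r1 y i \<gamma> \<delta> j k l = - r1 y i \<delta> \<gamma> j l k" "r2 y \<beta> \<gamma> \<delta> \<alpha> k l = - r2 y \<beta> \<delta> \<gamma> \<alpha> l k"
  unfolding r1_def r2_def
  using curvature_skew[of rho y "Y y \<gamma> k" "Y y \<delta> l"] curvature_skew[of pii y "Y y \<gamma> k" "Y y \<delta> l"] by simp_all

lemma trace_r:
  assumes y: "y \<in> U"
  shows "(\<Sigma> i. r1 y i \<gamma> \<delta> i k l) = 0" (is ?th1) "(\<Sigma> \<alpha>. r2 y \<alpha> \<gamma> \<delta> \<alpha> k l) = 0" (is ?th2)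
proof -
  have "trace (R1 y u v) = 0" "trace (R2 y u v) = 0" for u v
    by (intro trace_curvature[OF open_U y] form_rho form_pii trace_rho trace_pii)+
  then show ?th1 ?th2
    by (simp_all add: r1_def r2_def trace_def flip: sum_divide_distrib)
qed

lemma Nc_sym: "Nc y \<gamma> \<delta> k l = Nc y \<delta> \<gamma> l k"
  by (simp add: Nc_def SRic_def add.commute)

lemma dim_facts: "c0 \<noteq> 0" "(real CARD('p) + real CARD('q))\<^sup>2 - 4 \<noteq> 0"
proof -
  have 1: "real CARD('p) \<ge> 2" "real CARD('q) \<ge> 2" using dim_p dim_q by simp_all
  then have "(real CARD('p) + real CARD('q))\<^sup>2 \<ge> 4\<^sup>2" by (intro power_mono) simp_all
  then show "(real CARD('p) + real CARD('q))\<^sup>2 - 4 \<noteq> 0" by simp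
  show "c0 \<noteq> 0" using 1 by (simp add: c0_def)
qed

lemma b_skew: "b1c y i \<gamma> \<delta> j k l = - b1c y i \<delta> \<gamma> j l k" "b2c y \<beta> \<gamma> \<delta> \<alpha> k l = - b2c y \<beta> \<delta> \<gamma> \<alpha> l k"
  unfolding b1c_def b2c_def using r_skew(1)[of y i \<gamma> \<delta> j k l] r_skew(2)[of y \<beta> \<gamma> \<delta> \<alpha> k l]
  by (simp_all add: right_diff_distrib)

lemma b_traces:
  assumes y: "y \<in> U"
  shows "(\<Sigma> i. b1c y i \<gamma> \<delta> i k l) = 0" "(\<Sigma> \<alpha>. b2c y \<alpha> \<gamma> \<delta> \<alpha> k l) = 0"
  unfolding b1c_def b2c_def
  by (simp_all add: sum.distrib sum_subtractf trace_r[OF y] Nc_sym[of y \<delta> \<gamma>] flip: sum_distrib_left sum_divide_distrib)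

lemma b_ricci:
  "(\<Sigma> \<alpha>. b2c y \<gamma> \<alpha> \<delta> \<alpha> k l) - (\<Sigma> i. b1c y i \<gamma> \<delta> k i l)
   + (\<Sigma> \<alpha>. b2c y \<delta> \<alpha> \<gamma> \<alpha> l k) - (\<Sigma> i. b1c y i \<delta> \<gamma> l i k) = 0"
proof -
  have 1: "(\<Sigma> \<alpha>. b2c y \<gamma> \<alpha> \<delta> \<alpha> k l) - (\<Sigma> i. b1c y i \<gamma> \<delta> k i l)
     = Ric y \<gamma> \<delta> k l + c0 / 2 * ((real CARD('p) + real CARD('q)) * Nc y \<gamma> \<delta> k l - 2 * Nc y \<delta> \<gamma> k l)" for \<gamma> \<delta> k l
    unfolding b1c_def b2c_def Ric_def
    by (simp add: sum.distrib sum_subtractf Nc_sym[of y \<gamma> \<delta> l k] flip: sum_distrib_left sum_divide_distrib) (simp add: field_simps)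
  have 2: "SRic y \<gamma> \<delta> k l + c0 * ((real CARD('p) + real CARD('q)) * Nc y \<gamma> \<delta> k l - 2 * Nc y \<delta> \<gamma> k l) = 0"
  proof -
    define m where "m = real CARD('p) + real CARD('q)"
    define r s where "r = SRic y \<gamma> \<delta> k l" and "s = SRic y \<delta> \<gamma> k l"
    have m: "m\<^sup>2 - 4 \<noteq> 0" using dim_facts(2) by (simp add: m_def)
    have "c0 * (m * Nc y \<gamma> \<delta> k l - 2 * Nc y \<delta> \<gamma> k l) = - r"
    proof -
      have "c0 * Nc y \<gamma> \<delta> k l = - (m * r + 2 * s) / (m\<^sup>2 - 4)" "c0 * Nc y \<delta> \<gamma> k l = - (m * s + 2 * r) / (m\<^sup>2 - 4)"
        using dim_facts(1) unfolding Nc_def m_def[symmetric] r_def[symmetric] s_def[symmetric] by simp_all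
      moreover have "c0 * (m * Nc y \<gamma> \<delta> k l - 2 * Nc y \<delta> \<gamma> k l) = m * (c0 * Nc y \<gamma> \<delta> k l) - 2 * (c0 * Nc y \<delta> \<gamma> k l)"
        by (simp add: algebra_simps)
      ultimately have "c0 * (m * Nc y \<gamma> \<delta> k l - 2 * Nc y \<delta> \<gamma> k l) = (m * - (m * r + 2 * s) + 2 * (m * s + 2 * r)) / (m\<^sup>2 - 4)"
        by (simp only: times_divide_eq_right diff_divide_distrib[symmetric]) simp
      also have "m * - (m * r + 2 * s) + 2 * (m * s + 2 * r) = - r * (m\<^sup>2 - 4)" by (simp add: power2_eq_square algebra_simps)
      finally show ?thesis using m by simp
    qed
    then show ?thesis by (simp add: m_def r_def)
  qed
  show ?thesis
    unfolding add_diff_eq[symmetric] 1 using 2 Nc_sym[of y \<gamma> \<delta> k l] Nc_sym[of y \<delta> \<gamma> k l]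
    by (simp add: SRic_def algebra_simps)
qed

lemma smooth_r: "smooth_on U (\<lambda>y. r1 y i \<gamma> \<delta> j k l)" (is ?th1) "smooth_on U (\<lambda>y. r2 y \<beta> \<gamma> \<delta> \<alpha> k l)" (is ?th2)
proof -
  have e: "smooth_on U (\<lambda>y. \<beta> y (Y y \<gamma> k))" if "smooth_form U \<beta>" for \<beta> :: "_ \<Rightarrow> _ \<Rightarrow> 'z::real_normed_vector" and \<gamma> k
    by (rule smooth_form_compose[OF that open_U smooth_on_id _ smooth_Y]) simp
  have d: "smooth_on U (\<lambda>y. vext_d \<beta> y (Y y \<gamma> k) (Y y \<delta> l))" if "smooth_form U \<beta>" for \<beta> :: "_ \<Rightarrow> _ \<Rightarrow> 'z::real_normed_vector" and \<gamma> k \<delta> l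
    by (rule smooth_on_bilinear_family[OF open_U smooth_vext_d[OF open_U that] vext_d_bilinear[OF that open_U] smooth_Y smooth_Y])
  have c: "smooth_on U (\<lambda>y. (1/2) * f y $ i $ j)" if "smooth_on U f" for f :: "_ \<Rightarrow> real^'a^'b" and i j
    by (intro smooth_on_mult smooth_on_const smooth_on_vec_nth open_U that)
  have m: "smooth_on U (\<lambda>y. f y ** g y - g y ** f y)" if "smooth_on U f" "smooth_on U g" for f g :: "_ \<Rightarrow> real^'a^'a"
    by (intro smooth_on_diff smooth_on_bilinear[OF open_U bounded_bilinear_mm] open_U that)
  have "smooth_on U (\<lambda>y. R1 y (Y y \<gamma> k) (Y y \<delta> l))" "smooth_on U (\<lambda>y. R2 y (Y y \<gamma> k) (Y y \<delta> l))"
    unfolding curvature_def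
    by (rule smooth_on_diff[OF open_U d[OF form_rho] m[OF e[OF form_rho] e[OF form_rho]]]
       smooth_on_diff[OF open_U d[OF form_pii] m[OF e[OF form_pii] e[OF form_pii]]])+
  from c[OF this(1)] c[OF this(2)]
  show ?th1 ?th2
    by (simp_all add: r1_def r2_def)
qed

lemma form_nu: "smooth_form U nu"
proof -
  have R: "smooth_on U (\<lambda>y. Ric y \<gamma> \<delta> k l)" for \<gamma> \<delta> k l
    unfolding Ric_def by (intro smooth_on_diff smooth_on_sum smooth_r open_U)
  have S: "smooth_on U (\<lambda>y. SRic y \<gamma> \<delta> k l)" for \<gamma> \<delta> k l
    unfolding SRic_def by (intro smooth_on_add R open_U)
  have d: "smooth_on U (\<lambda>y. f y / c)" if "smooth_on U f" for f :: "_ \<Rightarrow> real" and c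
    using smooth_on_mult[OF open_U smooth_on_const that, of "1 / c"] by simp
  have "smooth_on U (\<lambda>y. Nc y \<gamma> \<delta> k l)" for \<gamma> \<delta> k l
    unfolding Nc_def by (intro d smooth_on_minus smooth_on_add smooth_on_mult smooth_on_const S open_U)
  then show ?thesis unfolding nu_def[abs_def] by (intro smooth_form_sum)
qed

text \<open>With the homothety form zero, the fourth structure equation demands exactly this
  symmetry; it follows from the symmetry of \<open>Nc\<close> in its index pairs.\<close>

lemma trace_nu_sym: "trace (nu y u ** \<theta> y v) = trace (nu y v ** \<theta> y u)"
proof -
  have e: "trace (nu y u ** \<theta> y v) = (\<Sigma> \<gamma> \<delta> k l. Nc y \<gamma> \<delta> k l * (\<theta> y u $ \<delta> $ l * \<theta> y v $ \<gamma> $ k))" for u v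
  proof -
    have "trace (nu y u ** \<theta> y v) = (\<Sigma> k \<gamma> \<delta> l. Nc y \<gamma> \<delta> k l * (\<theta> y u $ \<delta> $ l * \<theta> y v $ \<gamma> $ k))"
      by (simp add: trace_def matrix_matrix_mult_def nu_def sum_distrib_left mult_ac)
    also have "\<dots> = (\<Sigma> \<gamma> k \<delta> l. Nc y \<gamma> \<delta> k l * (\<theta> y u $ \<delta> $ l * \<theta> y v $ \<gamma> $ k))"
      by (rule sum.swap)
    also have "\<dots> = (\<Sigma> \<gamma> \<delta> k l. Nc y \<gamma> \<delta> k l * (\<theta> y u $ \<delta> $ l * \<theta> y v $ \<gamma> $ k))"
      by (rule sum.cong[OF refl], rule sum.swap)
    finally show ?thesis .
  qed
  have "trace (nu y u ** \<theta> y v) = (\<Sigma> \<delta> \<gamma> k l. Nc y \<gamma> \<delta> k l * (\<theta> y u $ \<delta> $ l * \<theta> y v $ \<gamma> $ k))"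
    unfolding e by (rule sum.swap)
  also have "\<dots> = (\<Sigma> \<delta> \<gamma> l k. Nc y \<gamma> \<delta> k l * (\<theta> y u $ \<delta> $ l * \<theta> y v $ \<gamma> $ k))"
    by (rule sum.cong[OF refl], rule sum.cong[OF refl], rule sum.swap)
  also have "\<dots> = (\<Sigma> \<delta> \<gamma> l k. Nc y \<delta> \<gamma> l k * (\<theta> y v $ \<gamma> $ k * \<theta> y u $ \<delta> $ l))"
    by (rule sum.cong[OF refl])+ (subst Nc_sym, simp add: mult.commute)
  finally show ?thesis unfolding e .
qed

lemma curvature_equations:
  assumes y: "y \<in> U"
  shows "R1 y u v $ j $ i = - (c0 *\<^sub>R (nu y u ** \<theta> y v - nu y v ** \<theta> y u)) $ j $ i
     + (\<Sigma> \<gamma> \<delta> k l. b1c y i \<gamma> \<delta> j k l *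
        (\<theta> y u $ \<gamma> $ k * \<theta> y v $ \<delta> $ l - \<theta> y v $ \<gamma> $ k * \<theta> y u $ \<delta> $ l))" (is ?th1)
    and "R2 y u v $ \<alpha> $ \<beta> = - (c0 *\<^sub>R (\<theta> y u ** nu y v - \<theta> y v ** nu y u)) $ \<alpha> $ \<beta>
     + (\<Sigma> \<gamma> \<delta> k l. b2c y \<beta> \<gamma> \<delta> \<alpha> k l *
        (\<theta> y u $ \<gamma> $ k * \<theta> y v $ \<delta> $ l - \<theta> y v $ \<gamma> $ k * \<theta> y u $ \<delta> $ l))" (is ?th2)
proof -
  define z where "z = \<theta> y u"
  define z' where "z' = \<theta> y v"
  define S where "S f = (\<Sigma> \<beta> \<gamma> j k. f \<beta> \<gamma> j k * (z $ \<beta> $ j * z' $ \<gamma> $ k))"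
    for f :: "'p \<Rightarrow> 'p \<Rightarrow> 'q \<Rightarrow> 'q \<Rightarrow> real"
  have 1: "R1 y u v $ j $ i = 2 * S (\<lambda>\<gamma> \<delta> k l. r1 y i \<gamma> \<delta> j k l)" "R2 y u v $ \<alpha> $ \<beta> = 2 * S (\<lambda>\<gamma> \<delta> k l. r2 y \<beta> \<gamma> \<delta> \<alpha> k l)"
    unfolding S_def z_def z'_def
    by (subst skew_form_expand[OF y bilinear_component2[OF bilinear_curvature[OF open_U form_rho y]]], subst curvature_skew, simp, unfold r1_def[symmetric],
       rule skew_array_expand, rule r_skew,
       subst skew_form_expand[OF y bilinear_component2[OF bilinear_curvature[OF open_U form_pii y]]], subst curvature_skew, simp, unfold r2_def[symmetric],
       rule skew_array_expand, rule r_skew)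
  have 2: "(\<Sigma> \<gamma> \<delta> k l. b1c y i \<gamma> \<delta> j k l * (z $ \<gamma> $ k * z' $ \<delta> $ l - z' $ \<gamma> $ k * z $ \<delta> $ l))
      = 2 * S (\<lambda>\<gamma> \<delta> k l. b1c y i \<gamma> \<delta> j k l)"
    "(\<Sigma> \<gamma> \<delta> k l. b2c y \<beta> \<gamma> \<delta> \<alpha> k l * (z $ \<gamma> $ k * z' $ \<delta> $ l - z' $ \<gamma> $ k * z $ \<delta> $ l))
      = 2 * S (\<lambda>\<gamma> \<delta> k l. b2c y \<beta> \<gamma> \<delta> \<alpha> k l)"
    unfolding S_def by (rule skew_array_expand, rule b_skew)+
  have 3: "S (\<lambda>\<gamma> \<delta> k l. b1c y i \<gamma> \<delta> j k l) = S (\<lambda>\<gamma> \<delta> k l. r1 y i \<gamma> \<delta> j k l)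
     + c0 / 2 * (S (\<lambda>\<gamma> \<delta> k l. if i = l then Nc y \<delta> \<gamma> j k else 0) - S (\<lambda>\<gamma> \<delta> k l. if i = k then Nc y \<gamma> \<delta> j l else 0))"
    "S (\<lambda>\<gamma> \<delta> k l. b2c y \<beta> \<gamma> \<delta> \<alpha> k l) = S (\<lambda>\<gamma> \<delta> k l. r2 y \<beta> \<gamma> \<delta> \<alpha> k l)
     + c0 / 2 * (S (\<lambda>\<gamma> \<delta> k l. if \<alpha> = \<gamma> then Nc y \<beta> \<delta> k l else 0) - S (\<lambda>\<gamma> \<delta> k l. if \<alpha> = \<delta> then Nc y \<beta> \<gamma> l k else 0))"
    unfolding S_def b1c_def b2c_def
    by (simp_all only: distrib_right left_diff_distrib right_diff_distrib sum.distrib sum_subtractf mult.assoc sum_distrib_left)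
  have 4: "S (\<lambda>\<gamma> \<delta> k l. if i = l then Nc y \<delta> \<gamma> j k else 0) = (nu y u ** z') $ j $ i"
  proof -
    have "(nu y u ** z') $ j $ i = (\<Sigma> \<delta> \<gamma> k. Nc y \<delta> \<gamma> j k * (z $ \<gamma> $ k * z' $ \<delta> $ i))"
      by (simp add: matrix_matrix_mult_def nu_def z_def sum_distrib_left sum_distrib_right mult_ac)
    also have "\<dots> = (\<Sigma> \<gamma> \<delta> k. Nc y \<delta> \<gamma> j k * (z $ \<gamma> $ k * z' $ \<delta> $ i))"
      by (rule sum.swap)
    finally show ?thesis unfolding S_def
      by (simp add: if_distrib[of "\<lambda>x. x * _"] sum_if_const cong: if_cong)
  qed
  have 5: "S (\<lambda>\<gamma> \<delta> k l. if i = k then Nc y \<gamma> \<delta> j l else 0) = (nu y v ** z) $ j $ i"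
  proof -
    have "(nu y v ** z) $ j $ i = (\<Sigma> \<gamma> \<delta> l. Nc y \<gamma> \<delta> j l * (z $ \<gamma> $ i * z' $ \<delta> $ l))"
      by (simp add: matrix_matrix_mult_def nu_def z'_def sum_distrib_left sum_distrib_right mult_ac)
    then show ?thesis unfolding S_def
      by (simp add: if_distrib[of "\<lambda>x. x * _"] sum_if_const cong: if_cong)
  qed
  have 6: "S (\<lambda>\<gamma> \<delta> k l. if \<alpha> = \<gamma> then Nc y \<beta> \<delta> k l else 0) = (z ** nu y v) $ \<alpha> $ \<beta>"
  proof -
    have "(z ** nu y v) $ \<alpha> $ \<beta> = (\<Sigma> k \<delta> l. Nc y \<beta> \<delta> k l * (z $ \<alpha> $ k * z' $ \<delta> $ l))"
      by (simp add: matrix_matrix_mult_def nu_def z'_def sum_distrib_left sum_distrib_right mult_ac)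
    also have "\<dots> = (\<Sigma> \<delta> k l. Nc y \<beta> \<delta> k l * (z $ \<alpha> $ k * z' $ \<delta> $ l))"
      by (rule sum.swap)
    finally show ?thesis unfolding S_def
      by (simp add: if_distrib[of "\<lambda>x. x * _"] sum_if_const cong: if_cong)
  qed
  have 7: "S (\<lambda>\<gamma> \<delta> k l. if \<alpha> = \<delta> then Nc y \<beta> \<gamma> l k else 0) = (z' ** nu y u) $ \<alpha> $ \<beta>"
  proof -
    have "(z' ** nu y u) $ \<alpha> $ \<beta> = (\<Sigma> l \<gamma> k. Nc y \<beta> \<gamma> l k * (z $ \<gamma> $ k * z' $ \<alpha> $ l))"
      by (simp add: matrix_matrix_mult_def nu_def z_def sum_distrib_left sum_distrib_right mult_ac)
    also have "\<dots> = (\<Sigma> \<gamma> l k. Nc y \<beta> \<gamma> l k * (z $ \<gamma> $ k * z' $ \<alpha> $ l))"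
      by (rule sum.swap)
    also have "\<dots> = (\<Sigma> \<gamma> k l. Nc y \<beta> \<gamma> l k * (z $ \<gamma> $ k * z' $ \<alpha> $ l))"
      by (rule sum.cong[OF refl], rule sum.swap)
    finally show ?thesis unfolding S_def
      by (simp add: if_distrib[of "\<lambda>x. x * _"] sum_if_const cong: if_cong)
  qed
  show ?th1 ?th2
    unfolding 1 z_def[symmetric] z'_def[symmetric] 2 3 4 5 6 7 by (simp_all add: field_simps)
qed

end

lemma trace_dyad_axis: "trace (M ** \<E> \<alpha> i) = M $ i $ \<alpha>"
  for M :: "real^'p::finite^'q::finite"
proof -
  have "(M *v axis \<alpha> 1) \<bullet> axis i 1 = (M *v axis \<alpha> 1) $ i" by (simp add: inner_axis)
  then show ?thesis
    by (simp add: matrix_dyad trace_dyad matrix_vector_mult_def axis_def if_distrib[of "\<lambda>x. _ * x"] cong: if_cong)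
qed

lemma sum6_rearrange: "(\<Sigma> i \<alpha> k \<gamma> \<beta> j. f i \<alpha> k \<gamma> \<beta> j) = (\<Sigma> k \<gamma> \<alpha> \<beta> i j. f i \<alpha> k \<gamma> \<beta> j)"
  for f :: "'a::finite \<Rightarrow> 'b::finite \<Rightarrow> 'c::finite \<Rightarrow> 'd::finite \<Rightarrow> 'e::finite \<Rightarrow> 'f::finite \<Rightarrow> real"
proof -
  have "(\<Sigma> i \<alpha> k \<gamma> \<beta> j. f i \<alpha> k \<gamma> \<beta> j) = (\<Sigma> k \<gamma> i \<alpha> \<beta> j. f i \<alpha> k \<gamma> \<beta> j)"
    by (rule sum4_rearrange(1)[THEN trans], subst sum.swap, rule sum.cong[OF refl],
        subst sum4_rearrange(1)[symmetric], subst sum.swap, rule refl)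
  also have "\<dots> = (\<Sigma> k \<gamma> \<alpha> \<beta> i j. f i \<alpha> k \<gamma> \<beta> j)"
    by (rule sum.cong[OF refl], rule sum.cong[OF refl], subst sum.swap, rule sum.cong[OF refl], rule sum.swap)
  finally show ?thesis .
qed

text \<open>The adjointness of torsion and \<open>tdual\<close> under the trace makes their
  contributions cancel in \<open>Om_cyclic\<close>.\<close>

lemma trace_tdual: "trace (n ** tors P y z z') = trace (tdual P y n z' ** z) - trace (tdual P y n z ** z')"
  for P :: "('p::finite, 'q::finite) prolonged_frame"
proof -
  have 1: "trace (tdual P y n a ** b) = (\<Sigma> k \<gamma> \<alpha> \<beta> i j.
     obj_a P y $ (k, \<alpha>, \<beta>, \<gamma>, i, j) * (n $ k $ \<gamma> * (a $ \<beta> $ j * b $ \<alpha> $ i)))" for a b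
    by (subst sum6_rearrange[symmetric]) (simp add: trace_def matrix_matrix_mult_def tdual_def sum_distrib_right mult.assoc)
  have "trace (n ** tors P y z z') = (\<Sigma> k \<gamma> \<alpha> \<beta> i j.
     obj_a P y $ (k, \<alpha>, \<beta>, \<gamma>, i, j) * (n $ k $ \<gamma> * (z' $ \<beta> $ j * z $ \<alpha> $ i))
     - obj_a P y $ (k, \<alpha>, \<beta>, \<gamma>, i, j) * (n $ k $ \<gamma> * (z $ \<beta> $ j * z' $ \<alpha> $ i)))"
    unfolding trace_def matrix_matrix_mult_def tors_def
    by (simp add: sum_distrib_left right_diff_distrib mult_ac)
  then show ?thesis unfolding 1 by (simp only: sum_subtractf)
qed

lemma bilinear_tdual_right: "tdual P y n (z + z') = tdual P y n z + tdual P y n z'" "tdual P y n (c *\<^sub>R z) = c *\<^sub>R tdual P y n z"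
  "tdual P y (n + n') z = tdual P y n z + tdual P y n' z" "tdual P y (c *\<^sub>R n) z = c *\<^sub>R tdual P y n z"
  by (simp_all add: tdual_def vec_eq_iff algebra_simps sum.distrib sum_distrib_left)

section \<open>The object c and the completed prolonged frame\<close>

context coframe
begin

text \<open>A provisional record that carries the forms and the torsion, so that \<open>tors\<close>
  and \<open>tdual\<close> can be used before b and c are available; the zeros are
  placeholders.\<close>

definition P0 :: "('p, 'q) prolonged_frame" where
  "P0 = \<lparr> frm_w = \<theta>, frm_h = (\<lambda>y v. 0), frm_p = pii, frm_q = rho, frm_n = nu,
     obj_a = Ta, obj_b1 = (\<lambda>y. 0), obj_b2 = (\<lambda>y. 0), obj_c = (\<lambda>y. 0) \<rparr>"

text \<open>The part of d\<nu> that the last structure equation attributes to c.\<close>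

definition Om :: "real^'q^'p \<Rightarrow> real^'q^'p \<Rightarrow> real^'q^'p \<Rightarrow> real^'p^'q" where
  "Om y u v = vext_d nu y u v - (nu y u ** pii y v - nu y v ** pii y u) - (rho y u ** nu y v - rho y v ** nu y u)
     + (tdual P0 y (nu y u) (\<theta> y v) - tdual P0 y (nu y v) (\<theta> y u))"

definition oc :: "real^'q^'p \<Rightarrow> 'p \<Rightarrow> 'p \<Rightarrow> 'p \<Rightarrow> 'q \<Rightarrow> 'q \<Rightarrow> 'q \<Rightarrow> real" where
  "oc y \<alpha> \<beta> \<gamma> i j k = Om y (Y y \<gamma> k) (Y y \<beta> j) $ i $ \<alpha> / 2"

lemma bilinear_Om: assumes y: "y \<in> U" shows "bilinear (Om y)"
proof -
  have l: "linear (rho y)" "linear (pii y)" "linear (nu y)" "linear (\<theta> y)"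
    using smooth_form_linear[OF _ y] form_rho form_pii form_nu form_\<theta> by blast+
  note b = vext_d_bilinear[OF form_nu open_U y]
  show ?thesis unfolding bilinear_def Om_def
    by (auto intro!: linearI simp: bilinear_ladd[OF b] bilinear_radd[OF b] bilinear_lmul[OF b] bilinear_rmul[OF b]
        l[THEN linear_add] l[THEN linear_scale] mm_simps bilinear_tdual_right algebra_simps)
qed

lemma Om_skew: "Om y u v = - Om y v u"
  unfolding Om_def using vext_d_skew[of nu y u v] by simp

lemma tors_P0: "y \<in> U \<Longrightarrow> vext_d \<theta> y u v = (\<theta> y u ** rho y v - \<theta> y v ** rho y u) + (pii y u ** \<theta> y v - pii y v ** \<theta> y u)
   + tors P0 y (\<theta> y u) (\<theta> y v)"
  by (simp add: vec_eq_iff first_structure_equation tors_def P0_def Ta_def)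

text \<open>The symmetry of \<open>trace (nu ** \<theta>)\<close> says that the 2-form on the right
  of the fourth structure equation is zero. So is its exterior derivative; evaluated by the first
  structure equation and the definition of \<open>Om\<close> it gives the cyclic identity, the
  source of the alternation identity for c.\<close>

lemma Om_cyclic:
  assumes y: "y \<in> U"
  shows "trace (Om y u v ** \<theta> y x) + trace (Om y v x ** \<theta> y u) + trace (Om y x u ** \<theta> y v) = 0"
proof -
  define dn where "dn a b = fder (\<lambda>z. nu z b) y a" for a b
  define dw where "dw a b = fder (\<lambda>z. \<theta> z b) y a" for a b
  have sym: "trace (nu y a ** dw k b) + trace (dn k a ** \<theta> y b) = trace (nu y b ** dw k a) + trace (dn k b ** \<theta> y a)" for a b k
  proof -
    have d: "((\<lambda>z. nu z a ** \<theta> z b) has_derivative (\<lambda>k. nu y a ** dw k b + dn k a ** \<theta> y b)) (at y)" for a b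
      unfolding dw_def dn_def
      by (rule bounded_bilinear.FDERIV[OF bounded_bilinear_mm]
          smooth_on_has_derivative[OF smooth_form_smooth[OF form_nu] y] smooth_on_has_derivative[OF smooth_form_smooth[OF form_\<theta>] y])+
    from bounded_linear.has_derivative[OF bounded_linear_trace d[of a b]] bounded_linear.has_derivative[OF bounded_linear_trace d[of b a]]
    have "((\<lambda>z. trace (nu z a ** \<theta> z b)) has_derivative (\<lambda>k. trace (nu y a ** dw k b + dn k a ** \<theta> y b))) (at y)"
      "((\<lambda>z. trace (nu z a ** \<theta> z b)) has_derivative (\<lambda>k. trace (nu y b ** dw k a + dn k b ** \<theta> y a))) (at y)"
      using trace_nu_sym[of _ a b] by simp_all
    then have "(\<lambda>k. trace (nu y a ** dw k b + dn k a ** \<theta> y b)) = (\<lambda>k. trace (nu y b ** dw k a + dn k b ** \<theta> y a))"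
      by (rule has_derivative_unique)
    from fun_cong[OF this, of k] show ?thesis by (simp only: trace_simps)
  qed
  have N: "vext_d nu y a b = dn a b - dn b a" for a b by (simp add: vext_d_def dn_def)
  have W: "dw a b - dw b a = (\<theta> y a ** rho y b - \<theta> y b ** rho y a) + (pii y a ** \<theta> y b - pii y b ** \<theta> y a)
      + tors P0 y (\<theta> y a) (\<theta> y b)" for a b
    using tors_P0[OF y, of a b] by (simp add: vext_d_def dw_def)
  have W': "trace (nu y c ** dw a b) - trace (nu y c ** dw b a)
     = trace (nu y c ** \<theta> y a ** rho y b) - trace (nu y c ** \<theta> y b ** rho y a)
      + (trace (nu y c ** pii y a ** \<theta> y b) - trace (nu y c ** pii y b ** \<theta> y a))
      + (trace (tdual P0 y (nu y c) (\<theta> y b) ** \<theta> y a) - trace (tdual P0 y (nu y c) (\<theta> y a) ** \<theta> y b))" for a b c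
    using arg_cong[OF W[of a b], of "\<lambda>z. trace (nu y c ** z)"]
    by (simp only: mm_simps trace_simps trace_tdual matrix_mul_assoc)
  have E: "trace (Om y a b ** \<theta> y c) = trace (dn a b ** \<theta> y c) - trace (dn b a ** \<theta> y c)
     - (trace (nu y a ** pii y b ** \<theta> y c) - trace (nu y b ** pii y a ** \<theta> y c))
     - (trace (nu y b ** \<theta> y c ** rho y a) - trace (nu y a ** \<theta> y c ** rho y b))
     + (trace (tdual P0 y (nu y a) (\<theta> y b) ** \<theta> y c) - trace (tdual P0 y (nu y b) (\<theta> y a) ** \<theta> y c))" for a b c
    unfolding Om_def N by (simp only: mm_simps trace_simps trace_commute3[of "rho y _"])
  show ?thesis
    unfolding E using sym[of v u x] sym[of x v u] sym[of u x v] W'[of u v x] W'[of x u v] W'[of v x u]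
    by (simp add: algebra_simps)
qed

text \<open>The homothety form is set to zero, a choice of the second order parameters that every
  coframe admits.\<close>

definition Pc :: "('p, 'q) prolonged_frame" where
  "Pc = \<lparr> frm_w = \<theta>, frm_h = (\<lambda>y v. 0), frm_p = pii, frm_q = rho, frm_n = nu, obj_a = Ta,
     obj_b1 = (\<lambda>y. vec_lambda (\<lambda>(i, \<gamma>, \<delta>, j, k, l). b1c y i \<gamma> \<delta> j k l)),
     obj_b2 = (\<lambda>y. vec_lambda (\<lambda>(\<beta>, \<gamma>, \<delta>, \<alpha>, k, l). b2c y \<beta> \<gamma> \<delta> \<alpha> k l)),
     obj_c = (\<lambda>y. vec_lambda (\<lambda>(\<alpha>, \<beta>, \<gamma>, i, j, k). oc y \<alpha> \<beta> \<gamma> i j k)) \<rparr>"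

lemma curvn_Pc:
  assumes y: "y \<in> U"
  shows "curvn Pc y (\<theta> y u) (\<theta> y v) = Om y u v"
proof -
  have "curvn Pc y (\<theta> y u) (\<theta> y v) $ i $ \<alpha> = Om y u v $ i $ \<alpha>" for i \<alpha>
  proof -
    have "Om y u v $ i $ \<alpha> = (\<Sigma> \<gamma> \<beta> k j. oc y \<alpha> \<beta> \<gamma> i j k *
        (\<theta> y u $ \<gamma> $ k * \<theta> y v $ \<beta> $ j - \<theta> y v $ \<gamma> $ k * \<theta> y u $ \<beta> $ j))"
      unfolding oc_def
      by (rule skew_form_expand[OF y bilinear_component2[OF bilinear_Om[OF y]]], subst Om_skew) simp
    also have "\<dots> = (\<Sigma> \<beta> \<gamma> k j. oc y \<alpha> \<beta> \<gamma> i j k *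
        (\<theta> y u $ \<gamma> $ k * \<theta> y v $ \<beta> $ j - \<theta> y v $ \<gamma> $ k * \<theta> y u $ \<beta> $ j))"
      by (rule sum.swap)
    also have "\<dots> = (\<Sigma> \<beta> \<gamma> j k. oc y \<alpha> \<beta> \<gamma> i j k *
        (\<theta> y u $ \<gamma> $ k * \<theta> y v $ \<beta> $ j - \<theta> y v $ \<gamma> $ k * \<theta> y u $ \<beta> $ j))"
      by (rule sum.cong[OF refl], rule sum.cong[OF refl], rule sum.swap)
    finally show ?thesis by (simp add: curvn_def Pc_def)
  qed
  then show ?thesis by (simp add: vec_eq_iff)
qed

lemma tdual_Pc: "tdual Pc = tdual P0" "tors Pc = tors P0"
  by (intro ext, simp add: tdual_def tors_def Pc_def P0_def)+

lemma matrix_structure_Pc: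
  assumes y: "y \<in> U"
  shows "matrix_structure_equations Pc y"
proof -
  have w: "frm_w Pc = \<theta>" "frm_h Pc = (\<lambda>y v. 0)" "frm_p Pc = pii" "frm_q Pc = rho" "frm_n Pc = nu" by (simp_all add: Pc_def)
  have t: "trace (nu y u ** \<theta> y v) - trace (nu y v ** \<theta> y u) = 0" "trace (\<theta> y u ** nu y v) - trace (\<theta> y v ** nu y u) = 0" for u v
    using trace_nu_sym[of y u v] by (simp_all add: trace_mul_sym[of "\<theta> y _"])
  have 1: "R1 y u v = - (c0 *\<^sub>R (nu y u ** \<theta> y v - nu y v ** \<theta> y u)) + curv1 Pc y (\<theta> y u) (\<theta> y v)" for u v
    unfolding vec_eq_iff vector_add_component curvature_equations(1)[OF y] by (simp add: curv1_def Pc_def)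
  have 2: "R2 y u v = - (c0 *\<^sub>R (\<theta> y u ** nu y v - \<theta> y v ** nu y u)) + curv2 Pc y (\<theta> y u) (\<theta> y v)" for u v
    unfolding vec_eq_iff vector_add_component curvature_equations(2)[OF y] by (simp add: curv2_def Pc_def)
  have c: "(real CARD('q) / (real CARD('p) + real CARD('q))) *\<^sub>R (0 *\<^sub>R mat 1 - real CARD('p) *\<^sub>R A) = - (c0 *\<^sub>R A)"
    "(real CARD('p) / (real CARD('p) + real CARD('q))) *\<^sub>R (0 *\<^sub>R mat 1 - real CARD('q) *\<^sub>R B) = - (c0 *\<^sub>R B)"
    for A :: "real^'p^'p" and B :: "real^'q^'q"
    by (simp_all add: c0_def mult.commute)
  have "vext_d (\<lambda>y v. 0 :: real) y u v = 0" for u v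
    by (simp add: vext_d_def)
  then show ?thesis
    unfolding matrix_structure_equations_def Let_def w t c tdual_Pc curvn_Pc[OF y] tors_P0[OF y]
    using 1 2 by (simp add: curvature_def Om_def algebra_simps)
qed

lemma oc_alternating:
  assumes y: "y \<in> U"
  shows "oc y \<alpha> \<beta> \<gamma> i j k + oc y \<beta> \<gamma> \<alpha> j k i + oc y \<gamma> \<alpha> \<beta> k i j = 0"
proof -
  have "\<theta> y (Y y \<beta> j) = \<E> \<beta> j" for \<beta> j
    unfolding Y_def using bij_\<theta>[OF y] by (simp add: bij_is_surj surj_f_inv_f)
  then have "trace (M ** \<theta> y (Y y \<alpha> i)) = M $ i $ \<alpha>" for M :: "real^'p^'q" and \<alpha> i
    by (simp add: trace_dyad_axis)
  then show ?thesis using Om_cyclic[OF y, of "Y y \<gamma> k" "Y y \<beta> j" "Y y \<alpha> i"] by (simp add: oc_def)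
qed

lemma oc_skew: "oc y \<alpha> \<beta> \<gamma> i j k = - oc y \<alpha> \<gamma> \<beta> i k j"
  unfolding oc_def by (subst Om_skew) simp

theorem prolonged_frame_Pc: "prolonged_frame_over U Pc"
proof -
  have w: "frm_w Pc = \<theta>" "frm_h Pc = (\<lambda>y v. 0)" "frm_p Pc = pii" "frm_q Pc = rho" "frm_n Pc = nu" by (simp_all add: Pc_def)
  have s: "structure_equations_at Pc y" if y: "y \<in> U" for y
    by (subst structure_equations_matrix_iff, unfold w)
      (intro smooth_on_differentiable[OF smooth_form_smooth y] form_\<theta> form_pii form_rho form_nu matrix_structure_Pc y)+
  have o: "object_identities_at Pc y" if y: "y \<in> U" for y
  proof -
    have o: "obj_a Pc y $ (i, \<beta>, \<gamma>, \<alpha>, j, k) = na (T0 y) i \<beta> \<gamma> \<alpha> j k"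
      "obj_b1 Pc y $ (i, \<beta>, \<gamma>, j, k, l) = b1c y i \<beta> \<gamma> j k l"
      "obj_b2 Pc y $ (\<alpha>, \<beta>, \<gamma>, \<delta>, j, k) = b2c y \<alpha> \<beta> \<gamma> \<delta> j k"
      "obj_c Pc y $ (\<alpha>, \<beta>, \<gamma>, i, j, k) = oc y \<alpha> \<beta> \<gamma> i j k" for i \<alpha> \<beta> \<gamma> \<delta> j k l
      by (simp_all add: Pc_def Ta_def)
    have 1: "oc y \<alpha> \<beta> \<gamma> i j k + oc y \<beta> \<gamma> \<alpha> j k i + oc y \<gamma> \<alpha> \<beta> k i j
           - oc y \<beta> \<alpha> \<gamma> j i k - oc y \<alpha> \<gamma> \<beta> i k j - oc y \<gamma> \<beta> \<alpha> k j i = 0" for \<alpha> \<beta> \<gamma> i j k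
      using oc_alternating[OF y, of \<alpha> \<beta> \<gamma> i j k] oc_skew[of y \<alpha> \<beta> \<gamma> i j k] oc_skew[of y \<beta> \<gamma> \<alpha> j k i] oc_skew[of y \<gamma> \<alpha> \<beta> k i j]
      by linarith
    show ?thesis
      unfolding object_identities_at_def Let_def o
      by (intro conjI allI na_skew[OF dim_p dim_q T0_skew] na_trace1[OF dim_p dim_q T0_skew] na_trace2[OF dim_p dim_q T0_skew]
          b_skew b_traces[OF y] b_ricci oc_skew 1)
  qed
  have t: "(\<Sigma> \<gamma>. p_form Pc \<gamma> \<gamma> y v) = 0" "(\<Sigma> k. q_form Pc k k y v) = 0" for y v
    using trace_pii[of y v] trace_rho[of y v] by (simp_all add: p_form_def q_form_def w trace_def)
  show ?thesis
    unfolding prolonged_frame_over_def w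
    using form_\<theta> form_pii form_rho form_nu open_U s o bij_\<theta> t
    by (auto simp: smooth_form_def linear_iff)
qed

end

text \<open>It guarantees that \<open>vanishes\<close> has content near every point, as the
  construction of integral manifolds requires.\<close>

theorem prolonged_frame_exists:
  fixes \<theta> :: "real^'q::finite^'p::finite \<Rightarrow> real^'q^'p \<Rightarrow> real^'q^'p"
  assumes "open U" "smooth_form U \<theta>" "\<And>y. y \<in> U \<Longrightarrow> bij (\<theta> y)" "CARD('p) \<ge> 2" "CARD('q) \<ge> 2"
  obtains P where "prolonged_frame_over U P" "frm_w P = \<theta>"
proof -
  interpret coframe U \<theta> using assms by unfold_locales
  show thesis by (rule that[OF prolonged_frame_Pc]) (simp add: Pc_def)
qed

section \<open>Transposition\<close>

abbreviation tpose :: "'a^'n^'m \<Rightarrow> 'a^'m^'n" where "tpose \<equiv> Finite_Cartesian_Product.transpose"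

lemma tpose_simps:
  fixes A B :: "real^'n^'m"
  shows "tpose (A + B) = tpose A + tpose B" "tpose (A - B) = tpose A - tpose B" "tpose (- A) = - tpose A"
    "tpose (c *\<^sub>R A) = c *\<^sub>R tpose A" "tpose (0 :: real^'n^'m) = 0"
  by (simp_all add: transpose_def vec_eq_iff)

lemma linear_tpose: "linear (tpose :: real^'n^'m \<Rightarrow> real^'m^'n)"
  by (intro linearI) (simp_all add: tpose_simps)

lemma tpose_mat1: "tpose (mat 1 :: real^'n^'n) = mat 1"
  by (rule transpose_mat)

lemma tpose_dyad: "tpose (dyad t s) = dyad s t"
  by (simp add: transpose_def dyad_def vec_eq_iff mult.commute)

lemma tpose_mult: "tpose (A ** B) = tpose B ** tpose A" for A :: "real^'n^'m" and B :: "real^'k^'n"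
  by (rule matrix_transpose_mul)

lemma trace_tpose: "trace (tpose A) = trace A"
  by (simp add: trace_def transpose_def)

lemma bij_tpose: "bij (tpose :: 'a^'n^'m \<Rightarrow> 'a^'m^'n)"
  by (rule bij_betw_byWitness[where f'=tpose]) auto

lemma tpose_mem: "tpose y \<in> U" if "y \<in> tpose ` U"
  using that by auto

lemma image_tpose_eq: "tpose ` U = tpose -` U"
  by (auto intro: image_eqI[where x="tpose _"])

lemma open_tpose: "open U \<Longrightarrow> open (tpose ` U)" for U :: "(real^'n^'m) set"
  unfolding image_tpose_eq
  by (rule open_vimage) (auto intro: linear_continuous_on linear_conv_bounded_linear[THEN iffD1, OF linear_tpose])

lemma smooth_form_tpose:
  fixes \<beta> :: "real^'q::finite^'p::finite \<Rightarrow> real^'q^'p \<Rightarrow> 'f::euclidean_space" and L :: "'f \<Rightarrow> 'g::real_normed_vector"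
  assumes U: "open U" and \<beta>: "smooth_form U \<beta>" and L: "linear L"
  shows "smooth_form (tpose ` U) (\<lambda>y v. L (\<beta> (tpose y) (tpose v)))"
  unfolding smooth_form_def
proof (intro conjI allI ballI)
  show "smooth_on (tpose ` U) (\<lambda>y. L (\<beta> (tpose y) (tpose v)))" for v
    by (rule smooth_on_linear[OF open_tpose[OF U] L], rule smooth_on_compose[OF open_tpose[OF U] smooth_form_smooth[OF \<beta>]])
      (auto intro: smooth_on_bounded_linear linear_conv_bounded_linear[THEN iffD1, OF linear_tpose])
  show "linear (\<lambda>v. L (\<beta> (tpose y) (tpose v)))" if "y \<in> tpose ` U" for y
    using linear_compose[OF linear_compose[OF linear_tpose smooth_form_linear[OF \<beta> tpose_mem[OF that]]] L]
    by (simp add: o_def)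
qed

lemma frechet_derivative_tpose:
  fixes f :: "real^'q::finite^'p::finite \<Rightarrow> 'f::euclidean_space" and L :: "'f \<Rightarrow> 'g::real_normed_vector"
  assumes "f differentiable (at (tpose y))" and L: "linear L"
  shows "fder (\<lambda>z. L (f (tpose z))) y v = L (fder f (tpose y) (tpose v))"
proof -
  have "(tpose has_derivative tpose) (at y)"
    by (intro bounded_linear_imp_has_derivative linear_conv_bounded_linear[THEN iffD1, OF linear_tpose])
  from diff_chain_at[OF this has_derivative_frechet[OF assms(1)]]
  have "((\<lambda>z. f (tpose z)) has_derivative (\<lambda>v. fder f (tpose y) (tpose v))) (at y)"
    by (simp add: o_def)
  from bounded_linear.has_derivative[OF linear_conv_bounded_linear[THEN iffD1, OF L] this]
  show ?thesis by (simp add: frechet_derivative_eqI)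
qed

lemma vext_d_tpose:
  fixes \<beta> :: "real^'q::finite^'p::finite \<Rightarrow> real^'q^'p \<Rightarrow> 'f::euclidean_space" and L :: "'f \<Rightarrow> 'g::real_normed_vector"
  assumes "smooth_form U \<beta>" and y: "tpose y \<in> U" and L: "linear L"
  shows "vext_d (\<lambda>y v. L (\<beta> (tpose y) (tpose v))) y u v = L (vext_d \<beta> (tpose y) (tpose u) (tpose v))"
  unfolding vext_d_def
  by (simp add: frechet_derivative_tpose[OF smooth_on_differentiable[OF smooth_form_smooth[OF assms(1)] y] L] linear_diff[OF L])

text \<open>Transposition reverses matrix products, so \<open>frm_p\<close> and \<open>frm_q\<close>
  are exchanged and acquire a minus sign, which keeps the sign of their quadratic terms. b^1 and b^2
  are exchanged with the same sign, while a and c only have their indices permuted.\<close>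

definition tp :: "('p::finite, 'q::finite) prolonged_frame \<Rightarrow> ('q, 'p) prolonged_frame" where
  "tp P = \<lparr> frm_w = (\<lambda>y v. tpose (frm_w P (tpose y) (tpose v))),
     frm_h = (\<lambda>y v. frm_h P (tpose y) (tpose v)),
     frm_p = (\<lambda>y v. - tpose (frm_q P (tpose y) (tpose v))),
     frm_q = (\<lambda>y v. - tpose (frm_p P (tpose y) (tpose v))),
     frm_n = (\<lambda>y v. tpose (frm_n P (tpose y) (tpose v))),
     obj_a = (\<lambda>y. vec_lambda (\<lambda>(i, \<beta>, \<gamma>, \<alpha>, j, k). obj_a P (tpose y) $ (\<alpha>, j, k, i, \<beta>, \<gamma>))),
     obj_b1 = (\<lambda>y. vec_lambda (\<lambda>(i, \<gamma>, \<delta>, j, k, l). - obj_b2 P (tpose y) $ (j, k, l, i, \<gamma>, \<delta>))),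
     obj_b2 = (\<lambda>y. vec_lambda (\<lambda>(\<beta>, \<gamma>, \<delta>, \<alpha>, k, l). - obj_b1 P (tpose y) $ (\<alpha>, k, l, \<beta>, \<gamma>, \<delta>))),
     obj_c = (\<lambda>y. vec_lambda (\<lambda>(\<alpha>, \<beta>, \<gamma>, i, j, k). obj_c P (tpose y) $ (i, j, k, \<alpha>, \<beta>, \<gamma>))) \<rparr>"

lemma tp_forms:
  "frm_w (tp P) = (\<lambda>y v. tpose (frm_w P (tpose y) (tpose v)))" "frm_h (tp P) = (\<lambda>y v. frm_h P (tpose y) (tpose v))"
  "frm_p (tp P) = (\<lambda>y v. - tpose (frm_q P (tpose y) (tpose v)))" "frm_q (tp P) = (\<lambda>y v. - tpose (frm_p P (tpose y) (tpose v)))"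
  "frm_n (tp P) = (\<lambda>y v. tpose (frm_n P (tpose y) (tpose v)))"
  "obj_a (tp P) y $ (i, \<beta>, \<gamma>, \<alpha>, j, k) = obj_a P (tpose y) $ (\<alpha>, j, k, i, \<beta>, \<gamma>)"
  "obj_b1 (tp P) y $ (i, \<gamma>, \<delta>, j, k, l) = - obj_b2 P (tpose y) $ (j, k, l, i, \<gamma>, \<delta>)"
  "obj_b2 (tp P) y $ (\<gamma>, \<delta>, \<alpha>, \<beta>, k, l) = - obj_b1 P (tpose y) $ (\<beta>, k, l, \<gamma>, \<delta>, \<alpha>)"
  "obj_c (tp P) y $ (\<alpha>, \<beta>, \<gamma>, i, j, k) = obj_c P (tpose y) $ (i, j, k, \<alpha>, \<beta>, \<gamma>)"
  by (simp_all add: tp_def)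

lemma tpose_nth: "tpose A $ i $ j = A $ j $ i"
  by (simp add: transpose_def)

lemma sum4_transpose: "(\<Sigma> \<beta> \<gamma> j k. f \<beta> \<gamma> j k) = (\<Sigma> j k \<beta> \<gamma>. f \<beta> \<gamma> j k)"
  for f :: "'a::finite \<Rightarrow> 'b::finite \<Rightarrow> 'c::finite \<Rightarrow> 'd::finite \<Rightarrow> real"
proof -
  have "(\<Sigma> \<beta> \<gamma> j k. f \<beta> \<gamma> j k) = (\<Sigma> \<beta> j \<gamma> k. f \<beta> \<gamma> j k)"
    by (rule sum.cong[OF refl], rule sum.swap)
  also have "\<dots> = (\<Sigma> j \<beta> \<gamma> k. f \<beta> \<gamma> j k)" by (rule sum.swap)
  also have "\<dots> = (\<Sigma> j \<beta> k \<gamma>. f \<beta> \<gamma> j k)"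
    by (rule sum.cong[OF refl], rule sum.cong[OF refl], rule sum.swap)
  also have "\<dots> = (\<Sigma> j k \<beta> \<gamma>. f \<beta> \<gamma> j k)"
    by (rule sum.cong[OF refl], rule sum.swap)
  finally show ?thesis .
qed

lemma tp_tensors:
  "tors (tp P) y z z' = tpose (tors P (tpose y) (tpose z) (tpose z'))" (is ?th1)
  "curv1 (tp P) y z z' = - tpose (curv2 P (tpose y) (tpose z) (tpose z'))" (is ?th2)
  "curv2 (tp P) y z z' = - tpose (curv1 P (tpose y) (tpose z) (tpose z'))" (is ?th3)
  "curvn (tp P) y z z' = tpose (curvn P (tpose y) (tpose z) (tpose z'))" (is ?th4)
  "tdual (tp P) y n z = tpose (tdual P (tpose y) (tpose n) (tpose z))" (is ?th5)
proof -
  show ?th1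
    ?th2
    ?th3
    ?th4
    unfolding vec_eq_iff
    by (intro allI, simp add: tors_def curv1_def curv2_def curvn_def tp_forms tpose_nth sum_negf, rule sum4_transpose)+
  show ?th5
    unfolding vec_eq_iff
  proof (intro allI)
    fix i \<alpha>
    have "(\<Sigma> k \<gamma> \<beta> j. f k \<gamma> \<beta> j) = (\<Sigma> \<gamma> k j \<beta>. f k \<gamma> \<beta> j)"
      for f :: "'a::finite \<Rightarrow> 'b::finite \<Rightarrow> 'c::finite \<Rightarrow> 'd::finite \<Rightarrow> real"
      by (subst sum.swap, rule sum.cong[OF refl], rule sum.cong[OF refl], rule sum.swap)
    then show "tdual (tp P) y n z $ i $ \<alpha> = tpose (tdual P (tpose y) (tpose n) (tpose z)) $ i $ \<alpha>"
      by (simp add: tdual_def tp_forms tpose_nth)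
  qed
qed

theorem prolonged_frame_over_tp:
  fixes P :: "('p::finite, 'q::finite) prolonged_frame"
  assumes "prolonged_frame_over U P"
  shows "prolonged_frame_over (tpose ` U) (tp P)"
proof -
  interpret pframe U P using assms by unfold_locales
  have F: "smooth_form (tpose ` U) (frm_w (tp P))" "smooth_form (tpose ` U) (frm_h (tp P))"
    "smooth_form (tpose ` U) (frm_p (tp P))" "smooth_form (tpose ` U) (frm_q (tp P))" "smooth_form (tpose ` U) (frm_n (tp P))"
    unfolding tp_forms
    by (rule smooth_form_tpose[OF open_U forms(1) linear_tpose] smooth_form_tpose[OF open_U forms(2) linear_ident]
        smooth_form_tpose[OF open_U forms(4) linear_compose_neg[OF linear_tpose]]
        smooth_form_tpose[OF open_U forms(3) linear_compose_neg[OF linear_tpose]] smooth_form_tpose[OF open_U forms(5) linear_tpose])+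
  have "structure_equations_at (tp P) y" if y: "y \<in> tpose ` U" for y
  proof -
    note y' = tpose_mem[OF y]
    have V: "vext_d (frm_w (tp P)) y u v = tpose (vext_d w (tpose y) (tpose u) (tpose v))"
      "vext_d (frm_h (tp P)) y u v = vext_d h (tpose y) (tpose u) (tpose v)"
      "vext_d (frm_p (tp P)) y u v = - tpose (vext_d \<rho> (tpose y) (tpose u) (tpose v))"
      "vext_d (frm_q (tp P)) y u v = - tpose (vext_d \<pi> (tpose y) (tpose u) (tpose v))"
      "vext_d (frm_n (tp P)) y u v = tpose (vext_d \<nu> (tpose y) (tpose u) (tpose v))" for u v
      unfolding tp_forms
      by (rule vext_d_tpose[OF forms(1) y' linear_tpose] vext_d_tpose[OF forms(2) y' linear_ident]
        vext_d_tpose[OF forms(4) y' linear_compose_neg[OF linear_tpose]]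
        vext_d_tpose[OF forms(3) y' linear_compose_neg[OF linear_tpose]] vext_d_tpose[OF forms(5) y' linear_tpose])+
    have t: "trace (tpose A ** tpose B) = trace (B ** A)" for A :: "real^'a^'b" and B :: "real^'b^'a"
      unfolding tpose_mult[symmetric] by (rule trace_tpose)
    have th: "trace (w (tpose y) (tpose v) ** \<nu> (tpose y) (tpose u)) = trace (\<nu> (tpose y) (tpose u) ** w (tpose y) (tpose v))" for u v
      by (rule trace_mul_sym)
    have "matrix_structure_equations (tp P) y"
      unfolding matrix_structure_equations_def Let_def V tp_tensors
      unfolding structure_eqs[OF y'] tp_forms
      by (intro allI conjI)
        (simp_all only: tpose_simps tpose_mult tpose_mat1 mm_simps t th transpose_transpose, simp_all add: algebra_simps)
    then show ?thesis
      by (subst structure_equations_matrix_iff)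
        (rule smooth_on_differentiable[OF smooth_form_smooth y] F | assumption)+
  qed
  moreover have "object_identities_at (tp P) y" if y: "y \<in> tpose ` U" for y
  proof -
    note o = object_identitiesD[OF object_identities[OF tpose_mem[OF y]]]
    show ?thesis
      unfolding object_identities_at_def Let_def tp_forms
    proof (intro conjI allI)
      fix \<alpha> \<beta> \<gamma> \<delta> :: 'q and i j k l :: 'p
      show "obj_a P (tpose y) $ (\<alpha>, j, k, i, \<beta>, \<gamma>) = - obj_a P (tpose y) $ (\<alpha>, k, j, i, \<gamma>, \<beta>)"
        by (rule o(1))
      show "(\<Sigma> \<alpha>. obj_a P (tpose y) $ (\<alpha>, j, k, i, \<alpha>, \<gamma>)) = 0" by (rule o(3))
      show "(\<Sigma> i. obj_a P (tpose y) $ (\<alpha>, i, k, i, \<beta>, \<gamma>)) = 0" by (rule o(2))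
      show "- obj_b1 P (tpose y) $ (\<alpha>, k, l, \<beta>, \<gamma>, \<delta>) = - (- obj_b1 P (tpose y) $ (\<alpha>, l, k, \<beta>, \<delta>, \<gamma>))"
        using o(5)[of \<alpha> k l \<beta> \<gamma> \<delta>] by simp
      show "- obj_b2 P (tpose y) $ (j, k, l, i, \<gamma>, \<delta>) = - (- obj_b2 P (tpose y) $ (j, l, k, i, \<delta>, \<gamma>))"
        using o(4)[of j k l i \<gamma> \<delta>] by simp
      show "(\<Sigma> \<alpha>. - obj_b1 P (tpose y) $ (\<alpha>, k, l, \<alpha>, \<gamma>, \<delta>)) = 0"
        by (simp only: sum_negf neg_equal_0_iff_equal o(7))
      show "(\<Sigma> i. - obj_b2 P (tpose y) $ (i, k, l, i, \<gamma>, \<delta>)) = 0"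
        by (simp only: sum_negf neg_equal_0_iff_equal o(6))
      show "(\<Sigma> \<alpha>. - obj_b1 P (tpose y) $ (\<alpha>, k, l, \<gamma>, \<alpha>, \<delta>)) - (\<Sigma> i. - obj_b2 P (tpose y) $ (k, i, l, i, \<gamma>, \<delta>))
           + (\<Sigma> \<alpha>. - obj_b1 P (tpose y) $ (\<alpha>, l, k, \<delta>, \<alpha>, \<gamma>)) - (\<Sigma> i. - obj_b2 P (tpose y) $ (l, i, k, i, \<delta>, \<gamma>)) = 0"
        using o(8)[of k l \<gamma> \<delta>] by (simp add: sum_negf)
      show "obj_c P (tpose y) $ (i, j, k, \<alpha>, \<beta>, \<gamma>) = - obj_c P (tpose y) $ (i, k, j, \<alpha>, \<gamma>, \<beta>)"
        by (rule o(9))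
      show "obj_c P (tpose y) $ (i, j, k, \<alpha>, \<beta>, \<gamma>) + obj_c P (tpose y) $ (j, k, i, \<beta>, \<gamma>, \<alpha>)
         + obj_c P (tpose y) $ (k, i, j, \<gamma>, \<alpha>, \<beta>) - obj_c P (tpose y) $ (j, i, k, \<beta>, \<alpha>, \<gamma>)
         - obj_c P (tpose y) $ (i, k, j, \<alpha>, \<gamma>, \<beta>) - obj_c P (tpose y) $ (k, j, i, \<gamma>, \<beta>, \<alpha>) = 0"
        by (rule o(10))
    qed
  qed
  moreover have "bij (frm_w (tp P) y)" if y: "y \<in> tpose ` U" for y
  proof -
    have "frm_w (tp P) y = tpose \<circ> frm_w P (tpose y) \<circ> tpose" by (simp add: tp_forms o_def)
    then show ?thesis using bij_w[OF tpose_mem[OF y]] bij_tpose by (metis bij_comp)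
  qed
  moreover have "(\<Sigma> \<gamma>. p_form (tp P) \<gamma> \<gamma> y v) = 0" "(\<Sigma> k. q_form (tp P) k k y v) = 0" if y: "y \<in> tpose ` U" for y v
    using trace_\<rho>[OF tpose_mem[OF y], of "tpose v"] trace_\<pi>[OF tpose_mem[OF y], of "tpose v"]
    by (simp_all add: p_form_def q_form_def tp_forms tpose_nth trace_def sum_negf)
  ultimately show ?thesis
    unfolding prolonged_frame_over_def
    using F open_tpose[OF open_U] by (auto simp: smooth_form_def)
qed

section \<open>Components on unit dyads; smoothness of the structure object\<close>

lemma array_axis:
  "(\<Sigma> \<beta> \<gamma> j k. f \<beta> \<gamma> j k
     * (\<E> b m $ \<beta> $ j * \<E> c n $ \<gamma> $ k)) = f b c m n"
  for f :: "'b::finite \<Rightarrow> 'c::finite \<Rightarrow> 'm::finite \<Rightarrow> 'n::finite \<Rightarrow> real"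
proof -
  have "(\<Sigma> \<beta> \<gamma> j k. f \<beta> \<gamma> j k
     * (\<E> b m $ \<beta> $ j * \<E> c n $ \<gamma> $ k))
    = (\<Sigma> \<beta> j. (\<Sigma> \<gamma> k. f \<beta> \<gamma> j k * \<E> c n $ \<gamma> $ k)
       * \<E> b m $ \<beta> $ j)"
    by (subst sum4_rearrange(1)) (simp add: sum_distrib_left sum_distrib_right mult_ac)
  then show ?thesis unfolding sum_delta2 .
qed

text \<open>The structure equations sum over ordered pairs of indices; by skewness of the
  coefficients each component is counted twice.\<close>

lemma curv_axis:
  assumes "object_identities_at P y"
  shows "curv1 P y (\<E> \<gamma> k) (\<E> \<delta> l) $ j $ i = 2 * obj_b1 P y $ (i, \<gamma>, \<delta>, j, k, l)" (is ?th1)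
    and "curv2 P y (\<E> \<gamma> k) (\<E> \<delta> l) $ \<alpha> $ \<beta> = 2 * obj_b2 P y $ (\<beta>, \<gamma>, \<delta>, \<alpha>, k, l)" (is ?th2)
    and "curvn P y (\<E> \<gamma> k) (\<E> \<delta> l) $ i $ \<alpha> = 2 * obj_c P y $ (\<alpha>, \<delta>, \<gamma>, i, l, k)" (is ?th3)
proof -
  show ?th1
    unfolding curv1_def
    using object_identitiesD(5)[OF assms, of i \<gamma> \<delta> j k l] by (simp add: right_diff_distrib sum_subtractf array_axis)
  show ?th2
    unfolding curv2_def
    using object_identitiesD(4)[OF assms, of \<beta> \<gamma> \<delta> \<alpha> k l] by (simp add: right_diff_distrib sum_subtractf array_axis)
  have "curvn P y z z' $ i $ \<alpha> = (\<Sigma> \<beta> \<gamma> j k. obj_c P y $ (\<alpha>, \<beta>, \<gamma>, i, j, k) * (z' $ \<beta> $ j * z $ \<gamma> $ k))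
     - (\<Sigma> \<beta> \<gamma> j k. obj_c P y $ (\<alpha>, \<beta>, \<gamma>, i, j, k) * (z $ \<beta> $ j * z' $ \<gamma> $ k))" for z z'
    by (simp add: curvn_def right_diff_distrib sum_subtractf mult_ac)
  then show ?th3
    using object_identitiesD(9)[OF assms, of \<alpha> \<delta> \<gamma> i l k] by (simp add: array_axis)
qed

lemmas curv1_axis = curv_axis(1) and curv2_axis = curv_axis(2) and curvn_axis = curv_axis(3)

context pframe
begin

text \<open>As for the torsion, the structure equation for \<open>\<rho>\<close> is solved for
  \<open>curv1\<close>, whose coefficients are not assumed smooth.\<close>

lemma smooth_curv1: "smooth_on U (\<lambda>y. curv1 P y z z')"
proof -
  have id: "smooth_on U (\<lambda>y. y)" by (rule smooth_on_id)
  have X: "smooth_on U (\<lambda>y. X y z)" for z by (rule smooth_form_smooth[OF smooth_form_X])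
  have f: "smooth_on U (\<lambda>y. \<beta> y (X y z))" if "smooth_form U \<beta>" for \<beta> :: "_ \<Rightarrow> _ \<Rightarrow> 'z::real_normed_vector" and z
    by (rule smooth_form_compose[OF that open_U id _ X]) simp
  have d: "smooth_on U (\<lambda>y. vext_d \<beta> y (X y z) (X y z'))" if "smooth_form U \<beta>" for \<beta> :: "_ \<Rightarrow> _ \<Rightarrow> 'z::real_normed_vector"
    by (rule smooth_on_bilinear_family[OF open_U smooth_vext_d[OF open_U that] vext_d_bilinear[OF that open_U] X X])
  have n: "smooth_on U (\<lambda>y. \<nu> y (X y z) ** z')" for z z'
    by (rule smooth_on_bilinear[OF open_U bounded_bilinear_mm f[OF forms(5)] smooth_on_const])
  have r: "smooth_on U (\<lambda>y. \<rho> y (X y z) ** \<rho> y (X y z'))" for z z'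
    by (rule smooth_on_bilinear[OF open_U bounded_bilinear_mm f[OF forms(4)] f[OF forms(4)]])
  have "smooth_on U (\<lambda>y. (vext_d \<rho> y (X y z) (X y z') - (\<rho> y (X y z) ** \<rho> y (X y z') - \<rho> y (X y z') ** \<rho> y (X y z)))
     - (real CARD('p) / (real CARD('p) + real CARD('q))) *\<^sub>R
            (vext_d h y (X y z) (X y z') *\<^sub>R mat 1 - real CARD('q) *\<^sub>R (\<nu> y (X y z) ** z' - \<nu> y (X y z') ** z)))"
    by (rule smooth_on_diff[OF open_U smooth_on_diff[OF open_U d[OF forms(4)] smooth_on_diff[OF open_U r r]]
         smooth_on_scaleR[OF open_U smooth_on_const smooth_on_diff[OF open_U smooth_on_scaleR[OF open_U d[OF forms(2)] smooth_on_const]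
          smooth_on_scaleR[OF open_U smooth_on_const smooth_on_diff[OF open_U n n]]]]])
  then show ?thesis
  proof (rule smooth_on_cong[OF open_U, rotated])
    fix y assume y: "y \<in> U"
    show "(vext_d \<rho> y (X y z) (X y z') - (\<rho> y (X y z) ** \<rho> y (X y z') - \<rho> y (X y z') ** \<rho> y (X y z)))
     - (real CARD('p) / (real CARD('p) + real CARD('q))) *\<^sub>R
            (vext_d h y (X y z) (X y z') *\<^sub>R mat 1 - real CARD('q) *\<^sub>R (\<nu> y (X y z) ** z' - \<nu> y (X y z') ** z)) = curv1 P y z z'"
      using Rq_eq[OF y, of "X y z" "X y z'"] y by (simp add: curvature_def)
  qed
qed

lemma smooth_obj_b1: "smooth_on U (\<lambda>y. obj_b1 P y $ (i, \<gamma>, \<delta>, j, k, l))"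
proof -
  have "smooth_on U (\<lambda>y. (1/2) * curv1 P y (\<E> \<gamma> k) (\<E> \<delta> l) $ j $ i)"
    by (intro smooth_on_mult smooth_on_const smooth_on_vec_nth smooth_curv1 open_U)
  then show ?thesis
    by (rule smooth_on_cong[OF open_U, rotated]) (simp add: curv1_axis[OF object_identities])
qed

lemma smooth_b1_alpha: "smooth_on U (\<lambda>y. b1_alpha P y $ (i, \<gamma>, \<delta>, j, k, l))"
proof -
  have "smooth_on U (\<lambda>y. (1/6) * (obj_b1 P y $ (i, \<gamma>, \<delta>, j, k, l) + obj_b1 P y $ (i, \<gamma>, \<delta>, k, l, j) + obj_b1 P y $ (i, \<gamma>, \<delta>, l, j, k)
      + obj_b1 P y $ (i, \<gamma>, \<delta>, k, j, l) + obj_b1 P y $ (i, \<gamma>, \<delta>, j, l, k) + obj_b1 P y $ (i, \<gamma>, \<delta>, l, k, j)))"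
    by (intro smooth_on_mult smooth_on_add smooth_on_const smooth_obj_b1 open_U)
  then show ?thesis by (simp add: b1_alpha_def sym3_def)
qed

end

lemma b1_alpha_tp: "b1_alpha (tp P) y $ (i, \<gamma>, \<delta>, j, k, l) = - b2_beta P (tpose y) $ (j, k, l, i, \<gamma>, \<delta>)"
  and b2_beta_tp: "b2_beta (tp P) y $ (\<beta>, \<gamma>, \<delta>, \<alpha>, k, l) = - b1_alpha P (tpose y) $ (\<alpha>, k, l, \<beta>, \<gamma>, \<delta>)"
  by (simp add: b1_alpha_def b2_beta_def sym3_def tp_forms, simp add: field_simps)+

lemma b1_alpha_tp_eq_0_iff: "b1_alpha (tp P) y = 0 \<longleftrightarrow> b2_beta P (tpose y) = 0"
  and b2_beta_tp_eq_0_iff: "b2_beta (tp P) y = 0 \<longleftrightarrow> b1_alpha P (tpose y) = 0"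
  by (auto simp: vec_eq_iff b1_alpha_tp b2_beta_tp)

theorem is_tensor_b2_beta:
  assumes q2: "CARD('q::finite) = 2"
  shows "is_tensor (b2_beta :: ('p::finite, 'q) prolonged_frame \<Rightarrow> _)"
proof -
  obtain L :: "real^'q^'q \<Rightarrow> real^'p^'p \<Rightarrow> real^('p \<times> 'q \<times> 'q \<times> 'p \<times> 'p \<times> 'p) \<Rightarrow> real^('p \<times> 'q \<times> 'q \<times> 'p \<times> 'p \<times> 'p)"
    where L: "(\<forall>A B. linear (L A B)) \<and> (\<forall>U P P' A B. prolonged_frame_over U P \<longrightarrow> prolonged_frame_over U P' \<longrightarrow>
          (\<forall>y\<in>U. invertible (A y) \<and> invertible (B y) \<and> (\<forall>v. frm_w P' y v = A y ** frm_w P y v ** B y)) \<longrightarrow>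
          (\<forall>y\<in>U. b1_alpha P' y = L (A y) (B y) (b1_alpha P y)))"
    using is_tensor_b1_alpha[OF q2, where 'q='p] unfolding is_tensor_def by (rule exE)
  note L = L[THEN conjunct1, rule_format] L[THEN conjunct2, rule_format]
  \<comment> \<open>\<open>f\<close> and \<open>g\<close> carry out the index exchange and the sign
    of transposition; they conjugate the law for b^1 into the law for b^2. Since the coframe is
    transposed as well, A and B change places and are transposed.\<close>
  define f :: "real^('p \<times> 'p \<times> 'p \<times> 'p \<times> 'q \<times> 'q) \<Rightarrow> real^('p \<times> 'q \<times> 'q \<times> 'p \<times> 'p \<times> 'p)" where
    "f T = vec_lambda (\<lambda>(i, \<gamma>, \<delta>, j, k, l). - T $ (j, k, l, i, \<gamma>, \<delta>))" for T
  define g :: "real^('p \<times> 'q \<times> 'q \<times> 'p \<times> 'p \<times> 'p) \<Rightarrow> real^('p \<times> 'p \<times> 'p \<times> 'p \<times> 'q \<times> 'q)" where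
    "g T = vec_lambda (\<lambda>(\<beta>, \<gamma>, \<delta>, \<alpha>, k, l). - T $ (\<alpha>, k, l, \<beta>, \<gamma>, \<delta>))" for T
  have f: "b1_alpha (tp P) y = f (b2_beta P (tpose y))" for P :: "('p, 'q) prolonged_frame" and y
    by (auto simp: vec_eq_iff f_def b1_alpha_tp)
  have g: "g (f T) = T" for T by (auto simp: vec_eq_iff f_def g_def)
  have fl: "linear f" and gl: "linear g" by (auto intro!: linearI simp: f_def g_def vec_eq_iff)
  have "linear (\<lambda>T. g (L (tpose B) (tpose A) (f T)))" for A B
    using linear_compose[OF linear_compose[OF fl L(1)] gl] by (simp add: o_def)
  moreover have "b2_beta P' y = g (L (tpose (B y)) (tpose (A y)) (f (b2_beta P y)))"
    if P: "prolonged_frame_over U P" and P': "prolonged_frame_over U P'"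
      and AB: "\<forall>y\<in>U. invertible (A y) \<and> invertible (B y) \<and> (\<forall>v. frm_w P' y v = A y ** frm_w P y v ** B y)" and y: "y \<in> U"
    for U A B y and P P' :: "('p, 'q) prolonged_frame"
  proof -
    have "b1_alpha (tp P') (tpose y) = L (tpose (B (tpose (tpose y)))) (tpose (A (tpose (tpose y)))) (b1_alpha (tp P) (tpose y))"
      by (rule L(2)[OF prolonged_frame_over_tp[OF P] prolonged_frame_over_tp[OF P'], of "\<lambda>y. tpose (B (tpose y))" "\<lambda>y. tpose (A (tpose y))"])
        (use AB y in \<open>auto simp: tp_forms tpose_mult matrix_mul_assoc transpose_invertible\<close>)
    then show ?thesis using g[of "b2_beta P' y"] by (simp add: f)
  qed
  ultimately show ?thesis
    unfolding is_tensor_def by (intro exI[of _ "\<lambda>A B T. g (L (tpose B) (tpose A) (f T))"]) blast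
qed

lemma pfaff_b1_alpha_tp:
  fixes P :: "('p::finite, 'q::finite) prolonged_frame"
  assumes "prolonged_frame_over U P" and y: "tpose y \<in> U"
  shows "pfaff_b1_alpha (tp P) y \<epsilon> m $ (i, \<gamma>, \<delta>, j, k, l) = - pfaff_b2_beta P (tpose y) m \<epsilon> $ (j, k, l, i, \<gamma>, \<delta>)"
proof -
  interpret T: pframe "tpose ` U" "tp P" using prolonged_frame_over_tp[OF assms(1)] by unfold_locales
  interpret pframe U P using assms(1) by unfold_locales
  have yT: "y \<in> tpose ` U" by (rule image_eqI[OF _ y]) simp
  have fv: "frame_vector (tp P) y \<epsilon> m = tpose (frame_vector P (tpose y) m \<epsilon>)"
  proof -
    have "frm_w (tp P) y (tpose (frame_vector P (tpose y) m \<epsilon>)) = \<E> \<epsilon> m"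
      using w_X[OF y] by (simp add: tp_forms frame_vector_def X_def tpose_dyad)
    then have "frame_vector (tp P) y \<epsilon> m = inv (frm_w (tp P) y) (frm_w (tp P) y (tpose (frame_vector P (tpose y) m \<epsilon>)))"
      by (simp only: frame_vector_def)
    also have "\<dots> = tpose (frame_vector P (tpose y) m \<epsilon>)" by (rule inv_f_f[OF bij_is_inj[OF T.bij_w[OF yT]]])
    finally show ?thesis .
  qed
  \<comment> \<open>Differentiability is available for b^1 of a prolonged frame; for b^2 it is taken
    from the transposed frame.\<close>
  have d: "(\<lambda>z. b2_beta P z $ (j, k, l, i, \<gamma>, \<delta>)) differentiable (at (tpose y))"
  proof -
    have "(\<lambda>z. b1_alpha (tp P) z $ (i, \<gamma>, \<delta>, j, k, l)) differentiable (at y)"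
      by (rule smooth_on_differentiable[OF T.smooth_b1_alpha yT])
    then have "(\<lambda>z. - b1_alpha (tp P) (tpose z) $ (i, \<gamma>, \<delta>, j, k, l)) differentiable (at (tpose y))"
      by (intro derivative_intros differentiable_compose[of "\<lambda>z. b1_alpha (tp P) z $ (i, \<gamma>, \<delta>, j, k, l)" tpose])
        (auto intro: linear_imp_differentiable linear_tpose)
    then show ?thesis by (simp add: b1_alpha_tp)
  qed
  have D: "fder (\<lambda>z. - b2_beta P (tpose z) $ (j, k, l, i, \<gamma>, \<delta>)) y (tpose v)
      = - fder (\<lambda>z. b2_beta P z $ (j, k, l, i, \<gamma>, \<delta>)) (tpose y) v" for v
    using frechet_derivative_tpose[OF d, of uminus "tpose v"] by (simp add: linear_iff)
  show ?thesis
    unfolding pfaff_b1_alpha_def pfaff_b2_beta_def fv nabla_b1_alpha_def nabla_b2_beta_def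
    by (simp add: Let_def D b1_alpha_tp p_form_def q_form_def tp_forms tpose_nth sum_negf sum.distrib)
qed

section \<open>The case of two-dimensional factors\<close>

text \<open>For \<open>p = q = 2\<close> the first Bianchi identity, the trace conditions and the Ricci normalization
  leave only the totally symmetric parts of \<open>b\<^sup>1\<close> and \<open>b\<^sup>2\<close>.\<close>

context
  fixes B1 :: "'q::finite \<Rightarrow> 'p::finite \<Rightarrow> 'p \<Rightarrow> 'q \<Rightarrow> 'q \<Rightarrow> 'q \<Rightarrow> real" and B2 :: "'p \<Rightarrow> 'p \<Rightarrow> 'p \<Rightarrow> 'p \<Rightarrow> 'q \<Rightarrow> 'q \<Rightarrow> real"
  assumes sk1: "\<And>i \<gamma> \<delta> j k l. B1 i \<gamma> \<delta> j k l = - B1 i \<delta> \<gamma> j l k" and sk2: "\<And>\<beta> \<gamma> \<delta> \<alpha> k l. B2 \<beta> \<gamma> \<delta> \<alpha> k l = - B2 \<beta> \<delta> \<gamma> \<alpha> l k"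
    and tr1: "\<And>\<gamma> \<delta> k l. (\<Sigma> i. B1 i \<gamma> \<delta> i k l) = 0" and tr2: "\<And>\<gamma> \<delta> k l. (\<Sigma> \<alpha>. B2 \<alpha> \<gamma> \<delta> \<alpha> k l) = 0"
    and ric: "\<And>\<gamma> \<delta> k l. (\<Sigma> \<alpha>. B2 \<gamma> \<alpha> \<delta> \<alpha> k l) - (\<Sigma> i. B1 i \<gamma> \<delta> k i l)
       + (\<Sigma> \<alpha>. B2 \<delta> \<alpha> \<gamma> \<alpha> l k) - (\<Sigma> i. B1 i \<delta> \<gamma> l i k) = 0"
    and bi: "\<And>\<gamma> \<delta> \<epsilon> k l j \<alpha> i. (if i = j then B2 \<epsilon> \<gamma> \<delta> \<alpha> k l else 0) + (if i = k then B2 \<gamma> \<delta> \<epsilon> \<alpha> l j else 0)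
       + (if i = l then B2 \<delta> \<epsilon> \<gamma> \<alpha> j k else 0) - (if \<alpha> = \<epsilon> then B1 i \<gamma> \<delta> j k l else 0)
       - (if \<alpha> = \<gamma> then B1 i \<delta> \<epsilon> k l j else 0) - (if \<alpha> = \<delta> then B1 i \<epsilon> \<gamma> l j k else 0) = 0"
begin

text \<open>Linear elimination from the listed instances of the trace, Ricci and Bianchi identities.
  Exchanging the two Greek or the two Latin values yields the remaining components; both orders of
  each inequality are assumed so that all index comparisons are decided.\<close>

lemma b1_symmetric_basis:
  assumes ab: "(UNIV :: 'p set) = {a, b}" "a \<noteq> b" "b \<noteq> a" and mn: "(UNIV :: 'q set) = {m, n}" "m \<noteq> n" "n \<noteq> m"
  shows "B1 m a a m n m = B1 m a a n m m" (is ?th1) "B1 m a a m n n = B1 m a a n m n" (is ?th2)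
    "B1 m a b m n m = B1 m a b n m m" (is ?th3) "B1 m a b m n n = B1 m a b n m n" (is ?th4)
proof -
  show ?th1
    using tr1[of a a m n] ric[of a a m n] bi[of m m b a a b m n] bi[of n n b a a b m n]
      sk1[of m a a m n m] sk1[of m a a n m m] sk1[of n a a m n n] sk1[of n a a n n m] sk2[of a a a a n m] sk2[of a b a b m n] sk2[of a b a b n m]
    by (simp add: ab mn)
  show ?th2
    using ric[of a a n n] bi[of m n b a a b m n]
      sk1[of m a a m n n] sk1[of n a a n n n] sk2[of a a a a n n] sk2[of a b a b n n]
    by (simp add: ab mn)
  show ?th3
    using tr1[of a b m n] tr2[of a b m n] tr1[of a b n m] tr2[of a b n m] ric[of a b n m] bi[of m m b a a a m n] bi[of n n b a a a m n] bi[of m n b a b b m m]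
      sk1[of m b a m m n] sk1[of m b a m n m] sk1[of m b a n m m] sk1[of n b a m n n] sk1[of n b a n n m] sk2[of a b a a n m] sk2[of a b b b n m] sk2[of b b a b m n] sk2[of b b a b n m]
    by (simp add: ab mn)
  show ?th4
    using tr2[of a b n n] ric[of a b n n] bi[of m n b a a a m n] bi[of m n b a b b n m]
      sk1[of m b a m n n] sk1[of m b a n m n] sk1[of m b a n n m] sk1[of n b a n n n] sk2[of a b b b n n] sk2[of b a a a n n] sk2[of b b a b n n]
    by (simp add: ab mn)
qed

lemma b1_symmetric:
  assumes p2: "CARD('p) = 2" and q2: "CARD('q) = 2"
  shows "B1 i \<gamma> \<delta> j k l = B1 i \<gamma> \<delta> k j l" "B1 i \<gamma> \<delta> j k l = B1 i \<gamma> \<delta> k l j"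
proof -
  obtain a b :: 'p where ab: "UNIV = {a, b}" "a \<noteq> b" using card_2_UNIV[OF p2] .
  obtain m n :: 'q where mn: "UNIV = {m, n}" "m \<noteq> n" using card_2_UNIV[OF q2] .
  have ab': "UNIV = {b, a}" "b \<noteq> a" and mn': "UNIV = {n, m}" "n \<noteq> m" using ab mn by auto
  have c: "\<gamma> = a \<or> \<gamma> = b" "j = m \<or> j = n" for \<gamma> :: 'p and j :: 'q using ab(1) mn(1) by auto
  have s: "B1 i \<gamma> \<delta> j k l = B1 i \<gamma> \<delta> k j l" for i \<gamma> \<delta> j k l
    using c(1)[of \<gamma>] c(1)[of \<delta>] c(2)[of i] c(2)[of j] c(2)[of k] c(2)[of l]
      b1_symmetric_basis[OF ab ab'(2) mn mn'(2)] b1_symmetric_basis[OF ab ab'(2) mn' mn(2)]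
      b1_symmetric_basis[OF ab' ab(2) mn mn'(2)] b1_symmetric_basis[OF ab' ab(2) mn' mn(2)]
    by (elim disjE) simp_all
  show "B1 i \<gamma> \<delta> j k l = B1 i \<gamma> \<delta> k j l" by (rule s)
  \<comment> \<open>Conjugating the exchange of the first two lower indices by the pair exchange
    \<open>sk1\<close> makes it act on other positions, so the full symmetric group is
    obtained.\<close>
  have "B1 i \<gamma> \<delta> j k l = B1 i \<gamma> \<delta> l j k" for i \<gamma> \<delta> j k l
    using s[of i \<gamma> \<delta> j k l] sk1[of i \<gamma> \<delta> k j l] s[of i \<delta> \<gamma> k l j] sk1[of i \<delta> \<gamma> l k j] by simp
  from this[of i \<gamma> \<delta> k l j] show "B1 i \<gamma> \<delta> j k l = B1 i \<gamma> \<delta> k l j" by simp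
qed

end

lemma mult_dyad_axis:
  "(A ** \<E> \<gamma> k) $ \<alpha>' $ i' = (if i' = k then A $ \<alpha>' $ \<gamma> else 0)"
  "(\<E> \<gamma> k ** B) $ \<alpha> $ i = (if \<alpha> = \<gamma> then B $ k $ i else 0)"
  for A :: "real^'p::finite^'r" and B :: "real^'s^'q::finite"
  by (auto simp: matrix_matrix_mult_def dyad_def axis_def if_distrib[of "\<lambda>x. x * _"] if_distrib[of "\<lambda>x. _ * x"] cong: if_cong)

context pframe
begin

text \<open>The \<nu>-terms drop out of the cyclic sum by themselves, so the algebraic Bianchi
  identity holds for b^1 and b^2 alone.\<close>

lemma torsion_free_bianchi:
  assumes T: "\<And>y z z'. y \<in> U \<Longrightarrow> tors P y z z' = 0" and y: "y \<in> U"
  shows "(curv2 P y z1 z2 ** z3 - z3 ** curv1 P y z1 z2) + (curv2 P y z2 z3 ** z1 - z1 ** curv1 P y z2 z3)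
    + (curv2 P y z3 z1 ** z2 - z2 ** curv1 P y z3 z1) = 0"
proof -
  define p q where "p = real CARD('p)" and "q = real CARD('q)"
  have pq: "p + q \<noteq> 0" by (simp add: p_def q_def) (metis add_pos_pos of_nat_0_less_iff zero_less_card_finite less_irrefl)
  have D: "fder (\<lambda>y. tors P y b c) y a = 0" for a b c
  proof -
    have "((\<lambda>y. tors P y b c) has_derivative (\<lambda>a. 0)) (at y)"
      by (rule has_derivative_transform_within_open[OF has_derivative_const open_U y]) (simp add: T)
    then show ?thesis by (simp add: frechet_derivative_eqI)
  qed
  define n where "n z = \<nu> y (X y z)" for z
  define t where "t a b = trace (n a ** b) - trace (n b ** a)" for a b
  have R: "Rg y (X y a) (X y b) z = (curv2 P y a b ** z - z ** curv1 P y a b)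
     - (p * q / (p + q)) *\<^sub>R ((a ** n b - b ** n a) ** z - z ** (n a ** b - n b ** a))" for a b z
  proof -
    have tt: "trace (a ** n b) - trace (b ** n a) = - t a b"
      by (simp add: t_def trace_mul_sym[of a] trace_mul_sym[of b])
    have 1: "Rp y (X y a) (X y b) = (q / (p + q)) *\<^sub>R ((- t a b) *\<^sub>R mat 1 - p *\<^sub>R (a ** n b - b ** n a)) + curv2 P y a b"
      using y by (simp add: curvature_def structure_eqs[OF y] p_def q_def n_def[symmetric] flip: tt)
    have 2: "Rq y (X y a) (X y b) = (p / (p + q)) *\<^sub>R (t a b *\<^sub>R mat 1 - q *\<^sub>R (n a ** b - n b ** a)) + curv1 P y a b"
      using y by (simp add: curvature_def structure_eqs[OF y] p_def q_def n_def[symmetric] t_def)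
    have 3: "vext_d h y (X y a) (X y b) = t a b"
      using y by (simp add: structure_eqs[OF y] n_def[symmetric] t_def)
    \<comment> \<open>The trace terms of the two curvature equations have the weights q/(p+q) and
      p/(p+q), which together cancel the homothety part.\<close>
    have 4: "(t a b - q * t a b / (p + q) - p * t a b / (p + q)) = 0"
      using pq by (simp add: field_simps)
    have "Rg y (X y a) (X y b) z = (t a b - q * t a b / (p + q) - p * t a b / (p + q)) *\<^sub>R z
       + ((curv2 P y a b ** z - z ** curv1 P y a b)
     - (p * q / (p + q)) *\<^sub>R ((a ** n b - b ** n a) ** z - z ** (n a ** b - n b ** a)))"
      unfolding Rg_def 1 2 3
      by (simp add: mm_simps algebra_simps)
    then show ?thesis unfolding 4 by simp
  qed
  have "(Rg y (X y z1) (X y z2) z3 + Rg y (X y z2) (X y z3) z1 + Rg y (X y z3) (X y z1) z2) = 0"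
    using bianchi[OF y, of "X y z1" "X y z2" "X y z3"] y
    by (simp add: D T linear_0[OF linear_gam'])
  then show ?thesis
    unfolding R by (simp add: mm_simps matrix_mul_assoc algebra_simps)
qed

lemma obj_b1_eq:
  assumes "CARD('p) = 2" "CARD('q) = 2" and y: "y \<in> U"
  shows "obj_b1 P y = b1_alpha P y"
proof -
  have T: "tors P y z z' = 0" if "y \<in> U" for y z z'
    using obj_a_eq_0[OF object_identities[OF that] assms(1,2)] by (simp add: tors_def vec_eq_iff)
  note o = object_identitiesD[OF object_identities[OF y]]
  have bi: "(if i = j then obj_b2 P y $ (\<epsilon>, \<gamma>, \<delta>, \<alpha>, k, l) else 0) + (if i = k then obj_b2 P y $ (\<gamma>, \<delta>, \<epsilon>, \<alpha>, l, j) else 0)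
       + (if i = l then obj_b2 P y $ (\<delta>, \<epsilon>, \<gamma>, \<alpha>, j, k) else 0) - (if \<alpha> = \<epsilon> then obj_b1 P y $ (i, \<gamma>, \<delta>, j, k, l) else 0)
       - (if \<alpha> = \<gamma> then obj_b1 P y $ (i, \<delta>, \<epsilon>, k, l, j) else 0) - (if \<alpha> = \<delta> then obj_b1 P y $ (i, \<epsilon>, \<gamma>, l, j, k) else 0) = 0"
    for \<gamma> \<delta> \<epsilon> k l j \<alpha> i
  proof -
    have "2 * ((if i = j then obj_b2 P y $ (\<epsilon>, \<gamma>, \<delta>, \<alpha>, k, l) else 0) + (if i = k then obj_b2 P y $ (\<gamma>, \<delta>, \<epsilon>, \<alpha>, l, j) else 0)
       + (if i = l then obj_b2 P y $ (\<delta>, \<epsilon>, \<gamma>, \<alpha>, j, k) else 0) - (if \<alpha> = \<epsilon> then obj_b1 P y $ (i, \<gamma>, \<delta>, j, k, l) else 0)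
       - (if \<alpha> = \<gamma> then obj_b1 P y $ (i, \<delta>, \<epsilon>, k, l, j) else 0) - (if \<alpha> = \<delta> then obj_b1 P y $ (i, \<epsilon>, \<gamma>, l, j, k) else 0)) = 0"
      using arg_cong[OF torsion_free_bianchi[OF T y, of "\<E> \<gamma> k" "\<E> \<delta> l" "\<E> \<epsilon> j"],
        of "\<lambda>A. A $ \<alpha> $ i"]
      by (simp add: mult_dyad_axis curv1_axis[OF object_identities[OF y]] curv2_axis[OF object_identities[OF y]]
          distrib_left right_diff_distrib if_distrib[of "\<lambda>x. 2 * x"] del: mult_cancel_left cong: if_cong)
    then show ?thesis by simp
  qed
  note s = b1_symmetric[where ?B1.0="\<lambda>i \<gamma> \<delta> j k l. obj_b1 P y $ (i, \<gamma>, \<delta>, j, k, l)" and ?B2.0="\<lambda>\<beta> \<gamma> \<delta> \<alpha> k l. obj_b2 P y $ (\<beta>, \<gamma>, \<delta>, \<alpha>, k, l)",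
      OF o(5) o(4) o(7) o(6) o(8) bi assms(1,2)]
  have "obj_b1 P y $ (i, \<gamma>, \<delta>, j, k, l) = b1_alpha P y $ (i, \<gamma>, \<delta>, j, k, l)" for i \<gamma> \<delta> j k l
    using s(1)[of i \<gamma> \<delta> j k l] s(2)[of i \<gamma> \<delta> j k l] s(2)[of i \<gamma> \<delta> k l j] s(2)[of i \<gamma> \<delta> k j l] s(2)[of i \<gamma> \<delta> j l k]
    by (simp add: b1_alpha_def sym3_def)
  then show ?thesis by (auto simp: vec_eq_iff)
qed

end

section \<open>The second Bianchi identity and the determination of c\<close>

context pframe
begin

text \<open>The covariant derivative of \<open>curv1\<close>: \<open>gam\<close> acts on both
  arguments and \<open>\<rho>\<close> on the value.\<close>

definition Dcurv1 :: "real^'q^'p \<Rightarrow> real^'q^'p \<Rightarrow> real^'q^'p \<Rightarrow> real^'q^'p \<Rightarrow> real^'q^'q" where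
  "Dcurv1 y u z z' = fder (\<lambda>y. curv1 P y z z') y u + curv1 P y (gam y u z) z' + curv1 P y z (gam y u z')
     - \<rho> y u ** curv1 P y z z' + curv1 P y z z' ** \<rho> y u"

text \<open>The exterior derivative of the curvature equation for \<open>\<rho>\<close>. The
  \<nu>-terms of that equation, with coefficient p q / (p + q), are differentiated by the last
  structure equation, which is how c enters.\<close>

lemma second_bianchi:
  assumes a0: "\<And>y. y \<in> U \<Longrightarrow> obj_a P y = 0" and y: "y \<in> U"
  shows "Dcurv1 y u (w y v) (w y x) + Dcurv1 y v (w y x) (w y u) + Dcurv1 y x (w y u) (w y v)
    = (real CARD('p) * real CARD('q) / (real CARD('p) + real CARD('q))) *\<^sub>R
      (curvn P y (w y u) (w y v) ** w y x + curvn P y (w y v) (w y x) ** w y u + curvn P y (w y x) (w y u) ** w y v)"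
proof -
  define W where "W = w y"
  define K where "K = curv1 P y"
  define G where "G = gam y"
  define r n where "r = \<rho> y" and "n = \<nu> y"
  define c where "c = real CARD('p) * real CARD('q) / (real CARD('p) + real CARD('q))"
  define e where "e = real CARD('p) / (real CARD('p) + real CARD('q))"
  define dw where "dw a b = fder (\<lambda>z. w z b) y a" for a b
  define dn where "dn a b = fder (\<lambda>z. \<nu> z b) y a" for a b
  define dr where "dr a b = fder (\<lambda>z. \<rho> z b) y a" for a b
  define DK where "DK a z z' = fder (\<lambda>y. curv1 P y z z') y a" for a z z'
  define Vr where "Vr k a b = fder (\<lambda>y. vext_d \<rho> y a b) y k" for a b k
  define Vh where "Vh k a b = fder (\<lambda>y. vext_d h y a b) y k" for a b k
  have tors0: "tors P y z z' = 0" and tdual0: "tdual P y n' z = 0" for z z' n'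
    using a0[OF y] by (simp_all add: tors_def tdual_def vec_eq_iff)
  have fd: "((\<lambda>z. \<beta> z b) has_derivative fder (\<lambda>z. \<beta> z b) y) (at y)" if "smooth_form U \<beta>"
    for \<beta> :: "_ \<Rightarrow> _ \<Rightarrow> 'z::real_normed_vector" and b
    by (rule smooth_on_has_derivative[OF smooth_form_smooth[OF that] y])
  have vd: "((\<lambda>z. vext_d \<beta> z a b) has_derivative fder (\<lambda>z. vext_d \<beta> z a b) y) (at y)" if "smooth_form U \<beta>"
    for \<beta> :: "_ \<Rightarrow> _ \<Rightarrow> 'z::euclidean_space" and a b
    by (rule smooth_on_has_derivative[OF smooth_vext_d[OF open_U that] y])
  have Kd: "((\<lambda>z. curv1 P z (w z a) (w z b)) has_derivative
      (\<lambda>k. DK k (W a) (W b) + K (dw k a) (W b) - K (dw k b) (W a))) (at y)" for a b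
    using has_derivative_bilinear_family[OF open_U y smooth_curv1 bilinear_curv1 smooth_form_smooth[OF forms(1), of a] smooth_form_smooth[OF forms(1), of b]]
    by (simp add: DK_def K_def W_def dw_def curv1_skew[of P y "w y a"])
  have D: "Vr k a b - (r a ** dr k b + dr k a ** r b - (r b ** dr k a + dr k b ** r a))
     = e *\<^sub>R (Vh k a b *\<^sub>R mat 1 - real CARD('q) *\<^sub>R ((n a ** dw k b + dn k a ** W b) - (n b ** dw k a + dn k b ** W a)))
       + (DK k (W a) (W b) + K (dw k a) (W b) - K (dw k b) (W a))" for k a b
  proof -
    have 1: "((\<lambda>y. Rq y a b) has_derivative
       (\<lambda>k. Vr k a b - (r a ** dr k b + dr k a ** r b - (r b ** dr k a + dr k b ** r a)))) (at y)"
      unfolding curvature_def Vr_def r_def dr_def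
      by (intro has_derivative_diff bounded_bilinear.FDERIV[OF bounded_bilinear_mm] fd vd forms)
    have 2: "fder (\<lambda>y. Rq y a b) y = (\<lambda>k. e *\<^sub>R (Vh k a b *\<^sub>R mat 1 - real CARD('q) *\<^sub>R ((n a ** dw k b + dn k a ** W b) - (n b ** dw k a + dn k b ** W a)))
       + (DK k (W a) (W b) + K (dw k a) (W b) - K (dw k b) (W a)))"
      unfolding Vh_def n_def dw_def dn_def W_def
      by (rule fder_eqI_open[where f="\<lambda>y. e *\<^sub>R (vext_d h y a b *\<^sub>R mat 1 - real CARD('q) *\<^sub>R (\<nu> y a ** w y b - \<nu> y b ** w y a)) + curv1 P y (w y a) (w y b)", OF _ open_U y],
          intro has_derivative_add has_derivative_diff has_derivative_scaleR_right has_derivative_scaleR_left bounded_bilinear.FDERIV[OF bounded_bilinear_mm] fd vd forms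
          Kd[unfolded dw_def W_def]) (simp add: Rq_eq e_def)
    show ?thesis using fun_cong[OF 2, of k] unfolding frechet_derivative_eqI[OF 1] .
  qed
  have rs: "dr a b = dr b a + (r a ** r b - r b ** r a) + Rq y a b" for a b
    by (simp add: curvature_def vext_d_def dr_def r_def)
  have ws: "dw a b = dw b a + (G a (W b) - G b (W a))" for a b
    using dw_gam[OF y, of a b] by (simp add: vext_d_def dw_def G_def W_def tors0 algebra_simps)
  have Gd: "G a z = \<pi> y a ** z - z ** r a + h y a *\<^sub>R z" for a z by (simp add: G_def gam_def r_def)
  have ns: "dn a b = dn b a + ((n a ** \<pi> y b - n b ** \<pi> y a) + (r a ** n b - r b ** n a)
      - (h y a *\<^sub>R n b - h y b *\<^sub>R n a) + curvn P y (W a) (W b))" for a b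
    using structure_eqs(5)[OF y, of a b] by (simp add: vext_d_def dn_def n_def r_def W_def tdual0 algebra_simps)
  have closed: "Vr u v x + Vr v x u + Vr x u v = 0" "Vh u v x + Vh v x u + Vh x u v = 0"
    using vext_d_closed[OF open_U y forms(4), of v x u] vext_d_closed[OF open_U y forms(2), of v x u]
    by (simp_all add: Vr_def Vh_def add_ac)
  note K_simps = bounded_bilinear.add_left[OF bounded_bilinear_curv1, of P y, folded K_def]
    bounded_bilinear.add_right[OF bounded_bilinear_curv1, of P y, folded K_def]
    bounded_bilinear.diff_left[OF bounded_bilinear_curv1, of P y, folded K_def]
    bounded_bilinear.diff_right[OF bounded_bilinear_curv1, of P y, folded K_def]
  have Ks: "K z z' = - K z' z" for z z' unfolding K_def by (rule curv1_skew)
  \<comment> \<open>The three groups of terms are treated separately: \<open>E1\<close> collects the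
    commutators of \<open>\<rho>\<close> with its curvature, \<open>E2\<close> the derivatives of
    the arguments of \<open>curv1\<close>, and \<open>E3\<close> the \<nu>-terms. The commutators
    with \<nu>-terms in \<open>E1\<close> and \<open>E3\<close> then cancel by
    \<open>Rqc\<close>.\<close>
  have E1: "(Vr u v x - (r v ** dr u x + dr u v ** r x - (r x ** dr u v + dr u x ** r v)))
      + (Vr v x u - (r x ** dr v u + dr v x ** r u - (r u ** dr v x + dr v u ** r x)))
      + (Vr x u v - (r u ** dr x v + dr x u ** r v - (r v ** dr x u + dr x v ** r u)))
    = (r u ** Rq y v x - Rq y v x ** r u) + (r v ** Rq y x u - Rq y x u ** r v) + (r x ** Rq y u v - Rq y u v ** r x)"
    using closed(1) unfolding rs[of u v] rs[of v x] rs[of x u]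
    by (simp add: mm_simps matrix_mul_assoc algebra_simps)
  have E2: "K (dw u v) (W x) - K (dw u x) (W v) + (K (dw v x) (W u) - K (dw v u) (W x)) + (K (dw x u) (W v) - K (dw x v) (W u))
     = (K (G u (W v)) (W x) + K (W v) (G u (W x))) + (K (G v (W x)) (W u) + K (W x) (G v (W u))) + (K (G x (W u)) (W v) + K (W u) (G x (W v)))"
    unfolding ws[of u v] ws[of v x] ws[of x u]
    using Ks[of "W v"] Ks[of "W x"] Ks[of "W u"] by (simp add: K_simps)
  define N where "N a b c = n b ** dw a c + dn a b ** W c - (n c ** dw a b + dn a c ** W b)" for a b c
  have E3: "N u v x + N v x u + N x u v
     = curvn P y (W u) (W v) ** W x + curvn P y (W v) (W x) ** W u + curvn P y (W x) (W u) ** W v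
     + ((r u ** (n v ** W x - n x ** W v) - (n v ** W x - n x ** W v) ** r u)
      + (r v ** (n x ** W u - n u ** W x) - (n x ** W u - n u ** W x) ** r v)
      + (r x ** (n u ** W v - n v ** W u) - (n u ** W v - n v ** W u) ** r x))"
    unfolding N_def ws[of u v] ws[of v x] ws[of x u] ns[of u v] ns[of v x] ns[of x u] Gd
    by (simp add: mm_simps matrix_mul_assoc algebra_simps)
  have Rqc: "r k ** Rq y a b - Rq y a b ** r k = - (c *\<^sub>R (r k ** (n a ** W b - n b ** W a) - (n a ** W b - n b ** W a) ** r k))
     + (r k ** K (W a) (W b) - K (W a) (W b) ** r k)" for k a b
  proof -
    have "Rq y a b = (e * vext_d h y a b) *\<^sub>R mat 1 - c *\<^sub>R (n a ** W b - n b ** W a) + K (W a) (W b)"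
      unfolding Rq_eq[OF y] e_def c_def n_def W_def K_def by (simp add: scaleR_diff_right)
    then show ?thesis by (simp add: mm_simps scaleR_diff_right)
  qed
  define S1 where "S1 = DK u (W v) (W x) + DK v (W x) (W u) + DK x (W u) (W v)"
  have "(r u ** Rq y v x - Rq y v x ** r u) + (r v ** Rq y x u - Rq y x u ** r v) + (r x ** Rq y u v - Rq y u v ** r x)
    = (e * (Vh u v x + Vh v x u + Vh x u v)) *\<^sub>R mat 1 - c *\<^sub>R (N u v x + N v x u + N x u v) + S1
     + (K (dw u v) (W x) - K (dw u x) (W v) + (K (dw v x) (W u) - K (dw v u) (W x)) + (K (dw x u) (W v) - K (dw x v) (W u)))"
    unfolding E1[symmetric] D N_def S1_def c_def e_def
    by (simp add: algebra_simps) (simp add: add_divide_distrib scaleR_add_left)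
  then have "S1 + ((K (G u (W v)) (W x) + K (W v) (G u (W x))) + (K (G v (W x)) (W u) + K (W x) (G v (W u))) + (K (G x (W u)) (W v) + K (W u) (G x (W v))))
     - ((r u ** K (W v) (W x) - K (W v) (W x) ** r u) + (r v ** K (W x) (W u) - K (W x) (W u) ** r v) + (r x ** K (W u) (W v) - K (W u) (W v) ** r x))
    = c *\<^sub>R (curvn P y (W u) (W v) ** W x + curvn P y (W v) (W x) ** W u + curvn P y (W x) (W u) ** W v)"
    unfolding closed E2 E3 Rqc by (simp add: algebra_simps)
  then show ?thesis
    unfolding Dcurv1_def c_def[symmetric] W_def[symmetric] K_def[symmetric] G_def[symmetric] r_def[symmetric]
    by (simp add: S1_def DK_def K_def algebra_simps)
qed

text \<open>Each of the two arguments contributes one homothety term, which is the weight two in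
  \<open>nabla_b1_alpha\<close>. The factor 2 is that of \<open>curv1_axis\<close>.\<close>

lemma Dcurv1_axis:
  assumes p2: "CARD('p) = 2" and q2: "CARD('q) = 2" and y: "y \<in> U"
  shows "Dcurv1 y u (\<E> \<gamma> k) (\<E> \<delta> l) $ j $ i = 2 * nabla_b1_alpha P y u $ (i, \<gamma>, \<delta>, j, k, l)"
proof -
  define E where "E \<gamma> k = (\<E> \<gamma> k :: real^'q^'p)" for \<gamma> k
  define b where "b i \<gamma> \<delta> j k l = b1_alpha P y $ (i, \<gamma>, \<delta>, j, k, l)" for i \<gamma> \<delta> j k l
  have ax0: "curv1 P y (E \<gamma> k) (E \<delta> l) $ j $ i = 2 * b1_alpha P y $ (i, \<gamma>, \<delta>, j, k, l)" if "y \<in> U" for y \<gamma> k \<delta> l j i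
    unfolding E_def curv1_axis[OF object_identities[OF that]] obj_b1_eq[OF p2 q2 that] by simp
  have ax: "curv1 P y (E \<gamma> k) (E \<delta> l) $ j $ i = 2 * b i \<gamma> \<delta> j k l" for \<gamma> k \<delta> l j i
    unfolding b_def by (rule ax0[OF y])
  have l: "linear (\<lambda>z. curv1 P y z z')" "linear (curv1 P y z)" for z z'
    using bilinear_curv1[of P y] by (auto simp: bilinear_def)
  have g: "gam y u (E \<gamma> k) = (\<Sigma> \<epsilon>. \<pi> y u $ \<epsilon> $ \<gamma> *\<^sub>R E \<epsilon> k) - (\<Sigma> m. \<rho> y u $ k $ m *\<^sub>R E \<gamma> m) + h y u *\<^sub>R E \<gamma> k" for \<gamma> k
  proof -
    have "(\<pi> y u *v axis \<gamma> 1) $ \<epsilon> = \<pi> y u $ \<epsilon> $ \<gamma>" "(axis k 1 v* \<rho> y u) $ m = \<rho> y u $ k $ m" for \<epsilon> m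
      by (simp_all add: matrix_vector_mult_def vector_matrix_mult_def axis_def if_distrib[of "\<lambda>x. _ * x"]
          if_distrib[of "\<lambda>x. x * _"] cong: if_cong)
    then show ?thesis
      unfolding gam_def E_def matrix_dyad dyad_matrix
      using dyad_sum_right[of "\<pi> y u *v axis \<gamma> 1" "axis k 1"] dyad_sum_left[of "axis k 1 v* \<rho> y u" "axis \<gamma> 1"] by simp
  qed
  have D: "fder (\<lambda>y. curv1 P y (E \<gamma> k) (E \<delta> l)) y u $ j $ i
     = 2 * fder (\<lambda>y. b1_alpha P y $ (i, \<gamma>, \<delta>, j, k, l)) y u"
  proof -
    have "((\<lambda>y. 2 * b1_alpha P y $ (i, \<gamma>, \<delta>, j, k, l)) has_derivative
       (\<lambda>u. 2 * fder (\<lambda>y. b1_alpha P y $ (i, \<gamma>, \<delta>, j, k, l)) y u)) (at y)"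
      by (intro has_derivative_mult_right smooth_on_has_derivative[OF smooth_b1_alpha y])
    then have 1: "((\<lambda>y. curv1 P y (E \<gamma> k) (E \<delta> l) $ j $ i) has_derivative
       (\<lambda>u. 2 * fder (\<lambda>y. b1_alpha P y $ (i, \<gamma>, \<delta>, j, k, l)) y u)) (at y)"
      by (rule has_derivative_transform_within_open[OF _ open_U y]) (simp add: ax0)
    have d: "(\<lambda>y. curv1 P y (E \<gamma> k) (E \<delta> l)) differentiable (at y)"
      by (rule smooth_on_differentiable[OF smooth_curv1 y])
    show ?thesis
      using fun_cong[OF frechet_derivative_eqI[OF 1], of u]
      unfolding frechet_derivative_component[OF differentiable_component[OF d]] frechet_derivative_component[OF d] .
  qed
  have "Dcurv1 y u (E \<gamma> k) (E \<delta> l) $ j $ i = 2 * nabla_b1_alpha P y u $ (i, \<gamma>, \<delta>, j, k, l)"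
    unfolding Dcurv1_def g
    by (simp add: linear_add[OF l(1)] linear_diff[OF l(1)] linear_scale[OF l(1)] linear_sum[OF l(1)]
        linear_add[OF l(2)] linear_diff[OF l(2)] linear_scale[OF l(2)] linear_sum[OF l(2)]
        D ax matrix_matrix_mult_def nabla_b1_alpha_def Let_def b_def[symmetric] p_form_def q_form_def)
      (simp add: sum.distrib sum_distrib_left algebra_simps)
  then show ?thesis by (simp add: E_def)
qed

text \<open>The second Bianchi identity on unit dyads; for p = q = 2 the coefficient p q / (p + q)
  is 1.\<close>

lemma curvn_cyclic:
  assumes p2: "CARD('p) = 2" and q2: "CARD('q) = 2" and y: "y \<in> U"
  defines "E \<equiv> \<lambda>\<gamma> k. \<E> \<gamma> k" and "B \<equiv> pfaff_b1_alpha P y"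
  shows "(curvn P y (E \<gamma> k) (E \<delta> l) ** E \<epsilon> m + curvn P y (E \<delta> l) (E \<epsilon> m) ** E \<gamma> k + curvn P y (E \<epsilon> m) (E \<gamma> k) ** E \<delta> l) $ j $ i
    = 2 * (B \<gamma> k $ (i, \<delta>, \<epsilon>, j, l, m) + B \<delta> l $ (i, \<epsilon>, \<gamma>, j, m, k) + B \<epsilon> m $ (i, \<gamma>, \<delta>, j, k, l))"
proof -
  have a0: "obj_a P y = 0" if "y \<in> U" for y
    by (rule obj_a_eq_0[OF object_identities[OF that] p2 q2])
  have c: "real CARD('p) * real CARD('q) / (real CARD('p) + real CARD('q)) = 1" by (simp add: p2 q2)
  have wX: "w y (X y z) = z" for z using y by simp
  have f: "X y (E \<gamma> k) = frame_vector P y \<gamma> k" for \<gamma> k by (simp add: X_def E_def frame_vector_def)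
  from second_bianchi[OF a0 y, of "X y (E \<gamma> k)" "X y (E \<delta> l)" "X y (E \<epsilon> m)", unfolded wX c]
  have "curvn P y (E \<gamma> k) (E \<delta> l) ** E \<epsilon> m + curvn P y (E \<delta> l) (E \<epsilon> m) ** E \<gamma> k + curvn P y (E \<epsilon> m) (E \<gamma> k) ** E \<delta> l
    = Dcurv1 y (X y (E \<gamma> k)) (E \<delta> l) (E \<epsilon> m) + Dcurv1 y (X y (E \<delta> l)) (E \<epsilon> m) (E \<gamma> k) + Dcurv1 y (X y (E \<epsilon> m)) (E \<gamma> k) (E \<delta> l)"
    by simp
  then show ?thesis
    unfolding f by (simp add: E_def Dcurv1_axis[OF p2 q2 y] B_def pfaff_b1_alpha_def)
qed

end

text \<open>In a two-element index set the indices of the cyclic sums can be chosen so that one term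
  survives: \<open>R\<close> kills entries with equal Latin indices in the two pairs,
  \<open>L\<close> those with equal Greek ones. If both differ, the last Greek index equals one of
  the first two, and \<open>R\<close> reduces the entry to a case already treated.\<close>

lemma skew_cyclic_eq_0:
  fixes Q :: "'p::finite \<Rightarrow> 'q::finite \<Rightarrow> 'p \<Rightarrow> 'q \<Rightarrow> 'q \<Rightarrow> 'p \<Rightarrow> real"
  assumes p2: "CARD('p) = 2" and q2: "CARD('q) = 2" and sk: "\<And>\<gamma> k i \<alpha>. Q \<gamma> k \<gamma> k i \<alpha> = 0"
    and R: "\<And>\<gamma> k \<delta> l \<epsilon> m j i. (if i = m then Q \<gamma> k \<delta> l j \<epsilon> else 0) + (if i = k then Q \<delta> l \<epsilon> m j \<gamma> else 0)
      + (if i = l then Q \<epsilon> m \<gamma> k j \<delta> else 0) = 0"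
    and L: "\<And>\<gamma> k \<delta> l \<epsilon> m \<beta> \<alpha>. (if \<beta> = \<epsilon> then Q \<gamma> k \<delta> l m \<alpha> else 0) + (if \<beta> = \<gamma> then Q \<delta> l \<epsilon> m k \<alpha> else 0)
      + (if \<beta> = \<delta> then Q \<epsilon> m \<gamma> k l \<alpha> else 0) = 0"
  shows "Q \<gamma> k \<delta> l i \<alpha> = 0"
proof -
  have ex: "\<exists>b. b \<noteq> a" if "CARD('x) = 2" for a :: "'x::finite"
    using that by (metis card_2_UNIV insertI1 insertI2 insert_iff)
  have two: "b = a \<or> b = c" if "CARD('x) = 2" "a \<noteq> c" for a b c :: "'x::finite"
    using card_2_UNIV[OF that(1)] that(2) by (metis UNIV_I empty_iff insert_iff)
  have k: "Q \<gamma> k \<delta> k i \<alpha> = 0" for \<gamma> k \<delta> i \<alpha>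
  proof -
    obtain m where "m \<noteq> k" using ex[OF q2] by blast
    then show ?thesis using R[of m m \<gamma> k \<delta> k i \<alpha>] by simp
  qed
  have g: "Q \<gamma> k \<gamma> l i \<alpha> = 0" for \<gamma> k l i \<alpha>
  proof -
    obtain \<epsilon> where "\<epsilon> \<noteq> \<gamma>" using ex[OF p2] by blast
    then show ?thesis using L[of \<epsilon> \<epsilon> \<gamma> k \<gamma> l i \<alpha>] by simp
  qed
  show ?thesis
  proof (cases "k = l \<or> \<gamma> = \<delta>")
    case True then show ?thesis using k g by auto
  next
    case False
    then have "\<alpha> = \<delta> \<or> \<alpha> = \<gamma>" using two[OF p2, of \<delta> \<gamma> \<alpha>] by auto
    then show ?thesis
    proof
      assume "\<alpha> = \<delta>"
      then show ?thesis using R[of k k \<gamma> k \<delta> l i \<delta>] g[of \<delta> l k i \<gamma>] False by simp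
    next
      assume "\<alpha> = \<gamma>"
      then show ?thesis using R[of l l \<gamma> k \<delta> l i \<gamma>] g[of \<gamma> l k i \<delta>] False by auto
    qed
  qed
qed

text \<open>Equal Pfaffian derivatives give equal right-hand sides in \<open>curvn_cyclic\<close>,
  both for the frames and for their transposes. The difference of the two values of c therefore
  satisfies the homogeneous equations of \<open>skew_cyclic_eq_0\<close>.\<close>

theorem obj_c_determined:
  fixes P P' :: "('p::finite, 'q::finite) prolonged_frame"
  assumes p2: "CARD('p) = 2" and q2: "CARD('q) = 2"
    and P: "prolonged_frame_over U P" "y \<in> U" and P': "prolonged_frame_over U' P'" "y' \<in> U'"
    and eq: "pfaff_b1_alpha P y = pfaff_b1_alpha P' y'" "pfaff_b2_beta P y = pfaff_b2_beta P' y'"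
  shows "obj_c P y = obj_c P' y'"
proof -
  define E where "E \<gamma> k = (\<E> \<gamma> k :: real^'q^'p)" for \<gamma> k
  define ET where "ET \<gamma> k = (\<E> \<gamma> k :: real^'p^'q)" for \<gamma> k
  define Q where "Q \<gamma> k \<delta> l i \<alpha> = curvn P y (E \<gamma> k) (E \<delta> l) $ i $ \<alpha> - curvn P' y' (E \<gamma> k) (E \<delta> l) $ i $ \<alpha>" for \<gamma> k \<delta> l i \<alpha>
  have pf: "pframe U P" "pframe U' P'" using P P' by (simp_all add: pframe_def)
  have T: "pframe (tpose ` U) (tp P)" "pframe (tpose ` U') (tp P')"
    using prolonged_frame_over_tp P P' by (simp_all add: pframe_def)
  have oid: "object_identities_at P y" "object_identities_at P' y'"
    using pframe.object_identities[OF pf(1) P(2)] pframe.object_identities[OF pf(2) P'(2)] by blast+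
  have sk: "Q \<gamma> k \<gamma> k i \<alpha> = 0" for \<gamma> k i \<alpha>
    by (simp add: Q_def curvn_def)
  have R: "(if i = m then Q \<gamma> k \<delta> l j \<epsilon> else 0) + (if i = k then Q \<delta> l \<epsilon> m j \<gamma> else 0)
      + (if i = l then Q \<epsilon> m \<gamma> k j \<delta> else 0) = 0" for \<gamma> k \<delta> l \<epsilon> m j i
  proof -
    have "(curvn P y (E \<gamma> k) (E \<delta> l) ** E \<epsilon> m + curvn P y (E \<delta> l) (E \<epsilon> m) ** E \<gamma> k + curvn P y (E \<epsilon> m) (E \<gamma> k) ** E \<delta> l) $ j $ i
      = (curvn P' y' (E \<gamma> k) (E \<delta> l) ** E \<epsilon> m + curvn P' y' (E \<delta> l) (E \<epsilon> m) ** E \<gamma> k + curvn P' y' (E \<epsilon> m) (E \<gamma> k) ** E \<delta> l) $ j $ i"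
      unfolding E_def pframe.curvn_cyclic[OF pf(1) p2 q2 P(2)] pframe.curvn_cyclic[OF pf(2) p2 q2 P'(2)] eq ..
    then show ?thesis
      unfolding vector_add_component E_def[of \<epsilon> m] E_def[of \<gamma> k] E_def[of \<delta> l] mult_dyad_axis
      unfolding E_def[symmetric] Q_def by (auto split: if_splits)
  qed
  have L: "(if \<beta> = \<epsilon> then Q \<gamma> k \<delta> l m \<alpha> else 0) + (if \<beta> = \<gamma> then Q \<delta> l \<epsilon> m k \<alpha> else 0)
      + (if \<beta> = \<delta> then Q \<epsilon> m \<gamma> k l \<alpha> else 0) = 0" for \<gamma> k \<delta> l \<epsilon> m \<beta> \<alpha>
  proof -
    have yT: "tpose y \<in> tpose ` U" "tpose y' \<in> tpose ` U'" using P P' by auto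
    have e: "pfaff_b1_alpha (tp P) (tpose y) \<epsilon> m $ (i, \<gamma>, \<delta>, j, k, l) = pfaff_b1_alpha (tp P') (tpose y') \<epsilon> m $ (i, \<gamma>, \<delta>, j, k, l)" for \<epsilon> m i \<gamma> \<delta> j k l
      using P P' by (simp add: pfaff_b1_alpha_tp[OF P(1)] pfaff_b1_alpha_tp[OF P'(1)] eq)
    have ET: "tpose (ET k \<gamma>) = E \<gamma> k" for k \<gamma> by (simp add: ET_def E_def tpose_dyad)
    have "(curvn (tp P) (tpose y) (ET k \<gamma>) (ET l \<delta>) ** ET m \<epsilon> + curvn (tp P) (tpose y) (ET l \<delta>) (ET m \<epsilon>) ** ET k \<gamma> + curvn (tp P) (tpose y) (ET m \<epsilon>) (ET k \<gamma>) ** ET l \<delta>) $ \<alpha> $ \<beta>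
      = (curvn (tp P') (tpose y') (ET k \<gamma>) (ET l \<delta>) ** ET m \<epsilon> + curvn (tp P') (tpose y') (ET l \<delta>) (ET m \<epsilon>) ** ET k \<gamma> + curvn (tp P') (tpose y') (ET m \<epsilon>) (ET k \<gamma>) ** ET l \<delta>) $ \<alpha> $ \<beta>"
      unfolding ET_def pframe.curvn_cyclic[OF T(1) q2 p2 yT(1)] pframe.curvn_cyclic[OF T(2) q2 p2 yT(2)] e ..
    then show ?thesis
      unfolding tp_tensors ET transpose_transpose
      unfolding vector_add_component ET_def mult_dyad_axis tpose_nth
      unfolding Q_def by (auto split: if_splits)
  qed
  have "Q \<gamma> k \<delta> l i \<alpha> = 0" for \<gamma> k \<delta> l i \<alpha>
    by (rule skew_cyclic_eq_0[where Q=Q, OF p2 q2 sk R L])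
  then have "obj_c P y $ (\<alpha>, \<beta>, \<gamma>, i, j, k) = obj_c P' y' $ (\<alpha>, \<beta>, \<gamma>, i, j, k)" for \<alpha> \<beta> \<gamma> i j k
    by (simp add: Q_def E_def curvn_axis[OF oid(1)] curvn_axis[OF oid(2)])
  then show ?thesis by (auto simp: vec_eq_iff)
qed

theorem complete_object_determined:
  assumes p2: "CARD('p::finite) = 2" and q2: "CARD('q::finite) = 2"
  shows "\<exists>F. \<forall>U (P :: ('p, 'q) prolonged_frame). prolonged_frame_over U P \<longrightarrow>
           (\<forall>y\<in>U. (obj_b1 P y, obj_b2 P y, obj_c P y) =
              F (b1_alpha P y) (b2_beta P y) (pfaff_b1_alpha P y) (pfaff_b2_beta P y))"
proof -
  \<comment> \<open>Any prolonged frame with the given derivatives may supply the value; by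
    \<open>obj_c_determined\<close> it does not depend on the frame.\<close>
  define C where "C d1 d2 = (SOME c. \<exists>U (P :: ('p, 'q) prolonged_frame) y. prolonged_frame_over U P \<and> y \<in> U \<and>
      pfaff_b1_alpha P y = d1 \<and> pfaff_b2_beta P y = d2 \<and> c = obj_c P y)" for d1 d2
  have "obj_b1 P y = b1_alpha P y \<and> obj_b2 P y = b2_beta P y \<and> obj_c P y = C (pfaff_b1_alpha P y) (pfaff_b2_beta P y)"
    if P: "prolonged_frame_over U P" and y: "y \<in> U" for U y and P :: "('p, 'q) prolonged_frame"
  proof (intro conjI)
    show "obj_b1 P y = b1_alpha P y"
      using pframe.obj_b1_eq[OF _ p2 q2 y] P by (simp add: pframe_def)
    have "obj_b1 (tp P) (tpose y) = b1_alpha (tp P) (tpose y)"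
      using pframe.obj_b1_eq[OF _ q2 p2, of "tpose ` U" "tp P" "tpose y"] prolonged_frame_over_tp[OF P] y
      by (simp add: pframe_def)
    then have "obj_b2 P y $ (j, k, l, i, \<gamma>, \<delta>) = b2_beta P y $ (j, k, l, i, \<gamma>, \<delta>)" for i j k l \<gamma> \<delta>
      using b1_alpha_tp[of P "tpose y" i \<gamma> \<delta> j k l] tp_forms(7)[of P "tpose y" i \<gamma> \<delta> j k l] by simp
    then show "obj_b2 P y = b2_beta P y" by (auto simp: vec_eq_iff)
    have "\<exists>c U' (P' :: ('p, 'q) prolonged_frame) y'. prolonged_frame_over U' P' \<and> y' \<in> U' \<and>
      pfaff_b1_alpha P' y' = pfaff_b1_alpha P y \<and> pfaff_b2_beta P' y' = pfaff_b2_beta P y \<and> c = obj_c P' y'"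
      using P y by blast
    from someI_ex[OF this] obtain U' P' y' where P': "prolonged_frame_over U' P'" "y' \<in> U'"
      "pfaff_b1_alpha P' y' = pfaff_b1_alpha P y" "pfaff_b2_beta P' y' = pfaff_b2_beta P y"
      "C (pfaff_b1_alpha P y) (pfaff_b2_beta P y) = obj_c P' y'"
      unfolding C_def[symmetric] by auto
    show "obj_c P y = C (pfaff_b1_alpha P y) (pfaff_b2_beta P y)"
      unfolding P'(5) by (rule obj_c_determined[OF p2 q2 P y P'(1,2)]) (simp_all add: P')
  qed
  then show ?thesis by (intro exI[of _ "\<lambda>b1 b2 d1 d2. (b1, b2, C d1 d2)"]) auto
qed

section \<open>The transposed structure\<close>

lemma model_segre_cone_tpose: "tpose ` (model_segre_cone :: (real^'q::finite^'p::finite) set) = model_segre_cone"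
  unfolding model_segre_cone_def image_tpose_eq by (auto simp: tpose_dyad) (metis tpose_dyad transpose_transpose)+

lemma tpose_range_dyad: "tpose ` range (\<lambda>t. dyad t s) = range (dyad s)" "tpose ` range (dyad t) = range (\<lambda>s. dyad s t)"
  by (auto simp: image_image tpose_dyad)

lemma model_gens_tpose: "(\<lambda>\<eta>. tpose ` \<eta>) ` (model_eta_gens :: (real^'q::finite^'p::finite) set set) = model_xi_gens"
  "(\<lambda>\<xi>. tpose ` \<xi>) ` (model_xi_gens :: (real^'q::finite^'p::finite) set set) = model_eta_gens"
  unfolding model_eta_gens_def model_xi_gens_def setcompr_eq_image image_image tpose_range_dyad by (simp_all add: tpose_dyad)

section \<open>Automorphisms of the Segre cone\<close>

lemma dyad_eq_0_iff: "dyad t s = 0 \<longleftrightarrow> t = 0 \<or> s = 0"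
  by (auto simp: dyad_def vec_eq_iff)

text \<open>Applied to suitable combinations of the independent vectors \<open>b1\<close> and
  \<open>b2\<close>, the rank-one equation expresses each of \<open>a1\<close>, \<open>a2\<close> as
  a multiple of \<open>c\<close>.\<close>

lemma parallel_of_rank_one:
  assumes "dyad a1 b1 + dyad a2 b2 = dyad c d" and b: "b1 \<noteq> 0" "\<And>r. b2 \<noteq> r *\<^sub>R b1"
  shows "\<exists>k1 k2. a1 = k1 *\<^sub>R c \<and> a2 = k2 *\<^sub>R c"
proof -
  have e: "(b1 \<bullet> x) *\<^sub>R a1 + (b2 \<bullet> x) *\<^sub>R a2 = (d \<bullet> x) *\<^sub>R c" for x
    using arg_cong[OF assms(1), of "\<lambda>A. A *v x"] by (simp add: dyad_vector matrix_vector_mult_add_rdistrib)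
  \<comment> \<open>The Gram determinant of \<open>b1\<close> and \<open>b2\<close>. The
    combinations substituted for x below are, up to this factor, the vectors dual to them.\<close>
  define g where "g = (b1 \<bullet> b1) * (b2 \<bullet> b2) - (b1 \<bullet> b2)\<^sup>2"
  have g0: "g \<noteq> 0"
  proof
    assume "g = 0"
    define r where "r = (b1 \<bullet> b2) / (b1 \<bullet> b1)"
    have b11: "b1 \<bullet> b1 \<noteq> 0" using b(1) by simp
    have "(b2 - r *\<^sub>R b1) \<bullet> (b2 - r *\<^sub>R b1) = b2 \<bullet> b2 - 2 * r * (b1 \<bullet> b2) + r\<^sup>2 * (b1 \<bullet> b1)"
      by (simp add: inner_diff_left inner_diff_right inner_commute power2_eq_square algebra_simps)
    also have "\<dots> = g / (b1 \<bullet> b1)"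
      using b11 unfolding r_def g_def by (simp add: field_simps power2_eq_square)
    finally have "b2 - r *\<^sub>R b1 = 0" using \<open>g = 0\<close> by simp
    then show False using b(2)[of r] by simp
  qed
  have "g *\<^sub>R a1 = (d \<bullet> ((b2 \<bullet> b2) *\<^sub>R b1 - (b1 \<bullet> b2) *\<^sub>R b2)) *\<^sub>R c"
    using e[of "(b2 \<bullet> b2) *\<^sub>R b1 - (b1 \<bullet> b2) *\<^sub>R b2"]
    by (simp add: g_def inner_diff_right inner_commute power2_eq_square mult_ac)
  moreover have "g *\<^sub>R a2 = (d \<bullet> ((b1 \<bullet> b1) *\<^sub>R b2 - (b1 \<bullet> b2) *\<^sub>R b1)) *\<^sub>R c"
    using e[of "(b1 \<bullet> b1) *\<^sub>R b2 - (b1 \<bullet> b2) *\<^sub>R b1"]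
    by (simp add: g_def inner_diff_right inner_commute power2_eq_square mult_ac)
  ultimately show ?thesis
    using g0 by (metis (no_types) divideR_right scaleR_scaleR)
qed

text \<open>Two elements \<open>dyad t s\<^sub>1\<close>, \<open>dyad t s\<^sub>2\<close> of a plane \<open>\<eta>\<close> that lie on no common \<open>\<xi>\<close> are mapped to
  elements of the cone with the same property, whose sum lies on the cone; so they lie on a common
  \<open>\<eta>\<close>.\<close>

lemma cone_map_eta_subset:
  fixes A :: "real^'q::finite^'p::finite \<Rightarrow> real^'q^'p"
  assumes A: "linear A" "bij A" "A ` model_segre_cone = model_segre_cone" "(\<lambda>\<xi>. A ` \<xi>) ` model_xi_gens = model_xi_gens"
    and t: "t \<noteq> 0"
  shows "\<exists>a. a \<noteq> 0 \<and> A ` range (dyad t) \<subseteq> range (dyad a)"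
proof -
  have "\<exists>a b. A (dyad t s) = dyad a b" for s
    using A(3) unfolding model_segre_cone_def by blast
  then obtain a b where ab: "A (dyad t s) = dyad (a s) (b s)" for s by metis
  have A0: "A z = 0 \<longleftrightarrow> z = 0" for z
    using A(1,2) by (metis bij_is_inj injD linear_0)
  have nz: "a s \<noteq> 0" "b s \<noteq> 0" if "s \<noteq> 0" for s
    using A0[of "dyad t s"] that t unfolding ab dyad_eq_0_iff by auto
  obtain s0 :: "real^'q" where s0: "s0 \<noteq> 0" by (metis zero_neq_one)
  have "dyad (a s) (b s) \<in> range (dyad (a s0))" for s
  proof (cases "\<exists>r. s = r *\<^sub>R s0")
    case True
    then obtain r where "s = r *\<^sub>R s0" ..
    then have "A (dyad t s) = r *\<^sub>R A (dyad t s0)" by (simp add: dyad_scale_right linear_scale[OF A(1)])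
    then show ?thesis unfolding ab dyad_scale_right[symmetric] by auto
  next
    case False
    then have s: "s \<noteq> 0" by (metis scaleR_zero_left)
    \<comment> \<open>If the images had proportional second factors, they would lie on a common
      \<xi>. Since the map preserves this family, their preimages would too, contrary to the
      independence of \<open>s\<close> and \<open>s0\<close>.\<close>
    have nb: "b s \<noteq> r *\<^sub>R b s0" for r
    proof
      assume r: "b s = r *\<^sub>R b s0"
      have "range (\<lambda>t. dyad t (b s0)) \<in> (\<lambda>\<xi>. A ` \<xi>) ` model_xi_gens"
        unfolding A(4) using nz(2)[OF s0] by (auto simp: model_xi_gens_def)
      then obtain \<sigma> where \<sigma>: "\<sigma> \<noteq> 0" "range (\<lambda>t. dyad t (b s0)) = A ` range (\<lambda>t. dyad t \<sigma>)"
        by (auto simp: model_xi_gens_def)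
      have "A (dyad t s) = dyad (r *\<^sub>R a s) (b s0)" "A (dyad t s0) = dyad (a s0) (b s0)"
        unfolding ab r by (simp_all add: dyad_scale_left dyad_scale_right)
      then have "A (dyad t s) \<in> A ` range (\<lambda>t. dyad t \<sigma>)" "A (dyad t s0) \<in> A ` range (\<lambda>t. dyad t \<sigma>)"
        unfolding \<sigma>(2)[symmetric] by auto
      then obtain t1 t2 where t12: "dyad t s = dyad t1 \<sigma>" "dyad t s0 = dyad t2 \<sigma>"
        using bij_is_inj[OF A(2)] by (auto simp: inj_image_mem_iff)
      have e: "(t \<bullet> t) *\<^sub>R s = (t \<bullet> t1) *\<^sub>R \<sigma>" "(t \<bullet> t) *\<^sub>R s0 = (t \<bullet> t2) *\<^sub>R \<sigma>"
        using arg_cong[OF t12(1), of "\<lambda>A. t v* A"] arg_cong[OF t12(2), of "\<lambda>A. t v* A"] by (simp_all add: vector_dyad)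
      have "t \<bullet> t2 \<noteq> 0" using e(2) s0 t by auto
      then have \<sigma>': "\<sigma> = (1 / (t \<bullet> t2)) *\<^sub>R ((t \<bullet> t) *\<^sub>R s0)" unfolding e(2) by simp
      have "s = (1 / (t \<bullet> t)) *\<^sub>R ((t \<bullet> t) *\<^sub>R s)" using t by simp
      also have "\<dots> = ((1 / (t \<bullet> t)) * ((t \<bullet> t1) * ((1 / (t \<bullet> t2)) * (t \<bullet> t)))) *\<^sub>R s0"
        unfolding e(1) \<sigma>' by (simp only: scaleR_scaleR mult.assoc)
      finally have "\<exists>r. s = r *\<^sub>R s0" by blast
      then show False using False by blast
    qed
    have "dyad (a s0) (b s0) + dyad (a s) (b s) = A (dyad t (s0 + s))"
      by (simp add: dyad_add_right linear_add[OF A(1)] ab)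
    from parallel_of_rank_one[OF this[unfolded ab] nz(2)[OF s0] nb]
    obtain c k1 k2 where k: "a s0 = k1 *\<^sub>R c" "a s = k2 *\<^sub>R c" by blast
    then have "k1 \<noteq> 0" using nz(1)[OF s0] by auto
    then have "dyad (a s) (b s) = dyad (a s0) ((k2 / k1) *\<^sub>R b s)"
      unfolding k by (simp add: dyad_scale_left dyad_scale_right)
    then show ?thesis by auto
  qed
  then show ?thesis using nz(1)[OF s0] ab by (intro exI[of _ "a s0"]) auto
qed

lemma range_dyad_eq:
  assumes "range (dyad t) \<subseteq> (range (dyad t') :: (real^'q::finite^'p::finite) set)" "t \<noteq> 0"
  shows "range (dyad t) = (range (dyad t') :: (real^'q^'p) set)"
proof -
  obtain s0 :: "real^'q" where s0: "s0 \<noteq> 0" by (metis zero_neq_one)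
  have "dyad t s0 \<in> range (dyad t')" by (rule subsetD[OF assms(1) rangeI])
  then obtain s where s: "dyad t s0 = dyad t' s" by (rule rangeE)
  have e: "(s0 \<bullet> s0) *\<^sub>R t = (s \<bullet> s0) *\<^sub>R t'"
    using arg_cong[OF s, of "\<lambda>A. A *v s0"] by (simp only: dyad_vector)
  define k where "k = (s \<bullet> s0) / (s0 \<bullet> s0)"
  have "t = (1 / (s0 \<bullet> s0)) *\<^sub>R ((s0 \<bullet> s0) *\<^sub>R t)" using s0 by simp
  also have "\<dots> = k *\<^sub>R t'" unfolding e k_def by simp
  finally have t: "t = k *\<^sub>R t'" .
  then have "k \<noteq> 0" using assms(2) by auto
  have "dyad t' x \<in> range (dyad t)" for x
  proof
    show "dyad t' x = dyad t ((1 / k) *\<^sub>R x)"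
      unfolding t dyad_scale_left dyad_scale_right using \<open>k \<noteq> 0\<close> by simp
  qed simp
  then show ?thesis using assms(1) by blast
qed

text \<open>The inverse map satisfies the same hypotheses, so the inclusion of generators holds in
  both directions and becomes an equality.\<close>

lemma cone_map_eta_gens_subset:
  fixes A :: "real^'q::finite^'p::finite \<Rightarrow> real^'q^'p"
  assumes A: "linear A" "bij A" "A ` model_segre_cone = model_segre_cone" "(\<lambda>\<xi>. A ` \<xi>) ` model_xi_gens = model_xi_gens"
  shows "(\<lambda>\<eta>. A ` \<eta>) ` model_eta_gens \<subseteq> model_eta_gens"
proof clarify
  fix \<eta> :: "(real^'q^'p) set" assume "\<eta> \<in> model_eta_gens"
  then obtain t where t: "t \<noteq> 0" "\<eta> = range (dyad t)" by (auto simp: model_eta_gens_def)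
  obtain a where a: "a \<noteq> 0" "A ` range (dyad t) \<subseteq> range (dyad a)" using cone_map_eta_subset[OF A t(1)] by blast
  define B where "B = inv A"
  have BA: "B (A z) = z" "A (B z) = z" for z
    using A(2) by (simp_all add: B_def bij_is_inj bij_is_surj surj_f_inv_f)
  have BI: "B ` (A ` S) = S" "A ` (B ` S) = S" for S by (simp_all add: image_image BA)
  have B: "linear B" "bij B"
    using A(1,2) by (auto simp: B_def bij_is_inj inj_linear_imp_inv_linear bij_imp_bij_inv)
  have "(\<lambda>\<xi>. B ` \<xi>) ` ((\<lambda>\<xi>. A ` \<xi>) ` model_xi_gens) = model_xi_gens"
    unfolding image_image[of "\<lambda>\<xi>. B ` \<xi>"] BI(1) by simp
  then have "B ` model_segre_cone = model_segre_cone" "(\<lambda>\<xi>. B ` \<xi>) ` model_xi_gens = model_xi_gens"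
    using BI(1)[of model_segre_cone] unfolding A(3,4) by blast+
  from cone_map_eta_subset[OF B this a(1)] obtain t' where t': "t' \<noteq> 0" "B ` range (dyad a) \<subseteq> range (dyad t')" by blast
  have "range (dyad t) \<subseteq> B ` range (dyad a)" using image_mono[OF a(2), of B] unfolding BI .
  then have "range (dyad t) = B ` range (dyad a)" using t'(2) range_dyad_eq[OF _ t(1)] by blast
  then have "A ` \<eta> = range (dyad a)" unfolding t(2) by (simp add: BI)
  then show "A ` \<eta> \<in> model_eta_gens" using a(1) by (auto simp: model_eta_gens_def)
qed

lemma cone_map_eta_gens:
  fixes A :: "real^'q::finite^'p::finite \<Rightarrow> real^'q^'p"
  assumes A: "linear A" "bij A" "A ` model_segre_cone = model_segre_cone" "(\<lambda>\<xi>. A ` \<xi>) ` model_xi_gens = model_xi_gens"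
  shows "A ` \<eta> \<in> model_eta_gens \<longleftrightarrow> \<eta> \<in> model_eta_gens"
proof
  show "\<eta> \<in> model_eta_gens \<Longrightarrow> A ` \<eta> \<in> model_eta_gens" using cone_map_eta_gens_subset[OF A] by blast
  define B where "B = inv A"
  have BA: "B (A z) = z" "A (B z) = z" for z
    using A(2) by (simp_all add: B_def bij_is_inj bij_is_surj surj_f_inv_f)
  have BI: "B ` (A ` S) = S" "A ` (B ` S) = S" for S by (simp_all add: image_image BA)
  have B: "linear B" "bij B"
    using A(1,2) by (auto simp: B_def bij_is_inj inj_linear_imp_inv_linear bij_imp_bij_inv)
  have "(\<lambda>\<xi>. B ` \<xi>) ` ((\<lambda>\<xi>. A ` \<xi>) ` model_xi_gens) = model_xi_gens"
    unfolding image_image[of "\<lambda>\<xi>. B ` \<xi>"] BI(1) by simp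
  then have "B ` model_segre_cone = model_segre_cone" "(\<lambda>\<xi>. B ` \<xi>) ` model_xi_gens = model_xi_gens"
    using BI(1)[of model_segre_cone] unfolding A(3,4) by blast+
  from cone_map_eta_gens_subset[OF B this] show "A ` \<eta> \<in> model_eta_gens \<Longrightarrow> \<eta> \<in> model_eta_gens"
    using BI(1)[of \<eta>] by (metis image_subset_iff)
qed

text \<open>\<open>eta_gens\<close> asks for some adapted coframe; any other one differs from it by
  an automorphism of the model cone that preserves the planes \<xi> and hence the planes \<eta>. So
  every adapted coframe computes the family.\<close>

lemma adapted_eta_gens:
  assumes "adapted_coframe_at N c x L"
  shows "eta_gens N c x = {\<eta>. L ` \<eta> \<in> model_eta_gens}"
proof -
  have "L ` \<eta> \<in> model_eta_gens" if "adapted_coframe_at N c x L'" "L' ` \<eta> \<in> model_eta_gens" for L' \<eta>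
  proof -
    have L: "linear L" "bij L" "L ` segre N c x = model_segre_cone" "(\<lambda>\<xi>. L ` \<xi>) ` xi_gens N c x = model_xi_gens"
      and L': "linear L'" "bij L'" "L' ` segre N c x = model_segre_cone" "(\<lambda>\<xi>. L' ` \<xi>) ` xi_gens N c x = model_xi_gens"
      using assms that(1) by (auto simp: adapted_coframe_at_def)
    define A where "A = L \<circ> inv L'"
    have i: "inv L' (L' z) = z" for z using L'(2) by (simp add: bij_is_inj)
    have AL: "A ` (L' ` S) = L ` S" for S by (simp add: A_def image_image i)
    have A: "linear A" "bij A"
      unfolding A_def using L L' by (auto intro!: linear_compose bij_comp bij_imp_bij_inv inj_linear_imp_inv_linear bij_is_inj)
    have "A ` model_segre_cone = model_segre_cone"
      using AL[of "segre N c x"] unfolding L(3) L'(3) .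
    moreover have "(\<lambda>\<xi>. A ` \<xi>) ` model_xi_gens = model_xi_gens"
      unfolding L'(4)[symmetric] image_image[of "\<lambda>\<xi>. A ` \<xi>"] AL L(4) by (rule refl)
    ultimately show ?thesis using cone_map_eta_gens[OF A, of "L' ` \<eta>"] that(2) by (simp add: AL)
  qed
  then show ?thesis using assms unfolding eta_gens_def by blast
qed

section \<open>Charts, coframes and prolonged frames of the transposed structure\<close>

definition tch :: "('m, 'p::finite, 'q::finite) chart \<Rightarrow> ('m, 'q, 'p) chart" where
  "tch c = (fst c, tpose \<circ> snd c)"

lemma tch_simps: "fst (tch c) = fst c" "snd (tch c) = tpose \<circ> snd c" "tch (tch c) = c" "snd (tch c) x = tpose (snd c x)"
  by (simp_all add: tch_def o_def)

lemma atlas_transposed: "atlas (transposed N) = tch ` atlas N"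
  by (simp add: transposed_def tch_def case_prod_beta')

lemma segre_transposed: "segre (transposed N) (tch c) x = tpose ` segre N c x"
  and xi_gens_transposed: "xi_gens (transposed N) (tch c) x = (\<lambda>\<eta>. tpose ` \<eta>) ` eta_gens N c x"
  by (simp_all add: transposed_def tch_def o_def)

lemma chart_inv_tch: "chart_inv (tch c) y = chart_inv c (tpose y)"
proof -
  have "(tpose (snd c x) = y) = (snd c x = tpose y)" for x by (metis transpose_transpose)
  then show ?thesis by (simp add: chart_inv_def inv_into_def tch_simps)
qed

lemma image_tch: "snd (tch c) ` fst (tch c) = tpose ` snd c ` fst c"
  by (simp add: tch_simps image_image)

lemma image_tpose_tpose: "tpose ` tpose ` S = S" by (simp add: image_image)

lemma adapted_transposed:
  assumes "adapted_coframe_at N c x L"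
  shows "adapted_coframe_at (transposed N) (tch c) x (\<lambda>v. tpose (L (tpose v)))"
proof -
  have L: "linear L" "bij L" "L ` segre N c x = model_segre_cone" using assms by (auto simp: adapted_coframe_at_def)
  have e: "(\<lambda>\<eta>. L ` \<eta>) ` eta_gens N c x = model_eta_gens"
  proof -
    have "\<eta> \<in> (\<lambda>\<eta>. L ` \<eta>) ` eta_gens N c x" if "\<eta> \<in> model_eta_gens" for \<eta>
    proof (rule image_eqI)
      show e: "\<eta> = L ` (inv L ` \<eta>)" using L(2) by (simp add: image_image bij_is_surj surj_f_inv_f)
      show "inv L ` \<eta> \<in> eta_gens N c x" unfolding adapted_eta_gens[OF assms] using that e by simp
    qed
    then show ?thesis unfolding adapted_eta_gens[OF assms] by auto
  qed
  have t: "(\<lambda>v. tpose (L (tpose v))) ` (tpose ` S) = tpose ` (L ` S)" for S by (simp add: image_image)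
  have "(\<lambda>\<xi>. (\<lambda>v. tpose (L (tpose v))) ` \<xi>) ` xi_gens (transposed N) (tch c) x = (\<lambda>\<eta>. tpose ` \<eta>) ` ((\<lambda>\<eta>. L ` \<eta>) ` eta_gens N c x)"
    unfolding xi_gens_transposed image_image[of "\<lambda>\<xi>. (\<lambda>v. tpose (L (tpose v))) ` \<xi>"] t image_image[of "\<lambda>\<eta>. tpose ` \<eta>"] ..
  then have "(\<lambda>\<xi>. (\<lambda>v. tpose (L (tpose v))) ` \<xi>) ` xi_gens (transposed N) (tch c) x = model_xi_gens"
    unfolding e model_gens_tpose .
  moreover have "linear (\<lambda>v. tpose (L (tpose v)))"
    using linear_compose[OF linear_compose[OF linear_tpose L(1)] linear_tpose] by (simp add: o_def)
  moreover have "bij (\<lambda>v. tpose (L (tpose v)))"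
    using bij_comp[OF bij_comp[OF bij_tpose L(2)] bij_tpose] by (simp add: o_def)
  ultimately show ?thesis
    unfolding adapted_coframe_at_def segre_transposed t L(3) model_segre_cone_tpose by blast
qed

text \<open>The given coframe is compared with the transpose of an adapted one. The two differ by an
  automorphism of the model cone, which preserves both families of generators, so transposing back
  gives an adapted coframe.\<close>

lemma adapted_transposedD:
  assumes L0: "adapted_coframe_at N c x L0" and L': "adapted_coframe_at (transposed N) (tch c) x L'"
  shows "adapted_coframe_at N c x (\<lambda>v. tpose (L' (tpose v)))"
proof -
  have L: "linear L0" "bij L0" "L0 ` segre N c x = model_segre_cone" "(\<lambda>\<xi>. L0 ` \<xi>) ` xi_gens N c x = model_xi_gens"
    using L0 by (auto simp: adapted_coframe_at_def)
  define M where "M v = tpose (L0 (tpose v))" for v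
  have M: "adapted_coframe_at (transposed N) (tch c) x M" using adapted_transposed[OF L0] by (simp add: M_def[abs_def])
  note Md = M[unfolded adapted_coframe_at_def] and Ld = L'[unfolded adapted_coframe_at_def]
  define A where "A = L' \<circ> inv M"
  have i: "inv M (M z) = z" for z using Md by (simp add: bij_is_inj)
  have AL: "A ` (M ` S) = L' ` S" for S by (simp add: A_def image_image i)
  have A: "linear A" "bij A"
    unfolding A_def using Md Ld by (auto intro!: linear_compose bij_comp bij_imp_bij_inv inj_linear_imp_inv_linear bij_is_inj)
  have As: "A ` model_segre_cone = model_segre_cone"
    using AL[of "segre (transposed N) (tch c) x"] Md Ld by metis
  have Ax: "(\<lambda>\<xi>. A ` \<xi>) ` model_xi_gens = model_xi_gens"
  proof -
    have "(\<lambda>\<xi>. A ` \<xi>) ` ((\<lambda>\<xi>. M ` \<xi>) ` xi_gens (transposed N) (tch c) x) = (\<lambda>\<xi>. L' ` \<xi>) ` xi_gens (transposed N) (tch c) x"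
      unfolding image_image[of "\<lambda>\<xi>. A ` \<xi>"] AL ..
    then show ?thesis using Md Ld by metis
  qed
  have Ae: "(\<lambda>\<eta>. A ` \<eta>) ` model_eta_gens = model_eta_gens"
  proof -
    have "\<eta> \<in> (\<lambda>\<eta>. A ` \<eta>) ` model_eta_gens" if "\<eta> \<in> model_eta_gens" for \<eta>
    proof (rule image_eqI)
      show e: "\<eta> = A ` (inv A ` \<eta>)" using A(2) by (simp add: image_image bij_is_surj surj_f_inv_f)
      show "inv A ` \<eta> \<in> model_eta_gens" using cone_map_eta_gens[OF A As Ax, of "inv A ` \<eta>"] that e by simp
    qed
    then show ?thesis using cone_map_eta_gens[OF A As Ax] by blast
  qed
  define K where "K v = tpose (L' (tpose v))" for v
  have AM: "L' v = A (M v)" for v by (simp add: A_def i)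
  have K: "K ` S = tpose ` (A ` (tpose ` (L0 ` S)))" for S
    unfolding K_def AM M_def by (simp add: image_image)
  have "K ` segre N c x = model_segre_cone"
    unfolding K L(3) model_segre_cone_tpose As ..
  moreover have "(\<lambda>\<xi>. K ` \<xi>) ` xi_gens N c x = model_xi_gens"
  proof -
    have "(\<lambda>\<xi>. K ` \<xi>) ` xi_gens N c x = (\<lambda>\<xi>. tpose ` \<xi>) ` (\<lambda>\<xi>. A ` \<xi>) ` (\<lambda>\<xi>. tpose ` \<xi>) ` (\<lambda>\<xi>. L0 ` \<xi>) ` xi_gens N c x"
      unfolding K by (simp only: image_image)
    then show ?thesis unfolding L(4) model_gens_tpose Ae .
  qed
  moreover have "linear K"
    using linear_compose[OF linear_compose[OF linear_tpose conjunct1[OF Ld]] linear_tpose] by (simp add: o_def K_def[abs_def])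
  moreover have "bij K"
    using bij_comp[OF bij_comp[OF bij_tpose] bij_tpose, of L'] Ld by (simp add: o_def K_def[abs_def])
  ultimately show ?thesis
    unfolding adapted_coframe_at_def K_def[abs_def] by blast
qed

lemma smooth_on_tpose_comp:
  fixes f :: "real^'q::finite^'p::finite \<Rightarrow> 'f::euclidean_space" and L :: "'f \<Rightarrow> 'g::real_normed_vector"
  assumes "open S" "smooth_on S f" "linear L"
  shows "smooth_on (tpose ` S) (\<lambda>y. L (f (tpose y)))"
  by (rule smooth_on_linear[OF open_tpose[OF assms(1)] assms(3)], rule smooth_on_compose[OF open_tpose[OF assms(1)] assms(2)])
    (auto intro: smooth_on_bounded_linear linear_conv_bounded_linear[THEN iffD1, OF linear_tpose])

lemma adapted_on_transposed:
  assumes "open S" "adapted_coframe_on N c S \<theta>"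
  shows "adapted_coframe_on (transposed N) (tch c) (tpose ` S) (\<lambda>y v. tpose (\<theta> (tpose y) (tpose v)))"
  using assms unfolding adapted_coframe_on_def
  by (auto simp: chart_inv_tch intro!: smooth_on_tpose_comp[OF _ _ linear_tpose] adapted_transposed)

lemma prolonged_frame_of_tp:
  assumes "prolonged_frame_of N c U P"
  shows "prolonged_frame_of (transposed N) (tch c) (tpose ` U) (tp P)"
proof -
  have "open U" using assms by (simp add: prolonged_frame_of_def prolonged_frame_over_def)
  moreover have "U \<subseteq> snd c ` fst c" "prolonged_frame_over U P" "adapted_coframe_on N c U (frm_w P)"
    using assms by (simp_all add: prolonged_frame_of_def)
  ultimately show ?thesis
    using image_mono[of U "snd c ` fst c" tpose] adapted_on_transposed prolonged_frame_over_tp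
    unfolding prolonged_frame_of_def image_tch tp_forms by blast
qed

locale grassmann =
  fixes N :: "('m::{t2_space, second_countable_topology}, 'p::finite, 'q::finite) cone_field"
  assumes N: "almost_grassmann N"
begin

lemma charts:
  assumes "c \<in> atlas N"
  shows "open (fst c)" "open (snd c ` fst c)" "homeomorphism (fst c) (snd c ` fst c) (snd c) (chart_inv c)"
    and "\<And>d. d \<in> atlas N \<Longrightarrow> smooth_on (snd c ` (fst c \<inter> fst d)) (snd d \<circ> chart_inv c)"
proof -
  have a: "smooth_atlas (atlas N)" using N unfolding almost_grassmann_def by (rule conjunct1)
  note a1 = a[unfolded smooth_atlas_def, THEN conjunct2, THEN conjunct1, rule_format, OF assms]
    and a2 = a[unfolded smooth_atlas_def, THEN conjunct2, THEN conjunct2, rule_format, OF assms]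
  show "open (fst c)" "open (snd c ` fst c)" "homeomorphism (fst c) (snd c ` fst c) (snd c) (chart_inv c)"
    using a1 by simp_all
  show "smooth_on (snd c ` (fst c \<inter> fst d)) (snd d \<circ> chart_inv c)" if "d \<in> atlas N" for d
    by (rule a2[OF that])
qed

lemma local_coframe:
  assumes "c \<in> atlas N" "x \<in> fst c"
  obtains U \<theta> where "open U" "snd c x \<in> U" "U \<subseteq> snd c ` fst c" "adapted_coframe_on N c U \<theta>"
proof -
  note n = N[unfolded almost_grassmann_def, THEN conjunct2, THEN conjunct2]
  from bspec[OF bspec[OF n assms(1)] assms(2)] show thesis using that by (elim exE conjE)
qed

lemma chart_inv_chart: "c \<in> atlas N \<Longrightarrow> x \<in> fst c \<Longrightarrow> chart_inv c (snd c x) = x"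
  using charts(3) by (rule homeomorphism_apply1)

lemma chart_chart_inv: "c \<in> atlas N \<Longrightarrow> y \<in> snd c ` fst c \<Longrightarrow> snd c (chart_inv c y) = y"
  using charts(3) by (rule homeomorphism_apply2)

lemma exists_adapted:
  assumes "c \<in> atlas N" "x \<in> fst c"
  shows "\<exists>L. adapted_coframe_at N c x L"
proof -
  obtain U \<theta> where "snd c x \<in> U" "adapted_coframe_on N c U \<theta>" by (rule local_coframe[OF assms])
  then have "adapted_coframe_at N c (chart_inv c (snd c x)) (\<theta> (snd c x))" by (simp add: adapted_coframe_on_def)
  then show ?thesis unfolding chart_inv_chart[OF assms] by blast
qed

lemma prolonged_frame_of_transposedD:
  assumes c: "c \<in> atlas N" and P: "prolonged_frame_of (transposed N) (tch c) U P"
  shows "prolonged_frame_of N c (tpose ` U) (tp P)"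
proof -
  have U: "open U" "U \<subseteq> tpose ` snd c ` fst c" "prolonged_frame_over U P"
    using P by (simp_all add: prolonged_frame_of_def image_tch, simp add: prolonged_frame_over_def)
  have s: "tpose ` U \<subseteq> snd c ` fst c" using image_mono[OF U(2), of tpose] by (simp add: image_tpose_tpose)
  have a: "adapted_coframe_on (transposed N) (tch c) U (frm_w P)" using P by (simp add: prolonged_frame_of_def)
  have "adapted_coframe_on N c (tpose ` U) (\<lambda>y v. tpose (frm_w P (tpose y) (tpose v)))"
    unfolding adapted_coframe_on_def
  proof (intro conjI allI ballI)
    show "smooth_on (tpose ` U) (\<lambda>y. tpose (frm_w P (tpose y) (tpose v)))" for v
      by (rule smooth_on_tpose_comp[OF U(1) _ linear_tpose]) (use a in \<open>simp add: adapted_coframe_on_def\<close>)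
    fix y assume y: "y \<in> tpose ` U"
    then have "y \<in> snd c ` fst c" using s by blast
    then have "chart_inv c y \<in> fst c" unfolding chart_inv_def by (rule inv_into_into)
    then obtain L0 where "adapted_coframe_at N c (chart_inv c y) L0" using exists_adapted[OF c] by blast
    moreover have "adapted_coframe_at (transposed N) (tch c) (chart_inv c y) (frm_w P (tpose y))"
      using a[unfolded adapted_coframe_on_def, THEN conjunct2, THEN bspec, OF tpose_mem[OF y]] by (simp add: chart_inv_tch)
    ultimately show "adapted_coframe_at N c (chart_inv c y) (\<lambda>v. tpose (frm_w P (tpose y) (tpose v)))"
      by (rule adapted_transposedD)
  qed
  then show ?thesis
    using s prolonged_frame_over_tp[OF U(3)] by (simp add: prolonged_frame_of_def tp_forms)
qed

lemma vanishes_transposed: "vanishes (transposed N) b1_alpha \<longleftrightarrow> vanishes N b2_beta"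
proof
  assume v: "vanishes (transposed N) b1_alpha"
  show "vanishes N b2_beta"
    unfolding vanishes_def
  proof (intro ballI allI impI)
    fix c U P y assume c: "c \<in> atlas N" and P: "prolonged_frame_of N c U P" and y: "y \<in> U"
    have "b1_alpha (tp P) (tpose y) = 0"
      by (rule v[unfolded vanishes_def atlas_transposed, rule_format, OF imageI[OF c] prolonged_frame_of_tp[OF P] imageI[OF y]])
    then show "b2_beta P y = 0" by (simp add: b1_alpha_tp_eq_0_iff)
  qed
next
  assume v: "vanishes N b2_beta"
  show "vanishes (transposed N) b1_alpha"
    unfolding vanishes_def atlas_transposed
  proof (intro ballI allI impI)
    fix c U P y assume "c \<in> tch ` atlas N" and P: "prolonged_frame_of (transposed N) c U P" and y: "y \<in> U"
    then obtain d where d: "d \<in> atlas N" "c = tch d" by blast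
    have "b2_beta (tp P) (tpose y) = 0"
      by (rule v[unfolded vanishes_def, rule_format, OF d(1) prolonged_frame_of_transposedD[OF d(1) P[unfolded d(2)]] imageI[OF y]])
    then show "b1_alpha P y = 0" by (simp add: b2_beta_tp_eq_0_iff)
  qed
qed

end

lemma continuous_on_tpose: "continuous_on S (tpose :: real^'n^'m \<Rightarrow> real^'m^'n)"
  by (intro linear_continuous_on linear_conv_bounded_linear[THEN iffD1, OF linear_tpose])

text \<open>The cone spans the matrix space, because the unit dyads lie on it. Thus a linear map
  onto the cone is surjective.\<close>

lemma subspace_model_segre_cone:
  assumes "subspace S" "model_segre_cone \<subseteq> S"
  shows "S = UNIV"
proof -
  have "(z $ fst k $ snd k) *\<^sub>R matE k \<in> S" for z k
    using assms unfolding model_segre_cone_def matE_def by (intro subspace_mul) auto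
  then have "(\<Sigma> k. (z $ fst k $ snd k) *\<^sub>R matE k) \<in> S" for z by (rule subspace_sum[OF assms(1)])
  then show ?thesis unfolding mat_representation by blast
qed

lemma integral_patch_tch:
  fixes c :: "('a, 'c::finite, 'b::finite) chart" and f :: "real^'n::finite \<Rightarrow> 'a"
  assumes inj: "\<And>x. gens' (tch c) x = (\<lambda>\<eta>. tpose ` \<eta>) ` gens c x"
  shows "integral_patch gens' (tch c) D f \<longleftrightarrow> integral_patch gens c D f" (is ?th1)
    and "integral_patch gens c D f \<Longrightarrow> u \<in> D \<Longrightarrow> range (fder (snd (tch c) \<circ> f) u)
      = tpose ` range (fder (snd c \<circ> f) u)" (is "PROP ?th2")
proof -
  have r: "range (fder (snd (tch c) \<circ> f) u) = tpose ` range (fder (snd c \<circ> f) u)"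
    if "smooth_on D (snd c \<circ> f)" "u \<in> D" for u
  proof -
    from bounded_linear.has_derivative[OF linear_conv_bounded_linear[THEN iffD1, OF linear_tpose] smooth_on_has_derivative[OF that]]
    have "((snd (tch c) \<circ> f) has_derivative (\<lambda>k. tpose (fder (snd c \<circ> f) u k))) (at u)"
      by (simp add: tch_simps o_def)
    then show ?thesis by (simp add: frechet_derivative_eqI image_image)
  qed
  have s: "smooth_on D (snd (tch c) \<circ> f) \<longleftrightarrow> smooth_on D (snd c \<circ> f)" if "open D"
    using smooth_on_linear[OF that linear_tpose, of "snd c \<circ> f"] smooth_on_linear[OF that linear_tpose, of "snd (tch c) \<circ> f"]
    by (auto simp: tch_simps o_def)
  have "inj (\<lambda>\<eta> :: (real^'b^'c) set. tpose ` \<eta>)"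
    by (rule injI) (simp only: inj_image_eq_iff[OF bij_is_inj[OF bij_tpose]])
  then have i: "tpose ` S \<in> (\<lambda>\<eta>. tpose ` \<eta>) ` G \<longleftrightarrow> S \<in> G" for S :: "(real^'b^'c) set" and G
    by (rule inj_image_mem_iff)
  show ?th1
    unfolding integral_patch_def using s r by (auto simp: tch_simps(1) inj i)
  show "PROP ?th2"
    using r by (simp add: integral_patch_def)
qed

lemma alpha_semiintegrable_transposed:
  fixes N :: "('m, 'p::finite, 'q::finite) cone_field"
  shows "alpha_semiintegrable (transposed N) \<longleftrightarrow> beta_semiintegrable N"
proof -
  note patch = integral_patch_tch[where gens'="xi_gens (transposed N)" and gens="eta_gens N", OF xi_gens_transposed]
  have i: "tpose ` A = tpose ` B \<longleftrightarrow> A = B" for A B :: "(real^'q^'p) set"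
    by (rule inj_image_eq_iff[OF bij_is_inj[OF bij_tpose]])
  have e: "(integral_patch (xi_gens (transposed N)) (tch c) D f \<and> 0 \<in> D \<and> f 0 = x \<and>
       range (fder (snd (tch c) \<circ> f) 0) = tpose ` \<eta>)
    = (integral_patch (eta_gens N) c D f \<and> 0 \<in> D \<and> f 0 = x \<and> range (fder (snd c \<circ> f) 0) = \<eta>)" for c D f x \<eta>
    using patch[of c D f] i[of "range (fder (snd c \<circ> f) 0)" \<eta>] by metis
  show ?thesis
    unfolding alpha_semiintegrable_def beta_semiintegrable_def atlas_transposed
    by (simp add: xi_gens_transposed e tch_simps(1))
qed

context grassmann
begin

lemma open_chart_Int: "c \<in> atlas N \<Longrightarrow> d \<in> atlas N \<Longrightarrow> open (snd c ` (fst c \<inter> fst d))"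
proof -
  assume c: "c \<in> atlas N" and d: "d \<in> atlas N"
  have "snd c ` (fst c \<inter> fst d) = snd c ` fst c \<inter> chart_inv c -` fst d"
    using chart_inv_chart[OF c] by (auto simp: image_iff)
  moreover have "continuous_on (snd c ` fst c) (chart_inv c)"
    using charts(3)[OF c] by (simp add: homeomorphism_def)
  ultimately show ?thesis using continuous_open_preimage[OF _ charts(2)[OF c] charts(1)[OF d]] by simp
qed

lemma transition_differentiable:
  assumes "c \<in> atlas N" "d \<in> atlas N" "x \<in> fst c \<inter> fst d"
  shows "(snd d \<circ> chart_inv c) differentiable (at (snd c x))"
  by (rule smooth_on_differentiable[OF charts(4)[OF assms(1,2)] imageI[OF assms(3)]])

lemma tangent_transition_tch:
  assumes "c \<in> atlas N" "d \<in> atlas N" "x \<in> fst c \<inter> fst d"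
  shows "tangent_transition (tch c) (tch d) x v = tpose (tangent_transition c d x (tpose v))"
proof -
  have "snd (tch d) \<circ> chart_inv (tch c) = (\<lambda>y. tpose ((snd d \<circ> chart_inv c) (tpose y)))"
    by (simp add: fun_eq_iff tch_simps chart_inv_tch)
  moreover have "(snd d \<circ> chart_inv c) differentiable (at (tpose (tpose (snd c x))))"
    using transition_differentiable[OF assms] by simp
  ultimately show ?thesis
    unfolding tangent_transition_def tch_simps(4)
    using frechet_derivative_tpose[of "snd d \<circ> chart_inv c" "tpose (snd c x)", OF _ linear_tpose] by simp
qed

lemma transition_gens:
  assumes "c \<in> atlas N" "d \<in> atlas N" "x \<in> fst c \<inter> fst d"
  shows "segre N d x = tangent_transition c d x ` segre N c x"
    and "xi_gens N d x = (\<lambda>\<xi>. tangent_transition c d x ` \<xi>) ` xi_gens N c x"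
  using N[unfolded almost_grassmann_def, THEN conjunct2, THEN conjunct1, THEN bspec, OF assms(1), THEN bspec, OF assms(2),
      THEN bspec, OF assms(3)] by blast+

lemma adapted_transition:
  assumes "c \<in> atlas N" "d \<in> atlas N" "x \<in> fst c \<inter> fst d" and L: "adapted_coframe_at N d x L"
  shows "adapted_coframe_at N c x (L \<circ> tangent_transition c d x)" and "bij (tangent_transition c d x)"
proof -
  define \<tau> where "\<tau> = tangent_transition c d x"
  note t = transition_gens[OF assms(1-3), folded \<tau>_def]
  have Ld: "linear L" "bij L" "L ` segre N d x = model_segre_cone" "(\<lambda>\<xi>. L ` \<xi>) ` xi_gens N d x = model_xi_gens"
    using L by (auto simp: adapted_coframe_at_def)
  have l: "linear \<tau>" unfolding \<tau>_def tangent_transition_def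
    by (rule linear_frechet_derivative[OF transition_differentiable[OF assms(1-3)]])
  have lc: "linear (L \<circ> \<tau>)" by (rule linear_compose[OF l Ld(1)])
  have s: "(L \<circ> \<tau>) ` segre N c x = model_segre_cone" using Ld(3) unfolding t(1) image_comp .
  have xi: "(\<lambda>\<xi>. (L \<circ> \<tau>) ` \<xi>) ` xi_gens N c x = model_xi_gens"
    using Ld(4) unfolding t(2) image_comp[symmetric] by (simp only: image_image)
  \<comment> \<open>Invertibility of the derivative of the transition map is read off from its
    action on the cones, without the inverse transition.\<close>
  have "range (L \<circ> \<tau>) = UNIV"
    by (rule subspace_model_segre_cone[OF linear_subspace_image[OF lc subspace_UNIV]]) (use s in blast)
  then have b: "bij (L \<circ> \<tau>)" using linear_surjective_imp_injective[OF lc] by (simp add: bij_def)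
  show "adapted_coframe_at N c x (L \<circ> \<tau>)" unfolding adapted_coframe_at_def using lc b s xi by blast
  have "\<tau> = inv L \<circ> (L \<circ> \<tau>)" using Ld(2) by (simp add: fun_eq_iff bij_is_inj)
  then show "bij \<tau>" using bij_comp[OF b bij_imp_bij_inv[OF Ld(2)]] by simp
qed

lemma transition_eta_gens:
  assumes "c \<in> atlas N" "d \<in> atlas N" "x \<in> fst c \<inter> fst d"
  shows "eta_gens N d x = (\<lambda>\<eta>. tangent_transition c d x ` \<eta>) ` eta_gens N c x"
proof -
  define \<tau> where "\<tau> = tangent_transition c d x"
  obtain L where L: "adapted_coframe_at N d x L" using exists_adapted[OF assms(2)] assms(3) by blast
  note a = adapted_transition[OF assms L, folded \<tau>_def]
  show ?thesis
    unfolding adapted_eta_gens[OF L] adapted_eta_gens[OF a(1)] \<tau>_def[symmetric]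
  proof (intro set_eqI iffI)
    fix \<eta> assume "\<eta> \<in> {\<eta>. L ` \<eta> \<in> model_eta_gens}"
    moreover have e: "\<tau> ` inv \<tau> ` \<eta> = \<eta>" using a(2) by (simp add: image_image bij_is_surj surj_f_inv_f)
    ultimately have "(L \<circ> \<tau>) ` inv \<tau> ` \<eta> \<in> model_eta_gens" unfolding image_comp[symmetric] by simp
    then show "\<eta> \<in> (\<lambda>\<eta>. \<tau> ` \<eta>) ` {\<eta>. (L \<circ> \<tau>) ` \<eta> \<in> model_eta_gens}"
      using e by (intro image_eqI[of _ _ "inv \<tau> ` \<eta>"]) simp_all
  qed (auto simp: image_comp)
qed

theorem almost_grassmann_transposed: "almost_grassmann (transposed N)"
  unfolding almost_grassmann_def atlas_transposed
proof (intro conjI)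
  have U: "(\<Union>c\<in>atlas N. fst c) = UNIV"
    using N unfolding almost_grassmann_def smooth_atlas_def by (elim conjE)
  show "smooth_atlas (tch ` atlas N)"
    unfolding smooth_atlas_def
  proof (intro conjI ballI)
    show "\<Union> (fst ` tch ` atlas N) = UNIV" using U by (simp add: image_image tch_simps)
  next
    fix c' assume "c' \<in> tch ` atlas N"
    then obtain c where c: "c \<in> atlas N" "c' = tch c" by blast
    show "open (fst c')" using charts(1)[OF c(1)] by (simp add: c tch_simps)
    show "open (snd c' ` fst c')" unfolding c image_tch by (rule open_tpose[OF charts(2)[OF c(1)]])
    have "homeomorphism (fst c) (tpose ` snd c ` fst c) (tpose \<circ> snd c) (chart_inv c \<circ> tpose)"
    proof (rule homeomorphism_compose[OF charts(3)[OF c(1)]])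
      show "homeomorphism (snd c ` fst c) (tpose ` snd c ` fst c) tpose tpose"
        by (auto simp: homeomorphism_def image_tpose_tpose continuous_on_tpose)
    qed
    moreover have "chart_inv c \<circ> tpose = chart_inv c'" by (simp add: fun_eq_iff c chart_inv_tch)
    ultimately show "homeomorphism (fst c') (snd c' ` fst c') (snd c') (chart_inv c')"
      unfolding c image_tch by (simp add: tch_simps)
  next
    fix c' d' assume "c' \<in> tch ` atlas N" "d' \<in> tch ` atlas N"
    then obtain c d where c: "c \<in> atlas N" "c' = tch c" and d: "d \<in> atlas N" "d' = tch d" by blast
    have "smooth_on (tpose ` snd c ` (fst c \<inter> fst d)) (\<lambda>y. tpose ((snd d \<circ> chart_inv c) (tpose y)))"
      by (rule smooth_on_tpose_comp[OF open_chart_Int[OF c(1) d(1)] charts(4)[OF c(1) d(1)] linear_tpose])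
    moreover have "snd c' ` (fst c' \<inter> fst d') = tpose ` snd c ` (fst c \<inter> fst d)"
      unfolding c d tch_simps(1,2) image_comp[symmetric] ..
    moreover have "snd d' \<circ> chart_inv c' = (\<lambda>y. tpose ((snd d \<circ> chart_inv c) (tpose y)))"
      by (simp add: fun_eq_iff c d tch_simps chart_inv_tch)
    ultimately show "smooth_on (snd c' ` (fst c' \<inter> fst d')) (snd d' \<circ> chart_inv c')" by simp
  qed
  show "\<forall>c\<in>tch ` atlas N. \<forall>d\<in>tch ` atlas N. \<forall>x\<in>fst c \<inter> fst d.
        segre (transposed N) d x = tangent_transition c d x ` segre (transposed N) c x \<and>
        xi_gens (transposed N) d x = (\<lambda>\<xi>. tangent_transition c d x ` \<xi>) ` xi_gens (transposed N) c x"
  proof (intro ballI)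
    fix c' d' x assume "c' \<in> tch ` atlas N" "d' \<in> tch ` atlas N" and x: "x \<in> fst c' \<inter> fst d'"
    then obtain c d where c: "c \<in> atlas N" "c' = tch c" and d: "d \<in> atlas N" "d' = tch d" by blast
    have x': "x \<in> fst c \<inter> fst d" using x by (simp add: c d tch_simps)
    have t: "tangent_transition (tch c) (tch d) x ` tpose ` S = tpose ` tangent_transition c d x ` S" for S
      by (simp add: image_image tangent_transition_tch[OF c(1) d(1) x'])
    show "segre (transposed N) d' x = tangent_transition c' d' x ` segre (transposed N) c' x \<and>
        xi_gens (transposed N) d' x = (\<lambda>\<xi>. tangent_transition c' d' x ` \<xi>) ` xi_gens (transposed N) c' x"
      unfolding c d segre_transposed xi_gens_transposed t transition_gens(1)[OF c(1) d(1) x'] transition_eta_gens[OF c(1) d(1) x']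
        image_image[of "\<lambda>\<xi>. tangent_transition (tch c) (tch d) x ` \<xi>"] image_image[of "\<lambda>\<eta>. tpose ` \<eta>"] by blast
  qed
  show "\<forall>c\<in>tch ` atlas N. \<forall>x\<in>fst c. \<exists>U \<theta>. open U \<and> snd c x \<in> U \<and> U \<subseteq> snd c ` fst c \<and>
        adapted_coframe_on (transposed N) c U \<theta>"
  proof (intro ballI)
    fix c' x assume "c' \<in> tch ` atlas N" and x: "x \<in> fst c'"
    then obtain c where c: "c \<in> atlas N" "c' = tch c" by blast
    have x': "x \<in> fst c" using x by (simp add: c tch_simps)
    obtain U \<theta> where U: "open U" "snd c x \<in> U" "U \<subseteq> snd c ` fst c" "adapted_coframe_on N c U \<theta>"
      by (rule local_coframe[OF c(1) x'])
    show "\<exists>U \<theta>. open U \<and> snd c' x \<in> U \<and> U \<subseteq> snd c' ` fst c' \<and> adapted_coframe_on (transposed N) c' U \<theta>"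
      using open_tpose[OF U(1)] imageI[OF U(2), of tpose] image_mono[OF U(3), of tpose] adapted_on_transposed[OF U(1,4)]
      unfolding c image_tch tch_simps(4) by blast
  qed
qed

end

section \<open>Semiintegrability and the vanishing of the tensors\<close>

context grassmann
begin

lemma xi_gens_iff:
  assumes "adapted_coframe_at N c x L"
  shows "\<xi> \<in> xi_gens N c x \<longleftrightarrow> L ` \<xi> \<in> model_xi_gens"
proof -
  have L: "bij L" "(\<lambda>\<xi>. L ` \<xi>) ` xi_gens N c x = model_xi_gens" using assms by (auto simp: adapted_coframe_at_def)
  have "inj (\<lambda>\<xi>. L ` \<xi>)" by (rule injI) (simp only: inj_image_eq_iff[OF bij_is_inj[OF L(1)]])
  from inj_image_mem_iff[OF this, of \<xi> "xi_gens N c x"] show ?thesis unfolding L(2) by simp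
qed

lemma vanishes_imp_alpha_semiintegrable:
  assumes p2: "CARD('p) = 2" and q2: "CARD('q) \<ge> 2" and v: "vanishes N b1_alpha"
  shows "alpha_semiintegrable N"
  unfolding alpha_semiintegrable_def
proof (intro ballI)
  fix c x \<xi> assume c: "c \<in> atlas N" and x: "x \<in> fst c" and \<xi>: "\<xi> \<in> xi_gens N c x"
  obtain U \<theta> where U: "open U" "snd c x \<in> U" "U \<subseteq> snd c ` fst c" and \<theta>: "adapted_coframe_on N c U \<theta>"
    by (rule local_coframe[OF c x])
  have ad: "adapted_coframe_at N c (chart_inv c y) (\<theta> y)" if "y \<in> U" for y
    using \<theta> that by (simp add: adapted_coframe_on_def)
  have lb: "linear (\<theta> y)" "bij (\<theta> y)" if "y \<in> U" for y
    using ad[OF that] by (simp_all add: adapted_coframe_at_def)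
  have sf: "smooth_form U \<theta>" using \<theta> lb(1) by (simp add: smooth_form_def adapted_coframe_on_def)
  have "CARD('p) \<ge> 2" using p2 by simp
  \<comment> \<open>The hypothesis on b^1 is usable only through a prolonged frame over the adapted
    coframe at hand.\<close>
  then obtain P where P: "prolonged_frame_over U P" "frm_w P = \<theta>"
    using prolonged_frame_exists[OF U(1) sf lb(2) _ q2] by blast
  interpret pframe U P using P(1) by unfold_locales
  have "prolonged_frame_of N c U P" unfolding prolonged_frame_of_def using U(3) P \<theta> by simp
  then have b0: "b1_alpha P y = 0" if "y \<in> U" for y
    using v[unfolded vanishes_def, rule_format, OF c _ that] by blast
  have "\<theta> (snd c x) ` \<xi> \<in> model_xi_gens"
    using \<xi> xi_gens_iff[OF ad[OF U(2)]] by (simp add: chart_inv_chart[OF c x])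
  then obtain s0 where s0: "s0 \<noteq> 0" "\<theta> (snd c x) ` \<xi> = range (\<lambda>t. dyad t s0)" by (auto simp: model_xi_gens_def)
  obtain D and \<phi> :: "real^'p \<Rightarrow> real^'q^'p" and T :: "real^'p \<Rightarrow> real^'p \<Rightarrow> real^'p" and s
    where D: "open D" "0 \<in> D" "\<phi> 0 = snd c x" "\<phi> ` D \<subseteq> U" "smooth_on D \<phi>" "s 0 = s0"
    "\<And>u. u \<in> D \<Longrightarrow> s u \<noteq> 0" "\<And>u. u \<in> D \<Longrightarrow> bij (T u)"
    "\<And>u k. u \<in> D \<Longrightarrow> w (\<phi> u) (fder \<phi> u k) = dyad (T u k) (s u)"
    by (rule alpha_integral_exists[OF _ _ U(2) s0(1)])
      (rule tors_dyad_eq_0[OF a_alpha_eq_0[OF object_identities p2]], assumption,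
       rule cub_eq_0[OF object_identities b0], assumption, assumption, rule that)
  define f where "f u = chart_inv c (\<phi> u)" for u
  have \<phi>U: "\<phi> u \<in> U" if "u \<in> D" for u using D(4) that by blast
  have fs: "snd c (f u) = \<phi> u" if "u \<in> D" for u
    unfolding f_def using chart_chart_inv[OF c] \<phi>U[OF that] U(3) by blast
  have ff: "f u \<in> fst c" if "u \<in> D" for u
    using \<phi>U[OF that] U(3) unfolding f_def chart_inv_def by (blast intro: inv_into_into)
  have d: "fder (snd c \<circ> f) u = fder \<phi> u" if u: "u \<in> D" for u
  proof -
    have "((snd c \<circ> f) has_derivative fder \<phi> u) (at u)"
      by (rule has_derivative_transform_within_open[OF smooth_on_has_derivative[OF D(5) u] D(1) u]) (simp add: fs)
    then show ?thesis by (simp add: frechet_derivative_eqI)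
  qed
  have im: "\<theta> (\<phi> u) ` range (fder (snd c \<circ> f) u) = range (\<lambda>t. dyad t (s u))" if u: "u \<in> D" for u
  proof -
    have "\<theta> (\<phi> u) ` range (fder (snd c \<circ> f) u) = (\<lambda>t. dyad t (s u)) ` range (T u)"
      unfolding d[OF u] image_image P(2)[symmetric] D(9)[OF u] ..
    then show ?thesis using bij_is_surj[OF D(8)[OF u]] by simp
  qed
  have "integral_patch (xi_gens N) c D f"
    unfolding integral_patch_def
  proof (intro conjI ballI)
    show "open D" by fact
    show "f ` D \<subseteq> fst c" using ff by blast
    show "smooth_on D (snd c \<circ> f)" by (rule smooth_on_cong[OF D(1) _ D(5)]) (simp add: fs)
    fix u assume u: "u \<in> D"
    show "range (fder (snd c \<circ> f) u) \<in> xi_gens N c (f u)"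
      unfolding f_def[of u] xi_gens_iff[OF ad[OF \<phi>U[OF u]]] using im[OF u] D(7)[OF u]
      by (auto simp: model_xi_gens_def f_def[symmetric])
  qed
  moreover have "f 0 = x" by (simp add: f_def D(3) chart_inv_chart[OF c x])
  moreover have "range (fder (snd c \<circ> f) 0) = \<xi>"
    by (rule inj_image_eq_iff[OF bij_is_inj[OF lb(2)[OF U(2)]], THEN iffD1])
      (use im[OF D(2)] s0(2) in \<open>simp only: D(3,6)\<close>)
  ultimately show "\<exists>D f. integral_patch (xi_gens N) c D f \<and> 0 \<in> D \<and> f 0 = x \<and> range (fder (snd c \<circ> f) (0 :: real^'p)) = \<xi>"
    using D(2) by blast
qed

lemma alpha_semiintegrable_imp_vanishes:
  assumes p2: "CARD('p) = 2" and a: "alpha_semiintegrable N"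
  shows "vanishes N b1_alpha"
  unfolding vanishes_def
proof (intro ballI allI impI)
  fix c U P y assume c: "c \<in> atlas N" and P: "prolonged_frame_of N c U P" and y: "y \<in> U"
  interpret pframe U P using P by unfold_locales (simp add: prolonged_frame_of_def)
  have Uc: "U \<subseteq> snd c ` fst c" and ad: "adapted_coframe_at N c (chart_inv c y) (w y)" if "y \<in> U" for y
    using P that by (simp_all add: prolonged_frame_of_def adapted_coframe_on_def)
  have x: "chart_inv c y \<in> fst c" "snd c (chart_inv c y) = y"
    using Uc y chart_chart_inv[OF c] unfolding chart_inv_def by (blast intro: inv_into_into)+
  show "b1_alpha P y = 0"
  proof (rule b1_alpha_eq_0_if_radial[OF p2 y])
    fix t t' and s :: "real^'q" assume s: "s \<noteq> 0"
    have L: "bij (w y)" "(\<lambda>\<xi>. w y ` \<xi>) ` xi_gens N c (chart_inv c y) = model_xi_gens"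
      using ad[OF y] by (simp_all add: adapted_coframe_at_def)
    have "range (\<lambda>t. dyad t s) \<in> (\<lambda>\<xi>. w y ` \<xi>) ` xi_gens N c (chart_inv c y)"
      unfolding L(2) model_xi_gens_def using s by blast
    then obtain \<xi> where \<xi>: "\<xi> \<in> xi_gens N c (chart_inv c y)" "w y ` \<xi> = range (\<lambda>t. dyad t s)" by auto
    obtain D0 f where f: "integral_patch (xi_gens N) c D0 f" "0 \<in> D0" "f 0 = chart_inv c y"
      "range (fder (snd c \<circ> f) (0 :: real^'p)) = \<xi>"
      using a[unfolded alpha_semiintegrable_def, THEN bspec, OF c, THEN bspec, OF x(1), THEN bspec, OF \<xi>(1)] by blast
    define \<phi> where "\<phi> = snd c \<circ> f"
    have D0: "open D0" "smooth_on D0 \<phi>" "f ` D0 \<subseteq> fst c" using f(1) by (simp_all add: integral_patch_def \<phi>_def)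
    \<comment> \<open>The parameter domain is cut down to the preimage of U, since the prolonged
      frame is only given there.\<close>
    define D where "D = D0 \<inter> \<phi> -` U"
    have D: "open D" unfolding D_def
      by (rule continuous_open_preimage[OF smooth_on_continuous[OF D0(2)] D0(1) open_U])
    have \<phi>0: "\<phi> 0 = y" by (simp add: \<phi>_def f(3) x(2))
    have "\<exists>c. cub P (\<phi> 0) t t' s = c *\<^sub>R s"
    proof (rule alpha_integral_curvature)
      show "CARD('p) \<ge> 2" using p2 by simp
      show "tors P y (dyad t s) (dyad t' s) = 0" if "y \<in> U" for y t t' s
        by (rule tors_dyad_eq_0[OF a_alpha_eq_0[OF object_identities[OF that] p2]])
      show "open D" by (rule D)
      show "0 \<in> D" using f(2) y by (simp add: D_def \<phi>0)
      show "smooth_on D \<phi>" by (rule smooth_on_subset[OF D0(2)]) (simp add: D_def)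
      show "\<phi> ` D \<subseteq> U" by (auto simp: D_def)
      show "s \<noteq> 0" by (rule s)
      have r: "range (\<lambda>k. w (\<phi> u) (fder \<phi> u k)) = w (\<phi> u) ` range (fder \<phi> u)" for u
        by (simp add: image_image)
      show "range (\<lambda>k. w (\<phi> 0) (fder \<phi> 0 k)) = range (\<lambda>t. dyad t s)"
        unfolding r using f(4) \<xi>(2) by (simp add: \<phi>0 \<phi>_def[symmetric])
      fix u assume u: "u \<in> D"
      have uU: "\<phi> u \<in> U" and u0: "u \<in> D0" using u by (simp_all add: D_def)
      have "f u \<in> fst c" using D0(3) u0 by blast
      then have "chart_inv c (\<phi> u) = f u" using chart_inv_chart[OF c] by (simp add: \<phi>_def)
      moreover have "range (fder \<phi> u) \<in> xi_gens N c (f u)"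
        using f(1) u0 by (simp add: integral_patch_def \<phi>_def)
      ultimately have "w (\<phi> u) ` range (fder \<phi> u) \<in> model_xi_gens"
        using xi_gens_iff[OF ad[OF uU]] by simp
      then show "\<exists>S. S \<noteq> 0 \<and> range (\<lambda>k. w (\<phi> u) (fder \<phi> u k)) = range (\<lambda>t. dyad t S)"
        unfolding r model_xi_gens_def by blast
    qed
    then show "\<exists>c. cub P y t t' s = c *\<^sub>R s" unfolding \<phi>0 .
  qed
qed

lemma prolonged_frame_of_identities:
  assumes "prolonged_frame_of N c U P" "y \<in> U"
  shows "object_identities_at P y"
  using assms by (simp add: prolonged_frame_of_def prolonged_frame_over_def)

end

theorem theorem2p6:
  fixes N :: "('m::{t2_space, second_countable_topology}, 'p::finite, 'q::finite) cone_field"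
  assumes "almost_grassmann N"
    and "CARD('p) \<ge> 2" and "CARD('q) \<ge> 2"
  shows
    "(CARD('p) = 2 \<longrightarrow>
        vanishes N a_alpha \<and> vanishes N b2_alpha \<and>
        is_tensor (b1_alpha :: ('p, 'q) prolonged_frame \<Rightarrow> _) \<and>
        (alpha_semiintegrable N \<longleftrightarrow> vanishes N b1_alpha)) \<and>
     (CARD('q) = 2 \<longrightarrow>
        vanishes N a_beta \<and> vanishes N b1_beta \<and>
        is_tensor (b2_beta :: ('p, 'q) prolonged_frame \<Rightarrow> _) \<and>
        (beta_semiintegrable N \<longleftrightarrow> vanishes N b2_beta) \<and>
        almost_grassmann (transposed N)) \<and>
     (CARD('p) = 2 \<and> CARD('q) = 2 \<longrightarrow>
        vanishes N obj_a \<and>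
        is_tensor (b1_alpha :: ('p, 'q) prolonged_frame \<Rightarrow> _) \<and>
        is_tensor (b2_beta :: ('p, 'q) prolonged_frame \<Rightarrow> _) \<and>
        (\<exists>F. \<forall>U (P :: ('p, 'q) prolonged_frame). prolonged_frame_over U P \<longrightarrow>
           (\<forall>y\<in>U. (obj_b1 P y, obj_b2 P y, obj_c P y) =
              F (b1_alpha P y) (b2_beta P y) (pfaff_b1_alpha P y) (pfaff_b2_beta P y))) \<and>
        (alpha_semiintegrable N \<longleftrightarrow> vanishes N b1_alpha) \<and>
        (beta_semiintegrable N \<longleftrightarrow> vanishes N b2_beta))"
proof -
  interpret grassmann N using assms(1) by unfold_locales
  interpret T: grassmann "transposed N" using almost_grassmann_transposed by unfold_locales
  have \<alpha>: "alpha_semiintegrable N \<longleftrightarrow> vanishes N b1_alpha" if "CARD('p) = 2"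
    using vanishes_imp_alpha_semiintegrable[OF that assms(3)] alpha_semiintegrable_imp_vanishes[OF that] by blast
  have \<beta>: "beta_semiintegrable N \<longleftrightarrow> vanishes N b2_beta" if "CARD('q) = 2"
    using T.vanishes_imp_alpha_semiintegrable[OF that assms(2)] T.alpha_semiintegrable_imp_vanishes[OF that]
    unfolding alpha_semiintegrable_transposed vanishes_transposed by blast
  have p: "vanishes N a_alpha" "vanishes N b2_alpha" if "CARD('p) = 2"
    unfolding vanishes_def
    using a_alpha_eq_0[OF prolonged_frame_of_identities that] b2_alpha_eq_0[OF that] by blast+
  have q: "vanishes N a_beta" "vanishes N b1_beta" if "CARD('q) = 2"
    unfolding vanishes_def
    using a_beta_eq_0[OF prolonged_frame_of_identities that] b1_beta_eq_0[OF that] by blast+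
  have pq: "vanishes N obj_a" if "CARD('p) = 2" "CARD('q) = 2"
    unfolding vanishes_def using obj_a_eq_0[OF prolonged_frame_of_identities that] by blast
  show ?thesis
    using \<alpha> \<beta> p q pq is_tensor_b1_alpha[where 'p='p and 'q='q] is_tensor_b2_beta[where 'p='p and 'q='q] almost_grassmann_transposed
      complete_object_determined[where 'p='p and 'q='q]
    by blast
qed

end
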